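(* Let $B_H=\{B_H(t)\}_{t\in\mathbb{R}}$ be an $\mathbb{R}^n$-valued time-reversible operator fractional Brownian motion as described in the context, and let $j_1<\dots<j_m$ be a fixed set of octaves. Then, as $\nu\to\infty$, $$\Big(\sqrt{K_j}\,\big(\mathrm{vec}_{\mathcal S}W(2^j)-\mathrm{vec}_{\mathcal S}EW(2^j)\big)\Big)_{j=j_1,\dots,j_m}\stackrel{d}{\to}N(0,F),$$ a (possibly degenerate) centered Gaussian law on $\mathbb{R}^{\frac{n(n+1)}2m}$, where $F=(G_{jj'})_{j,j'=j_1,\dots,j_m}\in\mathcal S(\tfrac{n(n+1)}2m,\mathbb{R})$ and the blocks $G_{jj'}\in M(n(n+1)/2,\mathbb{R})$ are those defined in the context.
   Context: Matrix conventions: $^*$ is (Hermitian) transposition; $c^M=\exp(\log(c)M)$ for $c>0$; $x_\pm=\max\{\pm x,0\}$, and $x_\pm^{-D}$ is read as the zero matrix when $x_\pm=0$; $|0|^H\Sigma|0|^{H^*}=0$. $\mathcal S(p,\mathbb{R})$ is the space of real symmetric $p\times p$ matrices. For $S\in\mathcal S(n,\mathbb{R})$, $\mathrm{vec}_{\mathcal S}(S)=(s_{11},s_{12},\dots,s_{1n};s_{22},\dots,s_{2n};\dots;s_{nn})^*$. Operator fractional Brownian motion (OFBM), $n\ge2$. $B_H$ is the $\mathbb{R}^n$-valued centered Gaussian process with finite-dimensional distributions those of $\int_{\mathbb{R}}\frac{e^{itx}-1}{ix}(x_+^{-D}A+x_-^{-D}\overline A)\widetilde B(dx)$, where $H\in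 M(n,\mathbb{R})$, $D=H-\frac12I$, $A\in M(n,\mathbb{C})$, and $\widetilde B(dx)$ is a complex Gaussian random measure with $\widetilde B(-dx)=\overline{\widetilde B(dx)}$, $E\widetilde B(dx)\widetilde B(dx)^*=dx\,I$. Assumptions: all eigenvalues $h_k$ of $H$ satisfy $0<\Re(h_k)<1$; $\Re(AA^* )$ has full rank; $\Im(AA^* )=0$ (time reversibility). Put $\Sigma=EB_H(1)B_H(1)^*$. Wavelet. $\psi\in L^1(\mathbb{R})$ is real-valued with $\int\psi^2=1$, $\int t^q\psi(t)dt=0$ for $q=0,\dots,N_\psi-1$, $N_\psi\ge2$; $\mathrm{supp}(\psi)$ is a compact interval; $\sup_x|\widehat\psi(x)|(1+|x|)^\alpha<\infty$ for some $\alpha>1$. Wavelet coefficients: $D(2^j,k)=\int_{\mathbb{R}}\psi(z)B_H(2^jz+2^jk)dz$ (mean-square sense), $j\in\mathbb{N}\cup\{0\}$, $k\in\mathbb{Z}$; $EW(2^j):=ED(2^j,0)D(2^j,0)^*$; with $\nu$ (number of data points) a power of $2$ and $K_j=\nu/2^j$, $W(2^j)=\frac1{K_j}\sum_{k=1}^{K_j}D(2^j,k)D(2^j,k)^*$. For octaves $j,j'$ and $z\in\mathbb{Z}$, with $g=\gcd(2^j,2^{j'})$, let $$\Omega_{j,j'}(z)=-\frac12\int_{\mathbb{R}}\int_{\mathbb{R}}\psi(t)\psi(t')\,|2^jt-2^{j'}t'+zg|^H\,\Sigma\,|2^jt-2^{j'}t'+zg|^{H^*}dt'dt .$$ $G_{jj'}$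 is the $\frac{n(n+1)}2\times\frac{n(n+1)}2$ matrix with rows and columns indexed by pairs $(i_1,i_2)$, $1\le i_1\le i_2\le n$, ordered as in $\mathrm{vec}_{\mathcal S}$, whose entry at row $(i_1,i_2)$, column $(l_1,l_2)$ is $$2^{-(j+j')/2}\,g\sum_{z\in\mathbb{Z}}\big[\Omega_{j,j'}(z)_{i_1l_1}\Omega_{j,j'}(z)_{i_2l_2}+\Omega_{j,j'}(z)_{i_1l_2}\Omega_{j,j'}(z)_{i_2l_1}\big];$$ it is the limit of $\sqrt{K_j}\sqrt{K_{j'}}\,\mathrm{Cov}(\mathrm{vec}_{\mathcal S}W(2^j),\mathrm{vec}_{\mathcal S}W(2^{j'}))$ as $\nu\to\infty$. *)

theory Defs
  imports "HOL-Probability.Probability"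
begin

section \<open>Matrices\<close>

text \<open>On \<^typ>\<open>real^'n^'n\<close> the operations \<open>*\<close> and \<open>^\<close> act entrywise, so the matrix exponential
  is not the library's \<^term>\<open>exp\<close> and is built here from the matrix product \<open>**\<close>.\<close>

definition mat_exp :: "real^'n^'n \<Rightarrow> real^'n^'n" where
  "mat_exp M = (\<Sum>k. (((**) M ^^ k) (mat 1)) /\<^sub>R fact k)"

text \<open>\<open>c\<^sup>M\<close>. The value \<open>0\<close> at \<open>c = 0\<close> gives both conventions in use:
  \<open>x\<^sub>+\<close> or \<open>x\<^sub>-\<close> raised to \<open>- D\<close> is the zero matrix where the base vanishes,
  and \<open>\<bar>0\<bar>\<^sup>H \<Sigma> \<bar>0\<bar>\<^sup>H\<^sup>* = 0\<close>.\<close>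

definition mat_powr :: "real \<Rightarrow> real^'n^'n \<Rightarrow> real^'n^'n" where
  "mat_powr c M = (if c > 0 then mat_exp (ln c *\<^sub>R M) else 0)"

definition cvec :: "real^'n \<Rightarrow> complex^'n" where
  "cvec v = (\<chi> i. complex_of_real (v $ i))"

definition cmat :: "real^'n^'m \<Rightarrow> complex^'n^'m" where
  "cmat M = (\<chi> i l. complex_of_real (M $ i $ l))"

definition cnj_mat :: "complex^'n^'m \<Rightarrow> complex^'n^'m" where
  "cnj_mat M = (\<chi> i l. cnj (M $ i $ l))"

definition Re_mat :: "complex^'n^'m \<Rightarrow> real^'n^'m" where
  "Re_mat M = (\<chi> i l. Re (M $ i $ l))"

definition Im_mat :: "complex^'n^'m \<Rightarrow> real^'n^'m" where
  "Im_mat M = (\<chi> i l. Im (M $ i $ l))"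

definition adjoint_mat :: "complex^'n^'m \<Rightarrow> complex^'m^'n" where
  "adjoint_mat M = transpose (cnj_mat M)"

definition eigenvalue :: "complex^'n^'n \<Rightarrow> complex \<Rightarrow> bool" where
  "eigenvalue M h \<longleftrightarrow> (\<exists>v. v \<noteq> 0 \<and> M *v v = h *s v)"

definition outer :: "real^'n \<Rightarrow> real^'n^'n" where
  "outer v = (\<chi> i l. v $ i * v $ l)"

text \<open>The coordinates of \<open>vec\<^sub>S\<close>: the pairs \<open>(i\<^sub>1, i\<^sub>2)\<close> with \<open>i\<^sub>1 \<le> i\<^sub>2\<close>. Vectors and matrices
  over this index type have \<open>n (n + 1) / 2\<close> coordinates, labelled by these pairs.\<close>

typedef (overloaded) ('n::linorder) sympair = "{(i :: 'n, l). i \<le> l}"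
  by auto

instance sympair :: ("{finite,linorder}") finite
proof
  have "finite ((Rep_sympair :: 'a sympair \<Rightarrow> _) ` UNIV)"
    by simp
  then show "finite (UNIV :: 'a sympair set)"
    by (rule finite_imageD) (simp add: Rep_sympair_inject inj_on_def)
qed

lemma card_sympair:
  "CARD('n::{finite,linorder} sympair) = CARD('n) * (CARD('n) + 1) div 2"
proof -
  let ?U = "{(i :: 'n, l). i \<le> l}" and ?V = "{(i :: 'n, l). l \<le> i}"
  have V: "?V = prod.swap ` ?U"
    by (auto simp: image_iff)
  have "?U \<union> ?V = UNIV" "?U \<inter> ?V = (\<lambda>i. (i, i)) ` UNIV"
    by auto
  then have "card ?U + card ?V = CARD('n \<times> 'n) + card (range (\<lambda>i :: 'n. (i, i)))"
    using card_Un_Int[of ?U ?V] by simp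
  moreover have "card ?V = card ?U"
    unfolding V by (rule card_image) simp
  moreover have "card (range (\<lambda>i :: 'n. (i, i))) = CARD('n)"
    by (rule card_image) (simp add: inj_on_def)
  ultimately have "2 * card ?U = CARD('n) * (CARD('n) + 1)"
    by simp
  moreover have "CARD('n sympair) = card ?U"
    using type_definition.card[OF type_definition_sympair] by simp
  ultimately show ?thesis
    by simp
qed

definition pfst :: "'n::linorder sympair \<Rightarrow> 'n" where
  "pfst p = fst (Rep_sympair p)"

definition psnd :: "'n::linorder sympair \<Rightarrow> 'n" where
  "psnd p = snd (Rep_sympair p)"

definition vec_S :: "real^('n::{finite,linorder})^('n::{finite,linorder}) \<Rightarrow> real^(('n::{finite,linorder}) sympair)" where
  "vec_S S = (\<chi> p. S $ pfst p $ psnd p)"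


section \<open>Gaussian laws and convergence in distribution\<close>

definition normal_law :: "real \<Rightarrow> real \<Rightarrow> real measure" where
  "normal_law \<mu> v =
     (if v = 0 then return borel \<mu> else density lborel (\<lambda>x. ennreal (normal_density \<mu> (sqrt v) x)))"

definition multivariate_normal :: "(real^'k) measure \<Rightarrow> real^'k \<Rightarrow> real^'k^'k \<Rightarrow> bool" where
  "multivariate_normal L \<mu> F \<longleftrightarrow>
     prob_space L \<and> sets L = sets borel \<and> transpose F = F \<and>
     (\<forall>u. 0 \<le> u \<bullet> (F *v u) \<and>
          distr L borel (\<lambda>x. u \<bullet> x) = normal_law (u \<bullet> \<mu>) (u \<bullet> (F *v u)))"

definition centered_gaussian :: "'a measure \<Rightarrow> ('a \<Rightarrow> real) \<Rightarrow> bool" where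
  "centered_gaussian P X \<longleftrightarrow>
     X \<in> borel_measurable P \<and> (\<exists>v\<ge>0. distr P borel X = normal_law 0 v)"

definition converges_in_distribution ::
    "'a measure \<Rightarrow> (nat \<Rightarrow> 'a \<Rightarrow> 'b::topological_space) \<Rightarrow> 'b measure \<Rightarrow> bool" where
  "converges_in_distribution P X L \<longleftrightarrow>
     (\<forall>N. X N \<in> borel_measurable P) \<and>
     (\<forall>f :: 'b \<Rightarrow> real. continuous_on UNIV f \<and> bounded (range f) \<longrightarrow>
        (\<lambda>N. \<integral>\<omega>. f (X N \<omega>) \<partial>P) \<longlonglongrightarrow> (\<integral>x. f x \<partial>L))"

definition second_moment :: "'a measure \<Rightarrow> ('a \<Rightarrow> real^'n) \<Rightarrow> real^'n^'n" where
  "second_moment P X = (\<chi> i l. \<integral>\<omega>. X \<omega> $ i * X \<omega> $ l \<partial>P)"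

definition same_fdds ::
    "'a measure \<Rightarrow> (real \<Rightarrow> 'a \<Rightarrow> 'v::topological_space) \<Rightarrow> 'b measure \<Rightarrow> (real \<Rightarrow> 'b \<Rightarrow> 'v) \<Rightarrow> bool" where
  "same_fdds P X Q Y \<longleftrightarrow>
     (\<forall>t. X t \<in> borel_measurable P) \<and> (\<forall>t. Y t \<in> borel_measurable Q) \<and>
     (\<forall>T. finite T \<longrightarrow>
        distr P (\<Pi>\<^sub>M t\<in>T. borel) (\<lambda>\<omega>. \<lambda>t\<in>T. X t \<omega>) =
        distr Q (\<Pi>\<^sub>M t\<in>T. borel) (\<lambda>\<omega>. \<lambda>t\<in>T. Y t \<omega>))"


section \<open>Mean-square integrals\<close>

definition square_integrable :: "'a measure \<Rightarrow> ('a \<Rightarrow> 'v::real_normed_vector) \<Rightarrow> bool" where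
  "square_integrable P X \<longleftrightarrow>
     X \<in> borel_measurable P \<and> integrable P (\<lambda>\<omega>. (norm (X \<omega>))\<^sup>2)"

definition L2_dist :: "'a measure \<Rightarrow> ('a \<Rightarrow> 'v::real_normed_vector) \<Rightarrow> ('a \<Rightarrow> 'v) \<Rightarrow> real" where
  "L2_dist P X Y = sqrt (\<integral>\<omega>. (norm (X \<omega> - Y \<omega>))\<^sup>2 \<partial>P)"

definition finite_borel :: "real set set" where
  "finite_borel = {E \<in> sets borel. emeasure lborel E < \<infinity>}"

text \<open>\<open>Y = \<integral> X(z) dz\<close> in the mean-square sense, i.e. as a Bochner integral in \<open>L\<^sup>2(P)\<close>: a list of
  pairs \<open>(E, \<xi>)\<close> stands for the simple \<open>L\<^sup>2(P)\<close>-valued function \<open>\<Sum> 1\<^sub>E(z) \<xi>\<close>.\<close>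

definition mean_square_integral ::
    "'a measure \<Rightarrow> (real \<Rightarrow> 'a \<Rightarrow> 'v::real_normed_vector) \<Rightarrow> ('a \<Rightarrow> 'v) \<Rightarrow> bool" where
  "mean_square_integral P X Y \<longleftrightarrow>
     (\<forall>z. square_integrable P (X z)) \<and> square_integrable P Y \<and>
     (\<exists>s :: nat \<Rightarrow> (real set \<times> ('a \<Rightarrow> 'v)) list.
        (\<forall>k. \<forall>(E, \<xi>) \<in> set (s k). E \<in> finite_borel \<and> square_integrable P \<xi>) \<and>
        (\<lambda>k. \<integral>\<^sup>+z. ennreal (L2_dist P (X z)
                (\<lambda>\<omega>. \<Sum>(E, \<xi>)\<leftarrow>s k. indicator E z *\<^sub>R \<xi> \<omega>)) \<partial>lborel) \<longlonglongrightarrow> 0 \<and>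
        (\<lambda>k. L2_dist P Y (\<lambda>\<omega>. \<Sum>(E, \<xi>)\<leftarrow>s k. measure lborel E *\<^sub>R \<xi> \<omega>)) \<longlonglongrightarrow> 0)"

text \<open>The random measure is defined on Borel sets of finite Lebesgue measure; that
  \<open>E Z(dx) Z(dx)\<^sup>* = dx I\<close> means \<open>E Z(E) Z(F)\<^sup>* = \<bar>E \<inter> F\<bar> I\<close>. Additivity, almost surely and
  in mean square, follows from this.\<close>

definition hermitian_gaussian_random_measure ::
    "'q measure \<Rightarrow> (real set \<Rightarrow> 'q \<Rightarrow> complex^'n) \<Rightarrow> bool" where
  "hermitian_gaussian_random_measure Q Z \<longleftrightarrow>
     prob_space Q \<and>
     (\<forall>E\<in>finite_borel. Z E \<in> borel_measurable Q) \<and>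
     (\<forall>I c. finite I \<and> I \<subseteq> finite_borel \<longrightarrow>
        centered_gaussian Q (\<lambda>\<omega>. Re (\<Sum>E\<in>I. \<Sum>i\<in>UNIV. (c E :: complex^'n) $ i * Z E \<omega> $ i))) \<and>
     (\<forall>E\<in>finite_borel. AE \<omega> in Q. \<forall>i. Z (uminus ` E) \<omega> $ i = cnj (Z E \<omega> $ i)) \<and>
     (\<forall>E\<in>finite_borel. \<forall>F\<in>finite_borel. \<forall>i l.
        (\<integral>\<omega>. Z E \<omega> $ i * cnj (Z F \<omega> $ l) \<partial>Q) =
          (if i = l then complex_of_real (measure lborel (E \<inter> F)) else 0))"

text \<open>\<open>Y = \<integral> f(x) Z(dx)\<close>: the \<open>L\<^sup>2\<close>-limit of the integrals of matrix-valued simple functions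
  \<open>\<Sum> 1\<^sub>E(x) M\<close>, again given by lists of pairs \<open>(E, M)\<close>.\<close>

definition spectral_integral ::
    "'q measure \<Rightarrow> (real set \<Rightarrow> 'q \<Rightarrow> complex^'n) \<Rightarrow> (real \<Rightarrow> complex^'n^'n) \<Rightarrow>
      ('q \<Rightarrow> complex^'n) \<Rightarrow> bool" where
  "spectral_integral Q Z f Y \<longleftrightarrow>
     square_integrable lborel f \<and> square_integrable Q Y \<and>
     (\<exists>s :: nat \<Rightarrow> (real set \<times> (complex^'n^'n)) list.
        (\<forall>k. \<forall>(E, M) \<in> set (s k). E \<in> finite_borel) \<and>
        (\<lambda>k. L2_dist lborel f (\<lambda>x. \<Sum>(E, M)\<leftarrow>s k. indicator E x *\<^sub>R M)) \<longlonglongrightarrow> 0 \<and>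
        (\<lambda>k. L2_dist Q Y (\<lambda>\<omega>. \<Sum>(E, M)\<leftarrow>s k. M *v Z E \<omega>)) \<longlonglongrightarrow> 0)"


section \<open>Operator fractional Brownian motion\<close>

definition ofbm_kernel :: "real^'n^'n \<Rightarrow> complex^'n^'n \<Rightarrow> real \<Rightarrow> real \<Rightarrow> complex^'n^'n" where
  "ofbm_kernel H A t x =
     (let D = H - (1/2) *\<^sub>R mat 1;
          M = cmat (mat_powr (max x 0) (- D)) ** A + cmat (mat_powr (max (- x) 0) (- D)) ** cnj_mat A
      in \<chi> i l. (exp (\<i> * of_real (t * x)) - 1) / (\<i> * of_real x) * M $ i $ l)"

text \<open>The random measure \<open>Z\<close> may live on a probability space \<open>Q\<close> other than that of \<open>B\<close>,
  because only the finite-dimensional distributions of \<open>B\<close> are prescribed.\<close>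

definition is_ofbm ::
    "'q measure \<Rightarrow> (real set \<Rightarrow> 'q \<Rightarrow> complex^'n) \<Rightarrow> real^'n^'n \<Rightarrow> complex^'n^'n \<Rightarrow>
      'a measure \<Rightarrow> (real \<Rightarrow> 'a \<Rightarrow> real^'n) \<Rightarrow> bool" where
  "is_ofbm Q Z H A P B \<longleftrightarrow>
     prob_space P \<and> (\<forall>t. B t \<in> borel_measurable P) \<and>
     hermitian_gaussian_random_measure Q Z \<and>
     (\<exists>Y. (\<forall>t. spectral_integral Q Z (ofbm_kernel H A t) (Y t)) \<and>
          same_fdds P (\<lambda>t \<omega>. cvec (B t \<omega>)) Q Y)"


section \<open>Wavelets and wavelet variance\<close>

definition fourier :: "(real \<Rightarrow> real) \<Rightarrow> real \<Rightarrow> complex" where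
  "fourier \<psi> x = (\<integral>t. exp (- (\<i> * of_real (t * x))) * of_real (\<psi> t) \<partial>lborel)"

definition is_wavelet :: "(real \<Rightarrow> real) \<Rightarrow> nat \<Rightarrow> real \<Rightarrow> bool" where
  "is_wavelet \<psi> N\<psi> \<alpha> \<longleftrightarrow>
     integrable lborel \<psi> \<and>
     has_bochner_integral lborel (\<lambda>t. (\<psi> t)\<^sup>2) 1 \<and>
     N\<psi> \<ge> 2 \<and> (\<forall>q<N\<psi>. has_bochner_integral lborel (\<lambda>t. t ^ q * \<psi> t) 0) \<and>
     (\<exists>a b. closure {t. \<psi> t \<noteq> 0} = {a..b}) \<and>
     \<alpha> > 1 \<and> bdd_above (range (\<lambda>x. cmod (fourier \<psi> x) * (1 + \<bar>x\<bar>) powr \<alpha>))"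

definition wavelet_coefficients ::
    "'a measure \<Rightarrow> (real \<Rightarrow> 'a \<Rightarrow> real^'n) \<Rightarrow> (real \<Rightarrow> real) \<Rightarrow>
      (nat \<Rightarrow> int \<Rightarrow> 'a \<Rightarrow> real^'n) \<Rightarrow> bool" where
  "wavelet_coefficients P B \<psi> Dc \<longleftrightarrow>
     (\<forall>j k. mean_square_integral P (\<lambda>z \<omega>. \<psi> z *\<^sub>R B (2 ^ j * z + 2 ^ j * of_int k) \<omega>) (Dc j k))"

text \<open>\<open>K\<^sub>j = \<nu> / 2\<^sup>j\<close>; the division is exact once the power of two \<open>\<nu>\<close> is at least \<open>2\<^sup>j\<close>.\<close>

definition num_coeffs :: "nat \<Rightarrow> nat \<Rightarrow> nat" where
  "num_coeffs \<nu> j = \<nu> div 2 ^ j"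

definition wavelet_W :: "(nat \<Rightarrow> int \<Rightarrow> 'a \<Rightarrow> real^'n) \<Rightarrow> nat \<Rightarrow> nat \<Rightarrow> 'a \<Rightarrow> real^'n^'n" where
  "wavelet_W Dc \<nu> j \<omega> =
     (1 / real (num_coeffs \<nu> j)) *\<^sub>R (\<Sum>k = 1..num_coeffs \<nu> j. outer (Dc j (int k) \<omega>))"

definition wavelet_EW :: "'a measure \<Rightarrow> (nat \<Rightarrow> int \<Rightarrow> 'a \<Rightarrow> real^'n) \<Rightarrow> nat \<Rightarrow> real^'n^'n" where
  "wavelet_EW P Dc j = second_moment P (Dc j 0)"

text \<open>The normalized fluctuations of the wavelet variances at the octaves \<open>j\<^sub>1 < \<dots> < j\<^sub>m\<close>, stacked
  into one vector indexed by (octave, coordinate of \<open>vec\<^sub>S\<close>).\<close>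

definition wavelet_fluctuation ::
    "'a measure \<Rightarrow> (nat \<Rightarrow> int \<Rightarrow> 'a \<Rightarrow> real^('n::{finite,linorder})) \<Rightarrow> ('m \<Rightarrow> nat) \<Rightarrow> nat \<Rightarrow> 'a \<Rightarrow>
      real^('m::finite \<times> ('n::{finite,linorder}) sympair)" where
  "wavelet_fluctuation P Dc oct \<nu> \<omega> =
     (\<chi> r. let j = oct (fst r) in
        (sqrt (real (num_coeffs \<nu> j)) *\<^sub>R
          (vec_S (wavelet_W Dc \<nu> j \<omega>) - vec_S (wavelet_EW P Dc j))) $ snd r)"


section \<open>Asymptotic covariance\<close>

definition Omega ::
    "(real \<Rightarrow> real) \<Rightarrow> real^'n^'n \<Rightarrow> real^'n^'n \<Rightarrow> nat \<Rightarrow> nat \<Rightarrow> int \<Rightarrow> real^'n^'n" where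
  "Omega \<psi> H \<Sigma> j j' z =
     - (1/2) *\<^sub>R (\<integral>t. (\<integral>t'.
         (let x = \<bar>2 ^ j * t - 2 ^ j' * t' + of_int z * real (gcd (2 ^ j) (2 ^ j'))\<bar>
          in (\<psi> t * \<psi> t') *\<^sub>R (mat_powr x H ** \<Sigma> ** mat_powr x (transpose H))) \<partial>lborel) \<partial>lborel)"

definition G_block ::
    "(real \<Rightarrow> real) \<Rightarrow> real^('n::{finite,linorder})^('n::{finite,linorder}) \<Rightarrow> real^('n::{finite,linorder})^('n::{finite,linorder}) \<Rightarrow> nat \<Rightarrow> nat \<Rightarrow>
      real^(('n::{finite,linorder}) sympair)^(('n::{finite,linorder}) sympair)" where
  "G_block \<psi> H \<Sigma> j j' = (\<chi> p q.
     2 powr (- (real (j + j') / 2)) * real (gcd (2 ^ j) (2 ^ j')) *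
     (\<Sum>\<^sub>\<infinity>z\<in>UNIV.
        Omega \<psi> H \<Sigma> j j' z $ pfst p $ pfst q * Omega \<psi> H \<Sigma> j j' z $ psnd p $ psnd q +
        Omega \<psi> H \<Sigma> j j' z $ pfst p $ psnd q * Omega \<psi> H \<Sigma> j j' z $ psnd p $ pfst q))"

definition F_matrix ::
    "(real \<Rightarrow> real) \<Rightarrow> real^('n::{finite,linorder})^('n::{finite,linorder}) \<Rightarrow> real^('n::{finite,linorder})^('n::{finite,linorder}) \<Rightarrow> ('m \<Rightarrow> nat) \<Rightarrow>
      real^('m::finite \<times> ('n::{finite,linorder}) sympair)^('m::finite \<times> ('n::{finite,linorder}) sympair)" where
  "F_matrix \<psi> H \<Sigma> oct = (\<chi> r s. G_block \<psi> H \<Sigma> (oct (fst r)) (oct (fst s)) $ snd r $ snd s)"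

end

theory Submission
  imports Defs
begin

text \<open>For a fixed vector \<open>u\<close>, the inner product of \<open>u\<close> with the fluctuation vector is a centred
  quadratic form in finitely many jointly Gaussian wavelet coefficients. Diagonalising its matrix
  \<open>M\<close> simultaneously with the covariance matrix \<open>G\<close> of these coefficients turns it into
  \<open>\<Sum>\<^sub>a d\<^sub>a (\<xi>\<^sub>a\<^sup>2 - 1)\<close> with independent standard normal \<open>\<xi>\<^sub>a\<close>, and such sums converge to \<open>N(0, v)\<close> as soon
  as \<open>max\<^sub>a \<bar>d\<^sub>a\<bar> \<rightarrow> 0\<close> and \<open>2 \<Sum>\<^sub>a d\<^sub>a\<^sup>2 \<rightarrow> v\<close>. The \<open>d\<^sub>a\<close> are bounded by the product of the maximal row sums of
  \<open>G\<close> and \<open>M\<close>. Those of \<open>M\<close> are \<open>O(K\<^sub>j\<^sup>-\<^sup>1\<^sup>/\<^sup>2)\<close>; those of \<open>G\<close> stay bounded because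
  \<open>\<Omega>\<^sub>j\<^sub>j\<^sub>'(z) = O(1 / (1 + z\<^sup>2))\<close>: two vanishing moments in each of the two integrals annihilate the Taylor
  polynomial of degree three of \<open>x \<mapsto> x\<^sup>H \<Sigma> x\<^sup>H\<^sup>*\<close>, whose fourth derivative is \<open>O(x\<^sup>-\<^sup>2)\<close>. Finally
  \<open>2 \<Sum>\<^sub>a d\<^sub>a\<^sup>2 = 2 tr (M G M G)\<close> is an average over pairs of positions of a function of their lag, so it
  converges by dominated convergence, and the limit is the quadratic form of \<open>F\<close> at \<open>u\<close>; in particular
  \<open>F\<close> is positive semidefinite. Levy's continuity theorem in \<open>m n (n + 1) / 2\<close> dimensions concludes.\<close>

section \<open>Convergence of characteristic functions\<close>

text \<open>The wavelet coefficients are mean-square integrals of \<open>B\<close>, so covariances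
  and Gaussianity must both pass through such an integral. Covariances pass by testing the integral
  against one square-integrable variable at a time. Gaussianity passes because each coefficient lies
  in the L2 closure of the span of the components of the \<open>B t\<close>, which is proved by a
  projection argument.

  The O(x^-2) bound rests on \<open>norm (mat_powr x H)\<close> being O(x) at infinity, and this is
  read off the process: the trace of x^H Sigma (x^H)^T is the second moment of B(x), which
  stationary increments keep below a multiple of x^2, and Sigma is positive definite because
  \<open>Re_mat (A ** adjoint_mat A)\<close> has full rank. Four derivatives then contribute x^-4 to
  a growth of x^2.

  Covariance matrices of finitely many coefficients may be singular. They are therefore factored as
  W W^T with W^T M W diagonal, and the vector of coefficients is replaced by W xi, which has the
  same characteristic function; the quadratic form then has the same law by the continuity theorem
  for a constant sequence.\<close>

inductive_set trig_polys :: "'i set \<Rightarrow> (('i \<Rightarrow> real) \<Rightarrow> real) set" for I where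
  trig_cos: "(\<lambda>x. a * cos ((\<Sum>i\<in>I. u i * x i) + c)) \<in> trig_polys I"
| trig_add: "f \<in> trig_polys I \<Longrightarrow> g \<in> trig_polys I \<Longrightarrow> (\<lambda>x. f x + g x) \<in> trig_polys I"

lemma trig_const: "(\<lambda>x. c) \<in> trig_polys I"
  using trig_cos[of c "\<lambda>_. 0" I 0] by simp

text \<open>Product-to-sum formula. Together with the phase \<open>c\<close>, which makes sines
  available, it turns the span of the cosines into an algebra, and the expectation of each generator
  is fixed by a characteristic function.\<close>

lemma trig_mult:
  assumes "f \<in> trig_polys I" "g \<in> trig_polys I"
  shows "(\<lambda>x. f x * g x) \<in> trig_polys I"
  using assms(1)
proof induction
  case (trig_cos a u c)
  from assms(2) show ?case
  proof induction
    case (trig_cos b v d)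
    have "(\<lambda>x. a * cos ((\<Sum>i\<in>I. u i * x i) + c) * (b * cos ((\<Sum>i\<in>I. v i * x i) + d))) =
      (\<lambda>x. (a * b / 2) * cos ((\<Sum>i\<in>I. (u i - v i) * x i) + (c - d))
         + (a * b / 2) * cos ((\<Sum>i\<in>I. (u i + v i) * x i) + (c + d)))" (is "?l = ?r")
    proof
      fix x
      have 1: "(\<Sum>i\<in>I. (u i - v i) * x i) + (c - d) =
          ((\<Sum>i\<in>I. u i * x i) + c) - ((\<Sum>i\<in>I. v i * x i) + d)"
        "(\<Sum>i\<in>I. (u i + v i) * x i) + (c + d) =
          ((\<Sum>i\<in>I. u i * x i) + c) + ((\<Sum>i\<in>I. v i * x i) + d)"
        by (simp_all add: algebra_simps sum.distrib sum_subtractf)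
      show "?l x = ?r x"
        unfolding 1 cos_diff cos_add by (simp add: algebra_simps)
    qed
    then show ?case
      by (simp only:) (intro trig_polys.intros)
  next
    case (trig_add f g)
    then show ?case
      using trig_polys.trig_add[OF trig_add.IH] by (simp add: algebra_simps)
  qed
next
  case (trig_add f g)
  then show ?case
    using trig_polys.trig_add[OF trig_add.IH] by (simp add: algebra_simps)
qed

text \<open>A sine is a cosine with phase -pi/2. These functions become the coordinates after the
  substitution w = sin (x / R).\<close>

lemma trig_sin_coordinate:
  assumes "finite I" "i \<in> I"
  shows "(\<lambda>x. sin (x i / R)) \<in> trig_polys I"
proof -
  have "(\<Sum>j\<in>I. (if j = i then 1 / R else 0) * x j) = x i / R" for x
    using assms by (simp add: if_distrib[of "\<lambda>t. t * _"] sum.delta' cong: if_cong)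
  then have "1 * cos ((\<Sum>j\<in>I. (if j = i then 1 / R else 0) * x j) + - (pi / 2)) = sin (x i / R)" for x
    by (simp only: cos_add) simp
  then show ?thesis
    using trig_cos[of 1 "\<lambda>j. if j = i then 1 / R else 0" I "- (pi / 2)"] by simp
qed

text \<open>Points are functions on a whole index type, only some of whose coordinates will matter,
  so compactness is Tychonoff's theorem.\<close>

lemma compact_cube: "compact {w :: 'i \<Rightarrow> real. \<forall>i. w i \<in> {-1..1}}"
proof -
  have "compactin (product_topology (\<lambda>_. euclidean) UNIV) (PiE UNIV (\<lambda>_ :: 'i. {-1..1::real}))"
    by (subst compactin_PiE) simp
  moreover have "{w :: 'i \<Rightarrow> real. \<forall>i. w i \<in> {-1..1}} = PiE UNIV (\<lambda>_ :: 'i. {-1..1::real})"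
    by auto
  ultimately show ?thesis
    by (simp add: euclidean_product_topology)
qed

text \<open>Approximating \<open>w \<mapsto> f (R arcsin w)\<close> by polynomials on the cube \<open>[-1,1]\<^sup>I\<close> and substituting
  \<open>w = sin (x / R)\<close> keeps the approximants bounded on the whole space.\<close>

lemma trig_polys_approx:
  fixes f :: "('i::countable \<Rightarrow> real) \<Rightarrow> real"
  assumes I: "finite I" and f: "continuous_on UNIV f" and M: "\<And>x. \<bar>f x\<bar> \<le> M"
    and dep: "\<And>x y. (\<And>i. i \<in> I \<Longrightarrow> x i = y i) \<Longrightarrow> f x = f y" and "R > 0" "\<epsilon> > 0"
  obtains g where "g \<in> trig_polys I" "\<And>x. \<bar>g x\<bar> \<le> M + \<epsilon>"
    "\<And>x. (\<And>i. i \<in> I \<Longrightarrow> \<bar>x i\<bar> \<le> R) \<Longrightarrow> \<bar>f x - g x\<bar> \<le> \<epsilon>"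
proof -
  \<comment> \<open>Coordinates outside \<open>I\<close> are frozen at 0; otherwise functions of the
    coordinates in \<open>I\<close> could not separate points.\<close>
  define S where "S = {w :: 'i \<Rightarrow> real. (\<forall>i. w i \<in> {-1..1}) \<and> (\<forall>i. i \<notin> I \<longrightarrow> w i = 0)}"
  define \<phi> where "\<phi> x = (\<lambda>i. if i \<in> I then sin (x i / R) else 0)" for x
  \<comment> \<open>The algebra for Stone-Weierstrass: continuous functions on \<open>S\<close>
    whose pullback along the sine substitution is a trigonometric polynomial.\<close>
  define T where "T = {F. continuous_on S F \<and> (\<lambda>x. F (\<phi> x)) \<in> trig_polys I}"
  have \<phi>S: "\<phi> x \<in> S" for x
    by (auto simp: \<phi>_def S_def)
  have "closed (\<Inter>i\<in>-I. {w :: 'i \<Rightarrow> real. w i = 0})"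
    by (intro closed_INT ballI closed_Collect_eq continuous_intros) auto
  then have "compact ({w :: 'i \<Rightarrow> real. \<forall>i. w i \<in> {-1..1}} \<inter> (\<Inter>i\<in>-I. {w. w i = 0}))"
    by (intro compact_Int_closed compact_cube)
  also have "{w :: 'i \<Rightarrow> real. \<forall>i. w i \<in> {-1..1}} \<inter> (\<Inter>i\<in>-I. {w. w i = 0}) = S"
    by (auto simp: S_def)
  finally have "compact S" .
  have cont_coord: "continuous_on S (\<lambda>w. w i)" for i
    by (rule continuous_on_subset[OF continuous_on_product_coordinates]) simp
  interpret function_ring_on T S
  proof
    show "compact S" by fact
    show "\<exists>f\<in>T. f x \<noteq> f y" if xy: "x \<in> S" "y \<in> S" "x \<noteq> y" for x y
    proof -
      obtain i where i: "x i \<noteq> y i" using xy(3) by (auto simp: fun_eq_iff)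
      then have "i \<in> I" using xy by (auto simp: S_def)
      then have "(\<lambda>w. w i) \<in> T"
        using trig_sin_coordinate[OF I, of i R] cont_coord by (simp add: T_def \<phi>_def)
      then show ?thesis using i by (intro bexI[of _ "\<lambda>w. w i"])
    qed
  qed (auto simp: T_def intro!: continuous_intros trig_polys.intros trig_const trig_mult)
  define h where "h w = f (\<lambda>i. R * arcsin (w i))" for w
  have c1: "continuous_on S (\<lambda>w i. R * arcsin (w i))"
    by (rule continuous_on_coordinatewise_then_product)
       (intro continuous_on_mult_left continuous_on_arcsin cont_coord; simp add: S_def)
  have "continuous_on S h"
    unfolding h_def
    using continuous_on_compose[OF c1 continuous_on_subset[OF f]] by (simp add: o_def)
  from Stone_Weierstrass_basic[OF this \<open>\<epsilon> > 0\<close>]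
  obtain F where F: "F \<in> T" "\<And>w. w \<in> S \<Longrightarrow> \<bar>h w - F w\<bar> < \<epsilon>" by blast
  show ?thesis
  proof
    show "(\<lambda>x. F (\<phi> x)) \<in> trig_polys I" using F by (simp add: T_def)
    show "\<bar>F (\<phi> x)\<bar> \<le> M + \<epsilon>" for x
      using F(2)[OF \<phi>S, of x] M[of "\<lambda>i. R * arcsin (\<phi> x i)"] unfolding h_def by linarith
    show "\<bar>f x - F (\<phi> x)\<bar> \<le> \<epsilon>" if x: "\<And>i. i \<in> I \<Longrightarrow> \<bar>x i\<bar> \<le> R" for x
    proof -
      have "R * arcsin (\<phi> x i) = x i" if "i \<in> I" for i
      proof -
        \<comment> \<open>On the box the argument of the sine lies in [-1, 1], inside [-pi/2, pi/2]
          where arcsin undoes it.\<close>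
        have "\<bar>x i / R\<bar> \<le> 1" using x[OF that] \<open>R > 0\<close> by simp
        then have "- (pi / 2) \<le> x i / R" "x i / R \<le> pi / 2"
          using pi_ge_two by linarith+
        then show ?thesis
          using that \<open>R > 0\<close> by (simp add: \<phi>_def arcsin_sin)
      qed
      then have "h (\<phi> x) = f x"
        unfolding h_def by (intro dep) auto
      then show ?thesis using F(2)[OF \<phi>S, of x] by simp
    qed
  qed
qed

lemma trig_polys_bounded:
  assumes "g \<in> trig_polys I" shows "\<exists>B. \<forall>x. \<bar>g x\<bar> \<le> B"
  using assms
proof induction
  case (trig_cos a u c)
  have "\<bar>a * cos t\<bar> \<le> \<bar>a\<bar>" for t
    by (simp add: abs_mult mult_left_le)
  then show ?case by blast
next
  case (trig_add f g)
  then show ?case by (meson abs_triangle_ineq add_mono order_trans)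
qed

lemma trig_polys_measurable:
  assumes "g \<in> trig_polys I" "\<And>i. i \<in> I \<Longrightarrow> (\<lambda>\<omega>. X \<omega> i) \<in> borel_measurable P"
  shows "(\<lambda>\<omega>. g (X \<omega>)) \<in> borel_measurable P"
  using assms(1)
  by induction (auto intro!: borel_measurable_add borel_measurable_times borel_measurable_sum
      borel_measurable_cos assms(2) borel_measurable_const intro: measurable_compose)

text \<open>A cosine with a phase is the real part of a fixed multiple of the exponential, so
  convergence of characteristic functions gives convergence of its expectation.\<close>

lemma (in prob_space) integral_iexp_Re:
  assumes "X \<in> borel_measurable M"
  shows "(\<integral>\<omega>. a * cos (X \<omega> + c) \<partial>M) = Re (a * iexp c * (\<integral>\<omega>. iexp (X \<omega>) \<partial>M))"
proof -
  have i: "integrable M (\<lambda>\<omega>. iexp (X \<omega>))"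
    using assms by (intro integrable_iexp) auto
  have "a * iexp c * (\<integral>\<omega>. iexp (X \<omega>) \<partial>M) = (\<integral>\<omega>. a * iexp c * iexp (X \<omega>) \<partial>M)"
    using i by simp
  also have "Re \<dots> = (\<integral>\<omega>. Re (a * iexp c * iexp (X \<omega>)) \<partial>M)"
    using i by (intro integral_Re[symmetric]) auto
  also have "\<dots> = (\<integral>\<omega>. a * cos (X \<omega> + c) \<partial>M)"
    by (intro Bochner_Integration.integral_cong refl)
       (simp add: cis_conv_exp[symmetric] cis_mult mult.assoc add.commute)
  finally show ?thesis ..
qed

lemma trig_polys_expectation_tendsto:
  assumes P: "prob_space P" and Q: "prob_space Q" and I: "finite I"
    and X: "\<And>n i. i \<in> I \<Longrightarrow> (\<lambda>\<omega>. X n \<omega> i) \<in> borel_measurable P"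
    and Y: "\<And>i. i \<in> I \<Longrightarrow> (\<lambda>\<omega>. Y \<omega> i) \<in> borel_measurable Q"
    and char: "\<And>u. (\<lambda>n. \<integral>\<omega>. iexp (\<Sum>i\<in>I. u i * X n \<omega> i) \<partial>P) \<longlonglongrightarrow> (\<integral>\<omega>. iexp (\<Sum>i\<in>I. u i * Y \<omega> i) \<partial>Q)"
    and g: "g \<in> trig_polys I"
  shows "(\<lambda>n. \<integral>\<omega>. g (X n \<omega>) \<partial>P) \<longlonglongrightarrow> (\<integral>\<omega>. g (Y \<omega>) \<partial>Q)"
proof -
  interpret P: prob_space P by fact
  interpret Q: prob_space Q by fact
  have int: "integrable P (\<lambda>\<omega>. h (X n \<omega>))" "integrable Q (\<lambda>\<omega>. h (Y \<omega>))" if h: "h \<in> trig_polys I" for h n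
  proof -
    obtain b where b: "\<And>x. \<bar>h x\<bar> \<le> b"
      using trig_polys_bounded[OF h] by blast
    show "integrable P (\<lambda>\<omega>. h (X n \<omega>))"
      using b by (intro P.integrable_const_bound[where B = b] trig_polys_measurable[OF h X]) auto
    show "integrable Q (\<lambda>\<omega>. h (Y \<omega>))"
      using b by (intro Q.integrable_const_bound[where B = b] trig_polys_measurable[OF h Y]) auto
  qed
  from g show ?thesis
  proof induction
    case (trig_cos a u c)
    show ?case
      using X Y I
      by (subst P.integral_iexp_Re, simp, subst Q.integral_iexp_Re, simp)
         (intro tendsto_intros char)
  next
    case (trig_add f g)
    then show ?case
      using int by (simp add: tendsto_add)
  qed
qed

text \<open>The cut-off is 0 for values up to R in modulus and 1 from R + 1 on. It replaces the
  indicator of a tail by a continuous function, whose expectation converges under weak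
  convergence.\<close>

lemma (in prob_space) tails_small:
  fixes Y :: "'a \<Rightarrow> 'i \<Rightarrow> real"
  assumes I: "finite I" and Y: "\<And>i. i \<in> I \<Longrightarrow> (\<lambda>\<omega>. Y \<omega> i) \<in> borel_measurable M" and "\<delta> > 0"
  obtains R where "R > 0" "(\<Sum>i\<in>I. \<integral>\<omega>. max 0 (min 1 (\<bar>Y \<omega> i\<bar> - R)) \<partial>M) < \<delta>"
proof -
  have "(\<lambda>n. \<Sum>i\<in>I. \<integral>\<omega>. max 0 (min 1 (\<bar>Y \<omega> i\<bar> - real n)) \<partial>M) \<longlonglongrightarrow> (\<Sum>i\<in>I. \<integral>\<omega>. 0 \<partial>M)"
  proof (intro tendsto_sum integral_dominated_convergence[where w = "\<lambda>_. 1"] AE_I2)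
    fix i \<omega>
    have "eventually (\<lambda>n. real n > \<bar>Y \<omega> i\<bar>) sequentially"
      by real_asymp
    then show "(\<lambda>n. max 0 (min 1 (\<bar>Y \<omega> i\<bar> - real n))) \<longlonglongrightarrow> 0"
      by (intro tendsto_eventually) (auto elim!: eventually_mono)
  qed (use Y in auto)
  then have "eventually (\<lambda>n. (\<Sum>i\<in>I. \<integral>\<omega>. max 0 (min 1 (\<bar>Y \<omega> i\<bar> - real n)) \<partial>M) < \<delta>) sequentially"
    using \<open>\<delta> > 0\<close> by (intro order_tendstoD(2)) auto
  from this[unfolded eventually_sequentially]
  obtain k where k: "\<forall>n\<ge>k. (\<Sum>i\<in>I. \<integral>\<omega>. max 0 (min 1 (\<bar>Y \<omega> i\<bar> - real n)) \<partial>M) < \<delta>" ..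
  show ?thesis
    by (rule that[of "real (Suc k)"], simp, rule k[rule_format], simp)
qed

text \<open>Trigonometric polynomials approximate \<open>f\<close> uniformly on a box, and their
  expectations converge by hypothesis. Tightness, which controls the rest, follows coordinatewise
  from the one-dimensional continuity theorem, since the limit is a given random vector.\<close>

theorem multivariate_levy_continuity:
  fixes f :: "('i::countable \<Rightarrow> real) \<Rightarrow> real" and P :: "'s measure" and Q :: "'t measure"
  assumes P: "prob_space P" and Q: "prob_space Q" and I: "finite I"
    and X: "\<And>n i. i \<in> I \<Longrightarrow> (\<lambda>\<omega>. X n \<omega> i) \<in> borel_measurable P"
    and Y: "\<And>i. i \<in> I \<Longrightarrow> (\<lambda>\<omega>. Y \<omega> i) \<in> borel_measurable Q"
    and char: "\<And>u. (\<lambda>n. \<integral>\<omega>. iexp (\<Sum>i\<in>I. u i * X n \<omega> i) \<partial>P) \<longlonglongrightarrow> (\<integral>\<omega>. iexp (\<Sum>i\<in>I. u i * Y \<omega> i) \<partial>Q)"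
    and f: "continuous_on UNIV f" and M: "\<And>x. \<bar>f x\<bar> \<le> M"
    and dep: "\<And>x y. (\<And>i. i \<in> I \<Longrightarrow> x i = y i) \<Longrightarrow> f x = f y"
    and fX: "\<And>n. (\<lambda>\<omega>. f (X n \<omega>)) \<in> borel_measurable P"
    and fY: "(\<lambda>\<omega>. f (Y \<omega>)) \<in> borel_measurable Q"
  shows "(\<lambda>n. \<integral>\<omega>. f (X n \<omega>) \<partial>P) \<longlonglongrightarrow> (\<integral>\<omega>. f (Y \<omega>) \<partial>Q)"
proof -
  interpret P: prob_space P by fact
  interpret Q: prob_space Q by fact
  have M0: "M \<ge> 0" using M[of "\<lambda>_. 0"] by linarith
  define \<tau> where "\<tau> R t = max 0 (min 1 (\<bar>t\<bar> - R))" for R t :: real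
  have \<tau>_meas: "\<tau> R \<in> borel_measurable borel" for R
    unfolding \<tau>_def by measurable
  have tau_conv: "(\<lambda>n. \<integral>\<omega>. \<tau> R (X n \<omega> i) \<partial>P) \<longlonglongrightarrow> (\<integral>\<omega>. \<tau> R (Y \<omega> i) \<partial>Q)" if i: "i \<in> I" for R i
  proof -
    have rX: "real_distribution (distr P borel (\<lambda>\<omega>. X n \<omega> i))" for n
      using X[OF i] by (intro P.real_distribution_distr) auto
    have rY: "real_distribution (distr Q borel (\<lambda>\<omega>. Y \<omega> i))"
      using Y[OF i] by (intro Q.real_distribution_distr) auto
    have sel: "(\<Sum>j\<in>I. (if j = i then t else 0) * x j) = t * x i" for t and x :: "'i \<Rightarrow> real"
      using I i by (simp add: if_distrib[of "\<lambda>t. t * _"] sum.delta' cong: if_cong)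
    have "weak_conv_m (\<lambda>n. distr P borel (\<lambda>\<omega>. X n \<omega> i)) (distr Q borel (\<lambda>\<omega>. Y \<omega> i))"
    proof (rule levy_continuity[OF rX rY])
      fix t
      have "char (distr P borel (\<lambda>\<omega>. X n \<omega> i)) t = (\<integral>\<omega>. iexp (\<Sum>j\<in>I. (if j = i then t else 0) * X n \<omega> j) \<partial>P)" for n
        unfolding char_def sel using X[OF i] by (subst integral_distr) auto
      moreover have "char (distr Q borel (\<lambda>\<omega>. Y \<omega> i)) t = (\<integral>\<omega>. iexp (\<Sum>j\<in>I. (if j = i then t else 0) * Y \<omega> j) \<partial>Q)"
        unfolding char_def sel using Y[OF i] by (subst integral_distr) auto
      ultimately show "(\<lambda>n. char (distr P borel (\<lambda>\<omega>. X n \<omega> i)) t) \<longlonglongrightarrow> char (distr Q borel (\<lambda>\<omega>. Y \<omega> i)) t"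
        using char[of "\<lambda>j. if j = i then t else 0"] by simp
    qed
    moreover have "isCont (\<tau> R) x" "\<bar>\<tau> R x\<bar> \<le> 1" for x
      unfolding \<tau>_def by (intro continuous_intros) auto
    ultimately have "(\<lambda>n. \<integral>x. \<tau> R x \<partial>distr P borel (\<lambda>\<omega>. X n \<omega> i)) \<longlonglongrightarrow> (\<integral>x. \<tau> R x \<partial>distr Q borel (\<lambda>\<omega>. Y \<omega> i))"
      by (intro weak_conv_imp_integral_bdd_continuous_conv[OF rX rY, where B = 1]) auto
    then show ?thesis
      using X[OF i] Y[OF i] \<tau>_meas by (simp add: integral_distr)
  qed
  \<comment> \<open>Common to all \<open>X n\<close> and \<open>Y\<close>: inside the box the error
    is epsilon; outside it some cut-off is 1 and the error is at most 2 M + epsilon.\<close>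
  have key: "\<bar>(\<integral>\<omega>. f (W \<omega>) \<partial>S) - (\<integral>\<omega>. g (W \<omega>) \<partial>S)\<bar> \<le> \<epsilon> + (2 * M + \<epsilon>) * (\<Sum>i\<in>I. \<integral>\<omega>. \<tau> R (W \<omega> i) \<partial>S)"
    if S: "prob_space S" and W: "\<And>i. i \<in> I \<Longrightarrow> (\<lambda>\<omega>. W \<omega> i) \<in> borel_measurable S"
      and fW: "(\<lambda>\<omega>. f (W \<omega>)) \<in> borel_measurable S"
      and g: "g \<in> trig_polys I" "\<And>x. \<bar>g x\<bar> \<le> M + \<epsilon>"
        "\<And>x. (\<And>i. i \<in> I \<Longrightarrow> \<bar>x i\<bar> \<le> R + 1) \<Longrightarrow> \<bar>f x - g x\<bar> \<le> \<epsilon>" and "\<epsilon> > 0"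
    for S :: "'r measure" and W g \<epsilon> R
  proof -
    interpret S: prob_space S by fact
    have gW: "(\<lambda>\<omega>. g (W \<omega>)) \<in> borel_measurable S"
      by (rule trig_polys_measurable[OF g(1) W])
    have if': "integrable S (\<lambda>\<omega>. f (W \<omega>))"
      using fW M by (intro S.integrable_const_bound[where B = M]) auto
    have ig: "integrable S (\<lambda>\<omega>. g (W \<omega>))"
      using gW g by (intro S.integrable_const_bound[where B = "M + \<epsilon>"]) auto
    have it: "integrable S (\<lambda>\<omega>. \<tau> R (W \<omega> i))" if "i \<in> I" for i
      using W[OF that] by (intro S.integrable_const_bound[where B = 1]) (auto simp: \<tau>_def)
    have "\<bar>(\<integral>\<omega>. f (W \<omega>) \<partial>S) - (\<integral>\<omega>. g (W \<omega>) \<partial>S)\<bar> = \<bar>\<integral>\<omega>. f (W \<omega>) - g (W \<omega>) \<partial>S\<bar>"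
      using if' ig by simp
    also have "\<dots> \<le> (\<integral>\<omega>. \<bar>f (W \<omega>) - g (W \<omega>)\<bar> \<partial>S)"
      by (rule integral_abs_bound)
    also have "\<dots> \<le> (\<integral>\<omega>. \<epsilon> + (2 * M + \<epsilon>) * (\<Sum>i\<in>I. \<tau> R (W \<omega> i)) \<partial>S)"
    proof (rule integral_mono)
      fix \<omega>
      have nn: "(\<Sum>i\<in>I. \<tau> R (W \<omega> i)) \<ge> 0"
        by (auto simp: \<tau>_def intro!: sum_nonneg)
      show "\<bar>f (W \<omega>) - g (W \<omega>)\<bar> \<le> \<epsilon> + (2 * M + \<epsilon>) * (\<Sum>i\<in>I. \<tau> R (W \<omega> i))"
      proof (cases "\<forall>i\<in>I. \<bar>W \<omega> i\<bar> \<le> R + 1")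
        case True
        then show ?thesis
          using g(3)[of "W \<omega>"] nn M0 \<open>\<epsilon> > 0\<close> by (smt (verit) mult_nonneg_nonneg)
      next
        case False
        then obtain i where i: "i \<in> I" "\<bar>W \<omega> i\<bar> > R + 1" by force
        have "1 = \<tau> R (W \<omega> i)" using i by (simp add: \<tau>_def)
        also have "\<dots> \<le> (\<Sum>i\<in>I. \<tau> R (W \<omega> i))"
          by (rule member_le_sum[OF i(1)]) (auto simp: \<tau>_def I)
        finally have "2 * M + \<epsilon> \<le> (2 * M + \<epsilon>) * (\<Sum>i\<in>I. \<tau> R (W \<omega> i))"
          using M0 \<open>\<epsilon> > 0\<close> by (simp add: mult_le_cancel_left1)
        then show ?thesis
          using M[of "W \<omega>"] g(2)[of "W \<omega>"] \<open>\<epsilon> > 0\<close> by linarith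
      qed
    qed (use if' ig it in auto)
    also have "\<dots> = \<epsilon> + (2 * M + \<epsilon>) * (\<Sum>i\<in>I. \<integral>\<omega>. \<tau> R (W \<omega> i) \<partial>S)"
      using it by (simp add: S.prob_space)
    finally show ?thesis .
  qed
  show ?thesis
  proof (rule LIMSEQ_I)
    fix r :: real assume "r > 0"
    \<comment> \<open>Both approximation errors stay below r/4: epsilon gives at most r/8, and since
      epsilon is at most 1 the tail term gives less than (2 M + 1) delta = r/8.\<close>
    define \<epsilon> where "\<epsilon> = min 1 (r / 8)"
    define \<delta> where "\<delta> = r / (8 * (2 * M + 1))"
    have \<epsilon>: "\<epsilon> > 0" "\<epsilon> \<le> 1" "\<epsilon> \<le> r / 8" using \<open>r > 0\<close> by (auto simp: \<epsilon>_def)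
    have \<delta>: "\<delta> > 0" using \<open>r > 0\<close> M0 by (simp add: \<delta>_def)
    obtain R where R: "R > 0" "(\<Sum>i\<in>I. \<integral>\<omega>. \<tau> R (Y \<omega> i) \<partial>Q) < \<delta>"
      unfolding \<tau>_def by (rule Q.tails_small[OF I Y \<delta>])
    obtain g where g: "g \<in> trig_polys I" "\<And>x. \<bar>g x\<bar> \<le> M + \<epsilon>"
        "\<And>x. (\<And>i. i \<in> I \<Longrightarrow> \<bar>x i\<bar> \<le> R + 1) \<Longrightarrow> \<bar>f x - g x\<bar> \<le> \<epsilon>"
    proof (rule trig_polys_approx[OF I f M dep, where R = "R + 1" and \<epsilon> = \<epsilon>])
      show "R + 1 > 0" "\<epsilon> > 0" using R(1) \<epsilon>(1) by auto
    qed auto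
    have bnd: "\<epsilon> + (2 * M + \<epsilon>) * s < r / 4" if "s < \<delta>" "s \<ge> 0" for s
    proof -
      have "(2 * M + \<epsilon>) * s \<le> (2 * M + 1) * s"
        using that \<epsilon> by (intro mult_right_mono) auto
      also have "\<dots> < (2 * M + 1) * \<delta>"
        using that M0 by (intro mult_strict_left_mono) auto
      also have "\<dots> = r / 8" using M0 by (simp add: \<delta>_def field_simps)
      finally show ?thesis using \<epsilon> by linarith
    qed
    have nn: "(\<Sum>i\<in>I. \<integral>\<omega>. \<tau> R (W \<omega> i) \<partial>S) \<ge> 0" for W and S :: "'s measure"
      by (intro sum_nonneg Bochner_Integration.integral_nonneg) (simp add: \<tau>_def)
    have nn': "(\<Sum>i\<in>I. \<integral>\<omega>. \<tau> R (W \<omega> i) \<partial>S) \<ge> 0" for W and S :: "'t measure"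
      by (intro sum_nonneg Bochner_Integration.integral_nonneg) (simp add: \<tau>_def)
    have "(\<lambda>n. \<Sum>i\<in>I. \<integral>\<omega>. \<tau> R (X n \<omega> i) \<partial>P) \<longlonglongrightarrow> (\<Sum>i\<in>I. \<integral>\<omega>. \<tau> R (Y \<omega> i) \<partial>Q)"
      by (intro tendsto_sum tau_conv)
    then have e1: "eventually (\<lambda>n. (\<Sum>i\<in>I. \<integral>\<omega>. \<tau> R (X n \<omega> i) \<partial>P) < \<delta>) sequentially"
      using R(2) by (rule order_tendstoD)
    have e2: "eventually (\<lambda>n. \<bar>(\<integral>\<omega>. g (X n \<omega>) \<partial>P) - (\<integral>\<omega>. g (Y \<omega>) \<partial>Q)\<bar> < r / 4) sequentially"
      using tendstoD[OF trig_polys_expectation_tendsto[OF P Q I X Y char g(1)], of "r / 4"] \<open>r > 0\<close>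
      by (simp add: dist_real_def)
    from e1 e2 have "eventually (\<lambda>n. norm ((\<integral>\<omega>. f (X n \<omega>) \<partial>P) - (\<integral>\<omega>. f (Y \<omega>) \<partial>Q)) < r) sequentially"
    proof eventually_elim
      case (elim n)
      have "\<bar>(\<integral>\<omega>. f (X n \<omega>) \<partial>P) - (\<integral>\<omega>. g (X n \<omega>) \<partial>P)\<bar> < r / 4"
        by (rule order_le_less_trans[OF key[OF P X fX g \<epsilon>(1)] bnd[OF elim(1) nn]])
      moreover have "\<bar>(\<integral>\<omega>. f (Y \<omega>) \<partial>Q) - (\<integral>\<omega>. g (Y \<omega>) \<partial>Q)\<bar> < r / 4"
        by (rule order_le_less_trans[OF key[OF Q Y fY g \<epsilon>(1)] bnd[OF R(2) nn']])
      ultimately show ?case using elim(2) \<open>r > 0\<close> unfolding real_norm_def by linarith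
    qed
    then show "\<exists>no. \<forall>n\<ge>no. norm ((\<integral>\<omega>. f (X n \<omega>) \<partial>P) - (\<integral>\<omega>. f (Y \<omega>) \<partial>Q)) < r"
      by (simp add: eventually_sequentially)
  qed
qed

section \<open>Diagonalization of symmetric matrices\<close>

lemma orthonormal_rotation:
  fixes x y x' y' c s :: real
  assumes "c\<^sup>2 + s\<^sup>2 = 1"
  shows "(c * x + s * y) * (c * x' + s * y') + (- s * x + c * y) * (- s * x' + c * y') = x * x' + y * y'"
proof -
  have "(c * x + s * y) * (c * x' + s * y') + (- s * x + c * y) * (- s * x' + c * y') =
      (c\<^sup>2 + s\<^sup>2) * (x * x' + y * y')"
    by (simp add: algebra_simps power2_eq_square)
  then show ?thesis using assms by simp
qed

text \<open>The expression is the off-diagonal entry of a symmetric 2 by 2 block with diagonal p, q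
  and off-diagonal r after a rotation. A quarter turn changes its sign, so an intermediate angle
  annihilates it.\<close>

lemma jacobi_angle:
  fixes p q r :: real
  obtains c s where "c\<^sup>2 + s\<^sup>2 = 1" "(q - p) * (c * s) + r * (c\<^sup>2 - s\<^sup>2) = 0"
proof -
  define g where "g t = (q - p) * (cos t * sin t) + r * ((cos t)\<^sup>2 - (sin t)\<^sup>2)" for t
  have cont: "continuous_on {0..pi/2} g"
    unfolding g_def by (intro continuous_intros)
  have "g 0 = r" "g (pi/2) = - r" by (simp_all add: g_def)
  then have "\<exists>t. 0 \<le> t \<and> t \<le> pi/2 \<and> g t = 0"
    using IVT'[of g 0 0 "pi/2"] IVT2'[of g "pi/2" 0 0] cont by (cases "r \<le> 0") auto
  then obtain t where "g t = 0" by blast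
  then show ?thesis
    by (intro that[of "cos t" "sin t"]) (auto simp: g_def)
qed

lemma sum_pair_split:
  fixes f :: "'i \<Rightarrow> real"
  assumes "finite I" "a \<in> I" "b \<in> I" "a \<noteq> b"
  shows "sum f I = f a + f b + sum f (I - {a, b})"
proof -
  have "sum f I = f a + sum f (I - {a})" using assms by (simp add: sum.remove)
  also have "sum f (I - {a}) = f b + sum f (I - {a} - {b})"
    using assms by (intro sum.remove) auto
  also have "I - {a} - {b} = I - {a, b}" by auto
  finally show ?thesis by simp
qed

text \<open>A maximiser of the sum of the squared diagonal entries of \<open>O\<^sup>T S O\<close> over the compact group
  of orthogonal matrices has no nonzero off-diagonal entry, since a Jacobi rotation would turn it
  into a gain on the diagonal.\<close>

theorem symmetric_diagonalization:
  fixes S :: "'i \<Rightarrow> 'i \<Rightarrow> real"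
  assumes I: "finite I" and S: "\<And>i j. i \<in> I \<Longrightarrow> j \<in> I \<Longrightarrow> S i j = S j i"
  obtains U :: "'i \<Rightarrow> 'i \<Rightarrow> real" and d where
    "\<forall>a\<in>I. \<forall>b\<in>I. (\<Sum>i\<in>I. U i a * U i b) = (if a = b then 1 else 0)"
    "\<forall>i\<in>I. \<forall>j\<in>I. (\<Sum>a\<in>I. U i a * U j a) = (if i = j then 1 else 0)"
    "\<forall>a\<in>I. \<forall>b\<in>I. (\<Sum>i\<in>I. \<Sum>j\<in>I. U i a * S i j * U j b) = (if a = b then d a else 0)"
proof -
  define cols where "cols W \<longleftrightarrow> (\<forall>a\<in>I. \<forall>b\<in>I. (\<Sum>i\<in>I. W (i, a) * W (i, b)) = (if a = b then 1 else (0::real)))" for W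
  define rows where "rows W \<longleftrightarrow> (\<forall>i\<in>I. \<forall>j\<in>I. (\<Sum>a\<in>I. W (i, a) * W (j, a)) = (if i = j then 1 else (0::real)))" for W
  \<comment> \<open>Entries off \<open>I\<close> are pinned to 0 so that \<open>K\<close> lies in
    the compact cube. Row and column orthonormality are both recorded, and a rotation of two columns
    preserves each.\<close>
  define K where "K = {W. (\<forall>p. p \<notin> I \<times> I \<longrightarrow> W p = 0) \<and> cols W \<and> rows W}"
  have cc: "continuous_on UNIV (\<lambda>W :: 'i \<times> 'i \<Rightarrow> real. W p)" for p
    by (rule continuous_on_product_coordinates)
  have "K = (\<Inter>p\<in>-(I \<times> I). {W. W p = 0})
      \<inter> (\<Inter>a\<in>I. \<Inter>b\<in>I. {W. (\<Sum>i\<in>I. W (i, a) * W (i, b)) = (if a = b then 1 else 0)})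
      \<inter> (\<Inter>i\<in>I. \<Inter>j\<in>I. {W. (\<Sum>a\<in>I. W (i, a) * W (j, a)) = (if i = j then 1 else 0)})"
    unfolding K_def cols_def rows_def by auto
  also have "closed \<dots>"
    by (intro closed_Int closed_INT ballI closed_Collect_eq continuous_on_sum continuous_on_mult
        continuous_on_const cc)
  finally have closed: "closed K" .
  have cube: "W p \<in> {-1..1}" if W: "W \<in> K" for W p
  proof (cases "p \<in> I \<times> I")
    case True
    then obtain i a where p: "p = (i, a)" "i \<in> I" "a \<in> I" by auto
    have "(W (i, a))\<^sup>2 \<le> (\<Sum>a\<in>I. (W (i, a))\<^sup>2)"
      using I p by (intro member_le_sum) auto
    also have "\<dots> = 1"
      using W p by (auto simp: K_def rows_def power2_eq_square)
    finally have "\<bar>W (i, a)\<bar> \<le> 1" by (simp add: abs_square_le_1)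
    then show ?thesis using p by auto
  next
    case False
    then have "W p = 0" using W unfolding K_def by blast
    then show ?thesis by simp
  qed
  have "compact ({W :: 'i \<times> 'i \<Rightarrow> real. \<forall>p. W p \<in> {-1..1}} \<inter> K)"
    by (intro compact_Int_closed compact_cube closed)
  also have "{W :: 'i \<times> 'i \<Rightarrow> real. \<forall>p. W p \<in> {-1..1}} \<inter> K = K"
    using cube by blast
  finally have comp: "compact K" .
  define e where "e = (\<lambda>(i, j). if i \<in> I \<and> i = j then 1 else (0::real))"
  have "cols e" "rows e"
    unfolding cols_def rows_def e_def using I by (auto simp: sum.delta if_distrib[of "\<lambda>t. t * _"] cong: if_cong)
  then have "e \<in> K" by (auto simp: K_def e_def)
  then have "K \<noteq> {}" by blast
  define T where "T W a b = (\<Sum>i\<in>I. \<Sum>j\<in>I. W (i, a) * S i j * W (j, b))" for W :: "'i \<times> 'i \<Rightarrow> real" and a b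
  have "continuous_on K (\<lambda>W. \<Sum>a\<in>I. (T W a a)\<^sup>2)"
    unfolding T_def
    by (intro continuous_on_sum continuous_on_mult continuous_on_power continuous_on_const
        continuous_on_subset[OF cc] subset_UNIV)
  from continuous_attains_sup[OF comp \<open>K \<noteq> {}\<close> this]
  obtain W where W: "W \<in> K" and max: "\<And>W'. W' \<in> K \<Longrightarrow> (\<Sum>a\<in>I. (T W' a a)\<^sup>2) \<le> (\<Sum>a\<in>I. (T W a a)\<^sup>2)"
    by blast
  have Tsym: "T W a b = T W b a" for a b
  proof -
    have "T W a b = (\<Sum>j\<in>I. \<Sum>i\<in>I. W (i, a) * S i j * W (j, b))"
      unfolding T_def by (rule sum.swap)
    also have "\<dots> = T W b a"
      unfolding T_def by (intro sum.cong refl) (simp add: S mult_ac)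
    finally show ?thesis .
  qed
  have diag: "T W a b = 0" if ab: "a \<in> I" "b \<in> I" "a \<noteq> b" for a b
  proof (rule ccontr)
    assume nz: "T W a b \<noteq> 0"
    define p q r where "p = T W a a" and "q = T W b b" and "r = T W a b"
    obtain c s where cs: "c\<^sup>2 + s\<^sup>2 = 1" "(q - p) * (c * s) + r * (c\<^sup>2 - s\<^sup>2) = 0"
      by (rule jacobi_angle)
    define V where "V = (\<lambda>(i, k). if k = a then c * W (i, a) + s * W (i, b)
        else if k = b then - s * W (i, a) + c * W (i, b) else W (i, k))"
    have Va: "V (i, a) = c * W (i, a) + s * W (i, b)" for i by (simp add: V_def)
    have Vb: "V (i, b) = - s * W (i, a) + c * W (i, b)" for i using ab by (simp add: V_def)
    have Vk: "V (i, k) = W (i, k)" if "k \<noteq> a" "k \<noteq> b" for i k using that by (simp add: V_def)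
    have rowsV: "rows V"
      unfolding rows_def
    proof (intro ballI)
      fix i j assume ij: "i \<in> I" "j \<in> I"
      have "(\<Sum>k\<in>I. V (i, k) * V (j, k)) = V (i, a) * V (j, a) + V (i, b) * V (j, b) + (\<Sum>k\<in>I - {a, b}. V (i, k) * V (j, k))"
        by (rule sum_pair_split[OF I ab])
      also have "(\<Sum>k\<in>I - {a, b}. V (i, k) * V (j, k)) = (\<Sum>k\<in>I - {a, b}. W (i, k) * W (j, k))"
        by (intro sum.cong refl) (simp add: Vk)
      also have "V (i, a) * V (j, a) + V (i, b) * V (j, b) = W (i, a) * W (j, a) + W (i, b) * W (j, b)"
        unfolding Va Vb by (rule orthonormal_rotation[OF cs(1)])
      also have "\<dots> + (\<Sum>k\<in>I - {a, b}. W (i, k) * W (j, k)) = (\<Sum>k\<in>I. W (i, k) * W (j, k))"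
        by (rule sum_pair_split[OF I ab, symmetric])
      finally show "(\<Sum>k\<in>I. V (i, k) * V (j, k)) = (if i = j then 1 else 0)"
        using W ij by (simp add: K_def rows_def)
    qed
    have W1: "(\<Sum>i\<in>I. W (i, k) * W (i, l)) = (if k = l then 1 else 0)" if "k \<in> I" "l \<in> I" for k l
      using W that by (simp add: K_def cols_def)
    have dot: "(\<Sum>i\<in>I. (\<alpha> * W (i, k) + \<beta> * W (i, l)) * (\<gamma> * W (i, m) + \<delta> * W (i, n))) =
        \<alpha> * \<gamma> * (\<Sum>i\<in>I. W (i, k) * W (i, m)) + \<alpha> * \<delta> * (\<Sum>i\<in>I. W (i, k) * W (i, n)) +
        \<beta> * \<gamma> * (\<Sum>i\<in>I. W (i, l) * W (i, m)) + \<beta> * \<delta> * (\<Sum>i\<in>I. W (i, l) * W (i, n))" for \<alpha> \<beta> \<gamma> \<delta> k l m n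
      by (simp add: sum_distrib_left sum.distrib[symmetric] algebra_simps)
    \<comment> \<open>One formula for every column of \<open>V\<close>, used for dot products and
      for \<open>T\<close> alike: column k combines columns \<open>f k\<close> and
      \<open>g k\<close> of \<open>W\<close>, with second coefficient 0 unless k is a or b.\<close>
    define \<alpha> \<beta> where "\<alpha> k = (if k = a then c else if k = b then - s else 1)"
      and "\<beta> k = (if k = a then s else if k = b then c else 0)" for k
    define f g where "f k = (if k = b then a else k)" and "g k = (if k = a then b else k)" for k
    have Vgen: "V (i, k) = \<alpha> k * W (i, f k) + \<beta> k * W (i, g k)" for i k
      using ab by (auto simp: V_def \<alpha>_def \<beta>_def f_def g_def)
    have colsV: "cols V"
      unfolding cols_def
    proof (intro ballI)
      fix k l assume kl: "k \<in> I" "l \<in> I"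
      have fg: "f k \<in> I" "g k \<in> I" "f l \<in> I" "g l \<in> I" using kl ab by (auto simp: f_def g_def)
      have "c * c + s * s = 1" using cs(1) by (simp add: power2_eq_square)
      then show "(\<Sum>i\<in>I. V (i, k) * V (i, l)) = (if k = l then 1 else 0)"
        unfolding Vgen dot using fg ab
        by (simp add: W1) (auto simp: \<alpha>_def \<beta>_def f_def g_def algebra_simps)
    qed
    have "V \<in> K"
      using W colsV rowsV ab by (auto simp: K_def V_def)
    from max[OF this] have le: "(\<Sum>k\<in>I. (T V k k)\<^sup>2) \<le> (\<Sum>k\<in>I. (T W k k)\<^sup>2)" .
    have TV: "T V k l = \<alpha> k * \<alpha> l * T W (f k) (f l) + \<alpha> k * \<beta> l * T W (f k) (g l) +
        \<beta> k * \<alpha> l * T W (g k) (f l) + \<beta> k * \<beta> l * T W (g k) (g l)" for k l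
      unfolding T_def Vgen by (simp add: sum_distrib_left sum.distrib[symmetric] algebra_simps)
    have r': "T W b a = r" unfolding r_def by (rule Tsym)
    have Taa: "T V a a = c\<^sup>2 * p + 2 * (c * s) * r + s\<^sup>2 * q"
      and Tbb: "T V b b = s\<^sup>2 * p - 2 * (c * s) * r + c\<^sup>2 * q"
      unfolding TV using ab r' by (auto simp: \<alpha>_def \<beta>_def f_def g_def p_def q_def r_def power2_eq_square algebra_simps)
    have Tkk: "T V k k = T W k k" if "k \<noteq> a" "k \<noteq> b" for k
      using that unfolding T_def by (simp add: Vk)
    \<comment> \<open>Rotation preserves the sum of squares of the 2 by 2 block; the extra square on
      the left is the new off-diagonal entry, which the chosen angle makes 0.\<close>
    have "(T V a a)\<^sup>2 + (T V b b)\<^sup>2 + 2 * ((q - p) * (c * s) + r * (c\<^sup>2 - s\<^sup>2))\<^sup>2 = (c\<^sup>2 + s\<^sup>2)\<^sup>2 * (p\<^sup>2 + q\<^sup>2 + 2 * r\<^sup>2)"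
      unfolding Taa Tbb by algebra
    then have gain: "(T V a a)\<^sup>2 + (T V b b)\<^sup>2 = p\<^sup>2 + q\<^sup>2 + 2 * r\<^sup>2"
      by (simp add: cs)
    have "(\<Sum>k\<in>I. (T V k k)\<^sup>2) = (T V a a)\<^sup>2 + (T V b b)\<^sup>2 + (\<Sum>k\<in>I - {a, b}. (T V k k)\<^sup>2)"
      by (rule sum_pair_split[OF I ab])
    also have "(\<Sum>k\<in>I - {a, b}. (T V k k)\<^sup>2) = (\<Sum>k\<in>I - {a, b}. (T W k k)\<^sup>2)"
      by (intro sum.cong refl) (simp add: Tkk)
    also have "(T V a a)\<^sup>2 + (T V b b)\<^sup>2 + \<dots> = (\<Sum>k\<in>I. (T W k k)\<^sup>2) + 2 * r\<^sup>2"
      unfolding gain sum_pair_split[OF I ab, of "\<lambda>k. (T W k k)\<^sup>2"] by (simp add: p_def q_def)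
    finally have "r\<^sup>2 \<le> 0" using le by simp
    then show False using nz by (simp add: r_def)
  qed
  show ?thesis
  proof (rule that[of "\<lambda>i a. W (i, a)" "\<lambda>a. T W a a"])
    show "\<forall>a\<in>I. \<forall>b\<in>I. (\<Sum>i\<in>I. \<Sum>j\<in>I. W (i, a) * S i j * W (j, b)) = (if a = b then T W a a else 0)"
      using diag by (auto simp: T_def)
  qed (use W in \<open>auto simp: K_def cols_def rows_def\<close>)
qed

text \<open>Scale the eigenvectors by the square roots of the eigenvalues, which are values of the
  form and hence nonnegative. Singular \<open>G\<close> is included.\<close>

lemma psd_factorization:
  fixes G :: "'i \<Rightarrow> 'i \<Rightarrow> real"
  assumes I: "finite I" and sym: "\<And>i j. i \<in> I \<Longrightarrow> j \<in> I \<Longrightarrow> G i j = G j i"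
    and psd: "\<And>u. 0 \<le> (\<Sum>i\<in>I. \<Sum>j\<in>I. u i * G i j * u j)"
  obtains V :: "'i \<Rightarrow> 'i \<Rightarrow> real" where "\<forall>i\<in>I. \<forall>j\<in>I. G i j = (\<Sum>a\<in>I. V i a * V j a)"
proof -
  obtain U d where
    U: "\<forall>a\<in>I. \<forall>b\<in>I. (\<Sum>i\<in>I. U i a * U i b) = (if a = b then 1 else 0)"
      "\<forall>i\<in>I. \<forall>j\<in>I. (\<Sum>a\<in>I. U i a * U j a) = (if i = j then 1 else 0)"
      "\<forall>a\<in>I. \<forall>b\<in>I. (\<Sum>i\<in>I. \<Sum>j\<in>I. U i a * G i j * U j b) = (if a = b then d a else 0)"
    by (rule symmetric_diagonalization[where S = G, OF I sym])
  note U1 = U(2)[rule_format] and U2 = U(3)[rule_format]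
  have d: "d a \<ge> 0" if "a \<in> I" for a
    using psd[of "\<lambda>i. U i a"] U2[OF that that] by simp
  show ?thesis
  proof (rule that[of "\<lambda>i a. sqrt (d a) * U i a"], intro ballI)
    fix k l assume kl: "k \<in> I" "l \<in> I"
    have "(\<Sum>a\<in>I. sqrt (d a) * U k a * (sqrt (d a) * U l a)) = (\<Sum>a\<in>I. U k a * d a * U l a)"
      using d by (intro sum.cong refl) (simp add: mult_ac)
    also have "\<dots> = (\<Sum>a\<in>I. \<Sum>b\<in>I. U k a * (\<Sum>i\<in>I. \<Sum>j\<in>I. U i a * G i j * U j b) * U l b)"
      using I by (intro sum.cong refl) (simp add: U2 if_distrib[of "\<lambda>t. _ * t * _"] sum.delta cong: if_cong)
    also have "\<dots> = (\<Sum>a\<in>I. \<Sum>b\<in>I. \<Sum>i\<in>I. \<Sum>j\<in>I. U k a * (U i a * G i j * U j b) * U l b)"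
      by (simp add: sum_distrib_left sum_distrib_right)
    also have "\<dots> = (\<Sum>a\<in>I. \<Sum>i\<in>I. \<Sum>b\<in>I. \<Sum>j\<in>I. U k a * (U i a * G i j * U j b) * U l b)"
      by (intro sum.cong refl sum.swap)
    also have "\<dots> = (\<Sum>i\<in>I. \<Sum>a\<in>I. \<Sum>b\<in>I. \<Sum>j\<in>I. U k a * (U i a * G i j * U j b) * U l b)"
      by (rule sum.swap)
    also have "\<dots> = (\<Sum>i\<in>I. \<Sum>a\<in>I. \<Sum>j\<in>I. \<Sum>b\<in>I. U k a * (U i a * G i j * U j b) * U l b)"
      by (intro sum.cong refl sum.swap)
    also have "\<dots> = (\<Sum>i\<in>I. \<Sum>j\<in>I. \<Sum>a\<in>I. \<Sum>b\<in>I. U k a * (U i a * G i j * U j b) * U l b)"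
      by (intro sum.cong refl sum.swap)
    also have "\<dots> = (\<Sum>i\<in>I. \<Sum>j\<in>I. (\<Sum>a\<in>I. U k a * U i a) * G i j * (\<Sum>b\<in>I. U l b * U j b))"
      by (simp add: sum_distrib_left sum_distrib_right mult_ac)
    also have "\<dots> = (\<Sum>i\<in>I. \<Sum>j\<in>I. (if k = i then 1 else 0) * G i j * (if l = j then 1 else 0))"
      using kl by (intro sum.cong refl) (simp add: U1)
    also have "\<dots> = G k l"
      using kl I by (simp add: if_distrib[of "\<lambda>t. t * _"] if_distrib[of "\<lambda>t. _ * t"] sum.delta' cong: if_cong)
    finally show "G k l = (\<Sum>a\<in>I. sqrt (d a) * U k a * (sqrt (d a) * U l a))" ..
  qed
qed

section \<open>Matrix exponentials and matrix powers\<close>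

abbreviation mat_pow :: "real^'n^'n \<Rightarrow> nat \<Rightarrow> real^'n^'n" where
  "mat_pow M k \<equiv> ((**) M ^^ k) (mat 1)"

lemma bounded_linear_matrix_mult_left: "bounded_linear (\<lambda>X :: real^'k^'n. (M :: real^'n^'m) ** X)"
  by (intro linear_conv_bounded_linear[THEN iffD1] linearI)
     (simp_all add: vec_eq_iff matrix_matrix_mult_def sum_distrib_left sum.distrib algebra_simps)

lemma bounded_linear_matrix_mult_right: "bounded_linear (\<lambda>X :: real^'n^'m. X ** (M :: real^'k^'n))"
  by (intro linear_conv_bounded_linear[THEN iffD1] linearI)
     (simp_all add: vec_eq_iff matrix_matrix_mult_def sum_distrib_left sum.distrib algebra_simps)

lemma scaleR_matrix_mult: "(c *\<^sub>R A) ** (B :: real^'k^'n) = c *\<^sub>R ((A :: real^'n^'m) ** B)"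
  by (simp add: vec_eq_iff matrix_matrix_mult_def sum_distrib_left mult_ac)

lemma matrix_mult_scaleR: "(A :: real^'n^'m) ** (c *\<^sub>R B) = c *\<^sub>R (A ** (B :: real^'k^'n))"
  by (simp add: vec_eq_iff matrix_matrix_mult_def sum_distrib_left mult_ac)

lemma matrix_mult_entry: "(A ** B) $ i $ j = (\<Sum>l\<in>UNIV. A $ i $ l * B $ l $ j)"
  by (simp add: matrix_matrix_mult_def)

lemma matrix_add_mult: "(A + B) ** C = A ** C + B ** (C :: real^'k^'n)" for A :: "real^'n^'m"
  by (simp add: vec_eq_iff matrix_mult_entry sum.distrib algebra_simps)

lemma mat_pow_bound:
  fixes M :: "real^'n^'n" and b :: real
  assumes "\<And>i j. \<bar>M $ i $ j\<bar> \<le> b"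
  shows "\<bar>mat_pow M k $ i $ j\<bar> \<le> (CARD('n) * b) ^ k"
proof (induction k arbitrary: i j)
  case 0
  show ?case by (simp add: mat_def)
next
  case (Suc k)
  have b: "0 \<le> b" using assms[of i j] by linarith
  have "\<bar>mat_pow M (Suc k) $ i $ j\<bar> = \<bar>\<Sum>l\<in>UNIV. M $ i $ l * mat_pow M k $ l $ j\<bar>"
    by (simp add: matrix_matrix_mult_def)
  also have "\<dots> \<le> (\<Sum>l\<in>(UNIV::'n set). b * (CARD('n) * b) ^ k)"
    by (rule order_trans[OF sum_abs sum_mono])
       (auto simp: abs_mult intro!: mult_mono assms Suc b)
  also have "\<dots> = (CARD('n) * b) ^ Suc k" by simp
  finally show ?case .
qed

lemma mat_pow_scaleR: "mat_pow (s *\<^sub>R M) k = s ^ k *\<^sub>R mat_pow M k"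
  by (induction k) (simp_all add: scaleR_matrix_mult matrix_mult_scaleR mult_ac)

lemma mat_pow_commute: "M ** mat_pow M k = mat_pow M k ** (M :: real^'n^'n)"
  by (induction k) (simp_all add: matrix_mul_assoc)

text \<open>For a fixed matrix each entry of exp(s M) is a real power series in s, to which termwise
  differentiation applies.\<close>

lemma summable_mat_exp_entry:
  "summable (\<lambda>k. mat_pow (M :: real^'n^'n) k $ i $ j / fact k * s ^ k)"
proof -
  define b where "b = norm M"
  have "\<bar>M $ i $ j\<bar> \<le> b" for i j
    unfolding b_def using component_le_norm_cart[of "M $ i" j] Finite_Cartesian_Product.norm_nth_le[of M i] by linarith
  then have mb: "\<bar>mat_pow M k $ i $ j\<bar> \<le> (CARD('n) * b) ^ k" for k i j
    by (rule mat_pow_bound)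
  show ?thesis
  proof (rule summable_comparison_test)
    show "summable (\<lambda>k. (CARD('n) * b * \<bar>s\<bar>) ^ k /\<^sub>R fact k)"
      by (rule summable_exp_generic)
    have "norm (mat_pow M k $ i $ j / fact k * s ^ k) \<le> (CARD('n) * b * \<bar>s\<bar>) ^ k /\<^sub>R fact k" for k
    proof -
      have "norm (mat_pow M k $ i $ j / fact k * s ^ k) = \<bar>mat_pow M k $ i $ j\<bar> * \<bar>s\<bar> ^ k / fact k"
        by (simp add: abs_mult power_abs)
      also have "\<dots> \<le> (CARD('n) * b) ^ k * \<bar>s\<bar> ^ k / fact k"
        by (intro divide_right_mono mult_right_mono mb) auto
      finally show ?thesis by (simp add: power_mult_distrib divide_inverse mult_ac)
    qed
    then show "\<exists>N. \<forall>k\<ge>N. norm (mat_pow M k $ i $ j / fact k * s ^ k) \<le> (CARD('n) * b * \<bar>s\<bar>) ^ k /\<^sub>R fact k"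
      by blast
  qed
qed

lemma summable_mat_exp: "summable (\<lambda>k. mat_pow (M :: real^'n^'n) k /\<^sub>R fact k)"
proof -
  have "(\<lambda>n. \<Sum>k<n. mat_pow M k /\<^sub>R fact k) \<longlonglongrightarrow> (\<chi> i j. \<Sum>k. mat_pow M k $ i $ j / fact k)"
  proof (intro vec_tendstoI)
    fix i j
    show "(\<lambda>n. (\<Sum>k<n. mat_pow M k /\<^sub>R fact k) $ i $ j) \<longlonglongrightarrow> (\<chi> i j. \<Sum>k. mat_pow M k $ i $ j / fact k) $ i $ j"
      using summable_LIMSEQ[OF summable_mat_exp_entry[of M i j 1]] by (simp add: divide_inverse mult_ac)
  qed
  then show ?thesis by (auto simp: summable_def sums_def)
qed

lemma mat_exp_entry:
  "mat_exp (s *\<^sub>R M) $ i $ j = (\<Sum>k. mat_pow (M :: real^'n^'n) k $ i $ j / fact k * s ^ k)"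
proof -
  have bl: "bounded_linear (\<lambda>X :: real^'n^'n. X $ i $ j)"
    by (intro bounded_linear_compose[OF bounded_linear_vec_nth] bounded_linear_vec_nth)
  have "mat_exp (s *\<^sub>R M) $ i $ j = (\<Sum>k. (mat_pow (s *\<^sub>R M) k /\<^sub>R fact k) $ i $ j)"
    unfolding mat_exp_def by (rule bounded_linear.suminf[OF bl summable_mat_exp])
  also have "\<dots> = (\<Sum>k. mat_pow M k $ i $ j / fact k * s ^ k)"
    by (intro suminf_cong) (simp add: mat_pow_scaleR divide_inverse mult_ac)
  finally show ?thesis .
qed

lemma mat_exp_commute: "M ** mat_exp (s *\<^sub>R M) = mat_exp (s *\<^sub>R M) ** (M :: real^'n^'n)"
proof -
  have "M ** mat_exp (s *\<^sub>R M) = (\<Sum>k. M ** (mat_pow (s *\<^sub>R M) k /\<^sub>R fact k))"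
    unfolding mat_exp_def by (rule bounded_linear.suminf[OF bounded_linear_matrix_mult_left summable_mat_exp])
  also have "\<dots> = (\<Sum>k. (mat_pow (s *\<^sub>R M) k /\<^sub>R fact k) ** M)"
    by (simp add: matrix_mult_scaleR scaleR_matrix_mult mat_pow_scaleR mat_pow_commute)
  also have "\<dots> = mat_exp (s *\<^sub>R M) ** M"
    unfolding mat_exp_def by (rule bounded_linear.suminf[OF bounded_linear_matrix_mult_right summable_mat_exp, symmetric])
  finally show ?thesis .
qed

lemma mat_exp_zero: "mat_exp 0 = (mat 1 :: real^'n^'n)"
proof -
  have "mat_exp (0 *\<^sub>R 0 :: real^'n^'n) $ i $ j = mat 1 $ i $ j" for i j
    unfolding mat_exp_entry by (subst powser_zero) simp
  then show ?thesis by (simp add: vec_eq_iff)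
qed

lemma DERIV_mat_exp:
  "((\<lambda>s. mat_exp (s *\<^sub>R M) $ i $ j) has_real_derivative ((M :: real^'n^'n) ** mat_exp (s *\<^sub>R M)) $ i $ j) (at s)"
proof -
  define c where "c k = mat_pow M k $ i $ j / fact k" for k
  have "((\<lambda>s. \<Sum>k. c k * s ^ k) has_real_derivative (\<Sum>k. diffs c k * s ^ k)) (at s)"
    using summable_mat_exp_entry[of M i j]
    by (intro termdiffs_strong_converges_everywhere) (simp add: c_def)
  also have "(\<lambda>s. \<Sum>k. c k * s ^ k) = (\<lambda>s. mat_exp (s *\<^sub>R M) $ i $ j)"
    by (simp add: mat_exp_entry c_def)
  also have "(\<Sum>k. diffs c k * s ^ k) = (\<Sum>k. \<Sum>l\<in>UNIV. M $ i $ l * (mat_pow M k $ l $ j / fact k * s ^ k))"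
    by (intro suminf_cong)
       (simp add: diffs_def c_def matrix_mult_entry sum_distrib_left sum_distrib_right sum_divide_distrib mult.assoc del: of_nat_Suc)
  also have "\<dots> = (\<Sum>l\<in>UNIV. \<Sum>k. M $ i $ l * (mat_pow M k $ l $ j / fact k * s ^ k))"
    by (intro suminf_sum summable_mult summable_mat_exp_entry)
  also have "\<dots> = (\<Sum>l\<in>UNIV. M $ i $ l * (\<Sum>k. mat_pow M k $ l $ j / fact k * s ^ k))"
    by (intro sum.cong refl suminf_mult summable_mat_exp_entry)
  also have "\<dots> = (M ** mat_exp (s *\<^sub>R M)) $ i $ j"
    by (simp add: matrix_matrix_mult_def mat_exp_entry)
  finally show ?thesis .
qed

text \<open>For a solution of X' = M X the product exp(-s M) X(s) has derivative 0. The inverse,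
  addition, shift and transposition rules below all come from exhibiting a solution of such an
  equation.\<close>

lemma linear_matrix_ode:
  fixes M :: "real^'n^'n" and X :: "real \<Rightarrow> real^'m^'n"
  assumes X: "\<And>s i j. ((\<lambda>s. X s $ i $ j) has_real_derivative (M ** X s) $ i $ j) (at s)"
  shows "mat_exp (- s *\<^sub>R M) ** X s = X 0"
proof -
  define Y where "Y s = mat_exp (- s *\<^sub>R M) ** X s" for s
  have "((\<lambda>s. Y s $ i $ j) has_real_derivative 0) (at s)" for s i j
  proof -
    have E: "((\<lambda>s. mat_exp (- s *\<^sub>R M) $ i $ l) has_real_derivative - (M ** mat_exp (- s *\<^sub>R M)) $ i $ l) (at s)" for l
      using DERIV_chain'[OF DERIV_minus[OF DERIV_ident] DERIV_mat_exp[of M i l "- s"]] by simp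
    have "((\<lambda>s. \<Sum>l\<in>UNIV. mat_exp (- s *\<^sub>R M) $ i $ l * X s $ l $ j) has_real_derivative
        (\<Sum>l\<in>UNIV. - (M ** mat_exp (- s *\<^sub>R M)) $ i $ l * X s $ l $ j + (M ** X s) $ l $ j * mat_exp (- s *\<^sub>R M) $ i $ l)) (at s)"
      by (intro DERIV_sum DERIV_mult E X)
    also have "(\<Sum>l\<in>UNIV. - (M ** mat_exp (- s *\<^sub>R M)) $ i $ l * X s $ l $ j + (M ** X s) $ l $ j * mat_exp (- s *\<^sub>R M) $ i $ l) =
        (mat_exp (- s *\<^sub>R M) ** (M ** X s)) $ i $ j - ((M ** mat_exp (- s *\<^sub>R M)) ** X s) $ i $ j"
      by (simp add: matrix_mult_entry[of "mat_exp (- (s *\<^sub>R M))" "M ** X s"]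
          matrix_mult_entry[of "M ** mat_exp (- (s *\<^sub>R M))" "X s"] sum.distrib sum_negf sum_subtractf mult_ac)
    also have "\<dots> = 0"
      using mat_exp_commute[of M "- s"] by (simp add: matrix_mul_assoc)
    finally show ?thesis by (simp add: Y_def matrix_matrix_mult_def)
  qed
  then have "Y s $ i $ j = Y 0 $ i $ j" for i j
    by (intro DERIV_isconst_all[of "\<lambda>s. Y s $ i $ j"]) blast
  then have "Y s = Y 0" by (simp add: vec_eq_iff)
  then show ?thesis by (simp add: Y_def mat_exp_zero)
qed

lemma mat_exp_inverse: "mat_exp (s *\<^sub>R M) ** mat_exp (- s *\<^sub>R M) = (mat 1 :: real^'n^'n)"
  using linear_matrix_ode[where X = "\<lambda>s. mat_exp (s *\<^sub>R M)" and M = M and s = "- s", OF DERIV_mat_exp]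
  by (simp add: mat_exp_zero)

lemma linear_matrix_ode_unique:
  fixes M :: "real^'n^'n" and X :: "real \<Rightarrow> real^'m^'n"
  assumes X: "\<And>s i j. ((\<lambda>s. X s $ i $ j) has_real_derivative (M ** X s) $ i $ j) (at s)"
  shows "X s = mat_exp (s *\<^sub>R M) ** X 0"
proof -
  have "mat_exp (s *\<^sub>R M) ** X 0 = mat_exp (s *\<^sub>R M) ** (mat_exp (- s *\<^sub>R M) ** X s)"
    by (simp only: linear_matrix_ode[OF X])
  also have "\<dots> = X s"
    by (simp only: matrix_mul_assoc mat_exp_inverse matrix_mul_lid)
  finally show ?thesis ..
qed

lemma mat_exp_add: "mat_exp ((s + t) *\<^sub>R M) = mat_exp (s *\<^sub>R M) ** mat_exp (t *\<^sub>R (M :: real^'n^'n))"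
proof -
  have "((\<lambda>s. mat_exp ((s + t) *\<^sub>R M) $ i $ j) has_real_derivative (M ** mat_exp ((s + t) *\<^sub>R M)) $ i $ j) (at s)" for s i j
    using DERIV_chain'[OF DERIV_add[OF DERIV_ident DERIV_const] DERIV_mat_exp[of M i j "s + t"]] by simp
  from linear_matrix_ode_unique[OF this, of s] show ?thesis by simp
qed

lemma mat_exp_shift: "mat_exp (s *\<^sub>R (M + c *\<^sub>R mat 1)) = exp (c * s) *\<^sub>R mat_exp (s *\<^sub>R (M :: real^'n^'n))"
proof -
  have "((\<lambda>s. (exp (c * s) *\<^sub>R mat_exp (s *\<^sub>R M)) $ i $ j) has_real_derivative
      ((M + c *\<^sub>R mat 1) ** (exp (c * s) *\<^sub>R mat_exp (s *\<^sub>R M))) $ i $ j) (at s)" for s i j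
  proof -
    have "((\<lambda>s. exp (c * s) * mat_exp (s *\<^sub>R M) $ i $ j) has_real_derivative
      (exp (c * s) * c) * mat_exp (s *\<^sub>R M) $ i $ j + (M ** mat_exp (s *\<^sub>R M)) $ i $ j * exp (c * s)) (at s)"
      by (intro DERIV_mult DERIV_mat_exp) (auto intro!: derivative_eq_intros)
    then show ?thesis
      by (simp add: matrix_add_mult matrix_mult_scaleR scaleR_matrix_mult algebra_simps)
  qed
  from linear_matrix_ode_unique[OF this, of s] show ?thesis by (simp add: mat_exp_zero)
qed

lemma mat_exp_transpose: "mat_exp (s *\<^sub>R transpose M) = transpose (mat_exp (s *\<^sub>R (M :: real^'n^'n)))"
proof -
  have "((\<lambda>s. transpose (mat_exp (s *\<^sub>R M)) $ i $ j) has_real_derivative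
      (transpose M ** transpose (mat_exp (s *\<^sub>R M))) $ i $ j) (at s)" for s i j
  proof -
    \<comment> \<open>Transposing exchanges the order of the factors; commutation with
      \<open>M\<close> restores the form of the equation.\<close>
    have "(transpose M ** transpose (mat_exp (s *\<^sub>R M))) $ i $ j = (M ** mat_exp (s *\<^sub>R M)) $ j $ i"
      unfolding matrix_transpose_mul[symmetric] mat_exp_commute by (simp add: transpose_def)
    then show ?thesis using DERIV_mat_exp[of M j i s] by (simp add: transpose_def)
  qed
  from linear_matrix_ode_unique[OF this, of s] show ?thesis by (simp add: mat_exp_zero transpose_mat)
qed

lemma mat_powr_mult:
  assumes "x > 0" "y > 0"
  shows "mat_powr (x * y) M = mat_powr x M ** mat_powr y M"
  using assms by (simp add: mat_powr_def ln_mult mat_exp_add)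

lemma mat_powr_one: "mat_powr 1 M = mat 1"
  by (simp add: mat_powr_def mat_exp_zero)

lemma mat_powr_inverse:
  assumes "x > 0" shows "mat_powr x M ** mat_powr (1 / x) M = mat 1" "mat_powr (1 / x) M ** mat_powr x M = mat 1"
  using mat_powr_mult[of x "1 / x" M] mat_powr_mult[of "1 / x" x M] assms by (simp_all add: mat_powr_one)

lemma mat_powr_minus: "x > 0 \<Longrightarrow> mat_powr x (- M) = mat_powr (1 / x) M"
  by (simp add: mat_powr_def ln_div)

lemma mat_powr_shift: "x > 0 \<Longrightarrow> mat_powr x (M + c *\<^sub>R mat 1) = (x powr c) *\<^sub>R mat_powr x M"
  by (simp add: mat_powr_def mat_exp_shift powr_def)

lemma mat_powr_transpose: "mat_powr x (transpose M) = transpose (mat_powr x M)"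
  by (simp add: mat_powr_def mat_exp_transpose) (simp add: transpose_def vec_eq_iff)

lemma DERIV_mat_powr:
  assumes "x > 0"
  shows "((\<lambda>x. mat_powr x M $ i $ j) has_real_derivative (M ** mat_powr x M) $ i $ j / x) (at x)"
proof -
  have "((\<lambda>x. mat_exp (ln x *\<^sub>R M) $ i $ j) has_real_derivative (M ** mat_exp (ln x *\<^sub>R M)) $ i $ j * (1 / x)) (at x)"
    using DERIV_chain2[OF DERIV_mat_exp DERIV_ln_divide[OF assms]] by simp
  then have "((\<lambda>x. mat_exp (ln x *\<^sub>R M) $ i $ j) has_real_derivative (M ** mat_powr x M) $ i $ j / x) (at x)"
    using assms by (simp add: mat_powr_def)
  moreover have "eventually (\<lambda>x. mat_exp (ln x *\<^sub>R M) $ i $ j = mat_powr x M $ i $ j) (nhds x)"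
    using eventually_nhds_in_open[of "{0<..}" x] assms
    by (auto elim!: eventually_mono simp: mat_powr_def)
  ultimately show ?thesis
    by (simp only: DERIV_cong_ev[OF refl _ refl])
qed

section \<open>Gaussian quadratic forms\<close>

abbreviation std_normal_PiM :: "'i set \<Rightarrow> ('i \<Rightarrow> real) measure" where
  "std_normal_PiM I \<equiv> \<Pi>\<^sub>M a\<in>I. std_normal_distribution"

lemma prob_space_std_normal_PiM: "prob_space (std_normal_PiM I)"
  by (rule prob_space_PiM) (rule prob_space_normal_density, simp)

lemma measurable_std_normal_PiM [measurable]:
  "a \<in> I \<Longrightarrow> (\<lambda>\<xi>. \<xi> a) \<in> borel_measurable (std_normal_PiM I)"
  using measurable_component_singleton[of a I "\<lambda>_. std_normal_distribution"] by simp

lemma integral_std_normal_PiM_prod: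
  fixes f :: "'i \<Rightarrow> real \<Rightarrow> complex"
  assumes "finite I" "\<And>a. a \<in> I \<Longrightarrow> f a \<in> borel_measurable borel" "\<And>a x. norm (f a x) \<le> 1"
  shows "(\<integral>\<xi>. (\<Prod>a\<in>I. f a (\<xi> a)) \<partial>std_normal_PiM I) = (\<Prod>a\<in>I. \<integral>x. f a x \<partial>std_normal_distribution)"
proof -
  interpret std: prob_space std_normal_distribution
    by (rule prob_space_normal_density) simp
  interpret product_sigma_finite "\<lambda>_ :: 'i. std_normal_distribution"
    by standard
  show ?thesis
    using assms by (intro product_integral_prod std.integrable_const_bound[where B = 1]) auto
qed

lemma iexp_sum: "finite I \<Longrightarrow> iexp (\<Sum>a\<in>I. f a) = (\<Prod>a\<in>I. iexp (f a))"
  by (simp add: exp_sum sum_distrib_left)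

lemma char_std_normal_PiM:
  assumes I: "finite I"
  shows "(\<integral>\<xi>. iexp (\<Sum>a\<in>I. c a * \<xi> a) \<partial>std_normal_PiM I) = of_real (exp (- (\<Sum>a\<in>I. (c a)\<^sup>2) / 2))"
proof -
  have "(\<integral>\<xi>. iexp (\<Sum>a\<in>I. c a * \<xi> a) \<partial>std_normal_PiM I) = (\<integral>\<xi>. (\<Prod>a\<in>I. iexp (c a * \<xi> a)) \<partial>std_normal_PiM I)"
    by (simp only: iexp_sum[OF I])
  also have "\<dots> = (\<Prod>a\<in>I. \<integral>x. iexp (c a * x) \<partial>std_normal_distribution)"
    by (intro integral_std_normal_PiM_prod I) (auto simp del: of_real_mult)
  also have "\<dots> = (\<Prod>a\<in>I. of_real (exp (- (c a)\<^sup>2 / 2)))"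
    using fun_cong[OF char_std_normal_distribution] unfolding char_def by (intro prod.cong refl) metis
  also have "\<dots> = of_real (exp (\<Sum>a\<in>I. - (c a)\<^sup>2 / 2))"
    using I by (simp add: exp_sum flip: of_real_prod)
  finally show ?thesis by (simp add: sum_negf sum_divide_distrib)
qed

text \<open>Characteristic function of the centred square of a standard normal variable; its
  variance is 2, so its Gaussian counterpart is exp(-s^2).\<close>

definition chisq_char :: "real \<Rightarrow> complex" where
  "chisq_char s = (\<integral>x. iexp (s * (x\<^sup>2 - 1)) \<partial>std_normal_distribution)"

lemma measure_std_normal_UNIV: "measure std_normal_distribution UNIV = 1"
  using prob_space.prob_space[OF prob_space_normal_density[of 1 0]] by simp

lemma norm_chisq_char: "norm (chisq_char s) \<le> 1"
proof -
  interpret std: prob_space std_normal_distribution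
    by (rule prob_space_normal_density) simp
  have "norm (chisq_char s) \<le> (\<integral>x. norm (iexp (s * (x\<^sup>2 - 1))) \<partial>std_normal_distribution)"
    unfolding chisq_char_def by (rule integral_norm_bound)
  then show ?thesis by (simp add: measure_std_normal_UNIV del: of_real_mult of_real_diff)
qed

lemma exp_minus_bound:
  fixes x :: real assumes "x \<ge> 0" shows "\<bar>exp (- x) - (1 - x)\<bar> \<le> x\<^sup>2"
proof (cases "x \<le> 1")
  case True
  have 1: "1 - x \<le> exp (- x)" using exp_ge_add_one_self[of "- x"] by simp
  have "exp (- x) * (1 + x) \<le> exp (- x) * exp x"
    using exp_ge_add_one_self[of x] by (intro mult_left_mono) auto
  then have "exp (- x) * (1 + x) \<le> 1" by (simp add: mult_exp_exp)
  \<comment> \<open>The right-hand side equals 1 + x^3.\<close>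
  moreover have "1 \<le> (1 - x + x\<^sup>2) * (1 + x)"
    using assms by (simp add: algebra_simps power2_eq_square)
  ultimately have "exp (- x) * (1 + x) \<le> (1 - x + x\<^sup>2) * (1 + x)" by linarith
  then have "exp (- x) \<le> 1 - x + x\<^sup>2" using assms by (simp add: mult_le_cancel_right)
  with 1 show ?thesis by auto
next
  case False
  then have "x \<le> x\<^sup>2" by (simp add: power2_eq_square)
  moreover have "0 < exp (- x)" "exp (- x) \<le> 1" using assms by auto
  ultimately show ?thesis using False by linarith
qed

text \<open>Third-order expansion of a characteristic function gives 1 - s^2 up to c |s|^3, with c
  the third absolute moment; passing to exp(-s^2) costs s^4, at most |s|^3 when |s| <= 1. For larger
  |s| the difference is at most 2, whence the constant c + 2.\<close>

lemma chisq_char_approx: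
  obtains C where "C \<ge> 0" "\<And>s. norm (chisq_char s - of_real (exp (- s\<^sup>2))) \<le> C * \<bar>s\<bar> ^ 3"
proof -
  interpret std: prob_space std_normal_distribution
    by (rule prob_space_normal_density) simp
  have im: "integrable std_normal_distribution (\<lambda>x. x ^ k)" for k
    by (rule integrable_std_normal_distribution_moment)
  have m2: "std.expectation (\<lambda>x. x\<^sup>2) = 1"
    using std_normal_distribution_even_moments(1)[of 1] by simp
  have m4: "std.expectation (\<lambda>x. x ^ 4) = 3"
    using std_normal_distribution_even_moments(1)[of 2] by (simp add: fact_numeral)
  define X where "X x = x\<^sup>2 - 1" for x :: real
  have X2: "(X x)\<^sup>2 = x ^ 4 - 2 * x\<^sup>2 + 1" for x
    by (simp add: X_def power2_eq_square eval_nat_numeral algebra_simps)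
  have iX: "integrable std_normal_distribution X"
    unfolding X_def using im[of 2] by simp
  have iX2: "integrable std_normal_distribution (\<lambda>x. (X x)\<^sup>2)"
    unfolding X2 using im[of 2] im[of 4] by simp
  have EX: "std.expectation X = 0"
    unfolding X_def using im[of 2] m2 by (simp add: measure_std_normal_UNIV)
  have "std.expectation (\<lambda>x. (X x)\<^sup>2) = 2"
    unfolding X2 using im[of 2] im[of 4] m2 m4 by (simp add: measure_std_normal_UNIV)
  then have VX: "std.variance X = 2" by (simp add: EX)
  have Xm: "X \<in> borel_measurable std_normal_distribution" unfolding X_def by simp
  have iX3: "integrable std_normal_distribution (\<lambda>x. \<bar>X x\<bar> ^ 3)"
  proof (rule Bochner_Integration.integrable_bound)
    show "integrable std_normal_distribution (\<lambda>x. (x ^ 4 - 2 * x\<^sup>2 + 1) * (x\<^sup>2 + 1))"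
      using im[of 6] im[of 4] im[of 2] by (simp add: algebra_simps flip: power_add)
    show "AE x in std_normal_distribution. norm (\<bar>X x\<bar> ^ 3) \<le> norm ((x ^ 4 - 2 * x\<^sup>2 + 1) * (x\<^sup>2 + 1))"
    proof (rule AE_I2)
      fix x :: real
      have "\<bar>X x\<bar> ^ 3 = (X x)\<^sup>2 * \<bar>X x\<bar>" by (simp add: power2_eq_square eval_nat_numeral abs_mult_self_eq)
      also have "\<dots> \<le> (X x)\<^sup>2 * (x\<^sup>2 + 1)"
        by (intro mult_left_mono) (auto simp: X_def abs_le_iff)
      finally show "norm (\<bar>X x\<bar> ^ 3) \<le> norm ((x ^ 4 - 2 * x\<^sup>2 + 1) * (x\<^sup>2 + 1))"
        unfolding X2[symmetric] by simp
    qed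
  qed (use Xm in measurable)
  define c where "c = std.expectation (\<lambda>x. \<bar>X x\<bar> ^ 3)"
  have c0: "c \<ge> 0" unfolding c_def by (intro Bochner_Integration.integral_nonneg) auto
  have char: "char (distr std_normal_distribution borel X) s = chisq_char s" for s
    unfolding char_def by (subst integral_distr[OF Xm], measurable) (simp add: chisq_char_def X_def)
  have b: "norm (chisq_char s - (1 - s\<^sup>2)) \<le> c * \<bar>s\<bar> ^ 3" for s
  proof -
    have "norm (chisq_char s - (1 - s\<^sup>2)) \<le> s\<^sup>2 / 6 * std.expectation (\<lambda>x. min (6 * (X x)\<^sup>2) (\<bar>s\<bar> * \<bar>X x\<bar> ^ 3))"
      using std.char_approx3'[OF Xm iX iX2 EX VX refl, of s] unfolding char by simp
    also have "\<dots> \<le> s\<^sup>2 / 6 * std.expectation (\<lambda>x. \<bar>s\<bar> * \<bar>X x\<bar> ^ 3)"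
      using iX3 iX2 by (intro mult_left_mono integral_mono integrable_min) auto
    also have "\<dots> = \<bar>s\<bar> ^ 3 * c / 6"
      unfolding c_def by (simp add: eval_nat_numeral)
    also have "\<dots> \<le> c * \<bar>s\<bar> ^ 3" using c0 by (simp add: mult.commute)
    finally show ?thesis .
  qed
  show ?thesis
  proof (rule that[of "c + 2"])
    show "c + 2 \<ge> 0" using c0 by simp
    show "norm (chisq_char s - of_real (exp (- s\<^sup>2))) \<le> (c + 2) * \<bar>s\<bar> ^ 3" for s
    proof (cases "\<bar>s\<bar> \<le> 1")
      case True
      have "norm (chisq_char s - of_real (exp (- s\<^sup>2))) \<le>
          norm (chisq_char s - (1 - s\<^sup>2)) + norm (of_real ((1 - s\<^sup>2) - exp (- s\<^sup>2)) :: complex)"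
        by (rule order_trans[OF _ norm_triangle_ineq]) simp
      also have "norm (of_real ((1 - s\<^sup>2) - exp (- s\<^sup>2)) :: complex) \<le> (s\<^sup>2)\<^sup>2"
        unfolding norm_of_real using exp_minus_bound[of "s\<^sup>2"] by (simp add: abs_minus_commute)
      also have "(s\<^sup>2)\<^sup>2 = \<bar>s\<bar> ^ 3 * \<bar>s\<bar>" by (simp add: eval_nat_numeral abs_mult_self_eq)
      also have "\<dots> \<le> \<bar>s\<bar> ^ 3" using True by (intro mult_left_le) auto
      also note b[of s]
      finally have "norm (chisq_char s - of_real (exp (- s\<^sup>2))) \<le> c * \<bar>s\<bar> ^ 3 + \<bar>s\<bar> ^ 3" by simp
      also have "\<dots> \<le> (c + 2) * \<bar>s\<bar> ^ 3" by (simp add: algebra_simps)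
      finally show ?thesis .
    next
      case False
      have "norm (chisq_char s - of_real (exp (- s\<^sup>2))) \<le> norm (chisq_char s) + norm (of_real (exp (- s\<^sup>2)) :: complex)"
        by (rule norm_triangle_ineq4)
      also have "\<dots> \<le> 1 + 1"
        by (rule add_mono[OF norm_chisq_char]) (simp only: norm_of_real abs_exp_cancel, simp)
      also have "1 + 1 = (2 :: real)" by simp
      also have "\<dots> \<le> (c + 2) * 1" using c0 by simp
      also have "\<dots> \<le> (c + 2) * \<bar>s\<bar> ^ 3"
        using False c0 by (intro mult_left_mono one_le_power) auto
      finally show ?thesis .
    qed
  qed
qed

text \<open>Products of numbers in the unit disc differ by at most the sum of the differences of
  their factors, here C |d|^3, bounded by C delta d^2. As the sum of d^2 converges and delta tends
  to 0, the total vanishes.\<close>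

lemma chisq_clt:
  fixes d :: "nat \<Rightarrow> 'i \<Rightarrow> real"
  assumes I: "\<And>n. finite (I n)" and v: "(\<lambda>n. \<Sum>a\<in>I n. (d n a)\<^sup>2) \<longlonglongrightarrow> v"
    and \<delta>: "\<delta> \<longlonglongrightarrow> 0" "\<And>n a. a \<in> I n \<Longrightarrow> \<bar>d n a\<bar> \<le> \<delta> n"
  shows "(\<lambda>n. \<Prod>a\<in>I n. chisq_char (d n a)) \<longlonglongrightarrow> of_real (exp (- v))"
proof -
  obtain C where C: "C \<ge> 0" "\<And>s. norm (chisq_char s - of_real (exp (- s\<^sup>2))) \<le> C * \<bar>s\<bar> ^ 3"
    by (rule chisq_char_approx) blast
  have "norm ((\<Prod>a\<in>I n. chisq_char (d n a)) - of_real (exp (- (\<Sum>a\<in>I n. (d n a)\<^sup>2)))) \<le> C * (\<delta> n * (\<Sum>a\<in>I n. (d n a)\<^sup>2))" for n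
  proof -
    have "of_real (exp (- (\<Sum>a\<in>I n. (d n a)\<^sup>2))) = (\<Prod>a\<in>I n. of_real (exp (- (d n a)\<^sup>2)) :: complex)"
      using I by (simp add: exp_sum sum_negf[symmetric] del: sum_negf flip: of_real_prod)
    then have "norm ((\<Prod>a\<in>I n. chisq_char (d n a)) - of_real (exp (- (\<Sum>a\<in>I n. (d n a)\<^sup>2)))) \<le>
        (\<Sum>a\<in>I n. norm (chisq_char (d n a) - of_real (exp (- (d n a)\<^sup>2))))"
      using norm_prod_diff[of "I n" "\<lambda>a. chisq_char (d n a)" "\<lambda>a. of_real (exp (- (d n a)\<^sup>2))"]
      by (simp add: norm_chisq_char norm_of_real del: of_real_exp)
    also have "\<dots> \<le> (\<Sum>a\<in>I n. C * (\<delta> n * (d n a)\<^sup>2))"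
    proof (rule sum_mono)
      fix a assume a: "a \<in> I n"
      have "\<bar>d n a\<bar> ^ 3 = \<bar>d n a\<bar> * (d n a)\<^sup>2" by (simp add: eval_nat_numeral)
      also have "\<dots> \<le> \<delta> n * (d n a)\<^sup>2" using \<delta>(2)[OF a] by (intro mult_right_mono) auto
      finally show "norm (chisq_char (d n a) - of_real (exp (- (d n a)\<^sup>2))) \<le> C * (\<delta> n * (d n a)\<^sup>2)"
        by (rule order_trans[OF C(2) mult_left_mono[OF _ C(1)]])
    qed
    finally show ?thesis by (simp add: sum_distrib_left)
  qed
  note bound = this
  have lim: "(\<lambda>n. C * (\<delta> n * (\<Sum>a\<in>I n. (d n a)\<^sup>2))) \<longlonglongrightarrow> 0"
    using tendsto_mult[OF tendsto_const[of C] tendsto_mult[OF \<delta>(1) v]] by (simp only: mult_zero_left mult_zero_right)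
  have A: "(\<lambda>n. (\<Prod>a\<in>I n. chisq_char (d n a)) - of_real (exp (- (\<Sum>a\<in>I n. (d n a)\<^sup>2)))) \<longlonglongrightarrow> 0"
    by (rule Lim_null_comparison[OF always_eventually lim]) (rule allI, rule bound)
  have B: "(\<lambda>n. of_real (exp (- (\<Sum>a\<in>I n. (d n a)\<^sup>2))) :: complex) \<longlonglongrightarrow> of_real (exp (- v))"
    by (intro tendsto_of_real tendsto_exp tendsto_minus v)
  show ?thesis
    using tendsto_add[OF A B] by (simp only: diff_add_cancel add_0)
qed

text \<open>Scaling a standard normal also produces the point mass at v = 0, so degenerate limits
  are treated together with the others.\<close>

lemma normal_law_eq_distr:
  assumes "v \<ge> 0"
  shows "normal_law 0 v = distr std_normal_distribution borel (\<lambda>x. sqrt v * x)"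
proof (cases "v = 0")
  case True
  interpret std: prob_space std_normal_distribution
    by (rule prob_space_normal_density) simp
  show ?thesis using True by (simp add: normal_law_def std.distr_const)
next
  case False
  interpret std: prob_space std_normal_distribution
    by (rule prob_space_normal_density) simp
  have "distributed std_normal_distribution lborel (\<lambda>x. x) (\<lambda>x. ennreal (std_normal_density x))"
    by (simp add: distributed_def distr_id2)
  from std.normal_density_affine[OF this, of "sqrt v" 0] False assms
  have "distributed std_normal_distribution lborel (\<lambda>x. sqrt v * x) (\<lambda>x. ennreal (normal_density 0 (sqrt v) x))"
    by simp
  then have "distr std_normal_distribution lborel (\<lambda>x. sqrt v * x) = density lborel (\<lambda>x. ennreal (normal_density 0 (sqrt v) x))"
    by (simp add: distributed_def)
  moreover have "distr std_normal_distribution borel (\<lambda>x. sqrt v * x) = distr std_normal_distribution lborel (\<lambda>x. sqrt v * x)"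
    by (rule distr_cong) auto
  ultimately show ?thesis using False by (simp add: normal_law_def)
qed

lemma char_normal_law:
  assumes "v \<ge> 0"
  shows "char (normal_law 0 v) t = of_real (exp (- (v * t\<^sup>2) / 2))"
proof -
  have "char (normal_law 0 v) t = (\<integral>x. iexp (t * sqrt v * x) \<partial>std_normal_distribution)"
    unfolding normal_law_eq_distr[OF assms] char_def by (subst integral_distr) (auto simp: mult_ac)
  also have "\<dots> = of_real (exp (- (t * sqrt v)\<^sup>2 / 2))"
    using fun_cong[OF char_std_normal_distribution, of "t * sqrt v"] by (simp add: char_def)
  finally show ?thesis using assms by (simp add: power_mult_distrib mult.commute)
qed

lemma real_distribution_normal_law:
  assumes "v \<ge> 0" shows "real_distribution (normal_law 0 v)"
  unfolding normal_law_eq_distr[OF assms]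
  by (intro prob_space.real_distribution_distr prob_space_normal_density) auto

lemma normal_law_second_moment:
  assumes "v \<ge> 0"
  shows "integrable (normal_law 0 v) (\<lambda>x. x\<^sup>2)" "(\<integral>x. x\<^sup>2 \<partial>normal_law 0 v) = v"
proof -
  have i: "integrable std_normal_distribution (\<lambda>x. x\<^sup>2)"
    by (rule integrable_std_normal_distribution_moment)
  have m2: "(\<integral>x. x\<^sup>2 \<partial>std_normal_distribution) = 1"
    using std_normal_distribution_even_moments(1)[of 1] by simp
  show "integrable (normal_law 0 v) (\<lambda>x. x\<^sup>2)"
    unfolding normal_law_eq_distr[OF assms]
    using i by (subst integrable_distr_eq) (auto simp: power_mult_distrib)
  show "(\<integral>x. x\<^sup>2 \<partial>normal_law 0 v) = v"
    unfolding normal_law_eq_distr[OF assms]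
    using m2 assms by (subst integral_distr) (auto simp: power_mult_distrib)
qed

section \<open>Reduction of a Gaussian quadratic form to a diagonal one\<close>

lemma sum_pair: "(\<Sum>i\<in>I. \<Sum>j\<in>J. f i j) = (\<Sum>p\<in>I \<times> J. f (fst p) (snd p))"
  by (simp add: sum.cartesian_product case_prod_beta)

lemma sum_swap4:
  "(\<Sum>i\<in>I. \<Sum>j\<in>J. \<Sum>k\<in>K. \<Sum>l\<in>L. f i j k l) = (\<Sum>k\<in>K. \<Sum>l\<in>L. \<Sum>i\<in>I. \<Sum>j\<in>J. f i j k l)"
proof -
  have "(\<Sum>i\<in>I. \<Sum>j\<in>J. \<Sum>k\<in>K. \<Sum>l\<in>L. f i j k l) = (\<Sum>p\<in>I \<times> J. \<Sum>k\<in>K. \<Sum>l\<in>L. f (fst p) (snd p) k l)"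
    by (rule sum_pair)
  also have "\<dots> = (\<Sum>k\<in>K. \<Sum>p\<in>I \<times> J. \<Sum>l\<in>L. f (fst p) (snd p) k l)"
    by (rule sum.swap)
  also have "\<dots> = (\<Sum>k\<in>K. \<Sum>l\<in>L. \<Sum>p\<in>I \<times> J. f (fst p) (snd p) k l)"
    by (intro sum.cong refl sum.swap)
  also have "\<dots> = (\<Sum>k\<in>K. \<Sum>l\<in>L. \<Sum>i\<in>I. \<Sum>j\<in>J. f i j k l)"
    by (intro sum.cong refl sum_pair[symmetric])
  finally show ?thesis .
qed

text \<open>Factor G = V V^T, diagonalise V^T M V by an orthogonal U and take W = V U. Then W W^T =
  V V^T, whether or not G is invertible.\<close>

lemma simultaneous_diagonalization:
  fixes G M :: "'i \<Rightarrow> 'i \<Rightarrow> real"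
  assumes I: "finite I" and G: "\<And>i j. i \<in> I \<Longrightarrow> j \<in> I \<Longrightarrow> G i j = G j i"
    and psd: "\<And>u. 0 \<le> (\<Sum>i\<in>I. \<Sum>j\<in>I. u i * G i j * u j)"
    and M: "\<And>i j. i \<in> I \<Longrightarrow> j \<in> I \<Longrightarrow> M i j = M j i"
  obtains W :: "'i \<Rightarrow> 'i \<Rightarrow> real" and d where
    "\<forall>i\<in>I. \<forall>j\<in>I. G i j = (\<Sum>a\<in>I. W i a * W j a)"
    "\<forall>a\<in>I. \<forall>b\<in>I. (\<Sum>i\<in>I. \<Sum>j\<in>I. W i a * M i j * W j b) = (if a = b then d a else 0)"
proof -
  obtain V where V: "\<forall>i\<in>I. \<forall>j\<in>I. G i j = (\<Sum>a\<in>I. V i a * V j a)"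
    by (rule psd_factorization[OF I G psd])
  define S where "S k l = (\<Sum>i\<in>I. \<Sum>j\<in>I. V i k * M i j * V j l)" for k l
  have S: "S k l = S l k" for k l
  proof -
    have "S k l = (\<Sum>j\<in>I. \<Sum>i\<in>I. V i k * M i j * V j l)"
      unfolding S_def by (rule sum.swap)
    also have "\<dots> = S l k"
      unfolding S_def by (intro sum.cong refl) (simp add: M mult_ac)
    finally show ?thesis .
  qed
  obtain U d where
    U: "\<forall>a\<in>I. \<forall>b\<in>I. (\<Sum>i\<in>I. U i a * U i b) = (if a = b then 1 else 0)"
      "\<forall>i\<in>I. \<forall>j\<in>I. (\<Sum>a\<in>I. U i a * U j a) = (if i = j then 1 else 0)"
      "\<forall>a\<in>I. \<forall>b\<in>I. (\<Sum>i\<in>I. \<Sum>j\<in>I. U i a * S i j * U j b) = (if a = b then d a else 0)"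
    by (rule symmetric_diagonalization[where S = S, OF I S])
  define W where "W i a = (\<Sum>b\<in>I. V i b * U b a)" for i a
  show ?thesis
  proof (rule that[of W d]; intro ballI)
    fix i j assume ij: "i \<in> I" "j \<in> I"
    have "(\<Sum>a\<in>I. W i a * W j a) = (\<Sum>a\<in>I. \<Sum>b\<in>I. \<Sum>c\<in>I. V i b * V j c * (U b a * U c a))"
      unfolding W_def by (simp add: sum_product mult_ac)
    also have "\<dots> = (\<Sum>b\<in>I. \<Sum>a\<in>I. \<Sum>c\<in>I. V i b * V j c * (U b a * U c a))"
      by (rule sum.swap)
    also have "\<dots> = (\<Sum>b\<in>I. \<Sum>c\<in>I. \<Sum>a\<in>I. V i b * V j c * (U b a * U c a))"
      by (intro sum.cong refl sum.swap)
    also have "\<dots> = (\<Sum>b\<in>I. \<Sum>c\<in>I. V i b * V j c * (\<Sum>a\<in>I. U b a * U c a))"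
      by (simp add: sum_distrib_left)
    also have "\<dots> = (\<Sum>b\<in>I. \<Sum>c\<in>I. V i b * V j c * (if b = c then 1 else 0))"
      using U(2) by (intro sum.cong refl) simp
    also have "\<dots> = (\<Sum>b\<in>I. V i b * V j b)"
      using I by (intro sum.cong refl) (simp add: if_distrib[of "\<lambda>t. _ * t"] sum.delta' cong: if_cong)
    finally show "G i j = (\<Sum>a\<in>I. W i a * W j a)" using V ij by simp
  next
    fix a b assume ab: "a \<in> I" "b \<in> I"
    have "(\<Sum>i\<in>I. \<Sum>j\<in>I. W i a * M i j * W j b) = (\<Sum>i\<in>I. \<Sum>j\<in>I. \<Sum>k\<in>I. \<Sum>l\<in>I. U k a * (V i k * M i j * V j l) * U l b)"
      unfolding W_def by (simp add: sum_distrib_left sum_distrib_right mult_ac)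
    also have "\<dots> = (\<Sum>k\<in>I. \<Sum>l\<in>I. \<Sum>i\<in>I. \<Sum>j\<in>I. U k a * (V i k * M i j * V j l) * U l b)"
      by (rule sum_swap4)
    also have "\<dots> = (\<Sum>k\<in>I. \<Sum>l\<in>I. U k a * S k l * U l b)"
      unfolding S_def by (simp add: sum_distrib_left sum_distrib_right)
    finally show "(\<Sum>i\<in>I. \<Sum>j\<in>I. W i a * M i j * W j b) = (if a = b then d a else 0)"
      using U(3) ab by simp
  qed
qed

text \<open>Cyclicity of the trace: W^T M W and M W W^T = M G have the same trace.\<close>

lemma diagonal_trace:
  fixes G M W :: "'i \<Rightarrow> 'i \<Rightarrow> real"
  assumes G: "\<forall>i\<in>I. \<forall>j\<in>I. G i j = (\<Sum>a\<in>I. W i a * W j a)"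
    and D: "\<forall>a\<in>I. \<forall>b\<in>I. (\<Sum>i\<in>I. \<Sum>j\<in>I. W i a * M i j * W j b) = (if a = b then d a else 0)"
  shows "(\<Sum>a\<in>I. d a) = (\<Sum>i\<in>I. \<Sum>j\<in>I. M i j * G i j)"
proof -
  have "(\<Sum>a\<in>I. d a) = (\<Sum>a\<in>I. \<Sum>i\<in>I. \<Sum>j\<in>I. W i a * M i j * W j a)"
    using D by (intro sum.cong refl) simp
  also have "\<dots> = (\<Sum>i\<in>I. \<Sum>a\<in>I. \<Sum>j\<in>I. W i a * M i j * W j a)"
    by (rule sum.swap)
  also have "\<dots> = (\<Sum>i\<in>I. \<Sum>j\<in>I. \<Sum>a\<in>I. W i a * M i j * W j a)"
    by (intro sum.cong refl sum.swap)
  also have "\<dots> = (\<Sum>i\<in>I. \<Sum>j\<in>I. M i j * G i j)"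
    using G by (intro sum.cong refl) (simp add: sum_distrib_left mult_ac)
  finally show ?thesis .
qed

text \<open>The trace of the square of W^T M W, regrouped so that the product W W^T appears
  twice.\<close>

lemma diagonal_trace_square:
  fixes G M W :: "'i \<Rightarrow> 'i \<Rightarrow> real"
  assumes I: "finite I" and G: "\<forall>i\<in>I. \<forall>j\<in>I. G i j = (\<Sum>a\<in>I. W i a * W j a)"
    and D: "\<forall>a\<in>I. \<forall>b\<in>I. (\<Sum>i\<in>I. \<Sum>j\<in>I. W i a * M i j * W j b) = (if a = b then d a else 0)"
  shows "(\<Sum>a\<in>I. (d a)\<^sup>2) = (\<Sum>i\<in>I. \<Sum>j\<in>I. \<Sum>k\<in>I. \<Sum>l\<in>I. M i j * G j k * M k l * G l i)"
proof -
  define T where "T a b = (\<Sum>i\<in>I. \<Sum>j\<in>I. W i a * M i j * W j b)" for a b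
  have "(\<Sum>a\<in>I. (d a)\<^sup>2) = (\<Sum>a\<in>I. \<Sum>b\<in>I. T a b * T b a)"
  proof (intro sum.cong refl)
    fix a assume a: "a \<in> I"
    have "(\<Sum>b\<in>I. T a b * T b a) = (\<Sum>b\<in>I. if b = a then d a * d a else 0)"
      using D a by (intro sum.cong refl) (auto simp: T_def)
    then show "(d a)\<^sup>2 = (\<Sum>b\<in>I. T a b * T b a)"
      using a I by (simp add: power2_eq_square)
  qed
  also have "\<dots> = (\<Sum>a\<in>I. \<Sum>b\<in>I. \<Sum>i\<in>I. \<Sum>j\<in>I. \<Sum>k\<in>I. \<Sum>l\<in>I. W i a * M i j * W j b * (W k b * M k l * W l a))"
  proof (intro sum.cong refl)
    fix a b
    have 1: "T a b * x = (\<Sum>i\<in>I. \<Sum>j\<in>I. W i a * M i j * W j b * x)" for x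
      by (simp add: T_def sum_distrib_right)
    have 2: "x * T b a = (\<Sum>k\<in>I. \<Sum>l\<in>I. x * (W k b * M k l * W l a))" for x
      by (simp add: T_def sum_distrib_left)
    show "T a b * T b a = (\<Sum>i\<in>I. \<Sum>j\<in>I. \<Sum>k\<in>I. \<Sum>l\<in>I. W i a * M i j * W j b * (W k b * M k l * W l a))"
      unfolding 1 by (intro sum.cong refl 2)
  qed
  also have "\<dots> = (\<Sum>i\<in>I. \<Sum>j\<in>I. \<Sum>a\<in>I. \<Sum>b\<in>I. \<Sum>k\<in>I. \<Sum>l\<in>I. W i a * M i j * W j b * (W k b * M k l * W l a))"
    by (rule sum_swap4)
  also have "\<dots> = (\<Sum>i\<in>I. \<Sum>j\<in>I. \<Sum>k\<in>I. \<Sum>l\<in>I. \<Sum>a\<in>I. \<Sum>b\<in>I. W i a * M i j * W j b * (W k b * M k l * W l a))"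
    by (intro sum.cong refl sum_swap4)
  also have "\<dots> = (\<Sum>i\<in>I. \<Sum>j\<in>I. \<Sum>k\<in>I. \<Sum>l\<in>I. M i j * (\<Sum>b\<in>I. W j b * W k b) * M k l * (\<Sum>a\<in>I. W l a * W i a))"
    by (intro sum.cong refl, subst sum.swap) (simp add: sum_distrib_left sum_distrib_right mult_ac)
  also have "\<dots> = (\<Sum>i\<in>I. \<Sum>j\<in>I. \<Sum>k\<in>I. \<Sum>l\<in>I. M i j * G j k * M k l * G l i)"
    using G by (intro sum.cong refl) simp
  finally show ?thesis .
qed

text \<open>A nonzero \<open>d\<^sub>a\<close> is an eigenvalue of \<open>G M\<close>, so it is bounded by the maximal row sums.\<close>

lemma diagonal_bound:
  fixes G M W :: "'i \<Rightarrow> 'i \<Rightarrow> real"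
  assumes I: "finite I" and G: "\<forall>i\<in>I. \<forall>j\<in>I. G i j = (\<Sum>a\<in>I. W i a * W j a)"
    and D: "\<forall>a\<in>I. \<forall>b\<in>I. (\<Sum>i\<in>I. \<Sum>j\<in>I. W i a * M i j * W j b) = (if a = b then d a else 0)"
    and g: "\<And>i. i \<in> I \<Longrightarrow> (\<Sum>j\<in>I. \<bar>G i j\<bar>) \<le> g" and m: "\<And>i. i \<in> I \<Longrightarrow> (\<Sum>j\<in>I. \<bar>M i j\<bar>) \<le> m"
    and a: "a \<in> I"
  shows "\<bar>d a\<bar> \<le> g * m"
proof (cases "\<forall>i\<in>I. W i a = 0")
  case True
  then have "d a = 0" using D a by fastforce
  have "0 \<le> g" "0 \<le> m"
    using g[OF a] m[OF a] by (auto intro: order_trans[OF sum_nonneg])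
  then show ?thesis using \<open>d a = 0\<close> by simp
next
  case False
  \<comment> \<open>The maximum norm of column a of \<open>W\<close>; row i attains it, so the
    relation G M w = d w for that column w, read in row i, bounds d.\<close>
  define s where "s = Max ((\<lambda>i. \<bar>W i a\<bar>) ` I)"
  have s_ge: "\<bar>W i a\<bar> \<le> s" if "i \<in> I" for i
    unfolding s_def using I that by (intro Max_ge) auto
  have "s \<in> (\<lambda>i. \<bar>W i a\<bar>) ` I"
    unfolding s_def using I a by (intro Max_in) auto
  then obtain i where i: "i \<in> I" "\<bar>W i a\<bar> = s" by auto
  have s: "s > 0" using False s_ge by force
  have g0: "0 \<le> g" and m0: "0 \<le> m"
    using g[OF a] m[OF a] by (auto intro: order_trans[OF sum_nonneg])
  \<comment> \<open>In matrix form this is row i of W (W^T M w) with w the column a, where W^T M w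
    is \<open>d a\<close> times a unit vector.\<close>
  have "d a * W i a = (\<Sum>b\<in>I. W i b * (\<Sum>j\<in>I. \<Sum>k\<in>I. W j b * M j k * W k a))"
    using D a i I by (simp add: if_distrib[of "\<lambda>t. _ * t"] sum.delta cong: if_cong)
  also have "\<dots> = (\<Sum>b\<in>I. \<Sum>j\<in>I. W i b * W j b * (\<Sum>k\<in>I. M j k * W k a))"
    by (simp add: sum_distrib_left mult_ac)
  also have "\<dots> = (\<Sum>j\<in>I. \<Sum>b\<in>I. W i b * W j b * (\<Sum>k\<in>I. M j k * W k a))"
    by (rule sum.swap)
  also have "\<dots> = (\<Sum>j\<in>I. G i j * (\<Sum>k\<in>I. M j k * W k a))"
    using G i by (simp add: sum_distrib_right)
  finally have "\<bar>d a\<bar> * s = \<bar>\<Sum>j\<in>I. G i j * (\<Sum>k\<in>I. M j k * W k a)\<bar>"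
    by (simp only: i(2)[symmetric] abs_mult[symmetric])
  also have "\<dots> \<le> (\<Sum>j\<in>I. \<bar>G i j\<bar> * (m * s))"
  proof (rule order_trans[OF sum_abs sum_mono])
    fix j assume j: "j \<in> I"
    have "\<bar>\<Sum>k\<in>I. M j k * W k a\<bar> \<le> (\<Sum>k\<in>I. \<bar>M j k\<bar> * s)"
      by (rule order_trans[OF sum_abs sum_mono]) (simp add: abs_mult mult_left_mono s_ge)
    also have "\<dots> \<le> m * s"
      unfolding sum_distrib_right[symmetric] by (intro mult_right_mono m j less_imp_le[OF s])
    finally show "\<bar>G i j * (\<Sum>k\<in>I. M j k * W k a)\<bar> \<le> \<bar>G i j\<bar> * (m * s)"
      by (simp add: abs_mult mult_left_mono)
  qed
  also have "\<dots> \<le> g * (m * s)"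
    unfolding sum_distrib_right[symmetric] by (intro mult_right_mono g i(1) mult_nonneg_nonneg m0 less_imp_le[OF s])
  finally have "\<bar>d a\<bar> * s \<le> (g * m) * s" by (simp only: mult.assoc)
  then show ?thesis using s by (rule mult_right_le_imp_le)
qed

lemma (in prob_space) norm_integral_iexp:
  "norm (\<integral>\<omega>. iexp (X \<omega>) \<partial>M) \<le> 1"
proof -
  have "norm (\<integral>\<omega>. iexp (X \<omega>) \<partial>M) \<le> (\<integral>\<omega>. norm (iexp (X \<omega>)) \<partial>M)"
    by (rule integral_norm_bound)
  also have "\<dots> = (\<integral>\<omega>. 1 \<partial>M)"
    by (simp only: norm_exp_i_times)
  also have "\<dots> = 1" using prob_space by simp
  finally show ?thesis .
qed

text \<open>Reduces complex expectations to those of the bounded continuous real functions cos and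
  sin, the class covered by the continuity theorem.\<close>

lemma (in prob_space) integral_iexp_Complex:
  assumes "X \<in> borel_measurable M"
  shows "(\<integral>\<omega>. iexp (X \<omega>) \<partial>M) = Complex (\<integral>\<omega>. cos (X \<omega>) \<partial>M) (\<integral>\<omega>. sin (X \<omega>) \<partial>M)"
proof -
  have i: "integrable M (\<lambda>\<omega>. iexp (X \<omega>))"
  proof (rule integrable_iexp)
    show "(\<lambda>\<omega>. complex_of_real (X \<omega>)) \<in> borel_measurable M" using assms by measurable
  qed (rule Im_complex_of_real)
  have "Re (iexp t) = cos t" "Im (iexp t) = sin t" for t
    by (simp_all only: cis_conv_exp[symmetric] cis.sel)
  then have "Re (\<integral>\<omega>. iexp (X \<omega>) \<partial>M) = (\<integral>\<omega>. cos (X \<omega>) \<partial>M)"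
    "Im (\<integral>\<omega>. iexp (X \<omega>) \<partial>M) = (\<integral>\<omega>. sin (X \<omega>) \<partial>M)"
    by (simp_all only: integral_Re[OF i, symmetric] integral_Im[OF i, symmetric])
  then show ?thesis by (simp only: complex_eq_iff complex.sel)
qed

text \<open>A characteristic function has modulus at most 1, so the exponent cannot be
  positive.\<close>

lemma gaussian_psd:
  fixes G :: "'i \<Rightarrow> 'i \<Rightarrow> real"
  assumes P: "prob_space P"
    and char: "(\<integral>\<omega>. iexp (\<Sum>i\<in>I. u i * Y \<omega> i) \<partial>P) =
      of_real (exp (- (\<Sum>i\<in>I. \<Sum>j\<in>I. u i * G i j * u j) / 2))"
  shows "0 \<le> (\<Sum>i\<in>I. \<Sum>j\<in>I. u i * G i j * u j)"
proof -
  have "norm (\<integral>\<omega>. iexp (\<Sum>i\<in>I. u i * Y \<omega> i) \<partial>P) \<le> 1"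
    by (rule prob_space.norm_integral_iexp[OF P])
  then have "exp (- (\<Sum>i\<in>I. \<Sum>j\<in>I. u i * G i j * u j) / 2) \<le> 1"
    unfolding char norm_of_real abs_exp_cancel .
  then show ?thesis by (simp only: exp_le_one_iff)
qed

text \<open>\<open>Y\<close> is compared with Z = W xi, xi standard normal, which has the same
  characteristic function. In terms of xi the form is diagonal, and independence factors its
  characteristic function.\<close>

theorem char_gaussian_quadratic_form:
  fixes G M :: "'i::countable \<Rightarrow> 'i \<Rightarrow> real" and Y :: "'a \<Rightarrow> 'i \<Rightarrow> real"
  assumes P: "prob_space P" and I: "finite I"
    and Y: "\<And>i. i \<in> I \<Longrightarrow> (\<lambda>\<omega>. Y \<omega> i) \<in> borel_measurable P"
    and char: "\<And>u. (\<integral>\<omega>. iexp (\<Sum>i\<in>I. u i * Y \<omega> i) \<partial>P) =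
      of_real (exp (- (\<Sum>i\<in>I. \<Sum>j\<in>I. u i * G i j * u j) / 2))"
    and G: "\<And>i j. i \<in> I \<Longrightarrow> j \<in> I \<Longrightarrow> G i j = G j i"
    and M: "\<And>i j. i \<in> I \<Longrightarrow> j \<in> I \<Longrightarrow> M i j = M j i"
    and g: "\<And>i. i \<in> I \<Longrightarrow> (\<Sum>j\<in>I. \<bar>G i j\<bar>) \<le> g" and m: "\<And>i. i \<in> I \<Longrightarrow> (\<Sum>j\<in>I. \<bar>M i j\<bar>) \<le> m"
  shows "\<exists>d. (\<forall>t. (\<integral>\<omega>. iexp (t * ((\<Sum>i\<in>I. \<Sum>j\<in>I. M i j * Y \<omega> i * Y \<omega> j) - (\<Sum>i\<in>I. \<Sum>j\<in>I. M i j * G i j))) \<partial>P)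
        = (\<Prod>a\<in>I. chisq_char (t * d a))) \<and>
      (\<Sum>a\<in>I. (d a)\<^sup>2) = (\<Sum>i\<in>I. \<Sum>j\<in>I. \<Sum>k\<in>I. \<Sum>l\<in>I. M i j * G j k * M k l * G l i) \<and>
      (\<forall>a\<in>I. \<bar>d a\<bar> \<le> g * m)"
proof -
  interpret P: prob_space P by fact
  interpret N: prob_space "std_normal_PiM I" by (rule prob_space_std_normal_PiM)
  obtain W d where
    W: "\<forall>i\<in>I. \<forall>j\<in>I. G i j = (\<Sum>a\<in>I. W i a * W j a)" and
    D: "\<forall>a\<in>I. \<forall>b\<in>I. (\<Sum>i\<in>I. \<Sum>j\<in>I. W i a * M i j * W j b) = (if a = b then d a else 0)"
    by (rule simultaneous_diagonalization[OF I G gaussian_psd[OF P char] M])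
  define Z where "Z \<xi> i = (\<Sum>a\<in>I. W i a * \<xi> a)" for \<xi> :: "'i \<Rightarrow> real" and i
  have Zm: "(\<lambda>\<xi>. Z \<xi> i) \<in> borel_measurable (std_normal_PiM I)" for i
    unfolding Z_def by (intro borel_measurable_sum borel_measurable_times borel_measurable_const measurable_std_normal_PiM)
  have charZ: "(\<integral>\<xi>. iexp (\<Sum>i\<in>I. u i * Z \<xi> i) \<partial>std_normal_PiM I) = (\<integral>\<omega>. iexp (\<Sum>i\<in>I. u i * Y \<omega> i) \<partial>P)" for u
  proof -
    have "(\<Sum>i\<in>I. u i * Z \<xi> i) = (\<Sum>a\<in>I. (\<Sum>i\<in>I. u i * W i a) * \<xi> a)" for \<xi>
      unfolding Z_def by (simp add: sum_distrib_left sum_distrib_right mult_ac) (rule sum.swap)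
    then have "(\<integral>\<xi>. iexp (\<Sum>i\<in>I. u i * Z \<xi> i) \<partial>std_normal_PiM I) = of_real (exp (- (\<Sum>a\<in>I. (\<Sum>i\<in>I. u i * W i a)\<^sup>2) / 2))"
      by (simp only: char_std_normal_PiM[OF I])
    also have "(\<Sum>a\<in>I. (\<Sum>i\<in>I. u i * W i a)\<^sup>2) = (\<Sum>a\<in>I. \<Sum>i\<in>I. \<Sum>j\<in>I. u i * (W i a * W j a) * u j)"
      by (simp add: power2_eq_square sum_product mult_ac)
    also have "\<dots> = (\<Sum>i\<in>I. \<Sum>a\<in>I. \<Sum>j\<in>I. u i * (W i a * W j a) * u j)"
      by (rule sum.swap)
    also have "\<dots> = (\<Sum>i\<in>I. \<Sum>j\<in>I. \<Sum>a\<in>I. u i * (W i a * W j a) * u j)"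
      by (intro sum.cong refl sum.swap)
    also have "\<dots> = (\<Sum>i\<in>I. \<Sum>j\<in>I. u i * G i j * u j)"
      using W by (intro sum.cong refl) (simp add: sum_distrib_left sum_distrib_right)
    finally show ?thesis by (simp only: char)
  qed
  define c where "c = (\<Sum>i\<in>I. \<Sum>j\<in>I. M i j * G i j)"
  define q where "q x = (\<Sum>i\<in>I. \<Sum>j\<in>I. M i j * x i * x j) - c" for x :: "'i \<Rightarrow> real"
  have qc: "continuous_on UNIV q"
    unfolding q_def
    by (intro continuous_on_diff continuous_on_sum continuous_on_mult continuous_on_const continuous_on_product_coordinates)
  have qdep: "q x = q y" if "\<And>i. i \<in> I \<Longrightarrow> x i = y i" for x y
    unfolding q_def using that by (auto intro!: sum.cong)
  have qY: "(\<lambda>\<omega>. q (Y \<omega>)) \<in> borel_measurable P"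
    unfolding q_def by (intro borel_measurable_diff borel_measurable_sum borel_measurable_times borel_measurable_const Y)
  have qZ: "(\<lambda>\<xi>. q (Z \<xi>)) \<in> borel_measurable (std_normal_PiM I)"
    unfolding q_def by (intro borel_measurable_diff borel_measurable_sum borel_measurable_times borel_measurable_const Zm)
  \<comment> \<open>Equal characteristic functions give equal laws of the form, by the continuity
    theorem for a constant sequence.\<close>
  have law: "(\<integral>\<omega>. f (t * q (Y \<omega>)) \<partial>P) = (\<integral>\<xi>. f (t * q (Z \<xi>)) \<partial>std_normal_PiM I)"
    if f: "continuous_on UNIV f" "\<And>x. \<bar>f x\<bar> \<le> 1" for f :: "real \<Rightarrow> real" and t
  proof -
    have fm: "f \<in> borel_measurable borel"
      using f(1) by (rule borel_measurable_continuous_onI)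
    have 1: "continuous_on UNIV (\<lambda>x. f (t * q x))"
      by (rule continuous_on_compose2[OF f(1)]) (auto intro!: continuous_on_mult continuous_on_const qc)
    have 2: "(\<lambda>n :: nat. \<integral>\<omega>. iexp (\<Sum>i\<in>I. u i * Y \<omega> i) \<partial>P) \<longlonglongrightarrow> (\<integral>\<xi>. iexp (\<Sum>i\<in>I. u i * Z \<xi> i) \<partial>std_normal_PiM I)" for u
      unfolding charZ by (rule tendsto_const)
    have 3: "(\<lambda>\<omega>. f (t * q (Y \<omega>))) \<in> borel_measurable P"
      by (rule measurable_compose[OF _ fm]) (use qY in measurable)
    have 4: "(\<lambda>\<omega>. f (t * q (Z \<omega>))) \<in> borel_measurable (std_normal_PiM I)"
      by (rule measurable_compose[OF _ fm]) (use qZ in measurable)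
    have 5: "f (t * q x) = f (t * q y)" if "\<And>i. i \<in> I \<Longrightarrow> x i = y i" for x y
      using qdep[OF that] by simp
    have "(\<lambda>n :: nat. \<integral>\<omega>. f (t * q (Y \<omega>)) \<partial>P) \<longlonglongrightarrow> (\<integral>\<xi>. f (t * q (Z \<xi>)) \<partial>std_normal_PiM I)"
      by (rule multivariate_levy_continuity[where f = "\<lambda>x. f (t * q x)", OF P N.prob_space_axioms I Y Zm 2 1 f(2) 5 3 4])
    then show ?thesis by (simp only: LIMSEQ_const_iff)
  qed
  have "(\<integral>\<omega>. iexp (t * q (Y \<omega>)) \<partial>P) = (\<Prod>a\<in>I. chisq_char (t * d a))" for t
  proof -
    have qZ': "t * q (Z \<xi>) = (\<Sum>a\<in>I. t * d a * ((\<xi> a)\<^sup>2 - 1))" for \<xi>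
    proof -
      have "(\<Sum>i\<in>I. \<Sum>j\<in>I. M i j * Z \<xi> i * Z \<xi> j) = (\<Sum>i\<in>I. \<Sum>j\<in>I. \<Sum>a\<in>I. \<Sum>b\<in>I. (W i a * M i j * W j b) * (\<xi> a * \<xi> b))"
        unfolding Z_def by (simp add: sum_distrib_left sum_distrib_right mult_ac)
      also have "\<dots> = (\<Sum>a\<in>I. \<Sum>b\<in>I. \<Sum>i\<in>I. \<Sum>j\<in>I. (W i a * M i j * W j b) * (\<xi> a * \<xi> b))"
        by (rule sum_swap4)
      also have "\<dots> = (\<Sum>a\<in>I. \<Sum>b\<in>I. (if a = b then d a else 0) * (\<xi> a * \<xi> b))"
        using D by (intro sum.cong refl) (simp add: sum_distrib_right[symmetric])
      also have "\<dots> = (\<Sum>a\<in>I. d a * (\<xi> a)\<^sup>2)"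
        using I by (intro sum.cong refl) (simp add: if_distrib[of "\<lambda>t. t * _"] sum.delta power2_eq_square cong: if_cong)
      finally have "q (Z \<xi>) = (\<Sum>a\<in>I. d a * (\<xi> a)\<^sup>2) - (\<Sum>a\<in>I. d a)"
        unfolding q_def c_def using diagonal_trace[OF W D] by simp
      then show ?thesis
        by (simp only: sum_subtractf[symmetric] sum_distrib_left right_diff_distrib mult_1_right mult.assoc)
    qed
    have "(\<integral>\<omega>. iexp (t * q (Y \<omega>)) \<partial>P) = (\<integral>\<xi>. iexp (t * q (Z \<xi>)) \<partial>std_normal_PiM I)"
    proof -
      have "(\<lambda>\<omega>. t * q (Y \<omega>)) \<in> borel_measurable P" "(\<lambda>\<xi>. t * q (Z \<xi>)) \<in> borel_measurable (std_normal_PiM I)"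
        using qY qZ by measurable
      then show ?thesis
        by (simp only: P.integral_iexp_Complex N.integral_iexp_Complex)
           (simp only: law[of cos] law[of sin] continuous_on_cos[OF continuous_on_id] continuous_on_sin[OF continuous_on_id] abs_cos_le_one abs_sin_le_one)
    qed
    also have "\<dots> = (\<integral>\<xi>. (\<Prod>a\<in>I. iexp (t * d a * ((\<xi> a)\<^sup>2 - 1))) \<partial>std_normal_PiM I)"
      by (simp only: qZ' iexp_sum[OF I])
    also have "\<dots> = (\<Prod>a\<in>I. chisq_char (t * d a))"
      unfolding chisq_char_def by (intro integral_std_normal_PiM_prod I) (auto simp del: of_real_mult of_real_diff)
    finally show ?thesis .
  qed
  then show ?thesis
    unfolding q_def c_def
    using diagonal_trace_square[OF I W D] diagonal_bound[OF I W D g m] by blast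
qed

theorem gaussian_quadratic_clt:
  fixes G M :: "nat \<Rightarrow> 'i::countable \<Rightarrow> 'i \<Rightarrow> real" and Y :: "'a \<Rightarrow> 'i \<Rightarrow> real"
  assumes P: "prob_space P" and I: "\<And>n. finite (I n)"
    and Y: "\<And>n i. i \<in> I n \<Longrightarrow> (\<lambda>\<omega>. Y \<omega> i) \<in> borel_measurable P"
    and char: "\<And>n u. (\<integral>\<omega>. iexp (\<Sum>i\<in>I n. u i * Y \<omega> i) \<partial>P) =
      of_real (exp (- (\<Sum>i\<in>I n. \<Sum>j\<in>I n. u i * G n i j * u j) / 2))"
    and G: "\<And>n i j. i \<in> I n \<Longrightarrow> j \<in> I n \<Longrightarrow> G n i j = G n j i"
    and M: "\<And>n i j. i \<in> I n \<Longrightarrow> j \<in> I n \<Longrightarrow> M n i j = M n j i"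
    and g: "\<And>n i. i \<in> I n \<Longrightarrow> (\<Sum>j\<in>I n. \<bar>G n i j\<bar>) \<le> g"
    and m: "\<And>n i. i \<in> I n \<Longrightarrow> (\<Sum>j\<in>I n. \<bar>M n i j\<bar>) \<le> m n" "m \<longlonglongrightarrow> 0"
    and v: "(\<lambda>n. 2 * (\<Sum>i\<in>I n. \<Sum>j\<in>I n. \<Sum>k\<in>I n. \<Sum>l\<in>I n. M n i j * G n j k * M n k l * G n l i)) \<longlonglongrightarrow> v"
  shows "(\<lambda>n. \<integral>\<omega>. iexp ((\<Sum>i\<in>I n. \<Sum>j\<in>I n. M n i j * Y \<omega> i * Y \<omega> j) - (\<Sum>i\<in>I n. \<Sum>j\<in>I n. M n i j * G n i j)) \<partial>P)
    \<longlonglongrightarrow> of_real (exp (- v / 2))"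
    and "v \<ge> 0"
proof -
  define tr where "tr n = (\<Sum>i\<in>I n. \<Sum>j\<in>I n. \<Sum>k\<in>I n. \<Sum>l\<in>I n. M n i j * G n j k * M n k l * G n l i)" for n
  define q where "q n \<omega> = (\<Sum>i\<in>I n. \<Sum>j\<in>I n. M n i j * Y \<omega> i * Y \<omega> j) - (\<Sum>i\<in>I n. \<Sum>j\<in>I n. M n i j * G n i j)" for n \<omega>
  have "\<exists>d. (\<forall>t. (\<integral>\<omega>. iexp (t * q n \<omega>) \<partial>P) = (\<Prod>a\<in>I n. chisq_char (t * d a))) \<and>
      (\<Sum>a\<in>I n. (d a)\<^sup>2) = tr n \<and> (\<forall>a\<in>I n. \<bar>d a\<bar> \<le> g * m n)" for n
    unfolding q_def tr_def
    by (rule char_gaussian_quadratic_form[OF P I Y char G M g m(1)])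
  then obtain d where
    "\<forall>n. (\<forall>t. (\<integral>\<omega>. iexp (t * q n \<omega>) \<partial>P) = (\<Prod>a\<in>I n. chisq_char (t * d n a))) \<and>
      (\<Sum>a\<in>I n. (d n a)\<^sup>2) = tr n \<and> (\<forall>a\<in>I n. \<bar>d n a\<bar> \<le> g * m n)"
    by metis
  then have d1: "(\<integral>\<omega>. iexp (t * q n \<omega>) \<partial>P) = (\<Prod>a\<in>I n. chisq_char (t * d n a))"
    and d2: "(\<Sum>a\<in>I n. (d n a)\<^sup>2) = tr n" and d3: "a \<in> I n \<Longrightarrow> \<bar>d n a\<bar> \<le> g * m n" for t n a
    by auto
  \<comment> \<open>Each centred square has variance 2, so twice the sum of the d^2 is the variance
    of the form and the sum itself tends to v / 2.\<close>
  have v2: "tr \<longlonglongrightarrow> v / 2"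
    using tendsto_divide[OF v tendsto_const[of 2]] unfolding tr_def[symmetric] by simp
  have "tr n \<ge> 0" for n unfolding d2[symmetric] by (rule sum_nonneg) simp
  then have "v / 2 \<ge> 0" by (intro LIMSEQ_le_const[OF v2]) auto
  then show "v \<ge> 0" by simp
  have "(\<lambda>n. \<Prod>a\<in>I n. chisq_char (d n a)) \<longlonglongrightarrow> of_real (exp (- (v / 2)))"
  proof (rule chisq_clt[OF I])
    show "(\<lambda>n. \<Sum>a\<in>I n. (d n a)\<^sup>2) \<longlonglongrightarrow> v / 2" unfolding d2 by (rule v2)
    show "(\<lambda>n. g * m n) \<longlonglongrightarrow> 0" using tendsto_mult_right_zero[OF m(2)] .
  qed (rule d3)
  then have "(\<lambda>n. \<integral>\<omega>. iexp (q n \<omega>) \<partial>P) \<longlonglongrightarrow> of_real (exp (- v / 2))"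
    using d1[of 1] by (simp only: mult_1_left minus_divide_left)
  then show "(\<lambda>n. \<integral>\<omega>. iexp ((\<Sum>i\<in>I n. \<Sum>j\<in>I n. M n i j * Y \<omega> i * Y \<omega> j) - (\<Sum>i\<in>I n. \<Sum>j\<in>I n. M n i j * G n i j)) \<partial>P)
    \<longlonglongrightarrow> of_real (exp (- v / 2))"
    by (simp only: q_def)
qed

section \<open>Multivariate normal laws\<close>

lemma borel_measurable_iexp: "(\<lambda>x. iexp (t * x)) \<in> borel_measurable borel"
  by measurable

lemma borel_measurable_vec:
  fixes f :: "'a \<Rightarrow> real^'k"
  assumes "\<And>i. (\<lambda>x. f x $ i) \<in> borel_measurable M"
  shows "f \<in> borel_measurable M"
proof -
  have "\<forall>b\<in>Basis. (\<lambda>x. f x \<bullet> b) \<in> borel_measurable M"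
  proof
    fix b :: "real^'k" assume "b \<in> Basis"
    then obtain i where "b = axis i 1" by (auto simp: Basis_vec_def)
    then have "(\<lambda>x. f x \<bullet> b) = (\<lambda>x. f x $ i)" by (simp add: inner_axis)
    then show "(\<lambda>x. f x \<bullet> b) \<in> borel_measurable M" by (simp only: assms)
  qed
  then show ?thesis by (rule borel_measurable_euclidean_space[THEN iffD2])
qed

lemma quadratic_form_sum: "u \<bullet> (F *v w) = (\<Sum>i\<in>UNIV. \<Sum>j\<in>UNIV. u $ i * F $ i $ j * w $ j)"
  by (simp add: inner_vec_def matrix_vector_mult_def sum_distrib_left mult_ac)

text \<open>The law of V xi with F = V V^T. Its one-dimensional projections are recognised by their
  characteristic functions, also in directions where the form vanishes.\<close>

theorem multivariate_normal_exists:
  fixes F :: "real^'k^'k"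
  assumes F: "transpose F = F" and psd: "\<And>u. 0 \<le> u \<bullet> (F *v u)"
  shows "\<exists>L. multivariate_normal L 0 F"
proof -
  have sym: "F $ i $ j = F $ j $ i" for i j
    using F by (metis transpose_def vec_lambda_beta)
  have psd': "0 \<le> (\<Sum>i\<in>UNIV. \<Sum>j\<in>UNIV. u i * F $ i $ j * u j)" for u
    using psd[of "\<chi> i. u i"] by (simp add: quadratic_form_sum)
  obtain V :: "'k \<Rightarrow> 'k \<Rightarrow> real" where V: "\<forall>i\<in>UNIV. \<forall>j\<in>UNIV. F $ i $ j = (\<Sum>a\<in>UNIV. V i a * V j a)"
    by (rule psd_factorization[where G = "\<lambda>i j. F $ i $ j", OF finite[of UNIV] sym psd'])
  define N where "N = std_normal_PiM (UNIV :: 'k set)"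
  interpret N: prob_space N unfolding N_def by (rule prob_space_std_normal_PiM)
  define X where "X \<xi> = (\<chi> i. \<Sum>a\<in>UNIV. V i a * \<xi> a)" for \<xi> :: "'k \<Rightarrow> real"
  have Nm: "(\<lambda>\<xi>. \<xi> a) \<in> borel_measurable N" for a
    unfolding N_def by (rule measurable_std_normal_PiM) simp
  have Xm: "X \<in> borel_measurable N"
    unfolding X_def
    by (rule borel_measurable_vec, simp only: vec_lambda_beta)
       (intro borel_measurable_sum borel_measurable_times borel_measurable_const Nm)
  have "distr (distr N borel X) borel (\<lambda>x. u \<bullet> x) = normal_law 0 (u \<bullet> (F *v u))" for u
  proof (rule Levy_uniqueness)
    have um: "(\<lambda>x. u \<bullet> x) \<in> borel_measurable borel" by measurable
    show "real_distribution (distr (distr N borel X) borel (\<lambda>x. u \<bullet> x))"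
      using Xm by (intro prob_space.real_distribution_distr N.prob_space_distr) auto
    show "real_distribution (normal_law 0 (u \<bullet> (F *v u)))"
      by (rule real_distribution_normal_law[OF psd])
    show "char (distr (distr N borel X) borel (\<lambda>x. u \<bullet> x)) = char (normal_law 0 (u \<bullet> (F *v u)))"
    proof
      fix t
      have uX: "t * (u \<bullet> X \<xi>) = (\<Sum>a\<in>UNIV. (t * (\<Sum>i\<in>UNIV. u $ i * V i a)) * \<xi> a)" for \<xi>
      proof -
        have "u \<bullet> X \<xi> = (\<Sum>i\<in>UNIV. \<Sum>a\<in>UNIV. u $ i * V i a * \<xi> a)"
          by (simp add: X_def inner_vec_def sum_distrib_left mult_ac)
        also have "\<dots> = (\<Sum>a\<in>UNIV. \<Sum>i\<in>UNIV. u $ i * V i a * \<xi> a)" by (rule sum.swap)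
        finally show ?thesis by (simp add: sum_distrib_left sum_distrib_right mult_ac)
      qed
      have "char (distr (distr N borel X) borel (\<lambda>x. u \<bullet> x)) t = (\<integral>\<xi>. iexp (t * (u \<bullet> X \<xi>)) \<partial>N)"
        unfolding char_def distr_distr[OF um Xm] o_def
        by (rule integral_distr[OF measurable_compose[OF Xm um] borel_measurable_iexp])
      also have "\<dots> = of_real (exp (- (\<Sum>a\<in>UNIV. (t * (\<Sum>i\<in>UNIV. u $ i * V i a))\<^sup>2) / 2))"
        unfolding uX N_def by (rule char_std_normal_PiM) simp
      also have "(\<Sum>a\<in>UNIV. (t * (\<Sum>i\<in>UNIV. u $ i * V i a))\<^sup>2) = t\<^sup>2 * (\<Sum>a\<in>UNIV. \<Sum>i\<in>UNIV. \<Sum>j\<in>UNIV. u $ i * (V i a * V j a) * u $ j)"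
        by (simp add: power_mult_distrib sum_distrib_left[symmetric]) (simp add: power2_eq_square sum_product mult_ac)
      also have "(\<Sum>a\<in>UNIV. \<Sum>i\<in>UNIV. \<Sum>j\<in>UNIV. u $ i * (V i a * V j a) * u $ j) = (\<Sum>i\<in>UNIV. \<Sum>a\<in>UNIV. \<Sum>j\<in>UNIV. u $ i * (V i a * V j a) * u $ j)"
        by (rule sum.swap)
      also have "\<dots> = (\<Sum>i\<in>UNIV. \<Sum>j\<in>UNIV. \<Sum>a\<in>UNIV. u $ i * (V i a * V j a) * u $ j)"
        by (intro sum.cong refl sum.swap)
      also have "\<dots> = u \<bullet> (F *v u)"
        unfolding quadratic_form_sum using V by (simp add: sum_distrib_left sum_distrib_right)
      also have "of_real (exp (- (t\<^sup>2 * (u \<bullet> (F *v u))) / 2)) = char (normal_law 0 (u \<bullet> (F *v u))) t"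
        unfolding char_normal_law[OF psd] by (simp add: mult.commute)
      finally show "char (distr (distr N borel X) borel (\<lambda>x. u \<bullet> x)) t = char (normal_law 0 (u \<bullet> (F *v u))) t" .
    qed
  qed
  then have "multivariate_normal (distr N borel X) 0 F"
    unfolding multivariate_normal_def inner_zero_right
    by (intro conjI allI F psd N.prob_space_distr[OF Xm] sets_distr)
  then show ?thesis by (rule exI)
qed

lemma char_multivariate_normal:
  assumes "multivariate_normal L 0 F"
  shows "(\<integral>x. iexp (u \<bullet> x) \<partial>L) = of_real (exp (- (u \<bullet> (F *v u)) / 2))"
proof -
  have L: "sets L = sets borel" "0 \<le> u \<bullet> (F *v u)" "distr L borel (\<lambda>x. u \<bullet> x) = normal_law 0 (u \<bullet> (F *v u))"
    using assms by (simp_all add: multivariate_normal_def)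
  have um: "(\<lambda>x. u \<bullet> x) \<in> borel_measurable L"
    unfolding measurable_cong_sets[OF L(1) refl] by measurable
  have "(\<integral>x. iexp (u \<bullet> x) \<partial>L) = char (distr L borel (\<lambda>x. u \<bullet> x)) 1"
    using integral_distr[OF um borel_measurable_iexp[of 1]] unfolding char_def mult_1_left by (rule sym)
  then show ?thesis unfolding L(3) char_normal_law[OF L(2)] by simp
qed

section \<open>Square-integrable random variables\<close>

lemma sqi_meas: "square_integrable M X \<Longrightarrow> X \<in> borel_measurable M"
  by (simp only: square_integrable_def)

lemma sqi_norm: "square_integrable M X \<Longrightarrow> integrable M (\<lambda>\<omega>. (norm (X \<omega>))\<^sup>2)"
  by (simp only: square_integrable_def)

lemma norm_add_sq_le: "(norm (a + b))\<^sup>2 \<le> 2 * (norm a)\<^sup>2 + 2 * (norm b)\<^sup>2" for a b :: "'v::real_inner"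
proof -
  have "2 * (norm a)\<^sup>2 + 2 * (norm b)\<^sup>2 - (norm (a + b))\<^sup>2 = (norm (a - b))\<^sup>2"
    by (simp add: power2_norm_eq_inner inner_diff_left inner_diff_right inner_add_left inner_add_right inner_commute)
  then show ?thesis by (metis diff_ge_0_iff_ge zero_le_power2)
qed

lemma sqi_bound:
  assumes "X \<in> borel_measurable M" "integrable M f" "\<And>\<omega>. (norm (X \<omega>))\<^sup>2 \<le> f \<omega>"
  shows "square_integrable M X"
  unfolding square_integrable_def
proof
  show "integrable M (\<lambda>\<omega>. (norm (X \<omega>))\<^sup>2)"
  proof (rule Bochner_Integration.integrable_bound[OF assms(2)])
    show "(\<lambda>\<omega>. (norm (X \<omega>))\<^sup>2) \<in> borel_measurable M" using assms(1) by measurable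
    show "AE \<omega> in M. norm ((norm (X \<omega>))\<^sup>2) \<le> norm (f \<omega>)"
      by (rule AE_I2) (smt (verit) assms(3) real_norm_def zero_le_power2)
  qed
qed (rule assms)

lemma sqi_add:
  fixes X Y :: "'a \<Rightarrow> 'v::euclidean_space"
  assumes X: "square_integrable M X" and Y: "square_integrable M Y"
  shows "square_integrable M (\<lambda>\<omega>. X \<omega> + Y \<omega>)"
proof (rule sqi_bound)
  show "(\<lambda>\<omega>. X \<omega> + Y \<omega>) \<in> borel_measurable M"
    by (intro borel_measurable_add sqi_meas X Y)
  show "integrable M (\<lambda>\<omega>. 2 * (norm (X \<omega>))\<^sup>2 + 2 * (norm (Y \<omega>))\<^sup>2)"
    by (intro Bochner_Integration.integrable_add integrable_mult_right sqi_norm X Y)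
qed (rule norm_add_sq_le)

lemma sqi_scaleR:
  fixes X :: "'a \<Rightarrow> 'v::euclidean_space"
  assumes X: "square_integrable M X"
  shows "square_integrable M (\<lambda>\<omega>. c *\<^sub>R X \<omega>)"
proof (rule sqi_bound)
  show "(\<lambda>\<omega>. c *\<^sub>R X \<omega>) \<in> borel_measurable M"
    by (intro borel_measurable_scaleR borel_measurable_const sqi_meas X)
  show "integrable M (\<lambda>\<omega>. c\<^sup>2 * (norm (X \<omega>))\<^sup>2)"
    by (intro integrable_mult_right sqi_norm X)
qed (simp add: power_mult_distrib)

lemma sqi_zero: "square_integrable M (\<lambda>\<omega>. 0 :: 'v::euclidean_space)"
  by (simp add: square_integrable_def)

lemma sqi_diff:
  fixes X Y :: "'a \<Rightarrow> 'v::euclidean_space"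
  assumes X: "square_integrable M X" and Y: "square_integrable M Y"
  shows "square_integrable M (\<lambda>\<omega>. X \<omega> - Y \<omega>)"
  using sqi_add[OF X sqi_scaleR[OF Y, of "-1"]] by simp

lemma sqi_sum:
  fixes X :: "'i \<Rightarrow> 'a \<Rightarrow> 'v::euclidean_space"
  assumes "\<And>i. i \<in> I \<Longrightarrow> square_integrable M (X i)"
  shows "square_integrable M (\<lambda>\<omega>. \<Sum>i\<in>I. X i \<omega>)"
  using assms by (induction I rule: infinite_finite_induct) (auto intro!: sqi_zero sqi_add)

lemma sqi_sum_list:
  fixes X :: "'i \<Rightarrow> 'a \<Rightarrow> 'v::euclidean_space"
  assumes "\<And>i. i \<in> set s \<Longrightarrow> square_integrable M (X i)"
  shows "square_integrable M (\<lambda>\<omega>. \<Sum>i\<leftarrow>s. X i \<omega>)"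
  using assms by (induction s) (auto intro!: sqi_zero sqi_add)

lemma sqi_contraction:
  fixes X :: "'a \<Rightarrow> 'v::euclidean_space" and Y :: "'a \<Rightarrow> 'w::euclidean_space"
  assumes "square_integrable M X" "Y \<in> borel_measurable M" "\<And>\<omega>. norm (Y \<omega>) \<le> norm (X \<omega>)"
  shows "square_integrable M Y"
  by (rule sqi_bound[OF assms(2) sqi_norm[OF assms(1)]]) (simp add: assms(3) power_mono)

lemma sqi_inner_integrable:
  fixes X Y :: "'a \<Rightarrow> 'v::euclidean_space"
  assumes X: "square_integrable M X" and Y: "square_integrable M Y"
  shows "integrable M (\<lambda>\<omega>. X \<omega> \<bullet> Y \<omega>)"
proof (rule Bochner_Integration.integrable_bound)
  show "integrable M (\<lambda>\<omega>. (norm (X \<omega>))\<^sup>2 + (norm (Y \<omega>))\<^sup>2)"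
    by (intro Bochner_Integration.integrable_add sqi_norm X Y)
  show "(\<lambda>\<omega>. X \<omega> \<bullet> Y \<omega>) \<in> borel_measurable M"
    by (intro borel_measurable_inner sqi_meas X Y)
  have "\<bar>x \<bullet> y\<bar> \<le> (norm x)\<^sup>2 + (norm y)\<^sup>2" for x y :: 'v
  proof -
    have "\<bar>x \<bullet> y\<bar> \<le> norm x * norm y" by (rule Cauchy_Schwarz_ineq2)
    also have "\<dots> \<le> (norm x)\<^sup>2 + (norm y)\<^sup>2"
      using zero_le_power2[of "norm x - norm y"] mult_nonneg_nonneg[OF norm_ge_zero norm_ge_zero, of x y]
      unfolding power2_diff by linarith
    finally show ?thesis .
  qed
  then show "AE \<omega> in M. norm (X \<omega> \<bullet> Y \<omega>) \<le> norm ((norm (X \<omega>))\<^sup>2 + (norm (Y \<omega>))\<^sup>2)"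
    by (intro AE_I2) simp
qed

definition L2_inner :: "'a measure \<Rightarrow> ('a \<Rightarrow> 'v::euclidean_space) \<Rightarrow> ('a \<Rightarrow> 'v) \<Rightarrow> real" where
  "L2_inner M X Y = (\<integral>\<omega>. X \<omega> \<bullet> Y \<omega> \<partial>M)"

lemma L2_inner_commute: "L2_inner M X Y = L2_inner M Y X"
  by (simp only: L2_inner_def inner_commute)

lemma L2_inner_add_left:
  fixes X Y Z :: "'a \<Rightarrow> 'v::euclidean_space"
  assumes "square_integrable M X" "square_integrable M Y" "square_integrable M Z"
  shows "L2_inner M (\<lambda>\<omega>. X \<omega> + Y \<omega>) Z = L2_inner M X Z + L2_inner M Y Z"
  unfolding L2_inner_def inner_add_left
  by (intro Bochner_Integration.integral_add sqi_inner_integrable assms)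

lemma L2_inner_scaleR_left: "L2_inner M (\<lambda>\<omega>. c *\<^sub>R X \<omega>) Z = c * L2_inner M X Z"
  unfolding L2_inner_def inner_scaleR_left by (rule integral_mult_right_zero)

lemma L2_inner_diff_left:
  fixes X Y Z :: "'a \<Rightarrow> 'v::euclidean_space"
  assumes "square_integrable M X" "square_integrable M Y" "square_integrable M Z"
  shows "L2_inner M (\<lambda>\<omega>. X \<omega> - Y \<omega>) Z = L2_inner M X Z - L2_inner M Y Z"
  unfolding L2_inner_def inner_diff_left
  by (intro Bochner_Integration.integral_diff sqi_inner_integrable assms)

lemma L2_inner_diff_right:
  fixes X Y Z :: "'a \<Rightarrow> 'v::euclidean_space"
  assumes "square_integrable M X" "square_integrable M Y" "square_integrable M Z"
  shows "L2_inner M Z (\<lambda>\<omega>. X \<omega> - Y \<omega>) = L2_inner M Z X - L2_inner M Z Y"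
  using L2_inner_diff_left[OF assms] by (simp only: L2_inner_commute[of M Z])

lemma L2_inner_scaleR_right: "L2_inner M Z (\<lambda>\<omega>. c *\<^sub>R X \<omega>) = c * L2_inner M Z X"
  using L2_inner_scaleR_left[of M c X Z] by (simp only: L2_inner_commute[of M Z])

lemma L2_inner_sum_left:
  fixes X :: "'i \<Rightarrow> 'a \<Rightarrow> 'v::euclidean_space"
  assumes "\<And>i. i \<in> I \<Longrightarrow> square_integrable M (X i)" "square_integrable M Z"
  shows "L2_inner M (\<lambda>\<omega>. \<Sum>i\<in>I. X i \<omega>) Z = (\<Sum>i\<in>I. L2_inner M (X i) Z)"
  unfolding L2_inner_def inner_sum_left
  by (intro Bochner_Integration.integral_sum sqi_inner_integrable assms)

lemma L2_inner_sum_right: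
  fixes X :: "'i \<Rightarrow> 'a \<Rightarrow> 'v::euclidean_space"
  assumes "\<And>i. i \<in> I \<Longrightarrow> square_integrable M (X i)" "square_integrable M Z"
  shows "L2_inner M Z (\<lambda>\<omega>. \<Sum>i\<in>I. X i \<omega>) = (\<Sum>i\<in>I. L2_inner M Z (X i))"
  unfolding L2_inner_commute[of M Z] by (rule L2_inner_sum_left[OF assms])

lemma L2_inner_self_nonneg: "L2_inner M X X \<ge> 0"
  unfolding L2_inner_def by (rule Bochner_Integration.integral_nonneg) simp

lemma L2_inner_self: "L2_inner M X X = (\<integral>\<omega>. (norm (X \<omega>))\<^sup>2 \<partial>M)"
  by (simp only: L2_inner_def power2_norm_eq_inner)

lemma L2_dist_inner: "L2_dist M X Y = sqrt (L2_inner M (\<lambda>\<omega>. X \<omega> - Y \<omega>) (\<lambda>\<omega>. X \<omega> - Y \<omega>))"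
  by (simp only: L2_dist_def L2_inner_self)

lemma L2_inner_square_expand:
  fixes X Y :: "'a \<Rightarrow> 'v::euclidean_space"
  assumes X: "square_integrable M X" and Y: "square_integrable M Y"
  shows "L2_inner M (\<lambda>\<omega>. X \<omega> - c *\<^sub>R Y \<omega>) (\<lambda>\<omega>. X \<omega> - c *\<^sub>R Y \<omega>) =
    L2_inner M X X - 2 * c * L2_inner M X Y + c\<^sup>2 * L2_inner M Y Y"
proof -
  note Y' = sqi_scaleR[OF Y, of c]
  note D = sqi_diff[OF X Y']
  show ?thesis
    unfolding L2_inner_diff_left[OF X Y' D] L2_inner_diff_right[OF X Y' X] L2_inner_diff_right[OF X Y' Y]
      L2_inner_diff_right[OF X Y' Y'] L2_inner_scaleR_left L2_inner_scaleR_right L2_inner_commute[of M Y X]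
    by (simp add: power2_eq_square algebra_simps)
qed

text \<open>The pairing is only semidefinite on functions: norm 0 does not mean the zero function.
  The case \<open>C = 0\<close> of the quadratic in c is therefore treated separately.\<close>

lemma L2_Cauchy_Schwarz:
  fixes X Y :: "'a \<Rightarrow> 'v::euclidean_space"
  assumes X: "square_integrable M X" and Y: "square_integrable M Y"
  shows "\<bar>L2_inner M X Y\<bar> \<le> sqrt (L2_inner M X X) * sqrt (L2_inner M Y Y)"
proof -
  define A B C where "A = L2_inner M X X" and "B = L2_inner M X Y" and "C = L2_inner M Y Y"
  have quad: "0 \<le> A - 2 * c * B + c\<^sup>2 * C" for c
    using L2_inner_self_nonneg[of M "\<lambda>\<omega>. X \<omega> - c *\<^sub>R Y \<omega>"]
    unfolding L2_inner_square_expand[OF X Y] A_def B_def C_def .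
  have A: "A \<ge> 0" and C: "C \<ge> 0" by (simp_all add: A_def C_def L2_inner_self_nonneg)
  have "B\<^sup>2 \<le> A * C"
  proof (cases "C = 0")
    case True
    have "B = 0"
    proof (rule ccontr)
      assume "B \<noteq> 0"
      \<comment> \<open>With C = 0 the quadratic is linear in c; at this c it equals -1.\<close>
      then show False using quad[of "(A + 1) / (2 * B)"] True by simp
    qed
    then show ?thesis using A C by simp
  next
    case False
    then have "C > 0" using C by simp
    have "0 \<le> (A - 2 * (B / C) * B + (B / C)\<^sup>2 * C) * C"
      using quad[of "B / C"] C by simp
    also have "\<dots> = A * C - B\<^sup>2"
      using \<open>C > 0\<close> by (simp add: field_simps power2_eq_square)
    finally show ?thesis by simp
  qed
  then have "sqrt (B\<^sup>2) \<le> sqrt (A * C)" by (rule real_sqrt_le_mono)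
  then show ?thesis by (simp add: real_sqrt_mult A_def B_def C_def)
qed

lemma L2_inner_diff_bound:
  fixes X Y X' Y' :: "'a \<Rightarrow> 'v::euclidean_space"
  assumes X: "square_integrable M X" and Y: "square_integrable M Y"
    and X': "square_integrable M X'" and Y': "square_integrable M Y'"
  shows "\<bar>L2_inner M X' Y' - L2_inner M X Y\<bar> \<le>
    L2_dist M X X' * L2_dist M Y Y' + L2_dist M X X' * sqrt (L2_inner M Y Y) + sqrt (L2_inner M X X) * L2_dist M Y Y'"
proof -
  note dX = sqi_diff[OF X X'] and dY = sqi_diff[OF Y Y']
  have e: "L2_inner M X' Y' - L2_inner M X Y = L2_inner M (\<lambda>\<omega>. X \<omega> - X' \<omega>) (\<lambda>\<omega>. Y \<omega> - Y' \<omega>)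
      - L2_inner M (\<lambda>\<omega>. X \<omega> - X' \<omega>) Y - L2_inner M X (\<lambda>\<omega>. Y \<omega> - Y' \<omega>)"
    unfolding L2_inner_diff_left[OF X X' dY] L2_inner_diff_left[OF X X' Y]
      L2_inner_diff_right[OF Y Y' X] L2_inner_diff_right[OF Y Y' X'] by simp
  show ?thesis
    unfolding e
    using L2_Cauchy_Schwarz[OF dX dY] L2_Cauchy_Schwarz[OF dX Y] L2_Cauchy_Schwarz[OF X dY]
    unfolding L2_dist_inner[symmetric] by linarith
qed

lemma L2_inner_tendsto:
  fixes X Y :: "'a \<Rightarrow> 'v::euclidean_space"
  assumes X: "square_integrable M X" and Y: "square_integrable M Y"
    and X': "\<And>k. square_integrable M (X' k)" and Y': "\<And>k. square_integrable M (Y' k)"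
    and lX: "(\<lambda>k. L2_dist M X (X' k)) \<longlonglongrightarrow> 0" and lY: "(\<lambda>k. L2_dist M Y (Y' k)) \<longlonglongrightarrow> 0"
  shows "(\<lambda>k. L2_inner M (X' k) (Y' k)) \<longlonglongrightarrow> L2_inner M X Y"
proof -
  have "(\<lambda>k. L2_dist M X (X' k) * L2_dist M Y (Y' k) + L2_dist M X (X' k) * sqrt (L2_inner M Y Y)
      + sqrt (L2_inner M X X) * L2_dist M Y (Y' k)) \<longlonglongrightarrow> 0 * 0 + 0 * sqrt (L2_inner M Y Y) + sqrt (L2_inner M X X) * 0"
    by (intro tendsto_add tendsto_mult tendsto_const lX lY)
  then have lim: "(\<lambda>k. L2_dist M X (X' k) * L2_dist M Y (Y' k) + L2_dist M X (X' k) * sqrt (L2_inner M Y Y)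
      + sqrt (L2_inner M X X) * L2_dist M Y (Y' k)) \<longlonglongrightarrow> 0"
    by simp
  have "(\<lambda>k. L2_inner M (X' k) (Y' k) - L2_inner M X Y) \<longlonglongrightarrow> 0"
    by (rule Lim_null_comparison[OF always_eventually lim], rule allI, unfold real_norm_def)
       (rule L2_inner_diff_bound[OF X Y X' Y'])
  then show ?thesis by (rule LIM_zero_cancel)
qed

lemma L2_dist_contraction:
  fixes X Y :: "'a \<Rightarrow> 'v::euclidean_space" and X' Y' :: "'a \<Rightarrow> 'w::euclidean_space"
  assumes "square_integrable M X" "square_integrable M Y" "square_integrable M X'" "square_integrable M Y'"
    and le: "\<And>\<omega>. norm (X' \<omega> - Y' \<omega>) \<le> norm (X \<omega> - Y \<omega>)"
  shows "L2_dist M X' Y' \<le> L2_dist M X Y"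
  unfolding L2_dist_def
  by (intro real_sqrt_le_mono integral_mono sqi_norm sqi_diff assms power_mono le norm_ge_zero)

lemma L2_dist_nonneg: "L2_dist M X Y \<ge> 0"
  by (simp add: L2_dist_def)

lemma L2_dist_add_tendsto:
  fixes X Y :: "'a \<Rightarrow> 'v::euclidean_space"
  assumes X: "square_integrable M X" and Y: "square_integrable M Y"
    and X': "\<And>k. square_integrable M (X' k)" and Y': "\<And>k. square_integrable M (Y' k)"
    and lX: "(\<lambda>k. L2_dist M X (X' k)) \<longlonglongrightarrow> 0" and lY: "(\<lambda>k. L2_dist M Y (Y' k)) \<longlonglongrightarrow> 0"
  shows "(\<lambda>k. L2_dist M (\<lambda>\<omega>. X \<omega> + Y \<omega>) (\<lambda>\<omega>. X' k \<omega> + Y' k \<omega>)) \<longlonglongrightarrow> 0"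
proof -
  have sq: "(L2_dist M (\<lambda>\<omega>. X \<omega> + Y \<omega>) (\<lambda>\<omega>. X' k \<omega> + Y' k \<omega>))\<^sup>2 \<le> 2 * (L2_dist M X (X' k))\<^sup>2 + 2 * (L2_dist M Y (Y' k))\<^sup>2" for k
  proof -
    have "(\<integral>\<omega>. (norm (X \<omega> + Y \<omega> - (X' k \<omega> + Y' k \<omega>)))\<^sup>2 \<partial>M) \<le>
        (\<integral>\<omega>. 2 * (norm (X \<omega> - X' k \<omega>))\<^sup>2 + 2 * (norm (Y \<omega> - Y' k \<omega>))\<^sup>2 \<partial>M)"
    proof (rule integral_mono)
      show "integrable M (\<lambda>\<omega>. (norm (X \<omega> + Y \<omega> - (X' k \<omega> + Y' k \<omega>)))\<^sup>2)"
        by (intro sqi_norm sqi_diff sqi_add X Y X' Y')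
      show "integrable M (\<lambda>\<omega>. 2 * (norm (X \<omega> - X' k \<omega>))\<^sup>2 + 2 * (norm (Y \<omega> - Y' k \<omega>))\<^sup>2)"
        by (intro Bochner_Integration.integrable_add integrable_mult_right sqi_norm sqi_diff X Y X' Y')
      show "(norm (X \<omega> + Y \<omega> - (X' k \<omega> + Y' k \<omega>)))\<^sup>2 \<le> 2 * (norm (X \<omega> - X' k \<omega>))\<^sup>2 + 2 * (norm (Y \<omega> - Y' k \<omega>))\<^sup>2" for \<omega>
        using norm_add_sq_le[of "X \<omega> - X' k \<omega>" "Y \<omega> - Y' k \<omega>"] by (simp only: add_diff_add)
    qed
    also have "\<dots> = 2 * (\<integral>\<omega>. (norm (X \<omega> - X' k \<omega>))\<^sup>2 \<partial>M) + 2 * (\<integral>\<omega>. (norm (Y \<omega> - Y' k \<omega>))\<^sup>2 \<partial>M)"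
      by (subst Bochner_Integration.integral_add; (intro integrable_mult_right sqi_norm sqi_diff X Y X' Y')?) simp
    finally show ?thesis by (simp add: L2_dist_def)
  qed
  have "(\<lambda>k. 2 * (L2_dist M X (X' k))\<^sup>2 + 2 * (L2_dist M Y (Y' k))\<^sup>2) \<longlonglongrightarrow> 2 * 0\<^sup>2 + 2 * 0\<^sup>2"
    by (intro tendsto_add tendsto_mult tendsto_const tendsto_power lX lY)
  then have lim: "(\<lambda>k. 2 * (L2_dist M X (X' k))\<^sup>2 + 2 * (L2_dist M Y (Y' k))\<^sup>2) \<longlonglongrightarrow> 0" by simp
  have "(\<lambda>k. (L2_dist M (\<lambda>\<omega>. X \<omega> + Y \<omega>) (\<lambda>\<omega>. X' k \<omega> + Y' k \<omega>))\<^sup>2) \<longlonglongrightarrow> 0"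
    by (rule Lim_null_comparison[OF always_eventually lim], rule allI) (simp add: sq)
  then have "(\<lambda>k. sqrt ((L2_dist M (\<lambda>\<omega>. X \<omega> + Y \<omega>) (\<lambda>\<omega>. X' k \<omega> + Y' k \<omega>))\<^sup>2)) \<longlonglongrightarrow> sqrt 0"
    by (rule tendsto_real_sqrt)
  then show ?thesis by (simp add: L2_dist_nonneg)
qed

lemma L2_dist_scaleR: "L2_dist M (\<lambda>\<omega>. c *\<^sub>R X \<omega>) (\<lambda>\<omega>. c *\<^sub>R Y \<omega>) = \<bar>c\<bar> * L2_dist M X Y"
proof -
  have "(norm (c *\<^sub>R X \<omega> - c *\<^sub>R Y \<omega>))\<^sup>2 = c\<^sup>2 * (norm (X \<omega> - Y \<omega>))\<^sup>2" for \<omega>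
    by (simp only: scaleR_diff_right[symmetric] norm_scaleR power_mult_distrib power2_abs)
  then show ?thesis
    by (simp only: L2_dist_def integral_mult_right_zero real_sqrt_mult real_sqrt_abs)
qed

text \<open>Only the value of the characteristic function at 1 is recorded. The predicate is used
  for arbitrary linear combinations, whose coefficients absorb the argument, and in this form it
  passes to L2 limits.\<close>

definition gaussian_rv :: "'a measure \<Rightarrow> ('a \<Rightarrow> real) \<Rightarrow> bool" where
  "gaussian_rv P X \<longleftrightarrow> square_integrable P X \<and>
     (\<integral>\<omega>. iexp (X \<omega>) \<partial>P) = of_real (exp (- (L2_inner P X X) / 2))"

lemma centered_gaussian_imp_gaussian_rv:
  assumes "centered_gaussian P X" shows "gaussian_rv P X"
proof -
  obtain v where X: "X \<in> borel_measurable P" and v: "v \<ge> 0" "distr P borel X = normal_law 0 v"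
    using assms unfolding centered_gaussian_def by blast
  have "integrable (distr P borel X) (\<lambda>x. x\<^sup>2)"
    unfolding v(2) by (rule normal_law_second_moment[OF v(1)])
  then have i: "integrable P (\<lambda>\<omega>. (X \<omega>)\<^sup>2)"
    by (subst (asm) integrable_distr_eq[OF X]) measurable
  have s: "square_integrable P X"
    unfolding square_integrable_def using X i by (simp only: real_norm_def power2_abs)
  have "L2_inner P X X = (\<integral>x. x\<^sup>2 \<partial>distr P borel X)"
    unfolding L2_inner_def by (subst integral_distr[OF X]) (measurable, simp add: power2_eq_square)
  also have "\<dots> = v" unfolding v(2) by (rule normal_law_second_moment[OF v(1)])
  finally have v': "L2_inner P X X = v" .
  have "(\<integral>\<omega>. iexp (X \<omega>) \<partial>P) = char (distr P borel X) 1"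
    using integral_distr[OF X borel_measurable_iexp[of 1]] unfolding char_def mult_1_left by (rule sym)
  also have "\<dots> = of_real (exp (- v / 2))"
    unfolding v(2) char_normal_law[OF v(1)] by simp
  finally show ?thesis unfolding gaussian_rv_def v' using s by blast
qed

lemma norm_iexp_diff: "norm (iexp x - iexp y) \<le> \<bar>x - y\<bar>"
proof -
  have "iexp x - iexp y = iexp y * (iexp (x - y) - 1)"
    by (simp add: exp_diff algebra_simps)
  then have "norm (iexp x - iexp y) = norm (iexp (x - y) - 1)"
    by (simp only: norm_mult norm_exp_i_times mult_1_left)
  also have "\<dots> \<le> \<bar>x - y\<bar>"
    using iexp_approx1[of "x - y" 0] by simp
  finally show ?thesis .
qed

text \<open>Both sides of the defining equation are L2-continuous: second moments converge, and the
  expectation of iexp X is 1-Lipschitz in L1, hence in L2 on a probability space.\<close>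

lemma gaussian_rv_limit:
  assumes P: "prob_space P" and X: "square_integrable P X"
    and g: "\<And>k :: nat. gaussian_rv P (X' k)" and l: "(\<lambda>k. L2_dist P X (X' k)) \<longlonglongrightarrow> 0"
  shows "gaussian_rv P X"
proof -
  interpret prob_space P by fact
  have X': "square_integrable P (X' k)" for k using g unfolding gaussian_rv_def by blast
  have c: "(\<integral>\<omega>. iexp (X' k \<omega>) \<partial>P) = of_real (exp (- (L2_inner P (X' k) (X' k)) / 2))" for k
    using g unfolding gaussian_rv_def by blast
  have lim: "(\<lambda>k. - L2_inner P (X' k) (X' k) / 2) \<longlonglongrightarrow> - L2_inner P X X / 2"
    by (rule tendsto_divide[OF tendsto_minus[OF L2_inner_tendsto[OF X X X' X' l l]] tendsto_const]) simp
  have 1: "(\<lambda>k. \<integral>\<omega>. iexp (X' k \<omega>) \<partial>P) \<longlonglongrightarrow> of_real (exp (- (L2_inner P X X) / 2))"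
    unfolding c by (rule tendsto_of_real[OF tendsto_exp[OF lim]])
  have int: "integrable P (\<lambda>\<omega>. iexp (Y \<omega>))" if Y: "square_integrable P Y" for Y
  proof (rule integrable_iexp)
    show "(\<lambda>\<omega>. complex_of_real (Y \<omega>)) \<in> borel_measurable P" using sqi_meas[OF Y] by measurable
  qed (rule Im_complex_of_real)
  have one: "square_integrable P (\<lambda>\<omega>. 1 :: real)"
    unfolding square_integrable_def by (intro conjI borel_measurable_const integrable_const)
  have bnd: "norm ((\<integral>\<omega>. iexp (X' k \<omega>) \<partial>P) - (\<integral>\<omega>. iexp (X \<omega>) \<partial>P)) \<le> L2_dist P X (X' k)" for k
  proof -
    have d: "square_integrable P (\<lambda>\<omega>. \<bar>X \<omega> - X' k \<omega>\<bar>)"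
    proof (rule sqi_contraction[OF sqi_diff[OF X X'[of k]]])
      show "(\<lambda>\<omega>. \<bar>X \<omega> - X' k \<omega>\<bar>) \<in> borel_measurable P"
        by (intro borel_measurable_abs borel_measurable_diff sqi_meas X X')
    qed (simp only: real_norm_def abs_idempotent order_refl)
    have "norm ((\<integral>\<omega>. iexp (X' k \<omega>) \<partial>P) - (\<integral>\<omega>. iexp (X \<omega>) \<partial>P)) = norm (\<integral>\<omega>. iexp (X' k \<omega>) - iexp (X \<omega>) \<partial>P)"
      by (subst Bochner_Integration.integral_diff[OF int[OF X'] int[OF X]]) (rule refl)
    also have "\<dots> \<le> (\<integral>\<omega>. norm (iexp (X' k \<omega>) - iexp (X \<omega>)) \<partial>P)"
      by (rule integral_norm_bound)
    also have "\<dots> \<le> (\<integral>\<omega>. \<bar>X \<omega> - X' k \<omega>\<bar> \<bullet> 1 \<partial>P)"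
    proof (rule integral_mono)
      show "integrable P (\<lambda>\<omega>. norm (iexp (X' k \<omega>) - iexp (X \<omega>)))"
        by (intro integrable_norm Bochner_Integration.integrable_diff int X X')
      show "integrable P (\<lambda>\<omega>. \<bar>X \<omega> - X' k \<omega>\<bar> \<bullet> 1)"
        by (rule sqi_inner_integrable[OF d one])
      show "norm (iexp (X' k \<omega>) - iexp (X \<omega>)) \<le> \<bar>X \<omega> - X' k \<omega>\<bar> \<bullet> 1" for \<omega>
        using norm_iexp_diff[of "X' k \<omega>" "X \<omega>"] by (simp add: abs_minus_commute)
    qed
    also have "\<dots> \<le> sqrt (L2_inner P (\<lambda>\<omega>. \<bar>X \<omega> - X' k \<omega>\<bar>) (\<lambda>\<omega>. \<bar>X \<omega> - X' k \<omega>\<bar>)) * sqrt (L2_inner P (\<lambda>\<omega>. 1 :: real) (\<lambda>\<omega>. 1))"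
      using L2_Cauchy_Schwarz[OF d one] unfolding L2_inner_def[of _ _ "\<lambda>_. 1"] by linarith
    also have "L2_inner P (\<lambda>\<omega>. 1 :: real) (\<lambda>\<omega>. 1) = 1"
      using prob_space by (simp add: L2_inner_def)
    also have "sqrt (L2_inner P (\<lambda>\<omega>. \<bar>X \<omega> - X' k \<omega>\<bar>) (\<lambda>\<omega>. \<bar>X \<omega> - X' k \<omega>\<bar>)) = L2_dist P X (X' k)"
      by (simp only: L2_dist_def L2_inner_self real_norm_def abs_idempotent)
    finally show ?thesis by simp
  qed
  have "(\<lambda>k. (\<integral>\<omega>. iexp (X' k \<omega>) \<partial>P) - (\<integral>\<omega>. iexp (X \<omega>) \<partial>P)) \<longlonglongrightarrow> 0"
    by (rule Lim_null_comparison[OF always_eventually l], rule allI) (rule bnd)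
  then have "(\<lambda>k. \<integral>\<omega>. iexp (X' k \<omega>) \<partial>P) \<longlonglongrightarrow> (\<integral>\<omega>. iexp (X \<omega>) \<partial>P)"
    by (rule LIM_zero_cancel)
  from LIMSEQ_unique[OF this 1] show ?thesis
    unfolding gaussian_rv_def using X by blast
qed

section \<open>Spectral integrals\<close>

definition simple_spectral :: "(real set \<Rightarrow> 'q \<Rightarrow> complex^'n) \<Rightarrow> (real set \<times> (complex^'n^'n)) list \<Rightarrow> 'q \<Rightarrow> complex^'n" where
  "simple_spectral Z s \<omega> = (\<Sum>(E, M)\<leftarrow>s. M *v Z E \<omega>)"

definition simple_kernel :: "(real set \<times> (complex^'n^'n)) list \<Rightarrow> real \<Rightarrow> complex^'n^'n" where
  "simple_kernel s x = (\<Sum>(E, M)\<leftarrow>s. indicator E x *\<^sub>R M)"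

text \<open>The variables that the definition of the random measure declares Gaussian, kept as a
  class so that components of simple integrals can be shown to belong to it.\<close>

definition real_Z_combination :: "(real set \<Rightarrow> 'q \<Rightarrow> complex^'n) \<Rightarrow> ('q \<Rightarrow> real) \<Rightarrow> bool" where
  "real_Z_combination Z X \<longleftrightarrow> (\<exists>I c. finite I \<and> I \<subseteq> finite_borel \<and>
     X = (\<lambda>\<omega>. Re (\<Sum>E\<in>I. \<Sum>i\<in>UNIV. (c E :: complex^'n) $ i * Z E \<omega> $ i)))"

lemma real_Z_combination_zero: "real_Z_combination Z (\<lambda>\<omega>. 0)"
  unfolding real_Z_combination_def by (rule exI[of _ "{}"]) simp

lemma real_Z_combination_add:
  fixes Z :: "real set \<Rightarrow> 'q \<Rightarrow> complex^'n"
  assumes "real_Z_combination Z X" "real_Z_combination Z Y"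
  shows "real_Z_combination Z (\<lambda>\<omega>. X \<omega> + Y \<omega>)"
proof -
  obtain I c J d where I: "finite I" "I \<subseteq> finite_borel"
      "X = (\<lambda>\<omega>. Re (\<Sum>E\<in>I. \<Sum>i\<in>UNIV. (c E :: complex^'n) $ i * Z E \<omega> $ i))"
    and J: "finite J" "J \<subseteq> finite_borel"
      "Y = (\<lambda>\<omega>. Re (\<Sum>E\<in>J. \<Sum>i\<in>UNIV. (d E :: complex^'n) $ i * Z E \<omega> $ i))"
    using assms unfolding real_Z_combination_def by blast
  \<comment> \<open>A set that occurs in both families receives the sum of its coefficients.\<close>
  define e where "e E = (if E \<in> I then c E else 0) + (if E \<in> J then d E else 0)" for E
  have "(\<Sum>E\<in>I \<union> J. \<Sum>i\<in>UNIV. e E $ i * Z E \<omega> $ i) =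
      (\<Sum>E\<in>I. \<Sum>i\<in>UNIV. c E $ i * Z E \<omega> $ i) + (\<Sum>E\<in>J. \<Sum>i\<in>UNIV. d E $ i * Z E \<omega> $ i)" for \<omega>
  proof -
    have "(\<Sum>E\<in>I \<union> J. \<Sum>i\<in>UNIV. e E $ i * Z E \<omega> $ i) =
        (\<Sum>E\<in>I \<union> J. if E \<in> I then \<Sum>i\<in>UNIV. c E $ i * Z E \<omega> $ i else 0) +
        (\<Sum>E\<in>I \<union> J. if E \<in> J then \<Sum>i\<in>UNIV. d E $ i * Z E \<omega> $ i else 0)"
      unfolding sum.distrib[symmetric]
      by (intro sum.cong refl) (auto simp: e_def sum.distrib distrib_right)
    also have "(\<Sum>E\<in>I \<union> J. if E \<in> I then \<Sum>i\<in>UNIV. c E $ i * Z E \<omega> $ i else 0) = (\<Sum>E\<in>I. \<Sum>i\<in>UNIV. c E $ i * Z E \<omega> $ i)"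
      using I J by (subst sum.inter_restrict[symmetric]) (auto intro: sum.cong)
    also have "(\<Sum>E\<in>I \<union> J. if E \<in> J then \<Sum>i\<in>UNIV. d E $ i * Z E \<omega> $ i else 0) = (\<Sum>E\<in>J. \<Sum>i\<in>UNIV. d E $ i * Z E \<omega> $ i)"
      using I J by (subst sum.inter_restrict[symmetric]) (auto intro: sum.cong)
    finally show ?thesis .
  qed
  then show ?thesis
    unfolding real_Z_combination_def I(3) J(3) using I(1,2) J(1,2)
    by (intro exI[of _ "I \<union> J"] exI[of _ e]) simp
qed

lemma real_Z_combination_sum:
  assumes "\<And>a. a \<in> K \<Longrightarrow> real_Z_combination Z (X a)"
  shows "real_Z_combination Z (\<lambda>\<omega>. \<Sum>a\<in>K. X a \<omega>)"
  using assms
  by (induction K rule: infinite_finite_induct) (simp_all add: real_Z_combination_zero real_Z_combination_add)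

lemma real_Z_combination_atom:
  fixes Z :: "real set \<Rightarrow> 'q \<Rightarrow> complex^'n"
  assumes "E \<in> finite_borel"
  shows "real_Z_combination Z (\<lambda>\<omega>. Re (a * Z E \<omega> $ m))"
proof -
  have "(\<Sum>F\<in>{E}. \<Sum>i\<in>UNIV. (axis m a :: complex^'n) $ i * Z F \<omega> $ i) = a * Z E \<omega> $ m" for \<omega>
    by (simp add: axis_def if_distrib[of "\<lambda>t. t * _"] sum.delta cong: if_cong)
  then show ?thesis
    unfolding real_Z_combination_def using assms
    by (intro exI[of _ "{E}"] exI[of _ "\<lambda>_. axis m a"]) simp
qed

lemma real_Z_combination_simple:
  fixes Z :: "real set \<Rightarrow> 'q \<Rightarrow> complex^'n"
  assumes "\<forall>(E, M)\<in>set s. E \<in> finite_borel"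
  shows "real_Z_combination Z (\<lambda>\<omega>. c * Re (simple_spectral Z s \<omega> $ i))"
  using assms
proof (induction s)
  case Nil
  then show ?case by (simp add: simple_spectral_def real_Z_combination_zero)
next
  case (Cons p s)
  obtain E M where p: "p = (E, M)" by fastforce
  have E: "E \<in> finite_borel" using Cons.prems p by simp
  have IH: "real_Z_combination Z (\<lambda>\<omega>. c * Re (simple_spectral Z s \<omega> $ i))"
    using Cons by simp
  have "real_Z_combination Z (\<lambda>\<omega>. \<Sum>m\<in>UNIV. Re ((of_real c * M $ i $ m) * Z E \<omega> $ m))"
    by (intro real_Z_combination_sum real_Z_combination_atom E)
  from real_Z_combination_add[OF this IH]
  have "real_Z_combination Z (\<lambda>\<omega>. (\<Sum>m\<in>UNIV. Re ((of_real c * M $ i $ m) * Z E \<omega> $ m)) + c * Re (simple_spectral Z s \<omega> $ i))" .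
  moreover have "(\<Sum>m\<in>UNIV. Re ((of_real c * M $ i $ m) * Z E \<omega> $ m)) = c * Re ((M *v Z E \<omega>) $ i)" for \<omega>
    unfolding matrix_vector_mult_def vec_lambda_beta Re_sum sum_distrib_left
    by (intro sum.cong refl) (simp add: algebra_simps)
  moreover have "simple_spectral Z (p # s) \<omega> = M *v Z E \<omega> + simple_spectral Z s \<omega>" for \<omega>
    by (simp add: simple_spectral_def p)
  ultimately show ?case
    by (simp only: vector_add_component plus_complex.sel distrib_left)
qed

lemma real_Z_combination_gaussian:
  assumes "hermitian_gaussian_random_measure Q Z" "real_Z_combination Z X"
  shows "gaussian_rv Q X"
  using assms unfolding hermitian_gaussian_random_measure_def real_Z_combination_def
  by (blast intro: centered_gaussian_imp_gaussian_rv)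

section \<open>The isometry for spectral integrals\<close>

lemma vec_nth_measurable:
  fixes X :: "'a \<Rightarrow> ('v::euclidean_space)^'k"
  assumes "X \<in> borel_measurable M" shows "(\<lambda>\<omega>. X \<omega> $ i) \<in> borel_measurable M"
  by (rule measurable_compose[OF assms borel_measurable_continuous_onI])
     (rule bounded_linear.continuous_on[OF bounded_linear_vec_nth continuous_on_id])

lemma sqi_vec_nth:
  fixes X :: "'a \<Rightarrow> ('v::euclidean_space)^'k"
  assumes "square_integrable M X" shows "square_integrable M (\<lambda>\<omega>. X \<omega> $ i)"
  by (rule sqi_contraction[OF assms vec_nth_measurable[OF sqi_meas[OF assms]]])
     (rule Finite_Cartesian_Product.norm_nth_le)

lemma L2_dist_vec_nth_tendsto:
  fixes X :: "'a \<Rightarrow> ('v::euclidean_space)^'k"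
  assumes X: "square_integrable M X" and X': "\<And>k. square_integrable M (X' k)"
    and l: "(\<lambda>k. L2_dist M X (X' k)) \<longlonglongrightarrow> 0"
  shows "(\<lambda>k. L2_dist M (\<lambda>\<omega>. X \<omega> $ i) (\<lambda>\<omega>. X' k \<omega> $ i)) \<longlonglongrightarrow> 0"
proof (rule Lim_null_comparison[OF always_eventually l], rule allI)
  fix k
  have "L2_dist M (\<lambda>\<omega>. X \<omega> $ i) (\<lambda>\<omega>. X' k \<omega> $ i) \<le> L2_dist M X (X' k)"
    by (rule L2_dist_contraction[OF X X' sqi_vec_nth[OF X] sqi_vec_nth[OF X']])
       (simp only: vector_minus_component[symmetric] Finite_Cartesian_Product.norm_nth_le)
  then show "norm (L2_dist M (\<lambda>\<omega>. X \<omega> $ i) (\<lambda>\<omega>. X' k \<omega> $ i)) \<le> L2_dist M X (X' k)"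
    by (simp only: real_norm_def abs_of_nonneg[OF L2_dist_nonneg])
qed

lemma sqi_real:
  fixes X :: "'a \<Rightarrow> real"
  shows "square_integrable M X \<longleftrightarrow> X \<in> borel_measurable M \<and> integrable M (\<lambda>\<omega>. (X \<omega>)\<^sup>2)"
  by (simp only: square_integrable_def real_norm_def power2_abs)

lemma sqi_complex:
  fixes X :: "'a \<Rightarrow> complex"
  assumes R: "square_integrable M (\<lambda>\<omega>. Re (X \<omega>))" and I: "square_integrable M (\<lambda>\<omega>. Im (X \<omega>))"
  shows "square_integrable M X"
proof (rule sqi_bound)
  have "(\<lambda>\<omega>. complex_of_real (Re (X \<omega>)) + \<i> * complex_of_real (Im (X \<omega>))) \<in> borel_measurable M"
    using sqi_meas[OF R] sqi_meas[OF I] by measurable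
  then show "X \<in> borel_measurable M" by (simp only: complex_eq[symmetric])
  show "integrable M (\<lambda>\<omega>. (norm (Re (X \<omega>)))\<^sup>2 + (norm (Im (X \<omega>)))\<^sup>2)"
    by (intro Bochner_Integration.integrable_add sqi_norm R I)
qed (simp add: cmod_power2)

text \<open>The imaginary part is the real part after multiplication by -i, so the Gaussian property
  of real parts covers both.\<close>

lemma hermitian_measure_sqi:
  fixes Z :: "real set \<Rightarrow> 'q \<Rightarrow> complex^'n"
  assumes Z: "hermitian_gaussian_random_measure Q Z" and E: "E \<in> finite_borel"
  shows "square_integrable Q (\<lambda>\<omega>. Z E \<omega> $ m)"
proof (rule sqi_complex)
  have g: "gaussian_rv Q (\<lambda>\<omega>. Re (a * Z E \<omega> $ m))" for a
    by (rule real_Z_combination_gaussian[OF Z real_Z_combination_atom[OF E]])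
  show "square_integrable Q (\<lambda>\<omega>. Re (Z E \<omega> $ m))"
    using g[of 1] by (simp add: gaussian_rv_def)
  show "square_integrable Q (\<lambda>\<omega>. Im (Z E \<omega> $ m))"
    using g[of "- \<i>"] by (simp add: gaussian_rv_def)
qed

lemma sqi_complex_mult:
  fixes X :: "'a \<Rightarrow> complex"
  assumes X: "square_integrable M X" shows "square_integrable M (\<lambda>\<omega>. a * X \<omega>)"
proof (rule sqi_bound)
  show "(\<lambda>\<omega>. a * X \<omega>) \<in> borel_measurable M"
    by (intro borel_measurable_times borel_measurable_const sqi_meas X)
  show "integrable M (\<lambda>\<omega>. (norm a)\<^sup>2 * (norm (X \<omega>))\<^sup>2)"
    by (intro integrable_mult_right sqi_norm X)
qed (simp add: norm_mult power_mult_distrib)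

lemma atom_sqi:
  fixes Z :: "real set \<Rightarrow> 'q \<Rightarrow> complex^'n"
  assumes Z: "hermitian_gaussian_random_measure Q Z" and E: "E \<in> finite_borel"
  shows "square_integrable Q (\<lambda>\<omega>. (M *v Z E \<omega>) $ i)"
  unfolding matrix_vector_mult_def vec_lambda_beta
  by (intro sqi_sum sqi_complex_mult hermitian_measure_sqi[OF Z E])

lemma sqi_vec:
  fixes X :: "'a \<Rightarrow> complex^'k"
  assumes "\<And>i. square_integrable M (\<lambda>\<omega>. X \<omega> $ i)" shows "square_integrable M X"
proof (rule sqi_bound)
  have "\<forall>b\<in>Basis. (\<lambda>x. X x \<bullet> b) \<in> borel_measurable M"
  proof
    fix b :: "complex^'k" assume "b \<in> Basis"
    then obtain i u where "b = axis i u" by (auto simp: Basis_vec_def)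
    then have "(\<lambda>x. X x \<bullet> b) = (\<lambda>x. X x $ i \<bullet> u)" by (simp add: inner_axis)
    then show "(\<lambda>x. X x \<bullet> b) \<in> borel_measurable M"
      by (simp only: borel_measurable_inner[OF sqi_meas[OF assms] borel_measurable_const])
  qed
  then show "X \<in> borel_measurable M" by (rule borel_measurable_euclidean_space[THEN iffD2])
  show "integrable M (\<lambda>\<omega>. \<Sum>i\<in>UNIV. (norm (X \<omega> $ i))\<^sup>2)"
    by (intro Bochner_Integration.integrable_sum sqi_norm assms)
qed (simp add: norm_vec_def L2_set_def sum_nonneg)

lemma simple_spectral_sqi:
  fixes Z :: "real set \<Rightarrow> 'q \<Rightarrow> complex^'n"
  assumes Z: "hermitian_gaussian_random_measure Q Z" and s: "\<forall>(E, M)\<in>set s. E \<in> finite_borel"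
  shows "square_integrable Q (simple_spectral Z s)"
  unfolding simple_spectral_def
proof (rule sqi_sum_list)
  fix p assume p: "p \<in> set s"
  obtain E M where p': "p = (E, M)" by fastforce
  have "E \<in> finite_borel" using p p' s by auto
  then show "square_integrable Q (\<lambda>\<omega>. case p of (E, M) \<Rightarrow> M *v Z E \<omega>)"
    unfolding p' prod.case by (intro sqi_vec atom_sqi[OF Z])
qed

lemma indicator_sqi:
  fixes M :: "'v::euclidean_space"
  assumes "E \<in> finite_borel" shows "square_integrable lborel (\<lambda>x. indicator E x *\<^sub>R M)"
proof -
  have E: "E \<in> sets lborel" "emeasure lborel E < \<infinity>" using assms by (auto simp: finite_borel_def)
  have 1: "(\<lambda>x. indicator E x *\<^sub>R M) \<in> borel_measurable lborel"
    by (intro borel_measurable_scaleR borel_measurable_indicator borel_measurable_const E)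
  have "integrable lborel (\<lambda>x. indicator E x *\<^sub>R ((norm M)\<^sup>2))"
    using E by (intro integrable_indicator) auto
  moreover have "(norm (indicator E x *\<^sub>R M))\<^sup>2 = indicator E x *\<^sub>R ((norm M)\<^sup>2)" for x :: real
    by (auto simp: indicator_def)
  ultimately show ?thesis using 1 by (simp only: square_integrable_def simp_thms)
qed

lemma simple_kernel_sqi:
  assumes s: "\<forall>(E, M)\<in>set s. E \<in> finite_borel"
  shows "square_integrable lborel (simple_kernel s)"
  unfolding simple_kernel_def
proof (rule sqi_sum_list)
  fix p assume p: "p \<in> set s"
  obtain E M where p': "p = (E, M)" by fastforce
  have "E \<in> finite_borel" using p p' s by auto
  then show "square_integrable lborel (\<lambda>x. case p of (E, M) \<Rightarrow> indicator E x *\<^sub>R M)"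
    unfolding p' prod.case by (rule indicator_sqi)
qed

text \<open>Distinct components are uncorrelated, and equal ones contribute the measure of the
  intersection of E and F; what remains is the inner product of row i of M with row l of N. The
  inner product on complex vectors is the real one, the real part of the Hermitian product.\<close>

lemma isometry_atom:
  fixes Z :: "real set \<Rightarrow> 'q \<Rightarrow> complex^'n"
  assumes Z: "hermitian_gaussian_random_measure Q Z" and E: "E \<in> finite_borel" and F: "F \<in> finite_borel"
  shows "L2_inner Q (\<lambda>\<omega>. (M *v Z E \<omega>) $ i) (\<lambda>\<omega>. (N *v Z F \<omega>) $ l) =
    L2_inner lborel (\<lambda>x. (indicator E x *\<^sub>R M) $ i) (\<lambda>x. (indicator F x *\<^sub>R N) $ l)"
proof -
  note ZE = hermitian_measure_sqi[OF Z E] and ZF = hermitian_measure_sqi[OF Z F]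
  have pair: "L2_inner Q (\<lambda>\<omega>. a * Z E \<omega> $ m) (\<lambda>\<omega>. b * Z F \<omega> $ m') =
      (if m = m' then (a \<bullet> b) * measure lborel (E \<inter> F) else 0)" for a b m m'
  proof -
    have meas: "(\<lambda>\<omega>. Z E \<omega> $ m * cnj (Z F \<omega> $ m')) \<in> borel_measurable Q"
      by (intro borel_measurable_times sqi_meas[OF ZE] measurable_compose[OF sqi_meas[OF ZF]]
          borel_measurable_continuous_onI continuous_on_cnj continuous_on_id)
    have int: "integrable Q (\<lambda>\<omega>. Z E \<omega> $ m * cnj (Z F \<omega> $ m'))"
    proof (rule Bochner_Integration.integrable_bound[OF _ meas])
      show "integrable Q (\<lambda>\<omega>. (norm (Z E \<omega> $ m))\<^sup>2 + (norm (Z F \<omega> $ m'))\<^sup>2)"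
        by (intro Bochner_Integration.integrable_add sqi_norm ZE ZF)
      have "norm z * norm w \<le> (norm z)\<^sup>2 + (norm w)\<^sup>2" for z w :: complex
        using zero_le_power2[of "norm z - norm w"] mult_nonneg_nonneg[OF norm_ge_zero norm_ge_zero, of z w]
        unfolding power2_diff by linarith
      then show "AE \<omega> in Q. norm (Z E \<omega> $ m * cnj (Z F \<omega> $ m')) \<le> norm ((norm (Z E \<omega> $ m))\<^sup>2 + (norm (Z F \<omega> $ m'))\<^sup>2)"
        by (intro AE_I2) (simp add: norm_mult)
    qed
    have inn: "(a * z) \<bullet> (b * w) = Re ((a * cnj b) * (z * cnj w))" for z w
      by (simp add: inner_complex_def algebra_simps)
    have "L2_inner Q (\<lambda>\<omega>. a * Z E \<omega> $ m) (\<lambda>\<omega>. b * Z F \<omega> $ m') = Re (\<integral>\<omega>. (a * cnj b) * (Z E \<omega> $ m * cnj (Z F \<omega> $ m')) \<partial>Q)"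
      unfolding L2_inner_def inn by (rule integral_Re[OF integrable_mult_right[OF int]])
    also have "\<dots> = Re ((a * cnj b) * (if m = m' then complex_of_real (measure lborel (E \<inter> F)) else 0))"
      using Z E F unfolding hermitian_gaussian_random_measure_def by simp
    also have "\<dots> = (if m = m' then (a \<bullet> b) * measure lborel (E \<inter> F) else 0)"
      by (simp add: inner_complex_def)
    finally show ?thesis .
  qed
  have "L2_inner Q (\<lambda>\<omega>. (M *v Z E \<omega>) $ i) (\<lambda>\<omega>. (N *v Z F \<omega>) $ l) =
      (\<Sum>m\<in>UNIV. \<Sum>m'\<in>UNIV. L2_inner Q (\<lambda>\<omega>. M $ i $ m * Z E \<omega> $ m) (\<lambda>\<omega>. N $ l $ m' * Z F \<omega> $ m'))"
    unfolding matrix_vector_mult_def vec_lambda_beta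
    by (subst L2_inner_sum_left; (intro sqi_sum sqi_complex_mult ZE ZF)?)
       (intro sum.cong refl L2_inner_sum_right sqi_complex_mult ZE ZF)
  also have "\<dots> = (M $ i \<bullet> N $ l) * measure lborel (E \<inter> F)"
    unfolding pair by (simp add: sum.delta' inner_vec_def sum_distrib_right)
  also have "\<dots> = (\<integral>x. (M $ i \<bullet> N $ l) * indicator (E \<inter> F) x \<partial>lborel)"
    using E F by (simp add: finite_borel_def)
  also have "\<dots> = L2_inner lborel (\<lambda>x. (indicator E x *\<^sub>R M) $ i) (\<lambda>x. (indicator F x *\<^sub>R N) $ l)"
    unfolding L2_inner_def by (intro Bochner_Integration.integral_cong refl) (simp add: indicator_inter_arith)
  finally show ?thesis .
qed

lemma isometry_simple:
  fixes Z :: "real set \<Rightarrow> 'q \<Rightarrow> complex^'n"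
  assumes Z: "hermitian_gaussian_random_measure Q Z"
    and s: "\<forall>(E, M)\<in>set s. E \<in> finite_borel" and t: "\<forall>(E, M)\<in>set t. E \<in> finite_borel"
  shows "L2_inner Q (\<lambda>\<omega>. simple_spectral Z s \<omega> $ i) (\<lambda>\<omega>. simple_spectral Z t \<omega> $ l) =
    L2_inner lborel (\<lambda>x. simple_kernel s x $ i) (\<lambda>x. simple_kernel t x $ l)"
  using s
proof (induction s)
  case Nil
  then show ?case by (simp add: simple_spectral_def simple_kernel_def L2_inner_def)
next
  case (Cons p s)
  obtain E M where p: "p = (E, M)" by fastforce
  have E: "E \<in> finite_borel" and s: "\<forall>(E, M)\<in>set s. E \<in> finite_borel"
    using Cons.prems p by auto
  note q1 = atom_sqi[OF Z E, of M i] and q2 = sqi_vec_nth[OF indicator_sqi[OF E, of M], of i]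
  have atom: "L2_inner Q (\<lambda>\<omega>. (M *v Z E \<omega>) $ i) (\<lambda>\<omega>. simple_spectral Z t \<omega> $ l) =
      L2_inner lborel (\<lambda>x. (indicator E x *\<^sub>R M) $ i) (\<lambda>x. simple_kernel t x $ l)"
    using t
  proof (induction t)
    case Nil
    then show ?case by (simp add: simple_spectral_def simple_kernel_def L2_inner_def)
  next
    case (Cons r t)
    obtain F N where r: "r = (F, N)" by fastforce
    have F: "F \<in> finite_borel" and t: "\<forall>(E, M)\<in>set t. E \<in> finite_borel"
      using Cons.prems r by auto
    have "L2_inner Q (\<lambda>\<omega>. (M *v Z E \<omega>) $ i) (\<lambda>\<omega>. (N *v Z F \<omega>) $ l + simple_spectral Z t \<omega> $ l) =
      L2_inner lborel (\<lambda>x. (indicator E x *\<^sub>R M) $ i) (\<lambda>x. (indicator F x *\<^sub>R N) $ l + simple_kernel t x $ l)"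
      unfolding L2_inner_commute[of Q "\<lambda>\<omega>. (M *v Z E \<omega>) $ i"] L2_inner_commute[of lborel "\<lambda>x. (indicator E x *\<^sub>R M) $ i"]
        L2_inner_add_left[OF atom_sqi[OF Z F, of N l] sqi_vec_nth[OF simple_spectral_sqi[OF Z t], of l] q1]
        L2_inner_add_left[OF sqi_vec_nth[OF indicator_sqi[OF F, of N], of l] sqi_vec_nth[OF simple_kernel_sqi[OF t], of l] q2]
      using isometry_atom[OF Z E F, of M i N l] Cons.IH[OF t]
      by (simp only: L2_inner_commute)
    then show ?case
      by (simp add: r simple_spectral_def simple_kernel_def)
  qed
  have "L2_inner Q (\<lambda>\<omega>. (M *v Z E \<omega>) $ i + simple_spectral Z s \<omega> $ i) (\<lambda>\<omega>. simple_spectral Z t \<omega> $ l) =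
      L2_inner lborel (\<lambda>x. (indicator E x *\<^sub>R M) $ i + simple_kernel s x $ i) (\<lambda>x. simple_kernel t x $ l)"
    unfolding
      L2_inner_add_left[OF q1 sqi_vec_nth[OF simple_spectral_sqi[OF Z s], of i] sqi_vec_nth[OF simple_spectral_sqi[OF Z t], of l]]
      L2_inner_add_left[OF q2 sqi_vec_nth[OF simple_kernel_sqi[OF s], of i] sqi_vec_nth[OF simple_kernel_sqi[OF t], of l]]
    using atom Cons.IH[OF s] by (simp only:)
  then show ?case
    by (simp add: p simple_spectral_def simple_kernel_def)
qed

lemma spectral_integral_approx:
  assumes "spectral_integral Q Z f Y"
  obtains s where "\<And>k. \<forall>(E, M)\<in>set (s k). E \<in> finite_borel"
    "(\<lambda>k. L2_dist lborel f (simple_kernel (s k))) \<longlonglongrightarrow> 0"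
    "(\<lambda>k. L2_dist Q Y (simple_spectral Z (s k))) \<longlonglongrightarrow> 0"
proof -
  have e: "(\<lambda>x. \<Sum>(E, M)\<leftarrow>t. indicator E x *\<^sub>R M) = simple_kernel t"
    "(\<lambda>\<omega>. \<Sum>(E, M)\<leftarrow>t. M *v Z E \<omega>) = simple_spectral Z t" for t
    by (simp_all add: simple_kernel_def[abs_def] simple_spectral_def[abs_def])
  from assms[unfolded spectral_integral_def e] that show ?thesis by blast
qed

text \<open>Only the real inner product of rows is tracked, that is the real part of the complex
  covariance, which determines the covariances of a real process.\<close>

theorem spectral_isometry:
  fixes Z :: "real set \<Rightarrow> 'q \<Rightarrow> complex^'n"
  assumes Z: "hermitian_gaussian_random_measure Q Z"
    and f: "spectral_integral Q Z f X" and g: "spectral_integral Q Z g Y"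
  shows "L2_inner Q (\<lambda>\<omega>. X \<omega> $ i) (\<lambda>\<omega>. Y \<omega> $ l) = L2_inner lborel (\<lambda>x. f x $ i) (\<lambda>x. g x $ l)"
proof -
  have sq: "square_integrable lborel f" "square_integrable Q X" "square_integrable lborel g" "square_integrable Q Y"
    using f g by (simp_all add: spectral_integral_def)
  obtain s where s: "\<And>k. \<forall>(E, M)\<in>set (s k). E \<in> finite_borel"
    "(\<lambda>k. L2_dist lborel f (simple_kernel (s k))) \<longlonglongrightarrow> 0"
    "(\<lambda>k. L2_dist Q X (simple_spectral Z (s k))) \<longlonglongrightarrow> 0"
    using spectral_integral_approx[OF f] by blast
  obtain t where t: "\<And>k. \<forall>(E, M)\<in>set (t k). E \<in> finite_borel"
    "(\<lambda>k. L2_dist lborel g (simple_kernel (t k))) \<longlonglongrightarrow> 0"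
    "(\<lambda>k. L2_dist Q Y (simple_spectral Z (t k))) \<longlonglongrightarrow> 0"
    using spectral_integral_approx[OF g] by blast
  note ks = simple_kernel_sqi[OF s(1)] and kt = simple_kernel_sqi[OF t(1)]
    and zs = simple_spectral_sqi[OF Z s(1)] and zt = simple_spectral_sqi[OF Z t(1)]
  have 1: "(\<lambda>k. L2_inner Q (\<lambda>\<omega>. simple_spectral Z (s k) \<omega> $ i) (\<lambda>\<omega>. simple_spectral Z (t k) \<omega> $ l)) \<longlonglongrightarrow> L2_inner Q (\<lambda>\<omega>. X \<omega> $ i) (\<lambda>\<omega>. Y \<omega> $ l)"
    by (intro L2_inner_tendsto sqi_vec_nth sq zs zt L2_dist_vec_nth_tendsto s t)
  have 2: "(\<lambda>k. L2_inner lborel (\<lambda>\<omega>. simple_kernel (s k) \<omega> $ i) (\<lambda>\<omega>. simple_kernel (t k) \<omega> $ l)) \<longlonglongrightarrow> L2_inner lborel (\<lambda>\<omega>. f \<omega> $ i) (\<lambda>\<omega>. g \<omega> $ l)"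
    by (intro L2_inner_tendsto sqi_vec_nth sq ks kt L2_dist_vec_nth_tendsto s t)
  show ?thesis
    using LIMSEQ_unique[OF 1] 2 unfolding isometry_simple[OF Z s(1) t(1)] by blast
qed

section \<open>Gaussianity of spectral integrals\<close>

lemma L2_dist_zero_const: "(\<lambda>k :: nat. L2_dist M X X) \<longlonglongrightarrow> 0"
  by (simp add: L2_dist_def)

lemma L2_dist_sum_tendsto:
  fixes X :: "'i \<Rightarrow> 'a \<Rightarrow> 'v::euclidean_space"
  assumes "\<And>i. i \<in> I \<Longrightarrow> square_integrable M (X i)" "\<And>i k. i \<in> I \<Longrightarrow> square_integrable M (X' i k)"
    and "\<And>i. i \<in> I \<Longrightarrow> (\<lambda>k. L2_dist M (X i) (X' i k)) \<longlonglongrightarrow> 0"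
  shows "(\<lambda>k. L2_dist M (\<lambda>\<omega>. \<Sum>i\<in>I. X i \<omega>) (\<lambda>\<omega>. \<Sum>i\<in>I. X' i k \<omega>)) \<longlonglongrightarrow> 0"
  using assms
proof (induction I rule: infinite_finite_induct)
  case (insert i I)
  have "(\<lambda>k. L2_dist M (\<lambda>\<omega>. X i \<omega> + (\<Sum>i\<in>I. X i \<omega>)) (\<lambda>\<omega>. X' i k \<omega> + (\<Sum>i\<in>I. X' i k \<omega>))) \<longlonglongrightarrow> 0"
    by (intro L2_dist_add_tendsto sqi_sum insert.IH insert.prems insertI1 insertI2)
  then show ?case using insert.hyps by simp
qed (simp_all add: L2_dist_zero_const)

lemma L2_dist_scaleR_tendsto:
  assumes "(\<lambda>k. L2_dist M X (X' k)) \<longlonglongrightarrow> 0"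
  shows "(\<lambda>k. L2_dist M (\<lambda>\<omega>. c *\<^sub>R X \<omega>) (\<lambda>\<omega>. c *\<^sub>R X' k \<omega>)) \<longlonglongrightarrow> 0"
  unfolding L2_dist_scaleR using tendsto_mult[OF tendsto_const[of "\<bar>c\<bar>"] assms] by simp

lemma sqi_Re:
  assumes X: "square_integrable M X" shows "square_integrable M (\<lambda>\<omega>. Re (X \<omega>))"
proof (rule sqi_contraction[OF X])
  show "(\<lambda>\<omega>. Re (X \<omega>)) \<in> borel_measurable M" using sqi_meas[OF X] by measurable
qed (simp only: real_norm_def abs_Re_le_cmod)

lemma sqi_Im:
  assumes X: "square_integrable M X" shows "square_integrable M (\<lambda>\<omega>. Im (X \<omega>))"
proof (rule sqi_contraction[OF X])
  show "(\<lambda>\<omega>. Im (X \<omega>)) \<in> borel_measurable M" using sqi_meas[OF X] by measurable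
qed (simp only: real_norm_def abs_Im_le_cmod)

lemma L2_dist_Re_tendsto:
  assumes X: "square_integrable M X" and X': "\<And>k. square_integrable M (X' k)"
    and l: "(\<lambda>k. L2_dist M X (X' k)) \<longlonglongrightarrow> 0"
  shows "(\<lambda>k. L2_dist M (\<lambda>\<omega>. Re (X \<omega>)) (\<lambda>\<omega>. Re (X' k \<omega>))) \<longlonglongrightarrow> 0"
proof (rule Lim_null_comparison[OF always_eventually l], rule allI)
  fix k
  have "L2_dist M (\<lambda>\<omega>. Re (X \<omega>)) (\<lambda>\<omega>. Re (X' k \<omega>)) \<le> L2_dist M X (X' k)"
    by (rule L2_dist_contraction[OF X X' sqi_Re[OF X] sqi_Re[OF X']])
       (simp only: minus_complex.sel(1)[symmetric] real_norm_def abs_Re_le_cmod)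
  then show "norm (L2_dist M (\<lambda>\<omega>. Re (X \<omega>)) (\<lambda>\<omega>. Re (X' k \<omega>))) \<le> L2_dist M X (X' k)"
    by (simp only: real_norm_def abs_of_nonneg[OF L2_dist_nonneg])
qed

theorem spectral_integral_gaussian:
  fixes Z :: "real set \<Rightarrow> 'q \<Rightarrow> complex^'n" and c :: "real \<Rightarrow> 'n \<Rightarrow> real"
  assumes Z: "hermitian_gaussian_random_measure Q Z"
    and Y: "\<And>t. spectral_integral Q Z (f t) (Y t)"
  shows "gaussian_rv Q (\<lambda>\<omega>. \<Sum>t\<in>T. \<Sum>i\<in>UNIV. c t i *\<^sub>R Re (Y t \<omega> $ i))"
proof -
  have Q: "prob_space Q" using Z by (simp add: hermitian_gaussian_random_measure_def)
  have sq: "square_integrable Q (Y t)" for t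
    using Y by (simp add: spectral_integral_def)
  define R where "R t s \<longleftrightarrow> (\<forall>k. \<forall>(E, M)\<in>set (s k). E \<in> finite_borel) \<and>
      (\<lambda>k. L2_dist Q (Y t) (simple_spectral Z (s k))) \<longlonglongrightarrow> 0" for t and s :: "nat \<Rightarrow> _"
  have "\<forall>t. \<exists>s. R t s"
  proof
    fix t
    show "\<exists>s. R t s"
      by (rule spectral_integral_approx[OF Y[of t]]) (unfold R_def, intro exI conjI allI)
  qed
  then have "\<exists>s. \<forall>t. R t (s t)" by (rule choice)
  then obtain s where R: "\<forall>t. R t (s t)" by (rule exE)
  have s: "\<forall>(E, M)\<in>set (s t k). E \<in> finite_borel"
    "(\<lambda>k. L2_dist Q (Y t) (simple_spectral Z (s t k))) \<longlonglongrightarrow> 0" for t k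
    using R[rule_format, of t] unfolding R_def by (rule conjunct1[THEN spec], rule conjunct2)
  note zs = simple_spectral_sqi[OF Z s(1)]
  show ?thesis
  proof (rule gaussian_rv_limit[OF Q])
    show "square_integrable Q (\<lambda>\<omega>. \<Sum>t\<in>T. \<Sum>i\<in>UNIV. c t i *\<^sub>R Re (Y t \<omega> $ i))"
      by (intro sqi_sum sqi_scaleR sqi_Re sqi_vec_nth sq)
    show "gaussian_rv Q (\<lambda>\<omega>. \<Sum>t\<in>T. \<Sum>i\<in>UNIV. c t i *\<^sub>R Re (simple_spectral Z (s t k) \<omega> $ i))" for k
      unfolding real_scaleR_def
      by (intro real_Z_combination_gaussian[OF Z] real_Z_combination_sum real_Z_combination_simple s(1))
    show "(\<lambda>k. L2_dist Q (\<lambda>\<omega>. \<Sum>t\<in>T. \<Sum>i\<in>UNIV. c t i *\<^sub>R Re (Y t \<omega> $ i))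
        (\<lambda>\<omega>. \<Sum>t\<in>T. \<Sum>i\<in>UNIV. c t i *\<^sub>R Re (simple_spectral Z (s t k) \<omega> $ i))) \<longlonglongrightarrow> 0"
      by (intro L2_dist_sum_tendsto L2_dist_scaleR_tendsto L2_dist_Re_tendsto L2_dist_vec_nth_tendsto
          sqi_sum sqi_scaleR sqi_Re sqi_vec_nth sq zs s(2))
  qed
qed

section \<open>The covariance of the process\<close>

text \<open>By the choice of \<open>g\<close>, equality of laws becomes equality of covariances, of
  characteristic functions, or of integrability.\<close>

lemma fdd_transfer:
  fixes g :: "(real \<Rightarrow> 'v::topological_space) \<Rightarrow> 'b::{banach, second_countable_topology}"
  assumes s: "same_fdds P X Q Y" and T: "finite T" and g: "g \<in> borel_measurable (\<Pi>\<^sub>M t\<in>T. borel)"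
    and gX: "\<And>\<omega>. g (\<lambda>t\<in>T. X t \<omega>) = g1 \<omega>" and gY: "\<And>\<omega>. g (\<lambda>t\<in>T. Y t \<omega>) = g2 \<omega>"
  shows "(\<integral>\<omega>. g1 \<omega> \<partial>P) = (\<integral>\<omega>. g2 \<omega> \<partial>Q)" and "integrable P g1 \<longleftrightarrow> integrable Q g2"
proof -
  have X: "(\<lambda>\<omega>. \<lambda>t\<in>T. X t \<omega>) \<in> measurable P (\<Pi>\<^sub>M t\<in>T. borel)"
    and Y: "(\<lambda>\<omega>. \<lambda>t\<in>T. Y t \<omega>) \<in> measurable Q (\<Pi>\<^sub>M t\<in>T. borel)"
    using s unfolding same_fdds_def by (blast intro: measurable_restrict)+
  have d: "distr P (\<Pi>\<^sub>M t\<in>T. borel) (\<lambda>\<omega>. \<lambda>t\<in>T. X t \<omega>) = distr Q (\<Pi>\<^sub>M t\<in>T. borel) (\<lambda>\<omega>. \<lambda>t\<in>T. Y t \<omega>)"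
    using s T unfolding same_fdds_def by blast
  show "(\<integral>\<omega>. g1 \<omega> \<partial>P) = (\<integral>\<omega>. g2 \<omega> \<partial>Q)"
    using integral_distr[OF X g] integral_distr[OF Y g] unfolding d gX gY by (rule trans[OF sym])
  show "integrable P g1 \<longleftrightarrow> integrable Q g2"
    using integrable_distr_eq[OF X g] integrable_distr_eq[OF Y g] unfolding d gX gY by (rule trans[OF sym])
qed

lemma PiM_Re_component: "t \<in> T \<Longrightarrow> (\<lambda>y. Re (y t $ i)) \<in> borel_measurable (\<Pi>\<^sub>M t\<in>T. (borel :: (complex^'n) measure))"
  and PiM_Im_component: "t \<in> T \<Longrightarrow> (\<lambda>y. Im (y t $ i)) \<in> borel_measurable (\<Pi>\<^sub>M t\<in>T. (borel :: (complex^'n) measure))"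
proof -
  assume t: "t \<in> T"
  have 1: "(\<lambda>y. y t) \<in> borel_measurable (\<Pi>\<^sub>M t\<in>T. (borel :: (complex^'n) measure))"
    by (rule measurable_component_singleton[OF t])
  have 2: "(\<lambda>y. y t $ i) \<in> borel_measurable (\<Pi>\<^sub>M t\<in>T. (borel :: (complex^'n) measure))"
    by (rule vec_nth_measurable[OF 1])
  show "(\<lambda>y. Re (y t $ i)) \<in> borel_measurable (\<Pi>\<^sub>M t\<in>T. (borel :: (complex^'n) measure))"
    "(\<lambda>y. Im (y t $ i)) \<in> borel_measurable (\<Pi>\<^sub>M t\<in>T. (borel :: (complex^'n) measure))"
    using 2 by measurable
qed

text \<open>\<open>B\<close> is real, so equality of laws forces the imaginary parts of
  \<open>Y\<close> to have second moment 0. The isometry for \<open>Y\<close> therefore computes the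
  covariances of \<open>B\<close>, and Gaussianity transfers as an identity of expectations.\<close>

lemma ofbm_spectral:
  fixes B :: "real \<Rightarrow> 'a \<Rightarrow> real^'n"
  assumes B: "is_ofbm Q Z H A P B"
  shows ofbm_sqi: "square_integrable P (\<lambda>\<omega>. B t \<omega> $ i)"
    and ofbm_inner: "L2_inner P (\<lambda>\<omega>. B s \<omega> $ i) (\<lambda>\<omega>. B t \<omega> $ l) =
      L2_inner lborel (\<lambda>x. ofbm_kernel H A s x $ i) (\<lambda>x. ofbm_kernel H A t x $ l)"
    and ofbm_gaussian: "finite T \<Longrightarrow> gaussian_rv P (\<lambda>\<omega>. \<Sum>t\<in>T. \<Sum>i\<in>UNIV. c t i *\<^sub>R B t \<omega> $ i)"
    and ofbm_kernel_sqi: "square_integrable lborel (ofbm_kernel H A t)"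
proof -
  obtain Y where Z: "hermitian_gaussian_random_measure Q Z" and Bm: "\<And>t. B t \<in> borel_measurable P"
    and Y: "\<And>t. spectral_integral Q Z (ofbm_kernel H A t) (Y t)"
    and fdd: "same_fdds P (\<lambda>t \<omega>. cvec (B t \<omega>)) Q Y"
    using B unfolding is_ofbm_def by blast
  show "square_integrable lborel (ofbm_kernel H A t)"
    using Y[of t] by (simp only: spectral_integral_def)
  have Ysq: "square_integrable Q (Y t)" for t
    using Y[of t] by (simp only: spectral_integral_def)
  have Rsq: "square_integrable Q (\<lambda>\<omega>. Re (Y t \<omega> $ i))" and Isq: "square_integrable Q (\<lambda>\<omega>. Im (Y t \<omega> $ i))" for t i
    by (intro sqi_Re sqi_Im sqi_vec_nth Ysq)+
  have cvec: "Re (cvec v $ i) = v $ i" "Im (cvec v $ i) = 0" for v :: "real^'n" and i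
    by (simp_all add: cvec_def)
  have sq: "square_integrable P (\<lambda>\<omega>. B t \<omega> $ i)" for t i
  proof -
    have "integrable P (\<lambda>\<omega>. (B t \<omega> $ i)\<^sup>2) \<longleftrightarrow> integrable Q (\<lambda>\<omega>. (Re (Y t \<omega> $ i))\<^sup>2)"
      by (rule fdd_transfer(2)[OF fdd, of "{t}" "\<lambda>y. (Re (y t $ i))\<^sup>2"])
         (simp, intro borel_measurable_power PiM_Re_component, simp_all add: cvec)
    then show ?thesis
      using Rsq[of t i] vec_nth_measurable[OF Bm] by (simp only: sqi_real)
  qed
  then show "square_integrable P (\<lambda>\<omega>. B t \<omega> $ i)" .
  have covR: "L2_inner P (\<lambda>\<omega>. B s \<omega> $ i) (\<lambda>\<omega>. B t \<omega> $ l) = L2_inner Q (\<lambda>\<omega>. Re (Y s \<omega> $ i)) (\<lambda>\<omega>. Re (Y t \<omega> $ l))" for s t i l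
    unfolding L2_inner_def inner_real_def
    by (rule fdd_transfer(1)[OF fdd, of "{s, t}" "\<lambda>y. Re (y s $ i) * Re (y t $ l)"])
       (simp, intro borel_measurable_times PiM_Re_component, simp_all add: cvec)
  have covI: "L2_inner Q (\<lambda>\<omega>. Im (Y t \<omega> $ i)) (\<lambda>\<omega>. Im (Y t \<omega> $ i)) = 0" for t i
  proof -
    have "(\<integral>\<omega>. 0 * 0 \<partial>P) = (\<integral>\<omega>. Im (Y t \<omega> $ i) * Im (Y t \<omega> $ i) \<partial>Q)"
      by (rule fdd_transfer(1)[OF fdd, of "{t}" "\<lambda>y. Im (y t $ i) * Im (y t $ i)"])
         (simp, intro borel_measurable_times PiM_Im_component, simp_all add: cvec)
    then show ?thesis unfolding L2_inner_def inner_real_def by simp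
  qed
  have covI2: "L2_inner Q (\<lambda>\<omega>. Im (Y s \<omega> $ i)) (\<lambda>\<omega>. Im (Y t \<omega> $ l)) = 0"
    using L2_Cauchy_Schwarz[OF Isq Isq, of s i t l] unfolding covI by simp
  have "L2_inner Q (\<lambda>\<omega>. Y s \<omega> $ i) (\<lambda>\<omega>. Y t \<omega> $ l) =
      L2_inner Q (\<lambda>\<omega>. Re (Y s \<omega> $ i)) (\<lambda>\<omega>. Re (Y t \<omega> $ l)) + L2_inner Q (\<lambda>\<omega>. Im (Y s \<omega> $ i)) (\<lambda>\<omega>. Im (Y t \<omega> $ l))"
  proof -
    have "Y s \<omega> $ i \<bullet> Y t \<omega> $ l = Re (Y s \<omega> $ i) \<bullet> Re (Y t \<omega> $ l) + Im (Y s \<omega> $ i) \<bullet> Im (Y t \<omega> $ l)" for \<omega>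
      by (simp add: inner_complex_def)
    then show ?thesis
      unfolding L2_inner_def
      by (simp only: Bochner_Integration.integral_add[OF sqi_inner_integrable[OF Rsq Rsq] sqi_inner_integrable[OF Isq Isq]])
  qed
  then show "L2_inner P (\<lambda>\<omega>. B s \<omega> $ i) (\<lambda>\<omega>. B t \<omega> $ l) =
      L2_inner lborel (\<lambda>x. ofbm_kernel H A s x $ i) (\<lambda>x. ofbm_kernel H A t x $ l)"
    unfolding covI2 covR spectral_isometry[OF Z Y Y] by simp
  assume T: "finite T"
  define g where "g y = (\<Sum>t\<in>T. \<Sum>i\<in>UNIV. c t i *\<^sub>R Re (y t $ i))" for y :: "real \<Rightarrow> complex^'n"
  have g: "g \<in> borel_measurable (\<Pi>\<^sub>M t\<in>T. borel)"
    unfolding g_def by (intro borel_measurable_sum borel_measurable_scaleR borel_measurable_const PiM_Re_component)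
  have gX: "g (\<lambda>t\<in>T. cvec (B t \<omega>)) = (\<Sum>t\<in>T. \<Sum>i\<in>UNIV. c t i *\<^sub>R B t \<omega> $ i)" for \<omega>
    unfolding g_def by (intro sum.cong refl) (simp add: cvec)
  have gY: "g (\<lambda>t\<in>T. Y t \<omega>) = (\<Sum>t\<in>T. \<Sum>i\<in>UNIV. c t i *\<^sub>R Re (Y t \<omega> $ i))" for \<omega>
    unfolding g_def by (intro sum.cong refl) simp
  have gauss: "gaussian_rv Q (\<lambda>\<omega>. \<Sum>t\<in>T. \<Sum>i\<in>UNIV. c t i *\<^sub>R Re (Y t \<omega> $ i))"
    by (rule spectral_integral_gaussian[OF Z Y])
  have sqX: "square_integrable P (\<lambda>\<omega>. \<Sum>t\<in>T. \<Sum>i\<in>UNIV. c t i *\<^sub>R B t \<omega> $ i)"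
    by (intro sqi_sum sqi_scaleR sq)
  have 1: "(\<integral>\<omega>. iexp (\<Sum>t\<in>T. \<Sum>i\<in>UNIV. c t i *\<^sub>R B t \<omega> $ i) \<partial>P) =
      (\<integral>\<omega>. iexp (\<Sum>t\<in>T. \<Sum>i\<in>UNIV. c t i *\<^sub>R Re (Y t \<omega> $ i)) \<partial>Q)"
    by (rule fdd_transfer(1)[OF fdd T, of "\<lambda>y. iexp (g y)"], use g in measurable) (simp_all only: gX gY)
  have 2: "L2_inner P (\<lambda>\<omega>. \<Sum>t\<in>T. \<Sum>i\<in>UNIV. c t i *\<^sub>R B t \<omega> $ i) (\<lambda>\<omega>. \<Sum>t\<in>T. \<Sum>i\<in>UNIV. c t i *\<^sub>R B t \<omega> $ i) =
      L2_inner Q (\<lambda>\<omega>. \<Sum>t\<in>T. \<Sum>i\<in>UNIV. c t i *\<^sub>R Re (Y t \<omega> $ i)) (\<lambda>\<omega>. \<Sum>t\<in>T. \<Sum>i\<in>UNIV. c t i *\<^sub>R Re (Y t \<omega> $ i))"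
    unfolding L2_inner_def inner_real_def
    by (rule fdd_transfer(1)[OF fdd T, of "\<lambda>y. g y * g y"], use g in measurable) (simp_all only: gX gY)
  show "gaussian_rv P (\<lambda>\<omega>. \<Sum>t\<in>T. \<Sum>i\<in>UNIV. c t i *\<^sub>R B t \<omega> $ i)"
    unfolding gaussian_rv_def 1 2 using gauss sqX unfolding gaussian_rv_def by (intro conjI) simp_all
qed

text \<open>The spectral density \<open>\<bar>x\<bar>\<^sup>-\<^sup>D \<Re>(A A\<^sup>*) \<bar>x\<bar>\<^sup>-\<^sup>D\<^sup>*\<close> of the increments, without the factor \<open>1 / x\<^sup>2\<close>.\<close>

definition spectral_density :: "real^'n^'n \<Rightarrow> complex^'n^'n \<Rightarrow> real \<Rightarrow> real^'n^'n" where
  "spectral_density H A r = mat_powr r (- (H - (1/2) *\<^sub>R mat 1)) ** Re_mat (A ** adjoint_mat A) **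
     transpose (mat_powr r (- (H - (1/2) *\<^sub>R mat 1)))"

lemma Re_fourier_increments:
  assumes "x \<noteq> 0"
  shows "Re ((exp (\<i> * of_real (s * x)) - 1) / (\<i> * of_real x) * cnj ((exp (\<i> * of_real (t * x)) - 1) / (\<i> * of_real x))) =
    (cos ((s - t) * x) - cos (s * x) - cos (t * x) + 1) / x\<^sup>2"
proof -
  have "(exp (\<i> * of_real (s * x)) - 1) / (\<i> * of_real x) * cnj ((exp (\<i> * of_real (t * x)) - 1) / (\<i> * of_real x)) =
      (cis (s * x) - 1) * (cis (- (t * x)) - 1) / of_real (x\<^sup>2)"
  proof -
    have "\<i> * of_real x * cnj (\<i> * of_real x) = of_real (x\<^sup>2)"
      by (simp add: complex_eq_iff power2_eq_square)
    then show ?thesis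
      unfolding cis_conv_exp[symmetric] complex_cnj_divide times_divide_times_eq
      by (simp add: cis_cnj del: of_real_power)
  qed
  also have "(cis (s * x) - 1) * (cis (- (t * x)) - 1) = cis ((s - t) * x) - cis (s * x) - cis (- (t * x)) + 1"
    by (simp add: algebra_simps cis_mult)
  finally show ?thesis
    by (simp add: Re_divide_of_real del: of_real_power)
qed

text \<open>For x > 0 the kernel carries \<open>A\<close>, for x < 0 its conjugate. Their Gram
  matrices are conjugate to each other and, by time reversibility, equal and real, so one even
  density serves both half-lines.\<close>

lemma ofbm_kernel_inner:
  fixes H :: "real^'n^'n"
  assumes A: "Im_mat (A ** adjoint_mat A) = 0"
  shows "ofbm_kernel H A s x $ i \<bullet> ofbm_kernel H A t x $ l =
    (cos ((s - t) * x) - cos (s * x) - cos (t * x) + 1) / x\<^sup>2 * spectral_density H A \<bar>x\<bar> $ i $ l"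
\<comment> \<open>At x = 0 both sides are 0, since division by 0 gives 0.\<close>
proof (cases "x = 0")
  case True
  then show ?thesis by (simp add: ofbm_kernel_def inner_vec_def)
next
  case False
  define p where "p = mat_powr \<bar>x\<bar> (- (H - (1/2) *\<^sub>R mat 1))"
  define \<kappa> where "\<kappa> t = (exp (\<i> * of_real (t * x)) - 1) / (\<i> * of_real x)" for t
  define A' where "A' = (if x > 0 then A else cnj_mat A)"
  have z: "mat_powr (max x 0) M = (if x > 0 then mat_powr \<bar>x\<bar> M else 0)"
    "mat_powr (max (- x) 0) M = (if x > 0 then 0 else mat_powr \<bar>x\<bar> M)" for M :: "real^'n^'n"
    using False by (auto simp: mat_powr_def)
  have c0: "cmat (0 :: real^'n^'n) ** W = 0" for W :: "complex^'n^'n"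
    by (simp add: cmat_def matrix_matrix_mult_def vec_eq_iff)
  have ker: "ofbm_kernel H A t x $ i $ m = \<kappa> t * (\<Sum>k\<in>UNIV. of_real (p $ i $ k) * A' $ k $ m)" for t i m
    unfolding ofbm_kernel_def Let_def z p_def[symmetric]
    by (auto simp: c0 \<kappa>_def A'_def matrix_matrix_mult_def cmat_def)
  have AA: "(\<Sum>m\<in>UNIV. A $ k $ m * cnj (A $ k' $ m)) = of_real (Re_mat (A ** adjoint_mat A) $ k $ k')" for k k'
  proof -
    have e: "(A ** adjoint_mat A) $ k $ k' = (\<Sum>m\<in>UNIV. A $ k $ m * cnj (A $ k' $ m))"
      by (simp add: matrix_matrix_mult_def adjoint_mat_def transpose_def cnj_mat_def)
    have "Im ((A ** adjoint_mat A) $ k $ k') = 0"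
      using arg_cong[OF A, of "\<lambda>M. M $ k $ k'"] by (simp add: Im_mat_def)
    then show ?thesis
      unfolding e[symmetric] by (simp add: complex_eq_iff Re_mat_def)
  qed
  have AA': "(\<Sum>m\<in>UNIV. A' $ k $ m * cnj (A' $ k' $ m)) = of_real (Re_mat (A ** adjoint_mat A) $ k $ k')" for k k'
  proof (cases "x > 0")
    case False
    have "(\<Sum>m\<in>UNIV. A' $ k $ m * cnj (A' $ k' $ m)) = cnj (\<Sum>m\<in>UNIV. A $ k $ m * cnj (A $ k' $ m))"
      using False by (simp add: A'_def cnj_mat_def)
    then show ?thesis unfolding AA by simp
  qed (simp add: A'_def AA)
  have "(\<Sum>m\<in>UNIV. (\<Sum>k\<in>UNIV. of_real (p $ i $ k) * A' $ k $ m) * cnj (\<Sum>k\<in>UNIV. of_real (p $ l $ k) * A' $ k $ m)) =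
      (\<Sum>m\<in>UNIV. \<Sum>k\<in>UNIV. \<Sum>k'\<in>UNIV. of_real (p $ i $ k) * of_real (p $ l $ k') * (A' $ k $ m * cnj (A' $ k' $ m)))"
    by (simp add: sum_product mult_ac)
  also have "\<dots> = (\<Sum>k\<in>UNIV. \<Sum>m\<in>UNIV. \<Sum>k'\<in>UNIV. of_real (p $ i $ k) * of_real (p $ l $ k') * (A' $ k $ m * cnj (A' $ k' $ m)))"
    by (rule sum.swap)
  also have "\<dots> = (\<Sum>k\<in>UNIV. \<Sum>k'\<in>UNIV. \<Sum>m\<in>UNIV. of_real (p $ i $ k) * of_real (p $ l $ k') * (A' $ k $ m * cnj (A' $ k' $ m)))"
    by (intro sum.cong refl sum.swap)
  also have "\<dots> = (\<Sum>k\<in>UNIV. \<Sum>k'\<in>UNIV. of_real (p $ i $ k * p $ l $ k' * Re_mat (A ** adjoint_mat A) $ k $ k'))"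
    by (intro sum.cong refl) (simp add: sum_distrib_left[symmetric] AA')
  also have "\<dots> = of_real (spectral_density H A \<bar>x\<bar> $ i $ l)"
    unfolding spectral_density_def p_def[symmetric]
    by (simp add: matrix_mult_entry transpose_def sum_distrib_left sum_distrib_right mult_ac) (rule sum.swap)
  finally have R: "(\<Sum>m\<in>UNIV. (\<Sum>k\<in>UNIV. of_real (p $ i $ k) * A' $ k $ m) * cnj (\<Sum>k\<in>UNIV. of_real (p $ l $ k) * A' $ k $ m)) =
      of_real (spectral_density H A \<bar>x\<bar> $ i $ l)" .
  have inn: "z \<bullet> w = Re (z * cnj w)" for z w :: complex
    by (simp add: inner_complex_def)
  have "ofbm_kernel H A s x $ i \<bullet> ofbm_kernel H A t x $ l =
      Re (\<Sum>m\<in>UNIV. (\<kappa> s * cnj (\<kappa> t)) * ((\<Sum>k\<in>UNIV. of_real (p $ i $ k) * A' $ k $ m) * cnj (\<Sum>k\<in>UNIV. of_real (p $ l $ k) * A' $ k $ m)))"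
    unfolding inner_vec_def ker inn Re_sum complex_cnj_mult by (simp only: mult_ac)
  also have "\<dots> = Re ((\<kappa> s * cnj (\<kappa> t)) * of_real (spectral_density H A \<bar>x\<bar> $ i $ l))"
    unfolding sum_distrib_left[symmetric] R ..
  also have "\<dots> = Re (\<kappa> s * cnj (\<kappa> t)) * spectral_density H A \<bar>x\<bar> $ i $ l"
    by simp
  finally show ?thesis
    unfolding \<kappa>_def Re_fourier_increments[OF False] .
qed

section \<open>Self-similarity and the covariance of the process\<close>

definition variance_mat :: "real^'n^'n \<Rightarrow> real^'n^'n \<Rightarrow> real \<Rightarrow> real^'n^'n" where
  "variance_mat H S t = mat_powr \<bar>t\<bar> H ** S ** mat_powr \<bar>t\<bar> (transpose H)"

lemma triple_product_entry:
  fixes h S :: "real^'n^'n"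
  shows "(h ** S ** transpose h) $ i $ l = (\<Sum>a\<in>UNIV. \<Sum>b\<in>UNIV. h $ i $ a * S $ a $ b * h $ l $ b)"
  by (simp add: matrix_mult_entry transpose_def sum_distrib_right) (rule sum.swap)

lemma variance_mat_entry:
  "variance_mat H S t $ i $ l = (\<Sum>a\<in>UNIV. \<Sum>b\<in>UNIV. mat_powr \<bar>t\<bar> H $ i $ a * S $ a $ b * mat_powr \<bar>t\<bar> H $ l $ b)"
  unfolding variance_mat_def mat_powr_transpose by (rule triple_product_entry)

lemma variance_mat_zero: "variance_mat H S 0 = 0"
  by (simp add: vec_eq_iff variance_mat_entry mat_powr_def)

lemma variance_mat_minus: "variance_mat H S (- t) = variance_mat H S t"
  by (simp add: variance_mat_def)

text \<open>With D = H - I/2 one has t^D = t^(-1/2) t^H, and the two outer factors together give 1 /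
  t. This is operator self-similarity in spectral form.\<close>

lemma spectral_density_scale:
  fixes H :: "real^'n^'n"
  assumes "t > 0" "r > 0"
  shows "spectral_density H A (r / t) = (1 / t) *\<^sub>R (mat_powr t H ** spectral_density H A r ** transpose (mat_powr t H))"
proof -
  define D where "D = H - (1/2) *\<^sub>R mat 1"
  have D: "D = H + (- 1/2) *\<^sub>R mat 1" by (simp add: D_def)
  have "mat_powr (r / t) (- D) = mat_powr (1 / t) (- D) ** mat_powr r (- D)"
    using mat_powr_mult[of "1 / t" r "- D"] assms by simp
  also have "mat_powr (1 / t) (- D) = mat_powr t D"
    using mat_powr_minus[of "1 / t" D] assms by simp
  also have "mat_powr t D = (t powr (- 1/2)) *\<^sub>R mat_powr t H"
    unfolding D by (rule mat_powr_shift[OF assms(1)])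
  finally have p: "mat_powr (r / t) (- D) = (t powr (- 1/2)) *\<^sub>R (mat_powr t H ** mat_powr r (- D))"
    by (simp only: scaleR_matrix_mult)
  have tt: "t powr (- 1/2) * t powr (- 1/2) = 1 / t"
    using assms by (simp add: powr_add[symmetric] powr_minus_divide)
  have tr: "transpose (c *\<^sub>R M) = c *\<^sub>R transpose M" for c and M :: "real^'n^'n"
    by (simp add: transpose_def vec_eq_iff)
  show ?thesis
    unfolding spectral_density_def D_def[symmetric] p tr scaleR_matrix_mult matrix_mult_scaleR scaleR_scaleR tt
      matrix_transpose_mul matrix_mul_assoc ..
qed

text \<open>The factor 2 (1 - cos (t x)) is the squared modulus of e^(itx) - 1, so this is the
  spectral form of the second moments of B(t).\<close>

definition spectral_variance :: "real^'n^'n \<Rightarrow> complex^'n^'n \<Rightarrow> real \<Rightarrow> 'n \<Rightarrow> 'n \<Rightarrow> real" where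
  "spectral_variance H A t i l = (\<integral>x. 2 * (1 - cos (t * x)) / x\<^sup>2 * spectral_density H A \<bar>x\<bar> $ i $ l \<partial>lborel)"

context
  fixes P :: "'a measure" and Q :: "'q measure" and Z :: "real set \<Rightarrow> 'q \<Rightarrow> complex^'n"
    and H :: "real^'n^'n" and A :: "complex^'n^'n" and B :: "real \<Rightarrow> 'a \<Rightarrow> real^'n"
  assumes B: "is_ofbm Q Z H A P B" and rev: "Im_mat (A ** adjoint_mat A) = 0"
begin

lemma spectral_variance_integrable:
  "integrable lborel (\<lambda>x. 2 * (1 - cos (t * x)) / x\<^sup>2 * spectral_density H A \<bar>x\<bar> $ i $ l)"
proof -
  have "integrable lborel (\<lambda>x. ofbm_kernel H A t x $ i \<bullet> ofbm_kernel H A t x $ l)"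
    by (intro sqi_inner_integrable sqi_vec_nth ofbm_kernel_sqi[OF B])
  then show ?thesis
    unfolding ofbm_kernel_inner[OF rev] by (simp add: algebra_simps)
qed

text \<open>Polarisation: cos ((s - t) x) - cos (s x) - cos (t x) + 1 is a combination of the terms
  1 - cos at s, t and s - t. The last of these expresses stationarity of the increments.\<close>

lemma ofbm_covariance_spectral:
  "L2_inner P (\<lambda>\<omega>. B s \<omega> $ i) (\<lambda>\<omega>. B t \<omega> $ l) =
    (spectral_variance H A s i l + spectral_variance H A t i l - spectral_variance H A (s - t) i l) / 2"
proof -
  define f where "f t x = 2 * (1 - cos (t * x)) / x\<^sup>2 * spectral_density H A \<bar>x\<bar> $ i $ l" for t x
  have f: "integrable lborel (f t)" for t
    unfolding f_def by (rule spectral_variance_integrable)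
  have e: "(cos ((s - t) * x) - cos (s * x) - cos (t * x) + 1) / x\<^sup>2 * spectral_density H A \<bar>x\<bar> $ i $ l =
      (1 / 2) * (f s x + f t x - f (s - t) x)" for x
    unfolding f_def by (simp add: add_divide_distrib diff_divide_distrib algebra_simps)
  have "L2_inner P (\<lambda>\<omega>. B s \<omega> $ i) (\<lambda>\<omega>. B t \<omega> $ l) = (\<integral>x. (1 / 2) * (f s x + f t x - f (s - t) x) \<partial>lborel)"
    unfolding ofbm_inner[OF B] unfolding L2_inner_def ofbm_kernel_inner[OF rev] e ..
  also have "\<dots> = (1 / 2) * ((\<integral>x. f s x \<partial>lborel) + (\<integral>x. f t x \<partial>lborel) - (\<integral>x. f (s - t) x \<partial>lborel))"
    using f by simp
  finally show ?thesis unfolding f_def spectral_variance_def by simp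
qed

lemma spectral_variance_zero: "spectral_variance H A 0 i l = 0"
  by (simp add: spectral_variance_def)

lemma spectral_variance_one: "spectral_variance H A 1 i l = second_moment P (B 1) $ i $ l"
  using ofbm_covariance_spectral[of 1 i 1 l]
  by (simp add: spectral_variance_zero second_moment_def L2_inner_def)

text \<open>The substitution of x / |t| for x brings the integral to time 1, where it is Sigma, and
  the scaling of the density supplies the two factors |t|^H.\<close>

lemma spectral_variance_eq: "spectral_variance H A t i l = variance_mat H (second_moment P (B 1)) t $ i $ l"
proof (cases "t = 0")
  case True
  then show ?thesis by (simp add: spectral_variance_zero variance_mat_zero)
next
  case False
  define u where "u = \<bar>t\<bar>"
  have u: "u > 0" using False by (simp add: u_def)
  define h where "h = mat_powr u H"
  define f where "f a b x = 2 * (1 - cos x) / x\<^sup>2 * spectral_density H A \<bar>x\<bar> $ a $ b" for a b x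
  have f: "integrable lborel (f a b)" for a b
    unfolding f_def using spectral_variance_integrable[of 1 a b] by simp
  have "spectral_variance H A t i l = spectral_variance H A u i l"
    unfolding spectral_variance_def u_def by (cases "t \<ge> 0") simp_all
  also have "\<dots> = (1 / u) * (\<integral>x. 2 * (1 - cos (u * (0 + (1 / u) * x))) / (0 + (1 / u) * x)\<^sup>2 * spectral_density H A \<bar>0 + (1 / u) * x\<bar> $ i $ l \<partial>lborel)"
    unfolding spectral_variance_def using u
    by (subst lborel_integral_real_affine[of "1 / u" _ 0]) simp_all
  also have "\<dots> = (1 / u) * (\<integral>x. u * (\<Sum>a\<in>UNIV. \<Sum>b\<in>UNIV. h $ i $ a * f a b x * h $ l $ b) \<partial>lborel)"
  proof (intro arg_cong[of _ _ "\<lambda>I. (1 / u) * I"] Bochner_Integration.integral_cong refl)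
    fix x :: real
    show "2 * (1 - cos (u * (0 + (1 / u) * x))) / (0 + (1 / u) * x)\<^sup>2 * spectral_density H A \<bar>0 + (1 / u) * x\<bar> $ i $ l =
        u * (\<Sum>a\<in>UNIV. \<Sum>b\<in>UNIV. h $ i $ a * f a b x * h $ l $ b)"
    proof (cases "x = 0")
      case True
      then show ?thesis by (simp add: f_def)
    next
      case False
      have a: "\<bar>0 + (1 / u) * x\<bar> = \<bar>x\<bar> / u" using u by (simp add: abs_mult)
      have b: "u * (0 + (1 / u) * x) = x" "(0 + (1 / u) * x)\<^sup>2 = x\<^sup>2 / u\<^sup>2"
        using u by (simp_all add: power_divide)
      have sd: "spectral_density H A (\<bar>x\<bar> / u) $ i $ l = (1 / u) * (\<Sum>a\<in>UNIV. \<Sum>b\<in>UNIV. h $ i $ a * spectral_density H A \<bar>x\<bar> $ a $ b * h $ l $ b)"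
        using spectral_density_scale[OF u, of "\<bar>x\<bar>" H A] False
        by (simp add: h_def triple_product_entry)
      have "(\<Sum>a\<in>UNIV. \<Sum>b\<in>UNIV. h $ i $ a * f a b x * h $ l $ b) = 2 * (1 - cos x) / x\<^sup>2 * (\<Sum>a\<in>UNIV. \<Sum>b\<in>UNIV. h $ i $ a * spectral_density H A \<bar>x\<bar> $ a $ b * h $ l $ b)"
        unfolding f_def sum_distrib_left by (intro sum.cong refl) (simp only: mult_ac)
      then show ?thesis
        unfolding a b sd using u by (simp add: power2_eq_square)
    qed
  qed
  also have "\<dots> = (\<integral>x. (\<Sum>a\<in>UNIV. \<Sum>b\<in>UNIV. h $ i $ a * f a b x * h $ l $ b) \<partial>lborel)"
    using u by simp
  also have "\<dots> = (\<Sum>a\<in>UNIV. \<Sum>b\<in>UNIV. h $ i $ a * (\<integral>x. f a b x \<partial>lborel) * h $ l $ b)"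
    using f by (simp add: Bochner_Integration.integral_sum)
  also have "\<dots> = variance_mat H (second_moment P (B 1)) t $ i $ l"
    unfolding variance_mat_entry spectral_variance_one[symmetric] spectral_variance_def f_def h_def u_def by simp
  finally show ?thesis .
qed

theorem ofbm_covariance:
  "L2_inner P (\<lambda>\<omega>. B s \<omega> $ i) (\<lambda>\<omega>. B t \<omega> $ l) =
    (variance_mat H (second_moment P (B 1)) s $ i $ l + variance_mat H (second_moment P (B 1)) t $ i $ l
      - variance_mat H (second_moment P (B 1)) (s - t) $ i $ l) / 2"
  unfolding ofbm_covariance_spectral spectral_variance_eq ..

end

section \<open>Positive definiteness of Sigma\<close>

lemma gram_entry: "Re_mat (A ** adjoint_mat A) $ i $ j = (\<Sum>m\<in>UNIV. Re (A $ i $ m * cnj (A $ j $ m)))"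
  by (simp add: Re_mat_def matrix_matrix_mult_def adjoint_mat_def transpose_def cnj_mat_def)

text \<open>Reads the form as the squared norm of the complex vector v^T A, which shows that it is
  semidefinite and identifies its null vectors.\<close>

lemma gram_form:
  fixes A :: "complex^'n^'n" and v :: "real^'n"
  shows "v \<bullet> (Re_mat (A ** adjoint_mat A) *v v) = (\<Sum>m\<in>UNIV. (cmod (\<Sum>i\<in>UNIV. of_real (v $ i) * A $ i $ m))\<^sup>2)"
proof -
  have "v \<bullet> (Re_mat (A ** adjoint_mat A) *v v) = (\<Sum>i\<in>UNIV. \<Sum>j\<in>UNIV. \<Sum>m\<in>UNIV. v $ i * Re (A $ i $ m * cnj (A $ j $ m)) * v $ j)"
    unfolding quadratic_form_sum gram_entry by (simp add: sum_distrib_left sum_distrib_right)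
  also have "\<dots> = (\<Sum>i\<in>UNIV. \<Sum>m\<in>UNIV. \<Sum>j\<in>UNIV. v $ i * Re (A $ i $ m * cnj (A $ j $ m)) * v $ j)"
    by (intro sum.cong refl sum.swap)
  also have "\<dots> = (\<Sum>m\<in>UNIV. \<Sum>i\<in>UNIV. \<Sum>j\<in>UNIV. v $ i * Re (A $ i $ m * cnj (A $ j $ m)) * v $ j)"
    by (rule sum.swap)
  also have "\<dots> = (\<Sum>m\<in>UNIV. (cmod (\<Sum>i\<in>UNIV. of_real (v $ i) * A $ i $ m))\<^sup>2)"
  proof (intro sum.cong refl)
    fix m
    define w where "w = (\<Sum>i\<in>UNIV. of_real (v $ i) * A $ i $ m)"
    have "(cmod w)\<^sup>2 = Re (w * cnj w)"
      by (simp add: complex_norm_square[symmetric] del: complex_mult_cnj)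
    also have "w * cnj w = (\<Sum>i\<in>UNIV. \<Sum>j\<in>UNIV. of_real (v $ i) * A $ i $ m * (of_real (v $ j) * cnj (A $ j $ m)))"
      unfolding w_def by (simp add: sum_product)
    finally show "(\<Sum>i\<in>UNIV. \<Sum>j\<in>UNIV. v $ i * Re (A $ i $ m * cnj (A $ j $ m)) * v $ j) = (cmod w)\<^sup>2"
      by (simp add: algebra_simps)
  qed
  finally show ?thesis .
qed

text \<open>A vanishing form means v^T A = 0, and then the matrix sends v to 0, against full
  rank.\<close>

lemma gram_positive:
  fixes A :: "complex^'n^'n" and v :: "real^'n"
  assumes rank: "rank (Re_mat (A ** adjoint_mat A)) = CARD('n)" and v: "v \<noteq> 0"
  shows "v \<bullet> (Re_mat (A ** adjoint_mat A) *v v) > 0"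
proof (rule ccontr)
  let ?C = "Re_mat (A ** adjoint_mat A)"
  assume "\<not> v \<bullet> (?C *v v) > 0"
  then have "(\<Sum>m\<in>UNIV. (cmod (\<Sum>i\<in>UNIV. of_real (v $ i) * A $ i $ m))\<^sup>2) = 0"
    unfolding gram_form by (intro antisym sum_nonneg) auto
  then have z: "(\<Sum>i\<in>UNIV. of_real (v $ i) * A $ i $ m) = 0" for m
    by (subst (asm) sum_nonneg_eq_0_iff) auto
  have "(?C *v v) $ i = 0" for i
  proof -
    have "(?C *v v) $ i = (\<Sum>j\<in>UNIV. \<Sum>m\<in>UNIV. Re (A $ i $ m * cnj (of_real (v $ j) * A $ j $ m)))"
      unfolding matrix_vector_mult_def vec_lambda_beta gram_entry sum_distrib_right
      by (intro sum.cong refl) (simp add: algebra_simps)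
    also have "\<dots> = (\<Sum>m\<in>UNIV. \<Sum>j\<in>UNIV. Re (A $ i $ m * cnj (of_real (v $ j) * A $ j $ m)))"
      by (rule sum.swap)
    also have "\<dots> = (\<Sum>m\<in>UNIV. Re (A $ i $ m * cnj (\<Sum>j\<in>UNIV. of_real (v $ j) * A $ j $ m)))"
      by (simp add: sum_distrib_left)
    finally show ?thesis unfolding z by simp
  qed
  then have eq: "?C *v v = ?C *v 0" by (simp add: vec_eq_iff)
  have inj: "inj ((*v) ?C)" using rank by (simp only: full_rank_injective)
  show False using injD[OF inj eq] v by contradiction
qed

lemma spectral_density_positive:
  fixes H :: "real^'n^'n"
  assumes rank: "rank (Re_mat (A ** adjoint_mat A)) = CARD('n)" and u: "u \<noteq> 0" and r: "r > 0"
  shows "u \<bullet> (spectral_density H A r *v u) > 0"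
proof -
  define p where "p = mat_powr r (- (H - (1/2) *\<^sub>R mat 1))"
  have "transpose p *v u \<noteq> 0"
  proof
    assume "transpose p *v u = 0"
    then have "transpose (mat_powr (1 / r) (- (H - (1/2) *\<^sub>R mat 1))) *v (transpose p *v u) = 0" by simp
    then have "transpose (p ** mat_powr (1 / r) (- (H - (1/2) *\<^sub>R mat 1))) *v u = 0"
      by (simp only: matrix_vector_mul_assoc matrix_transpose_mul)
    then show False
      unfolding p_def mat_powr_inverse[OF r] using u by (simp add: transpose_mat)
  qed
  from gram_positive[OF rank this] show ?thesis
    unfolding spectral_density_def p_def[symmetric]
    by (simp add: matrix_vector_mul_assoc[symmetric] transpose_matrix_vector dot_lmul_matrix)
qed

text \<open>The quadratic form of Sigma is an integral of a nonnegative function that is strictly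
  positive on (1, 2), where cos x < 1.\<close>

theorem ofbm_variance_positive:
  fixes B :: "real \<Rightarrow> 'a \<Rightarrow> real^'n"
  assumes B: "is_ofbm Q Z H A P B" and rev: "Im_mat (A ** adjoint_mat A) = 0"
    and rank: "rank (Re_mat (A ** adjoint_mat A)) = CARD('n)" and u: "u \<noteq> 0"
  shows "u \<bullet> (second_moment P (B 1) *v u) > 0"
proof -
  define h where "h x = 2 * (1 - cos x) / x\<^sup>2 * (u \<bullet> (spectral_density H A \<bar>x\<bar> *v u))" for x
  define k where "k i l x = 2 * (1 - cos (1 * x)) / x\<^sup>2 * spectral_density H A \<bar>x\<bar> $ i $ l" for i l x
  have h_sum: "h x = (\<Sum>i\<in>UNIV. \<Sum>l\<in>UNIV. u $ i * k i l x * u $ l)" for x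
    unfolding h_def k_def quadratic_form_sum sum_distrib_left by (intro sum.cong refl) simp
  have k: "integrable lborel (k i l)" for i l
    unfolding k_def by (rule spectral_variance_integrable[OF B rev])
  have hi: "integrable lborel h"
    unfolding h_sum
    by (intro Bochner_Integration.integrable_sum integrable_mult_left integrable_mult_right k)
  have "(\<integral>x. h x \<partial>lborel) = (\<Sum>i\<in>UNIV. \<Sum>l\<in>UNIV. u $ i * (\<integral>x. k i l x \<partial>lborel) * u $ l)"
    unfolding h_sum using k by (simp add: Bochner_Integration.integral_sum)
  then have "(\<integral>x. h x \<partial>lborel) = (\<Sum>i\<in>UNIV. \<Sum>l\<in>UNIV. u $ i * spectral_variance H A 1 i l * u $ l)"
    unfolding k_def spectral_variance_def .
  then have hI: "(\<integral>x. h x \<partial>lborel) = u \<bullet> (second_moment P (B 1) *v u)"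
    unfolding spectral_variance_one[OF B rev] quadratic_form_sum .
  have pos: "h x \<ge> 0" for x
  proof (cases "x = 0")
    case False
    then show ?thesis
      unfolding h_def using spectral_density_positive[OF rank u, of "\<bar>x\<bar>" H] by (intro mult_nonneg_nonneg divide_nonneg_nonneg) auto
  qed (simp add: h_def)
  have "(\<integral>x. h x \<partial>lborel) \<noteq> 0"
  proof
    assume "(\<integral>x. h x \<partial>lborel) = 0"
    then have AE0: "AE x in lborel. h x = 0"
      using integral_nonneg_eq_0_iff_AE[OF hi] pos by simp
    have hpos: "h x > 0" if "x \<in> {1<..<2}" for x
    proof -
      have "cos x < cos 0"
        using that pi_ge_two by (intro cos_monotone_0_pi) auto
      then show ?thesis
        unfolding h_def using that spectral_density_positive[OF rank u, of "\<bar>x\<bar>" H] by auto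
    qed
    have "AE x in lborel. x \<notin> {1<..<2::real}"
      using AE0 by (rule eventually_mono) (metis hpos less_irrefl)
    then have "{1<..<2::real} \<in> null_sets lborel"
      by (subst (asm) AE_iff_null_sets[symmetric]) auto
    then have "emeasure lborel {1<..<2::real} = 0" by auto
    then show False by simp
  qed
  moreover have "(\<integral>x. h x \<partial>lborel) \<ge> 0" using pos by (rule Bochner_Integration.integral_nonneg)
  ultimately show ?thesis unfolding hI by simp
qed

section \<open>Regularity and growth of the variance function\<close>

lemma mat_powr_commute: "M ** mat_powr x M = mat_powr x M ** (M :: real^'n^'n)"
proof (cases "x > 0")
  case True
  then show ?thesis by (simp add: mat_powr_def mat_exp_commute)
qed (simp add: mat_powr_def matrix_matrix_mult_def vec_eq_iff)

text \<open>The variance function without the absolute value, to be differentiated on x > 0.\<close>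

definition mat_conj :: "real^'n^'n \<Rightarrow> real^'n^'n \<Rightarrow> real \<Rightarrow> real^'n^'n" where
  "mat_conj H S x = mat_powr x H ** S ** transpose (mat_powr x H)"

lemma variance_mat_conj: "variance_mat H S t = mat_conj H S \<bar>t\<bar>"
  by (simp only: variance_mat_def mat_conj_def mat_powr_transpose)

lemma mat_conj_linear:
  "mat_conj H (S - c *\<^sub>R T) x $ i $ l = mat_conj H S x $ i $ l - c * mat_conj H T x $ i $ l"
  unfolding mat_conj_def triple_product_entry
  by (simp add: algebra_simps sum.distrib sum_subtractf sum_distrib_left)

text \<open>The derivative of x^H is H x^H / x and H commutes with x^H. Hence differentiation keeps
  the form x^H C (x^H)^T up to a factor 1 / x and only changes the middle matrix.\<close>

lemma DERIV_mat_conj: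
  fixes H :: "real^'n^'n"
  assumes x: "x > 0"
  shows "((\<lambda>x. mat_conj H S x $ i $ l) has_real_derivative mat_conj H (H ** S + S ** transpose H) x $ i $ l / x) (at x)"
proof -
  define h where "h = mat_powr x H"
  have "((\<lambda>x. \<Sum>a\<in>UNIV. \<Sum>b\<in>UNIV. (mat_powr x H $ i $ a * S $ a $ b) * mat_powr x H $ l $ b) has_real_derivative
      (\<Sum>a\<in>UNIV. \<Sum>b\<in>UNIV. ((H ** h) $ i $ a / x * S $ a $ b) * h $ l $ b + (H ** h) $ l $ b / x * (h $ i $ a * S $ a $ b))) (at x)"
    unfolding h_def by (intro DERIV_sum DERIV_mult DERIV_cmult_right DERIV_mat_powr x)
  also have "(\<Sum>a\<in>UNIV. \<Sum>b\<in>UNIV. ((H ** h) $ i $ a / x * S $ a $ b) * h $ l $ b + (H ** h) $ l $ b / x * (h $ i $ a * S $ a $ b)) =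
      ((\<Sum>a\<in>UNIV. \<Sum>b\<in>UNIV. (h ** H) $ i $ a * S $ a $ b * h $ l $ b) + (\<Sum>a\<in>UNIV. \<Sum>b\<in>UNIV. h $ i $ a * S $ a $ b * (h ** H) $ l $ b)) / x"
    unfolding h_def mat_powr_commute
    by (simp add: sum.distrib sum_divide_distrib add_divide_distrib mult_ac)
  also have "(\<Sum>a\<in>UNIV. \<Sum>b\<in>UNIV. (h ** H) $ i $ a * S $ a $ b * h $ l $ b) = ((h ** H) ** S ** transpose h) $ i $ l"
    by (simp add: matrix_mult_entry[of "(h ** H) ** S"] matrix_mult_entry[of "h ** H" S] transpose_def sum_distrib_right) (rule sum.swap)
  also have "(\<Sum>a\<in>UNIV. \<Sum>b\<in>UNIV. h $ i $ a * S $ a $ b * (h ** H) $ l $ b) = (h ** S ** transpose (h ** H)) $ i $ l"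
    by (simp add: matrix_mult_entry[of "h ** S"] matrix_mult_entry[of h S] transpose_def sum_distrib_right) (rule sum.swap)
  also have "((h ** H) ** S ** transpose h) $ i $ l + (h ** S ** transpose (h ** H)) $ i $ l =
      mat_conj H (H ** S + S ** transpose H) x $ i $ l"
    unfolding mat_conj_def h_def[symmetric] matrix_transpose_mul matrix_add_ldistrib matrix_add_mult matrix_mul_assoc by simp
  finally show ?thesis
    unfolding mat_conj_def triple_product_entry .
qed

text \<open>The middle matrices of the successive derivatives; the term with \<open>real k\<close>
  comes from differentiating x^(-k).\<close>

fun conj_coeff :: "real^'n^'n \<Rightarrow> real^'n^'n \<Rightarrow> nat \<Rightarrow> real^'n^'n" where
  "conj_coeff H S 0 = S"
| "conj_coeff H S (Suc k) = (H ** conj_coeff H S k + conj_coeff H S k ** transpose H) - real k *\<^sub>R conj_coeff H S k"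

definition conj_deriv :: "real^'n^'n \<Rightarrow> real^'n^'n \<Rightarrow> 'n \<Rightarrow> 'n \<Rightarrow> nat \<Rightarrow> real \<Rightarrow> real" where
  "conj_deriv H S i l k x = mat_conj H (conj_coeff H S k) x $ i $ l * inverse x ^ k"

lemma DERIV_conj_deriv:
  fixes H :: "real^'n^'n"
  assumes x: "x > 0"
  shows "(conj_deriv H S i l k has_real_derivative conj_deriv H S i l (Suc k) x) (at x)"
proof -
  define C where "C = conj_coeff H S k"
  have i: "((\<lambda>x. inverse x ^ k) has_real_derivative - (real k * inverse x ^ Suc k)) (at x)"
  proof -
    have "((\<lambda>x. inverse x ^ k) has_real_derivative of_nat k * (- (inverse x ^ Suc (Suc 0)) * inverse x ^ (k - Suc 0))) (at x)"
      by (rule DERIV_power[OF DERIV_inverse]) (use x in simp)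
    also have "of_nat k * (- (inverse x ^ Suc (Suc 0)) * inverse x ^ (k - Suc 0)) = - (real k * inverse x ^ Suc k)"
      by (cases k) simp_all
    finally show ?thesis .
  qed
  have "((\<lambda>x. mat_conj H C x $ i $ l * inverse x ^ k) has_real_derivative
      mat_conj H (H ** C + C ** transpose H) x $ i $ l / x * inverse x ^ k + - (real k * inverse x ^ Suc k) * mat_conj H C x $ i $ l) (at x)"
    by (intro DERIV_mult DERIV_mat_conj x i)
  then show ?thesis
    unfolding conj_deriv_def[abs_def] conj_coeff.simps mat_conj_linear C_def[symmetric]
    by (simp add: divide_inverse algebra_simps)
qed

lemma mat_entry_le_norm: "\<bar>M $ i $ a\<bar> \<le> norm (M :: real^'n^'m)"
  using component_le_norm_cart[of "M $ i" a] Finite_Cartesian_Product.norm_nth_le[of M i] by linarith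

lemma mat_conj_bound:
  fixes H S :: "real^'n^'n"
  shows "\<bar>mat_conj H S x $ i $ l\<bar> \<le> (\<Sum>a\<in>UNIV. \<Sum>b\<in>UNIV. \<bar>S $ a $ b\<bar>) * (norm (mat_powr x H))\<^sup>2"
proof -
  have "\<bar>mat_conj H S x $ i $ l\<bar> \<le> (\<Sum>a\<in>UNIV. \<Sum>b\<in>UNIV. \<bar>mat_powr x H $ i $ a * S $ a $ b * mat_powr x H $ l $ b\<bar>)"
    unfolding mat_conj_def triple_product_entry by (rule order_trans[OF sum_abs sum_mono[OF sum_abs]])
  also have "\<dots> \<le> (\<Sum>a\<in>UNIV. \<Sum>b\<in>UNIV. norm (mat_powr x H) * \<bar>S $ a $ b\<bar> * norm (mat_powr x H))"
    unfolding abs_mult by (intro sum_mono mult_mono mat_entry_le_norm mult_right_mono) auto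
  also have "\<dots> = (\<Sum>a\<in>UNIV. \<Sum>b\<in>UNIV. \<bar>S $ a $ b\<bar>) * (norm (mat_powr x H))\<^sup>2"
    by (simp add: sum_distrib_left sum_distrib_right power2_eq_square mult_ac)
  finally show ?thesis .
qed

text \<open>Lagrange remainder of order 4. The intermediate point t is at least x / 2, hence at
  least 1, so the growth of t^H bounds the fourth derivative by s K^2 t^2 / t^4.\<close>

lemma conj_taylor:
  fixes H S :: "real^'n^'n"
  assumes K: "\<And>t. t \<ge> 1 \<Longrightarrow> norm (mat_powr t H) \<le> K * t"
  shows "\<exists>C\<ge>0. \<forall>x y i l. x \<ge> 2 \<longrightarrow> \<bar>y\<bar> \<le> x / 2 \<longrightarrow>
    \<bar>mat_conj H S (x + y) $ i $ l - (\<Sum>r<4. conj_deriv H S i l r x / fact r * y ^ r)\<bar> \<le> C / x\<^sup>2 * y ^ 4"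
proof -
  define s where "s = (\<Sum>a\<in>UNIV. \<Sum>b\<in>UNIV. \<bar>conj_coeff H S 4 $ a $ b\<bar>)"
  have s: "s \<ge> 0" unfolding s_def by (intro sum_nonneg) auto
  have d4: "\<bar>conj_deriv H S i l 4 t\<bar> \<le> s * K\<^sup>2 / t\<^sup>2" if t: "t \<ge> 1" for t i l
  proof -
    have "\<bar>mat_conj H (conj_coeff H S 4) t $ i $ l\<bar> \<le> s * (norm (mat_powr t H))\<^sup>2"
      unfolding s_def by (rule mat_conj_bound)
    also have "\<dots> \<le> s * (K * t)\<^sup>2"
      by (intro mult_left_mono s power_mono K t) auto
    finally have "\<bar>mat_conj H (conj_coeff H S 4) t $ i $ l\<bar> * inverse t ^ 4 \<le> s * (K * t)\<^sup>2 * inverse t ^ 4"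
      using t by (intro mult_right_mono) auto
    also have "inverse t ^ 4 = 1 / (t\<^sup>2 * t\<^sup>2)"
      by (simp add: power_inverse divide_inverse flip: power_add)
    also have "s * (K * t)\<^sup>2 * (1 / (t\<^sup>2 * t\<^sup>2)) = s * K\<^sup>2 / t\<^sup>2"
    proof -
      have "s * (K * t)\<^sup>2 * (1 / (t\<^sup>2 * t\<^sup>2)) = (s * K\<^sup>2) * t\<^sup>2 / (t\<^sup>2 * t\<^sup>2)"
        by (simp only: power_mult_distrib mult.assoc times_divide_eq_right mult_1_right)
      also have "\<dots> = s * K\<^sup>2 / t\<^sup>2"
        by (rule nonzero_mult_divide_mult_cancel_right) (use t in simp)
      finally show ?thesis .
    qed
    finally show ?thesis
      unfolding conj_deriv_def abs_mult using t by (simp add: divide_inverse power_inverse)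
  qed
  show ?thesis
  \<comment> \<open>The 4 comes from t^2 being at least (x / 2)^2; the factor 1 / 4! is
    dropped.\<close>
  proof (rule exI[of _ "4 * (s * K\<^sup>2)"], intro conjI allI impI)
    show "0 \<le> 4 * (s * K\<^sup>2)" using s by simp
    fix x y :: real and i l :: 'n
    assume x: "x \<ge> 2" and y: "\<bar>y\<bar> \<le> x / 2"
    show "\<bar>mat_conj H S (x + y) $ i $ l - (\<Sum>r<4. conj_deriv H S i l r x / fact r * y ^ r)\<bar> \<le> 4 * (s * K\<^sup>2) / x\<^sup>2 * y ^ 4"
    proof (cases "y = 0")
      case True
      then show ?thesis by (simp add: eval_nat_numeral conj_deriv_def)
    next
      case False
      define f where "f = conj_deriv H S i l"
      have f0: "f 0 = (\<lambda>x. mat_conj H S x $ i $ l)" by (simp add: f_def conj_deriv_def[abs_def])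
      have D: "\<forall>m t. m < 4 \<and> x / 2 \<le> t \<and> t \<le> 3 * x / 2 \<longrightarrow> DERIV (f m) t :> f (Suc m) t"
      proof (intro allI impI)
        fix m :: nat and t :: real assume "m < 4 \<and> x / 2 \<le> t \<and> t \<le> 3 * x / 2"
        then have "t > 0" using x by linarith
        then show "DERIV (f m) t :> f (Suc m) t" unfolding f_def by (rule DERIV_conj_deriv)
      qed
      have "\<exists>t. (if x + y < x then x + y < t \<and> t < x else x < t \<and> t < x + y) \<and>
          mat_conj H S (x + y) $ i $ l = (\<Sum>m<4. f m x / fact m * (x + y - x) ^ m) + f 4 t / fact 4 * (x + y - x) ^ 4"
        by (rule Taylor[OF _ f0 D]) (use x y False in linarith)+
      then obtain t where t: "if x + y < x then x + y < t \<and> t < x else x < t \<and> t < x + y" and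
          e: "mat_conj H S (x + y) $ i $ l = (\<Sum>m<4. f m x / fact m * (x + y - x) ^ m) + f 4 t / fact 4 * (x + y - x) ^ 4"
        by blast
      have tx: "t \<ge> x / 2" using t y x by (auto split: if_splits)
      then have t1: "t \<ge> 1" using x by linarith
      have "\<bar>mat_conj H S (x + y) $ i $ l - (\<Sum>r<4. f r x / fact r * y ^ r)\<bar> = \<bar>f 4 t\<bar> / fact 4 * y ^ 4"
        unfolding e by (simp add: abs_mult)
      also have "\<dots> \<le> (4 * (s * K\<^sup>2) / x\<^sup>2) * y ^ 4"
      proof (rule mult_right_mono)
        have "\<bar>f 4 t\<bar> / fact 4 \<le> \<bar>f 4 t\<bar> / 1"
          by (intro divide_left_mono) (auto simp: fact_numeral)
        also have "\<dots> \<le> s * K\<^sup>2 / t\<^sup>2"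
          using d4[OF t1, of i l] by (simp add: f_def)
        also have "\<dots> \<le> s * K\<^sup>2 / (x / 2)\<^sup>2"
          using s x tx by (intro divide_left_mono power_mono mult_nonneg_nonneg mult_pos_pos) auto
        also have "\<dots> = 4 * (s * K\<^sup>2) / x\<^sup>2" by (simp add: power_divide)
        finally show "\<bar>f 4 t\<bar> / fact 4 \<le> 4 * (s * K\<^sup>2) / x\<^sup>2" .
      qed simp
      finally show ?thesis unfolding f_def .
    qed
  qed
qed

section \<open>Growth of the variance and of x^H\<close>

lemma positive_definite_coercive:
  fixes S :: "real^'n^'n"
  assumes "\<And>u. u \<noteq> 0 \<Longrightarrow> u \<bullet> (S *v u) > 0"
  obtains c where "c > 0" "\<And>u. u \<bullet> (S *v u) \<ge> c * (norm u)\<^sup>2"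
proof -
  have cont: "continuous_on (sphere 0 1) (\<lambda>u. u \<bullet> (S *v u))"
    by (intro continuous_on_inner continuous_on_id linear_continuous_on matrix_vector_mul_bounded_linear)
  have "sphere (0 :: real^'n) 1 \<noteq> {}"
  proof -
    have "axis undefined 1 \<in> sphere (0 :: real^'n) 1" by (simp add: norm_axis_1)
    then show ?thesis by blast
  qed
  from continuous_attains_inf[OF compact_sphere this cont]
  obtain v where v: "v \<in> sphere 0 1" "\<And>u. u \<in> sphere 0 1 \<Longrightarrow> v \<bullet> (S *v v) \<le> u \<bullet> (S *v u)" by blast
  show ?thesis
  proof (rule that[of "v \<bullet> (S *v v)"])
    have "v \<noteq> 0" using v(1) by auto
    then show "v \<bullet> (S *v v) > 0" by (rule assms)
    show "u \<bullet> (S *v u) \<ge> v \<bullet> (S *v v) * (norm u)\<^sup>2" for u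
    proof (cases "u = 0")
      case False
      define w where "w = (1 / norm u) *\<^sub>R u"
      have "w \<in> sphere 0 1" using False by (simp add: w_def)
      from v(2)[OF this] have "v \<bullet> (S *v v) \<le> (u \<bullet> (S *v u)) / (norm u)\<^sup>2"
        by (simp add: w_def matrix_vector_mult_scaleR power2_eq_square)
      then show ?thesis using False by (simp add: pos_le_divide_eq)
    qed simp
  qed
qed

lemma norm_mat_square: "(norm (M :: real^'n^'m))\<^sup>2 = (\<Sum>i\<in>UNIV. (norm (M $ i))\<^sup>2)"
  by (simp add: norm_vec_def[of M] L2_set_def sum_nonneg)

text \<open>The diagonal entries of t^H S (t^H)^T are the values of the form S at the rows of
  t^H.\<close>

lemma mat_powr_norm_le_trace:
  fixes H S :: "real^'n^'n"
  assumes c: "\<And>u. u \<bullet> (S *v u) \<ge> c * (norm u)\<^sup>2"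
  shows "c * (norm (mat_powr t H))\<^sup>2 \<le> (\<Sum>i\<in>UNIV. mat_conj H S t $ i $ i)"
  unfolding norm_mat_square sum_distrib_left
proof (rule sum_mono)
  fix i
  have "mat_conj H S t $ i $ i = mat_powr t H $ i \<bullet> (S *v (mat_powr t H $ i))"
    unfolding mat_conj_def triple_product_entry quadratic_form_sum ..
  then show "c * (norm (mat_powr t H $ i))\<^sup>2 \<le> mat_conj H S t $ i $ i" using c by simp
qed

lemma continuous_mat_conj:
  "continuous_on {0<..} (\<lambda>t. mat_conj H S t $ i $ l)"
  by (intro continuous_at_imp_continuous_on ballI DERIV_isCont[OF DERIV_mat_conj]) simp

text \<open>Growth from the subadditivity of \<open>t \<mapsto> \<parallel>B(t)\<parallel>\<close>: doubling gives a quadratic bound at infinity,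
  and \<open>B(t) = B(2 + t) - (B(2 + t) - B(t))\<close> gives boundedness near \<open>0\<close>.\<close>

lemma doubling_growth:
  fixes T :: "real \<Rightarrow> real"
  assumes sub: "\<And>s t. T (s + t) \<le> 2 * T s + 2 * T t" and even: "\<And>t. T (- t) = T t"
    and cont: "continuous_on {0<..} T" and nn: "\<And>t. T t \<ge> 0"
  shows "\<exists>K\<ge>0. (\<forall>t\<ge>1. T t \<le> K * t\<^sup>2) \<and> (\<forall>t. T t \<le> 26 * K * (1 + t\<^sup>2))"
proof -
  have "continuous_on {1..2} T" by (rule continuous_on_subset[OF cont]) auto
  from continuous_attains_sup[OF compact_Icc _ this]
  obtain m where m: "m \<in> {1..2}" "\<And>t. t \<in> {1..2} \<Longrightarrow> T t \<le> T m" by auto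
  define K where "K = T m"
  have K0: "K \<ge> 0" unfolding K_def by (rule nn)
  \<comment> \<open>Doubling the argument at most quadruples \<open>T\<close>, just as it does
    t^2.\<close>
  have dy: "T t \<le> 4 ^ k * K" if "2 ^ k \<le> t" "t \<le> 2 ^ Suc k" for k t
    using that
  proof (induction k arbitrary: t)
    case 0
    then show ?case using m(2)[of t] by (simp add: K_def)
  next
    case (Suc k)
    have "T t = T (t / 2 + t / 2)" by simp
    also have "\<dots> \<le> 2 * T (t / 2) + 2 * T (t / 2)" by (rule sub)
    also have "\<dots> = 4 * T (t / 2)" by simp
    also have "T (t / 2) \<le> 4 ^ k * K" by (rule Suc.IH) (use Suc.prems in simp_all)
    finally show ?case by simp
  qed
  have q: "T t \<le> K * t\<^sup>2" if t: "t \<ge> 1" for t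
  proof -
    obtain n where n: "t < 2 ^ n" using real_arch_pow[of 2 t] by auto
    \<comment> \<open>The dyadic exponent with 2^k <= t < 2^(k + 1); the least n is not 0 because t
      is at least 1.\<close>
    define k where "k = (LEAST n. t < 2 ^ n) - 1"
    have L: "t < 2 ^ (LEAST n. t < 2 ^ n)" by (rule LeastI[of "\<lambda>n. t < 2 ^ n"]) (rule n)
    have "(LEAST n. t < 2 ^ n) \<noteq> 0" using L t by (intro notI) simp
    then have S: "(LEAST n. t < 2 ^ n) = Suc k" by (simp add: k_def)
    have "\<not> t < 2 ^ k" by (rule not_less_Least) (simp add: S)
    then have k: "2 ^ k \<le> t" "t \<le> 2 ^ Suc k" using L unfolding S by auto
    have "T t \<le> 4 ^ k * K" by (rule dy[OF k])
    also have "(4::real) ^ k = (2 ^ k)\<^sup>2" by (simp add: power2_eq_square power_mult_distrib[symmetric])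
    also have "(2 ^ k)\<^sup>2 * K \<le> t\<^sup>2 * K" using k K0 by (intro mult_right_mono power_mono) auto
    finally show ?thesis by (simp add: mult.commute)
  qed
  have "T t \<le> 26 * K * (1 + t\<^sup>2)" for t
  proof (cases "\<bar>t\<bar> \<ge> 1")
    case True
    have "T t = T \<bar>t\<bar>" using even[of t] by (auto simp: abs_if)
    also have "\<dots> \<le> K * \<bar>t\<bar>\<^sup>2" by (rule q[OF True])
    also have "\<dots> = K * t\<^sup>2" by simp
    also have "\<dots> \<le> 26 * K * (1 + t\<^sup>2)"
    proof -
      have "0 \<le> K * (26 + 25 * t\<^sup>2)" using K0 by (intro mult_nonneg_nonneg) auto
      then show ?thesis by (simp add: algebra_simps)
    qed
    finally show ?thesis .
  next
    case False
    have "T t = T ((2 + t) + (- 2))" by simp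
    also have "\<dots> \<le> 2 * T (2 + t) + 2 * T (- 2)" by (rule sub)
    also have "T (2 + t) \<le> K * (2 + t)\<^sup>2" using False by (intro q) auto
    also have "T (- 2) \<le> K * 2\<^sup>2" unfolding even by (rule q) simp
    finally have "T t \<le> 2 * (K * (2 + t)\<^sup>2) + 2 * (K * 2\<^sup>2)" by simp
    also have "K * (2 + t)\<^sup>2 \<le> K * 3\<^sup>2" using False K0 by (intro mult_left_mono power_mono) auto
    \<comment> \<open>2 * 3^2 + 2 * 2^2 = 26.\<close>
    finally have "T t \<le> 26 * K" by simp
    also have "\<dots> \<le> 26 * K * (1 + t\<^sup>2)" using K0 by (simp add: algebra_simps)
    finally show ?thesis .
  qed
  then show ?thesis using K0 q by blast
qed

text \<open>The trace of the variance function grows at most quadratically. Off-diagonal entries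
  follow by Cauchy-Schwarz, and coercivity of Sigma turns the trace bound into a bound on the norm
  of t^H.\<close>

theorem ofbm_variance_growth:
  fixes B :: "real \<Rightarrow> 'a \<Rightarrow> real^'n"
  assumes B: "is_ofbm Q Z H A P B" and rev: "Im_mat (A ** adjoint_mat A) = 0"
    and rank: "rank (Re_mat (A ** adjoint_mat A)) = CARD('n)"
  defines "S \<equiv> second_moment P (B 1)"
  shows "\<exists>K\<ge>0. \<forall>t i l. \<bar>variance_mat H S t $ i $ l\<bar> \<le> K * (1 + t\<^sup>2)"
    and "\<exists>K. \<forall>t\<ge>1. norm (mat_powr t H) \<le> K * t"
proof -
  note cov = ofbm_covariance[OF B rev, folded S_def]
  note sq = ofbm_sqi[OF B]
  define T where "T t = (\<Sum>i\<in>UNIV. variance_mat H S t $ i $ i)" for t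
  have var: "L2_inner P (\<lambda>\<omega>. B t \<omega> $ i) (\<lambda>\<omega>. B t \<omega> $ l) = variance_mat H S t $ i $ l" for t i l
    unfolding cov by (simp add: variance_mat_zero)
  have dnn: "variance_mat H S t $ i $ i \<ge> 0" for t i
    unfolding var[symmetric] by (rule L2_inner_self_nonneg)
  have sub1: "variance_mat H S (s + t) $ i $ i \<le> 2 * variance_mat H S s $ i $ i + 2 * variance_mat H S t $ i $ i" for s t i
  proof -
    \<comment> \<open>The expansion of the second moment of B(s + t) - 2 B(t), by components; with
      stationary increments it reduces to 2 V(s) + 2 V(t) - V(s + t).\<close>
    have "0 \<le> variance_mat H S (s + t) $ i $ i - 2 * 2 * ((variance_mat H S (s + t) $ i $ i + variance_mat H S t $ i $ i
        - variance_mat H S (s + t - t) $ i $ i) / 2) + 2\<^sup>2 * variance_mat H S t $ i $ i"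
      using L2_inner_self_nonneg[of P "\<lambda>\<omega>. B (s + t) \<omega> $ i - 2 *\<^sub>R B t \<omega> $ i"]
      unfolding L2_inner_square_expand[OF sq sq] var unfolding cov .
    then show ?thesis by (simp add: field_simps)
  qed
  have T: "\<exists>K\<ge>0. (\<forall>t\<ge>1. T t \<le> K * t\<^sup>2) \<and> (\<forall>t. T t \<le> 26 * K * (1 + t\<^sup>2))"
  proof (rule doubling_growth)
    show "T (s + t) \<le> 2 * T s + 2 * T t" for s t
      unfolding T_def sum_distrib_left sum.distrib[symmetric] by (rule sum_mono) (rule sub1)
    show "T (- t) = T t" for t by (simp add: T_def variance_mat_minus)
    show "T t \<ge> 0" for t unfolding T_def by (intro sum_nonneg dnn)
    have "continuous_on {0<..} (\<lambda>t. \<Sum>i\<in>UNIV. mat_conj H S t $ i $ i)"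
      by (intro continuous_on_sum continuous_mat_conj)
    then show "continuous_on {0<..} T"
      by (rule continuous_on_eq) (simp add: T_def variance_mat_conj)
  qed
  then obtain K where K: "K \<ge> 0" "\<And>t. t \<ge> 1 \<Longrightarrow> T t \<le> K * t\<^sup>2" "\<And>t. T t \<le> 26 * K * (1 + t\<^sup>2)" by blast
  have dT: "variance_mat H S t $ i $ i \<le> T t" for t i
    unfolding T_def by (rule member_le_sum) (auto intro: dnn)
  have entry: "\<bar>variance_mat H S t $ i $ l\<bar> \<le> 26 * K * (1 + t\<^sup>2)" for t i l
  proof -
    have "\<bar>variance_mat H S t $ i $ l\<bar> \<le> sqrt (variance_mat H S t $ i $ i) * sqrt (variance_mat H S t $ l $ l)"
      using L2_Cauchy_Schwarz[OF sq sq, of t i t l] unfolding var .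
    also have "\<dots> \<le> sqrt (T t) * sqrt (T t)"
      by (intro mult_mono real_sqrt_le_mono dT) (auto intro: dnn order_trans[OF dnn dT])
    also have "\<dots> = T t" using order_trans[OF dnn dT, of t] by simp
    finally show ?thesis using K(3)[of t] by linarith
  qed
  have K26: "26 * K \<ge> 0" using K(1) by simp
  show "\<exists>K\<ge>0. \<forall>t i l. \<bar>variance_mat H S t $ i $ l\<bar> \<le> K * (1 + t\<^sup>2)"
    using entry K26 by blast
  obtain c where c: "c > 0" "\<And>u. u \<bullet> (S *v u) \<ge> c * (norm u)\<^sup>2"
    using positive_definite_coercive[OF ofbm_variance_positive[OF B rev rank, folded S_def]] by blast
  have "norm (mat_powr t H) \<le> sqrt (K / c) * t" if t: "t \<ge> 1" for t
  proof -
    have "c * (norm (mat_powr t H))\<^sup>2 \<le> T t"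
      using mat_powr_norm_le_trace[OF c(2), of t H] t by (simp add: T_def variance_mat_conj)
    also have "\<dots> \<le> K * t\<^sup>2" by (rule K(2)[OF t])
    finally have "(norm (mat_powr t H))\<^sup>2 \<le> K / c * t\<^sup>2" using c(1) by (simp add: field_simps)
    then have "sqrt ((norm (mat_powr t H))\<^sup>2) \<le> sqrt (K / c * t\<^sup>2)" by (rule real_sqrt_le_mono)
    also have "sqrt (K / c * t\<^sup>2) = sqrt (K / c) * t"
      unfolding real_sqrt_mult using t by simp
    finally show ?thesis by simp
  qed
  then show "\<exists>K. \<forall>t\<ge>1. norm (mat_powr t H) \<le> K * t" by blast
qed

section \<open>Decay of wavelet covariances\<close>

text \<open>A bound on \<open>f\<close> is asked only where \<psi> is nonzero, which admits
  functions of polynomial growth when the support is compact.\<close>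

lemma weighted_integral_bound:
  fixes \<psi> f :: "real \<Rightarrow> real"
  assumes \<psi>: "integrable lborel \<psi>" and f: "f \<in> borel_measurable borel" and M: "\<And>t. \<psi> t \<noteq> 0 \<Longrightarrow> \<bar>f t\<bar> \<le> M"
  shows "integrable lborel (\<lambda>t. \<psi> t * f t)" and "\<bar>\<integral>t. \<psi> t * f t \<partial>lborel\<bar> \<le> M * (\<integral>t. \<bar>\<psi> t\<bar> \<partial>lborel)"
proof -
  have le: "\<bar>\<psi> t * f t\<bar> \<le> M * \<bar>\<psi> t\<bar>" for t
    by (cases "\<psi> t = 0") (simp_all add: abs_mult M mult.commute mult_left_mono)
  have i: "integrable lborel (\<lambda>t. M * \<bar>\<psi> t\<bar>)"
    by (intro integrable_mult_right integrable_abs \<psi>)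
  show int: "integrable lborel (\<lambda>t. \<psi> t * f t)"
  proof (rule Bochner_Integration.integrable_bound[OF i])
    show "(\<lambda>t. \<psi> t * f t) \<in> borel_measurable lborel"
      by (intro borel_measurable_times borel_measurable_integrable[OF \<psi>]) (simp only: f measurable_lborel2)
    show "AE t in lborel. norm (\<psi> t * f t) \<le> norm (M * \<bar>\<psi> t\<bar>)"
    proof (rule AE_I2)
      fix t
      show "norm (\<psi> t * f t) \<le> norm (M * \<bar>\<psi> t\<bar>)"
        using le[of t] unfolding real_norm_def by linarith
    qed
  qed
  have "\<bar>\<integral>t. \<psi> t * f t \<partial>lborel\<bar> \<le> (\<integral>t. \<bar>\<psi> t * f t\<bar> \<partial>lborel)"
    by (rule integral_abs_bound)
  also have "\<dots> \<le> (\<integral>t. M * \<bar>\<psi> t\<bar> \<partial>lborel)"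
    by (intro integral_mono integrable_abs int i le)
  finally show "\<bar>\<integral>t. \<psi> t * f t \<partial>lborel\<bar> \<le> M * (\<integral>t. \<bar>\<psi> t\<bar> \<partial>lborel)"
    by (simp only: integral_mult_right_zero)
qed

text \<open>For an entry \<open>V\<close> of the variance function, with a = 2^j and b = 2^j', this
  is -2 times the corresponding entry of Omega, as a function of the real shift x = z g.\<close>

definition double_wavelet :: "(real \<Rightarrow> real) \<Rightarrow> (real \<Rightarrow> real) \<Rightarrow> real \<Rightarrow> real \<Rightarrow> real \<Rightarrow> real" where
  "double_wavelet \<psi> V a b x = (\<integral>t. \<psi> t * (\<integral>t'. \<psi> t' * V (a * t - b * t' + x) \<partial>lborel) \<partial>lborel)"

context
  fixes \<psi> :: "real \<Rightarrow> real" and R :: real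
  assumes \<psi>: "integrable lborel \<psi>" and supp: "\<And>t. \<psi> t \<noteq> 0 \<Longrightarrow> \<bar>t\<bar> \<le> R"
begin

lemma psi_meas: "\<psi> \<in> borel_measurable borel"
  using borel_measurable_integrable[OF \<psi>] by (simp only: measurable_lborel2)

lemma inner_wavelet_measurable:
  assumes V: "V \<in> borel_measurable borel"
  shows "(\<lambda>t. \<integral>t'. \<psi> t' * V (a * t - b * t' + x) \<partial>lborel) \<in> borel_measurable borel"
proof (rule sigma_finite_measure.borel_measurable_lebesgue_integral[OF sigma_finite_lborel])
  have 1: "(\<lambda>p. \<psi> (snd p)) \<in> borel_measurable (borel \<Otimes>\<^sub>M lborel)"
    by (rule measurable_compose[OF _ psi_meas]) measurable
  have 2: "(\<lambda>p. V (a * fst p - b * snd p + x)) \<in> borel_measurable (borel \<Otimes>\<^sub>M lborel)"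
    by (rule measurable_compose[OF _ V]) measurable
  show "(\<lambda>(t, t'). \<psi> t' * V (a * t - b * t' + x)) \<in> borel_measurable (borel \<Otimes>\<^sub>M lborel)"
    using borel_measurable_times[OF 1 2] by (simp only: case_prod_beta')
qed

lemma shift_bound:
  assumes "\<psi> t \<noteq> 0" "\<psi> t' \<noteq> 0"
  shows "\<bar>a * t - b * t'\<bar> \<le> (\<bar>a\<bar> + \<bar>b\<bar>) * R"
proof -
  have "\<bar>a * t - b * t'\<bar> \<le> \<bar>a\<bar> * \<bar>t\<bar> + \<bar>b\<bar> * \<bar>t'\<bar>"
    using abs_triangle_ineq4[of "a * t" "b * t'"] by (simp add: abs_mult)
  also have "\<dots> \<le> \<bar>a\<bar> * R + \<bar>b\<bar> * R"
    by (intro add_mono mult_left_mono supp assms) auto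
  finally show ?thesis by (simp add: algebra_simps)
qed

lemma shift_measurable:
  fixes V :: "real \<Rightarrow> real" and a b t x :: real
  assumes V: "V \<in> borel_measurable borel" shows "(\<lambda>t'. V (a * t - b * t' + x)) \<in> borel_measurable borel"
  by (rule measurable_compose[OF _ V]) measurable

lemma inner_wavelet_integrable:
  assumes V: "V \<in> borel_measurable borel" and K: "\<And>y. \<bar>V y\<bar> \<le> K * (1 + y\<^sup>2)" "K \<ge> 0" and t: "\<psi> t \<noteq> 0"
  shows "integrable lborel (\<lambda>t'. \<psi> t' * V (a * t - b * t' + x))"
    and "\<bar>\<integral>t'. \<psi> t' * V (a * t - b * t' + x) \<partial>lborel\<bar> \<le> K * (1 + ((\<bar>a\<bar> + \<bar>b\<bar>) * R + \<bar>x\<bar>)\<^sup>2) * (\<integral>t. \<bar>\<psi> t\<bar> \<partial>lborel)"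
proof -
  have "\<bar>V (a * t - b * t' + x)\<bar> \<le> K * (1 + ((\<bar>a\<bar> + \<bar>b\<bar>) * R + \<bar>x\<bar>)\<^sup>2)" if "\<psi> t' \<noteq> 0" for t'
  proof -
    have "\<bar>a * t - b * t' + x\<bar> \<le> (\<bar>a\<bar> + \<bar>b\<bar>) * R + \<bar>x\<bar>"
      using shift_bound[OF t that, of a b] by linarith
    then have "(a * t - b * t' + x)\<^sup>2 \<le> ((\<bar>a\<bar> + \<bar>b\<bar>) * R + \<bar>x\<bar>)\<^sup>2"
      by (metis abs_ge_zero power2_abs power_mono)
    then have "K * (1 + (a * t - b * t' + x)\<^sup>2) \<le> K * (1 + ((\<bar>a\<bar> + \<bar>b\<bar>) * R + \<bar>x\<bar>)\<^sup>2)"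
      using K(2) by (intro mult_left_mono) auto
    then show ?thesis using K(1)[of "a * t - b * t' + x"] by linarith
  qed
  from weighted_integral_bound[OF \<psi> shift_measurable[OF V] this]
  show "integrable lborel (\<lambda>t'. \<psi> t' * V (a * t - b * t' + x))"
    and "\<bar>\<integral>t'. \<psi> t' * V (a * t - b * t' + x) \<partial>lborel\<bar> \<le> K * (1 + ((\<bar>a\<bar> + \<bar>b\<bar>) * R + \<bar>x\<bar>)\<^sup>2) * (\<integral>t. \<bar>\<psi> t\<bar> \<partial>lborel)"
    by blast+
qed

lemma double_wavelet_bound:
  assumes V: "V \<in> borel_measurable borel" and K: "\<And>y. \<bar>V y\<bar> \<le> K * (1 + y\<^sup>2)" "K \<ge> 0"
  shows "integrable lborel (\<lambda>t. \<psi> t * (\<integral>t'. \<psi> t' * V (a * t - b * t' + x) \<partial>lborel))"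
    and "\<bar>double_wavelet \<psi> V a b x\<bar> \<le> K * (1 + ((\<bar>a\<bar> + \<bar>b\<bar>) * R + \<bar>x\<bar>)\<^sup>2) * (\<integral>t. \<bar>\<psi> t\<bar> \<partial>lborel) * (\<integral>t. \<bar>\<psi> t\<bar> \<partial>lborel)"
  unfolding double_wavelet_def
  by (rule weighted_integral_bound[OF \<psi> inner_wavelet_measurable[OF V] inner_wavelet_integrable(2)[OF V K]], assumption)+

section \<open>Decay through vanishing moments\<close>

lemma power_integrable: "integrable lborel (\<lambda>t. \<psi> t * t ^ k)"
  by (rule weighted_integral_bound(1)[OF \<psi>, of _ "R ^ k"])
     (measurable, simp add: power_abs power_mono supp)

lemma linear_integrable: "integrable lborel (\<lambda>t. \<psi> t * t)"
  using power_integrable[of 1] by (simp only: power_one_right)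

context
  assumes m0: "(\<integral>t. \<psi> t \<partial>lborel) = 0" and m1: "(\<integral>t. \<psi> t * t \<partial>lborel) = 0"
begin

text \<open>The moments of order 0 and 1 remove the coefficients of t'^0 and t'^1. What multiplies
  t'^2 and t'^3 has degree at most 1 in t, so the outer integral will remove it by the same two
  moments.\<close>

lemma inner_cubic_moment:
  shows "integrable lborel (\<lambda>t'. \<psi> t' * (\<Sum>r<4. c r * (a * t - b * t') ^ r))"
    and "(\<integral>t'. \<psi> t' * (\<Sum>r<4. c r * (a * t - b * t') ^ r) \<partial>lborel) =
      (c 2 * b\<^sup>2 * (\<integral>t. \<psi> t * t ^ 2 \<partial>lborel) - c 3 * b ^ 3 * (\<integral>t. \<psi> t * t ^ 3 \<partial>lborel)) + (3 * c 3 * a * b\<^sup>2 * (\<integral>t. \<psi> t * t ^ 2 \<partial>lborel)) * t"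
proof -
  define C0 C1 C2 C3 where "C0 = c 0 + c 1 * a * t + c 2 * a\<^sup>2 * t\<^sup>2 + c 3 * a ^ 3 * t ^ 3"
    and "C1 = - (c 1 * b) - 2 * c 2 * a * b * t - 3 * c 3 * a\<^sup>2 * b * t\<^sup>2"
    and "C2 = c 2 * b\<^sup>2 + 3 * c 3 * a * b\<^sup>2 * t" and "C3 = - (c 3 * b ^ 3)"
  have "(\<Sum>r<4. c r * (a * t - b * s) ^ r) = C0 + C1 * s + C2 * s\<^sup>2 + C3 * s ^ 3" for s
    unfolding C0_def C1_def C2_def C3_def
    by (simp add: eval_nat_numeral algebra_simps)
  note poly = this
  have e: "\<psi> s * (\<Sum>r<4. c r * (a * t - b * s) ^ r) = C0 * \<psi> s + C1 * (\<psi> s * s) + C2 * (\<psi> s * s ^ 2) + C3 * (\<psi> s * s ^ 3)" for s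
    unfolding poly by (simp add: algebra_simps)
  have i: "integrable lborel (\<lambda>s. C0 * \<psi> s)" "integrable lborel (\<lambda>s. C1 * (\<psi> s * s))"
    "integrable lborel (\<lambda>s. C2 * (\<psi> s * s ^ 2))" "integrable lborel (\<lambda>s. C3 * (\<psi> s * s ^ 3))"
    by (intro integrable_mult_right \<psi> linear_integrable power_integrable)+
  show "integrable lborel (\<lambda>t'. \<psi> t' * (\<Sum>r<4. c r * (a * t - b * t') ^ r))"
    unfolding e by (intro Bochner_Integration.integrable_add i)
  have "(\<integral>t'. \<psi> t' * (\<Sum>r<4. c r * (a * t - b * t') ^ r) \<partial>lborel) =
      (\<integral>s. C0 * \<psi> s \<partial>lborel) + (\<integral>s. C1 * (\<psi> s * s) \<partial>lborel) + (\<integral>s. C2 * (\<psi> s * s ^ 2) \<partial>lborel) + (\<integral>s. C3 * (\<psi> s * s ^ 3) \<partial>lborel)"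
    unfolding e by (simp only: Bochner_Integration.integral_add Bochner_Integration.integrable_add i)
  also have "\<dots> = C2 * (\<integral>t. \<psi> t * t ^ 2 \<partial>lborel) + C3 * (\<integral>t. \<psi> t * t ^ 3 \<partial>lborel)"
    by (simp only: integral_mult_right_zero m0 m1 mult_zero_right add_0)
  finally show "(\<integral>t'. \<psi> t' * (\<Sum>r<4. c r * (a * t - b * t') ^ r) \<partial>lborel) =
      (c 2 * b\<^sup>2 * (\<integral>t. \<psi> t * t ^ 2 \<partial>lborel) - c 3 * b ^ 3 * (\<integral>t. \<psi> t * t ^ 3 \<partial>lborel)) + (3 * c 3 * a * b\<^sup>2 * (\<integral>t. \<psi> t * t ^ 2 \<partial>lborel)) * t"
    unfolding C2_def C3_def by (simp add: algebra_simps)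
qed

text \<open>Subtracting the cubic polynomial changes nothing after both integrations: its inner
  integral is \<open>\<alpha> + \<beta> * t\<close>, which integrates to 0 against \<psi>. Only the
  remainder is left.\<close>

lemma double_wavelet_far:
  assumes V: "V \<in> borel_measurable borel" and K: "\<And>y. \<bar>V y\<bar> \<le> K * (1 + y\<^sup>2)" "K \<ge> 0"
    and C: "C \<ge> 0" "\<And>y. \<bar>y\<bar> \<le> x / 2 \<Longrightarrow> \<bar>V (x + y) - (\<Sum>r<4. c r * y ^ r)\<bar> \<le> C * y ^ 4"
    and x: "2 * ((\<bar>a\<bar> + \<bar>b\<bar>) * R) \<le> x"
  shows "\<bar>double_wavelet \<psi> V a b x\<bar> \<le> C * ((\<bar>a\<bar> + \<bar>b\<bar>) * R) ^ 4 * (\<integral>t. \<bar>\<psi> t\<bar> \<partial>lborel) * (\<integral>t. \<bar>\<psi> t\<bar> \<partial>lborel)"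
proof -
  define \<rho> where "\<rho> = (\<bar>a\<bar> + \<bar>b\<bar>) * R"
  define I where "I t = (\<integral>t'. \<psi> t' * V (a * t - b * t' + x) \<partial>lborel)" for t
  define \<alpha> \<beta> where "\<alpha> = c 2 * b\<^sup>2 * (\<integral>t. \<psi> t * t ^ 2 \<partial>lborel) - c 3 * b ^ 3 * (\<integral>t. \<psi> t * t ^ 3 \<partial>lborel)"
    and "\<beta> = 3 * c 3 * a * b\<^sup>2 * (\<integral>t. \<psi> t * t ^ 2 \<partial>lborel)"
  have Im: "I \<in> borel_measurable borel" unfolding I_def by (rule inner_wavelet_measurable[OF V])
  have near: "\<bar>I t - (\<alpha> + \<beta> * t)\<bar> \<le> C * \<rho> ^ 4 * (\<integral>t. \<bar>\<psi> t\<bar> \<partial>lborel)" if t: "\<psi> t \<noteq> 0" for t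
  proof -
    define p where "p s = (\<Sum>r<4. c r * (a * t - b * s) ^ r)" for s
    have "(\<alpha> + \<beta> * t) = (\<integral>t'. \<psi> t' * p t' \<partial>lborel)"
      unfolding p_def inner_cubic_moment(2) \<alpha>_def \<beta>_def ..
    then have "I t - (\<alpha> + \<beta> * t) = (\<integral>t'. \<psi> t' * V (a * t - b * t' + x) - \<psi> t' * p t' \<partial>lborel)"
      unfolding I_def
      by (simp only: Bochner_Integration.integral_diff[OF inner_wavelet_integrable(1)[OF V K t] inner_cubic_moment(1)] p_def)
    also have "\<dots> = (\<integral>t'. \<psi> t' * (V (a * t - b * t' + x) - p t') \<partial>lborel)"
      by (simp only: right_diff_distrib)
    also have "\<bar>\<dots>\<bar> \<le> C * \<rho> ^ 4 * (\<integral>t. \<bar>\<psi> t\<bar> \<partial>lborel)"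
    proof (rule weighted_integral_bound(2)[OF \<psi>])
      show "(\<lambda>t'. V (a * t - b * t' + x) - p t') \<in> borel_measurable borel"
        unfolding p_def using shift_measurable[OF V, of a t b x] by measurable
      fix t' assume t': "\<psi> t' \<noteq> 0"
      have y: "\<bar>a * t - b * t'\<bar> \<le> \<rho>" unfolding \<rho>_def by (rule shift_bound[OF t t'])
      then have "\<bar>V (x + (a * t - b * t')) - p t'\<bar> \<le> C * (a * t - b * t') ^ 4"
        unfolding p_def using x by (intro C(2)) (simp add: \<rho>_def)
      also have "(a * t - b * t') ^ 4 = \<bar>a * t - b * t'\<bar> ^ 4" by simp
      also have "C * \<bar>a * t - b * t'\<bar> ^ 4 \<le> C * \<rho> ^ 4" by (intro mult_left_mono power_mono y C(1)) simp
      finally show "\<bar>V (a * t - b * t' + x) - p t'\<bar> \<le> C * \<rho> ^ 4" by (simp only: add.commute)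
    qed
    finally show ?thesis .
  qed
  have Im': "(\<lambda>t. I t - (\<alpha> + \<beta> * t)) \<in> borel_measurable borel" using Im by measurable
  have lin: "integrable lborel (\<lambda>t. \<alpha> * \<psi> t + \<beta> * (\<psi> t * t))"
    by (intro Bochner_Integration.integrable_add integrable_mult_right \<psi> linear_integrable)
  have lin0: "(\<integral>t. \<alpha> * \<psi> t + \<beta> * (\<psi> t * t) \<partial>lborel) = 0"
    by (simp only: Bochner_Integration.integral_add[OF integrable_mult_right[OF \<psi>] integrable_mult_right[OF linear_integrable]]
        integral_mult_right_zero m0 m1 mult_zero_right add_0_right)
  have d: "integrable lborel (\<lambda>t. \<psi> t * (I t - (\<alpha> + \<beta> * t)))"
    "\<bar>\<integral>t. \<psi> t * (I t - (\<alpha> + \<beta> * t)) \<partial>lborel\<bar> \<le> C * \<rho> ^ 4 * (\<integral>t. \<bar>\<psi> t\<bar> \<partial>lborel) * (\<integral>t. \<bar>\<psi> t\<bar> \<partial>lborel)"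
    by (rule weighted_integral_bound[OF \<psi> Im' near], assumption)+
  have "double_wavelet \<psi> V a b x = (\<integral>t. \<psi> t * (I t - (\<alpha> + \<beta> * t)) + (\<alpha> * \<psi> t + \<beta> * (\<psi> t * t)) \<partial>lborel)"
    unfolding double_wavelet_def I_def[symmetric]
    by (intro Bochner_Integration.integral_cong refl) (simp add: algebra_simps)
  also have "\<dots> = (\<integral>t. \<psi> t * (I t - (\<alpha> + \<beta> * t)) \<partial>lborel)"
    using Bochner_Integration.integral_add[OF d(1) lin] unfolding lin0 add_0_right .
  finally show ?thesis
    using d(2) by (simp only: \<rho>_def)
qed

text \<open>Evenness trades a negative shift for sign changes of a and b, to which the bounds are
  insensitive.\<close>

lemma double_wavelet_reflect:
  assumes "\<And>y. V (- y) = V y"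
  shows "double_wavelet \<psi> V a b (- x) = double_wavelet \<psi> V (- a) (- b) x"
proof -
  have "V (a * t - b * t' + - x) = V (- a * t - - b * t' + x)" for t t'
    using assms[of "- a * t - - b * t' + x"] by (simp add: algebra_simps)
  then show ?thesis unfolding double_wavelet_def by simp
qed

theorem double_wavelet_decay:
  assumes V: "V \<in> borel_measurable borel" and K: "\<And>y. \<bar>V y\<bar> \<le> K * (1 + y\<^sup>2)" "K \<ge> 0"
    and even: "\<And>y. V (- y) = V y"
    and C: "C \<ge> 0" "\<And>x. x \<ge> 2 \<Longrightarrow> \<exists>c. \<forall>y. \<bar>y\<bar> \<le> x / 2 \<longrightarrow> \<bar>V (x + y) - (\<Sum>r<4. c r * y ^ r)\<bar> \<le> C / x\<^sup>2 * y ^ 4"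
  shows "\<exists>C'\<ge>0. \<forall>x. \<bar>double_wavelet \<psi> V a b x\<bar> \<le> C' / (1 + x\<^sup>2)"
proof -
  define \<rho> where "\<rho> = (\<bar>a\<bar> + \<bar>b\<bar>) * R"
  define n where "n = (\<integral>t. \<bar>\<psi> t\<bar> \<partial>lborel)"
  have n: "n \<ge> 0" unfolding n_def by (intro Bochner_Integration.integral_nonneg) simp
  \<comment> \<open>From X on the Taylor estimate is available, as x is at least 2, and all
    displacements, at most rho, stay within x / 2. \<open>C1\<close> serves beyond X,
    \<open>C2\<close> below it.\<close>
  define X where "X = max 2 (2 * \<bar>\<rho>\<bar>)"
  have X: "X \<ge> 2" "2 * \<rho> \<le> X" by (auto simp: X_def)
  define C1 where "C1 = C * \<rho> ^ 4 * n * n"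
  define C2 where "C2 = K * (1 + (\<bar>\<rho>\<bar> + X)\<^sup>2) * n * n"
  have C1: "C1 \<ge> 0" using C(1) n by (simp add: C1_def)
  have C2: "C2 \<ge> 0" using K(2) n by (simp add: C2_def)
  have far: "\<bar>double_wavelet \<psi> V a' b' x\<bar> \<le> C1 / x\<^sup>2" if x: "x \<ge> X" and ab: "\<bar>a'\<bar> = \<bar>a\<bar>" "\<bar>b'\<bar> = \<bar>b\<bar>" for x a' b'
  proof -
    have x2: "x \<ge> 2" using x X by linarith
    obtain c where c: "\<And>y. \<bar>y\<bar> \<le> x / 2 \<Longrightarrow> \<bar>V (x + y) - (\<Sum>r<4. c r * y ^ r)\<bar> \<le> C / x\<^sup>2 * y ^ 4"
      using C(2)[OF x2] by blast
    have "\<bar>double_wavelet \<psi> V a' b' x\<bar> \<le> (C / x\<^sup>2) * ((\<bar>a'\<bar> + \<bar>b'\<bar>) * R) ^ 4 * n * n"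
      unfolding n_def
    proof (rule double_wavelet_far[OF V K _ c])
      show "0 \<le> C / x\<^sup>2" using C(1) by simp
      show "2 * ((\<bar>a'\<bar> + \<bar>b'\<bar>) * R) \<le> x" using X x unfolding ab \<rho>_def by linarith
    qed
    then show ?thesis unfolding ab C1_def \<rho>_def by (simp add: mult_ac)
  qed
  have main: "\<bar>double_wavelet \<psi> V a b x\<bar> \<le> (2 * C1 + C2 * (1 + X\<^sup>2)) / (1 + x\<^sup>2)" for x
  proof (cases "\<bar>x\<bar> \<ge> X")
    case True
    have "\<bar>double_wavelet \<psi> V a b x\<bar> \<le> C1 / \<bar>x\<bar>\<^sup>2"
    proof (cases "x \<ge> 0")
      case True
      then show ?thesis using far[of x a b] \<open>\<bar>x\<bar> \<ge> X\<close> by simp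
    next
      case False
      then have "double_wavelet \<psi> V a b x = double_wavelet \<psi> V (- a) (- b) \<bar>x\<bar>"
        using double_wavelet_reflect[of V a b "\<bar>x\<bar>", OF even] by simp
      then show ?thesis using far[of "\<bar>x\<bar>" "- a" "- b"] True by simp
    qed
    also have "C1 / \<bar>x\<bar>\<^sup>2 \<le> (2 * C1) / (1 + x\<^sup>2)"
    proof -
      have "2\<^sup>2 \<le> \<bar>x\<bar>\<^sup>2" using True X by (intro power_mono) auto
      then have x1: "1 \<le> x\<^sup>2" by simp
      then have "C1 * (1 + x\<^sup>2) \<le> C1 * (2 * x\<^sup>2)" using C1 by (intro mult_left_mono) auto
      then show ?thesis using x1 C1 by (simp add: divide_le_eq pos_le_divide_eq mult_ac frac_le_eq field_simps)
    qed
    also have "\<dots> \<le> (2 * C1 + C2 * (1 + X\<^sup>2)) / (1 + x\<^sup>2)"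
      using C2 by (intro divide_right_mono) auto
    finally show ?thesis .
  next
    case False
    have "\<bar>double_wavelet \<psi> V a b x\<bar> \<le> K * (1 + (\<rho> + \<bar>x\<bar>)\<^sup>2) * n * n"
      using double_wavelet_bound(2)[OF V K, of a b x] unfolding \<rho>_def n_def .
    also have "\<dots> \<le> C2"
    proof -
      have "\<bar>\<rho> + \<bar>x\<bar>\<bar> \<le> \<bar>\<rho>\<bar> + X" using False by linarith
      then have "\<bar>\<rho> + \<bar>x\<bar>\<bar>\<^sup>2 \<le> (\<bar>\<rho>\<bar> + X)\<^sup>2" by (intro power_mono) auto
      then show ?thesis
        unfolding C2_def using K(2) n by (intro mult_right_mono mult_left_mono) auto
    qed
    also have "C2 \<le> (2 * C1 + C2 * (1 + X\<^sup>2)) / (1 + x\<^sup>2)"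
    proof -
      have "x\<^sup>2 \<le> X\<^sup>2" using False by (metis abs_ge_zero linear not_le power2_abs power_mono)
      then have "C2 * (1 + x\<^sup>2) \<le> C2 * (1 + X\<^sup>2)" using C2 by (intro mult_left_mono) auto
      also have "\<dots> \<le> 2 * C1 + C2 * (1 + X\<^sup>2)" using C1 by simp
      finally show ?thesis by (simp add: pos_le_divide_eq add_pos_nonneg)
    qed
    finally show ?thesis .
  qed
  have "2 * C1 + C2 * (1 + X\<^sup>2) \<ge> 0" using C1 C2 by simp
  with main show ?thesis by blast
qed

end

end

section \<open>Mean-square integrals\<close>

lemma simple_L2_integral:
  fixes s :: "(real set \<times> ('a \<Rightarrow> 'v::euclidean_space)) list"
  assumes s: "\<forall>(E, \<xi>)\<in>set s. E \<in> finite_borel \<and> square_integrable P \<xi>" and \<eta>: "square_integrable P \<eta>"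
  shows "square_integrable P (\<lambda>\<omega>. \<Sum>(E, \<xi>)\<leftarrow>s. indicator E z *\<^sub>R \<xi> \<omega>)"
    and "square_integrable P (\<lambda>\<omega>. \<Sum>(E, \<xi>)\<leftarrow>s. measure lborel E *\<^sub>R \<xi> \<omega>)"
    and "has_bochner_integral lborel (\<lambda>z. L2_inner P (\<lambda>\<omega>. \<Sum>(E, \<xi>)\<leftarrow>s. indicator E z *\<^sub>R \<xi> \<omega>) \<eta>)
      (L2_inner P (\<lambda>\<omega>. \<Sum>(E, \<xi>)\<leftarrow>s. measure lborel E *\<^sub>R \<xi> \<omega>) \<eta>)"
proof -
  have "(\<forall>z. square_integrable P (\<lambda>\<omega>. \<Sum>(E, \<xi>)\<leftarrow>s. indicator E z *\<^sub>R \<xi> \<omega>)) \<and>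
      square_integrable P (\<lambda>\<omega>. \<Sum>(E, \<xi>)\<leftarrow>s. measure lborel E *\<^sub>R \<xi> \<omega>) \<and>
      has_bochner_integral lborel (\<lambda>z. L2_inner P (\<lambda>\<omega>. \<Sum>(E, \<xi>)\<leftarrow>s. indicator E z *\<^sub>R \<xi> \<omega>) \<eta>)
        (L2_inner P (\<lambda>\<omega>. \<Sum>(E, \<xi>)\<leftarrow>s. measure lborel E *\<^sub>R \<xi> \<omega>) \<eta>)"
    using s
  proof (induction s)
    case Nil
    then show ?case by (simp add: sqi_zero L2_inner_def has_bochner_integral_zero)
  next
    case (Cons p s)
    obtain E \<xi> where p: "p = (E, \<xi>)" by fastforce
    have E: "E \<in> finite_borel" and \<xi>: "square_integrable P \<xi>" using Cons.prems p by auto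
    have IH1: "square_integrable P (\<lambda>\<omega>. \<Sum>(E, \<xi>)\<leftarrow>s. indicator E z *\<^sub>R \<xi> \<omega>)"
      and IH2: "square_integrable P (\<lambda>\<omega>. \<Sum>(E, \<xi>)\<leftarrow>s. measure lborel E *\<^sub>R \<xi> \<omega>)"
      and IH3: "has_bochner_integral lborel (\<lambda>z. L2_inner P (\<lambda>\<omega>. \<Sum>(E, \<xi>)\<leftarrow>s. indicator E z *\<^sub>R \<xi> \<omega>) \<eta>)
        (L2_inner P (\<lambda>\<omega>. \<Sum>(E, \<xi>)\<leftarrow>s. measure lborel E *\<^sub>R \<xi> \<omega>) \<eta>)" for z
      using Cons.IH Cons.prems by auto
    have "has_bochner_integral lborel (\<lambda>z. indicator E z * L2_inner P \<xi> \<eta> + L2_inner P (\<lambda>\<omega>. \<Sum>(E, \<xi>)\<leftarrow>s. indicator E z *\<^sub>R \<xi> \<omega>) \<eta>)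
        (measure lborel E * L2_inner P \<xi> \<eta> + L2_inner P (\<lambda>\<omega>. \<Sum>(E, \<xi>)\<leftarrow>s. measure lborel E *\<^sub>R \<xi> \<omega>) \<eta>)"
      using E by (intro has_bochner_integral_add IH3 has_bochner_integral_mult_left has_bochner_integral_real_indicator)
        (auto simp: finite_borel_def)
    then show ?case
      unfolding p list.map sum_list.Cons prod.case
        L2_inner_add_left[OF sqi_scaleR[OF \<xi>] IH1 \<eta>] L2_inner_add_left[OF sqi_scaleR[OF \<xi>] IH2 \<eta>] L2_inner_scaleR_left
      by (intro conjI allI sqi_add sqi_scaleR \<xi> IH1 IH2)
  qed
  then show "square_integrable P (\<lambda>\<omega>. \<Sum>(E, \<xi>)\<leftarrow>s. indicator E z *\<^sub>R \<xi> \<omega>)"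
    "square_integrable P (\<lambda>\<omega>. \<Sum>(E, \<xi>)\<leftarrow>s. measure lborel E *\<^sub>R \<xi> \<omega>)"
    "has_bochner_integral lborel (\<lambda>z. L2_inner P (\<lambda>\<omega>. \<Sum>(E, \<xi>)\<leftarrow>s. indicator E z *\<^sub>R \<xi> \<omega>) \<eta>)
      (L2_inner P (\<lambda>\<omega>. \<Sum>(E, \<xi>)\<leftarrow>s. measure lborel E *\<^sub>R \<xi> \<omega>) \<eta>)"
    by blast+
qed

text \<open>The factor \<open>L2_dist\<close> in the definition of the mean-square integral need not be measurable in \<open>z\<close>;
  its integral still dominates that of the measurable scalar function below.\<close>

lemma mean_square_integral_weak_unit:
  fixes X :: "real \<Rightarrow> 'a \<Rightarrow> 'v::euclidean_space"
  assumes msi: "mean_square_integral P X Y" and \<eta>: "square_integrable P \<eta>" and unit: "L2_inner P \<eta> \<eta> \<le> 1"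
    and meas: "(\<lambda>z. L2_inner P (X z) \<eta>) \<in> borel_measurable borel"
  shows "L2_inner P Y \<eta> = (\<integral>z. L2_inner P (X z) \<eta> \<partial>lborel)"
proof -
  define S where "S k z \<omega> = (\<Sum>(E, \<xi>)\<leftarrow>(k :: (real set \<times> ('a \<Rightarrow> 'v)) list). indicator E z *\<^sub>R \<xi> \<omega>)" for k and z :: real and \<omega>
  define U where "U k \<omega> = (\<Sum>(E, \<xi>)\<leftarrow>(k :: (real set \<times> ('a \<Rightarrow> 'v)) list). measure lborel E *\<^sub>R \<xi> \<omega>)" for k and \<omega>
  have X: "square_integrable P (X z)" and Y: "square_integrable P Y" for z
    using msi by (simp_all only: mean_square_integral_def)
  have "\<exists>s. (\<forall>k. \<forall>(E, \<xi>)\<in>set (s k). E \<in> finite_borel \<and> square_integrable P \<xi>) \<and>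
      (\<lambda>k. \<integral>\<^sup>+z. ennreal (L2_dist P (X z) (S (s k) z)) \<partial>lborel) \<longlonglongrightarrow> 0 \<and>
      (\<lambda>k. L2_dist P Y (U (s k))) \<longlonglongrightarrow> 0"
    using msi unfolding mean_square_integral_def S_def[abs_def] U_def[abs_def] by (elim conjE)
  then obtain s where s: "\<forall>k. \<forall>(E, \<xi>)\<in>set (s k). E \<in> finite_borel \<and> square_integrable P \<xi>"
    and lS: "(\<lambda>k. \<integral>\<^sup>+z. ennreal (L2_dist P (X z) (S (s k) z)) \<partial>lborel) \<longlonglongrightarrow> 0"
    and lU: "(\<lambda>k. L2_dist P Y (U (s k))) \<longlonglongrightarrow> 0"
    by (elim exE conjE)
  define h where "h z = L2_inner P (X z) \<eta>" for z
  define g where "g k z = L2_inner P (S (s k) z) \<eta>" for k z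
  have Ssq: "square_integrable P (S (s k) z)" and Usq: "square_integrable P (U (s k))"
    and gI: "has_bochner_integral lborel (g k) (L2_inner P (U (s k)) \<eta>)" for k z
    unfolding S_def[abs_def] U_def[abs_def] g_def[abs_def]
    by (rule simple_L2_integral[OF s[THEN spec, of k] \<eta>])+
  have gi: "integrable lborel (g k)" and gI': "(\<integral>z. g k z \<partial>lborel) = L2_inner P (U (s k)) \<eta>" for k
    using gI[of k] by (simp_all only: has_bochner_integral_iff)
  have hm: "h \<in> borel_measurable lborel" unfolding h_def[abs_def] using meas by (simp only: measurable_lborel2)
  have le: "norm (g k z - h z) \<le> L2_dist P (X z) (S (s k) z)" for k z
  proof -
    have "\<bar>h z - g k z\<bar> = \<bar>L2_inner P (\<lambda>\<omega>. X z \<omega> - S (s k) z \<omega>) \<eta>\<bar>"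
      unfolding h_def g_def L2_inner_diff_left[OF X Ssq \<eta>] ..
    also have "\<dots> \<le> L2_dist P (X z) (S (s k) z) * sqrt (L2_inner P \<eta> \<eta>)"
      unfolding L2_dist_inner by (rule L2_Cauchy_Schwarz[OF sqi_diff[OF X Ssq] \<eta>])
    also have "\<dots> \<le> L2_dist P (X z) (S (s k) z) * 1"
      using unit by (intro mult_left_mono L2_dist_nonneg) simp
    finally show ?thesis by (simp add: abs_minus_commute)
  qed
  have le': "(\<integral>\<^sup>+z. ennreal (norm (g k z - h z)) \<partial>lborel) \<le> (\<integral>\<^sup>+z. ennreal (L2_dist P (X z) (S (s k) z)) \<partial>lborel)" for k
    by (intro nn_integral_mono ennreal_leI le)
  have l0: "(\<lambda>k. \<integral>\<^sup>+z. ennreal (norm (g k z - h z)) \<partial>lborel) \<longlonglongrightarrow> 0"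
    by (rule tendsto_sandwich[OF _ _ tendsto_const lS]) (intro always_eventually allI zero_le le')+
  \<comment> \<open>A single approximant at finite distance from \<open>h\<close> makes
    \<open>h\<close> integrable.\<close>
  have "eventually (\<lambda>k. (\<integral>\<^sup>+z. ennreal (norm (g k z - h z)) \<partial>lborel) < 1) sequentially"
    using l0 by (rule order_tendstoD) simp
  then obtain k0 where k0: "(\<integral>\<^sup>+z. ennreal (norm (g k0 z - h z)) \<partial>lborel) < 1"
    by (rule eventually_happens'[OF sequentially_bot, THEN exE])
  have "integrable lborel (\<lambda>z. g k0 z - h z)"
  proof (rule integrableI_bounded)
    show "(\<lambda>z. g k0 z - h z) \<in> borel_measurable lborel"
      by (intro borel_measurable_diff borel_measurable_integrable[OF gi] hm)
    show "(\<integral>\<^sup>+z. ennreal (norm (g k0 z - h z)) \<partial>lborel) < \<infinity>"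
      using k0 by (rule order_less_trans) simp
  qed
  from Bochner_Integration.integrable_diff[OF gi[of k0] this]
  have hi: "integrable lborel h" by simp
  have "(\<lambda>k. \<integral>z. g k z \<partial>lborel) \<longlonglongrightarrow> (\<integral>z. h z \<partial>lborel)"
  proof -
    have "(\<lambda>k. ennreal (norm ((\<integral>z. g k z \<partial>lborel) - (\<integral>z. h z \<partial>lborel)))) \<longlonglongrightarrow> 0"
    proof (rule tendsto_sandwich[OF always_eventually always_eventually tendsto_const l0])
      show "\<forall>k. ennreal (norm ((\<integral>z. g k z \<partial>lborel) - (\<integral>z. h z \<partial>lborel))) \<le> (\<integral>\<^sup>+z. ennreal (norm (g k z - h z)) \<partial>lborel)"
        using integral_norm_bound_ennreal[OF Bochner_Integration.integrable_diff[OF gi hi]]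
        by (simp only: Bochner_Integration.integral_diff[OF gi hi] simp_thms)
    qed simp
    then have "(\<lambda>k. norm ((\<integral>z. g k z \<partial>lborel) - (\<integral>z. h z \<partial>lborel))) \<longlonglongrightarrow> 0"
      using tendsto_ennreal_iff[of "\<lambda>k. norm ((\<integral>z. g k z \<partial>lborel) - (\<integral>z. h z \<partial>lborel))" sequentially 0] by simp
    then show ?thesis by (rule LIM_zero_cancel[OF tendsto_norm_zero_cancel])
  qed
  then have 1: "(\<lambda>k. L2_inner P (U (s k)) \<eta>) \<longlonglongrightarrow> (\<integral>z. h z \<partial>lborel)" unfolding gI' .
  have 2: "(\<lambda>k. L2_inner P (U (s k)) \<eta>) \<longlonglongrightarrow> L2_inner P Y \<eta>"
    by (rule L2_inner_tendsto[OF Y \<eta> Usq \<eta> lU L2_dist_zero_const])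
  show ?thesis using LIMSEQ_unique[OF 2 1] unfolding h_def .
qed

lemma mean_square_integral_weak:
  fixes X :: "real \<Rightarrow> 'a \<Rightarrow> 'v::euclidean_space"
  assumes msi: "mean_square_integral P X Y" and \<eta>: "square_integrable P \<eta>"
    and meas: "(\<lambda>z. L2_inner P (X z) \<eta>) \<in> borel_measurable borel"
  shows "L2_inner P Y \<eta> = (\<integral>z. L2_inner P (X z) \<eta> \<partial>lborel)"
proof -
  define r where "r = sqrt (L2_inner P \<eta> \<eta>)"
  \<comment> \<open>Adding 1 keeps c positive and well defined also when \<eta> has norm 0.\<close>
  define c where "c = 1 / (r + 1)"
  have nn: "r \<ge> 0" by (simp add: r_def L2_inner_self_nonneg)
  then have c: "c > 0" unfolding c_def by (intro divide_pos_pos) linarith+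
  have "c * r \<le> 1" using nn by (simp add: c_def divide_le_eq)
  then have "(c * r)\<^sup>2 \<le> 1\<^sup>2" using c nn by (intro power_mono) auto
  then have u: "L2_inner P (\<lambda>\<omega>. c *\<^sub>R \<eta> \<omega>) (\<lambda>\<omega>. c *\<^sub>R \<eta> \<omega>) \<le> 1"
    unfolding L2_inner_scaleR_left L2_inner_scaleR_right
    by (simp add: r_def power_mult_distrib L2_inner_self_nonneg) (simp add: power2_eq_square mult.assoc)
  have "L2_inner P Y (\<lambda>\<omega>. c *\<^sub>R \<eta> \<omega>) = (\<integral>z. L2_inner P (X z) (\<lambda>\<omega>. c *\<^sub>R \<eta> \<omega>) \<partial>lborel)"
  proof (rule mean_square_integral_weak_unit[OF msi sqi_scaleR[OF \<eta>] u])
    show "(\<lambda>z. L2_inner P (X z) (\<lambda>\<omega>. c *\<^sub>R \<eta> \<omega>)) \<in> borel_measurable borel"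
      unfolding L2_inner_scaleR_right using meas by measurable
  qed
  then show ?thesis
    unfolding L2_inner_scaleR_right integral_mult_right_zero using c by simp
qed

text \<open>If \<open>R\<close> almost attains the distance of \<open>D\<close> from \<open>V\<close>, then \<open>D - R\<close> is almost orthogonal to \<open>V\<close>;
  so \<open>D\<close> lies in the closure of \<open>V\<close> as soon as near orthogonality to \<open>V\<close> forces near orthogonality to \<open>D\<close>.\<close>

lemma L2_closure_criterion:
  fixes D :: "'a \<Rightarrow> real"
  assumes V0: "(\<lambda>\<omega>. 0) \<in> V" and Vadd: "\<And>v w c. v \<in> V \<Longrightarrow> w \<in> V \<Longrightarrow> (\<lambda>\<omega>. v \<omega> + c *\<^sub>R w \<omega>) \<in> V"
    and Vsq: "\<And>v. v \<in> V \<Longrightarrow> square_integrable P v" and D: "square_integrable P D"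
    and crit: "\<And>R e. R \<in> V \<Longrightarrow> e \<ge> 0 \<Longrightarrow>
      (\<And>v. v \<in> V \<Longrightarrow> \<bar>L2_inner P (\<lambda>\<omega>. D \<omega> - R \<omega>) v\<bar> \<le> e * sqrt (L2_inner P v v)) \<Longrightarrow>
      L2_inner P (\<lambda>\<omega>. D \<omega> - R \<omega>) D \<le> e * K" and K: "K \<ge> 0"
  shows "\<exists>R. (\<forall>m :: nat. R m \<in> V) \<and> (\<lambda>m. L2_dist P D (R m)) \<longlonglongrightarrow> 0"
proof -
  define d where "d R = L2_inner P (\<lambda>\<omega>. D \<omega> - R \<omega>) (\<lambda>\<omega>. D \<omega> - R \<omega>)" for R
  define \<delta> where "\<delta> = (INF R\<in>V. d R)"
  have dnn: "d R \<ge> 0" for R unfolding d_def by (rule L2_inner_self_nonneg)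
  have bdd: "bdd_below (d ` V)" using dnn by (intro bdd_belowI[of _ 0]) auto
  have ne: "V \<noteq> {}" using V0 by blast
  have \<delta>0: "\<delta> \<ge> 0" unfolding \<delta>_def by (rule cINF_greatest[OF ne]) (rule dnn)
  have \<delta>le: "\<delta> \<le> d R" if "R \<in> V" for R unfolding \<delta>_def by (rule cINF_lower[OF bdd that])
  \<comment> \<open>\<open>K\<close> controls the pairing of the error with \<open>D\<close>, the
    square root bounds the norm of a near minimiser; together e M bounds the squared
    distance.\<close>
  define M where "M = K + sqrt (2 * L2_inner P D D + 2 * (\<delta> + 1))"
  have main: "\<exists>R\<in>V. d R < \<delta> + e\<^sup>2 \<and> d R \<le> e * M" if e: "0 < e" "e \<le> 1" for e
  proof -
    have "Inf (d ` V) < \<delta> + e\<^sup>2" using e by (simp add: \<delta>_def)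
    then obtain R where R: "R \<in> V" "d R < \<delta> + e\<^sup>2"
      using cInf_lessD[of "d ` V" "\<delta> + e\<^sup>2"] ne by blast
    note Rsq = Vsq[OF R(1)]
    note E = sqi_diff[OF D Rsq]
    have orth: "\<bar>L2_inner P (\<lambda>\<omega>. D \<omega> - R \<omega>) v\<bar> \<le> e * sqrt (L2_inner P v v)" if v: "v \<in> V" for v
    proof -
      define b n where "b = L2_inner P (\<lambda>\<omega>. D \<omega> - R \<omega>) v" and "n = L2_inner P v v"
      have n: "n \<ge> 0" by (simp add: n_def L2_inner_self_nonneg)
      \<comment> \<open>Near minimality in the direction v. The best choice a = b / n then yields
        b^2 <= e^2 n, the near orthogonality.\<close>
      have q: "- (e\<^sup>2) \<le> - 2 * a * b + a\<^sup>2 * n" for a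
      proof -
        have "\<delta> \<le> d (\<lambda>\<omega>. R \<omega> + a *\<^sub>R v \<omega>)" by (intro \<delta>le Vadd R(1) v)
        also have "d (\<lambda>\<omega>. R \<omega> + a *\<^sub>R v \<omega>) = L2_inner P (\<lambda>\<omega>. (D \<omega> - R \<omega>) - a *\<^sub>R v \<omega>) (\<lambda>\<omega>. (D \<omega> - R \<omega>) - a *\<^sub>R v \<omega>)"
          unfolding d_def by (simp only: diff_diff_add)
        also have "\<dots> = d R - 2 * a * b + a\<^sup>2 * n"
          unfolding L2_inner_square_expand[OF E Vsq[OF v]] d_def b_def n_def ..
        finally show ?thesis using R(2) by linarith
      qed
      have "b\<^sup>2 \<le> e\<^sup>2 * n"
      proof (cases "n = 0")
        case True
        have "b = 0"
        proof (rule ccontr)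
          assume "b \<noteq> 0"
          then have "e\<^sup>2 \<le> - 2" using q[of "(e\<^sup>2 + 1) / b"] True by simp
          then show False using zero_le_power2[of e] by linarith
        qed
        then show ?thesis using n by simp
      next
        case False
        then have "n > 0" using n by simp
        have "- (e\<^sup>2) \<le> - (b\<^sup>2 / n)"
          using q[of "b / n"] False by (simp add: power2_eq_square)
        then have "b\<^sup>2 / n \<le> e\<^sup>2" by simp
        then show ?thesis using \<open>n > 0\<close> by (simp add: divide_le_eq)
      qed
      then have "sqrt (b\<^sup>2) \<le> sqrt (e\<^sup>2 * n)" by (rule real_sqrt_le_mono)
      then show ?thesis using e by (simp add: real_sqrt_mult b_def n_def)
    qed
    have 1: "L2_inner P (\<lambda>\<omega>. D \<omega> - R \<omega>) D \<le> e * K"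
      using e by (intro crit R(1) orth) auto
    have "L2_inner P R R \<le> 2 * L2_inner P D D + 2 * d R"
    proof -
      have "0 \<le> L2_inner P (\<lambda>\<omega>. R \<omega> - 2 *\<^sub>R D \<omega>) (\<lambda>\<omega>. R \<omega> - 2 *\<^sub>R D \<omega>)" by (rule L2_inner_self_nonneg)
      also have "\<dots> = L2_inner P R R - 2 * 2 * L2_inner P R D + 2\<^sup>2 * L2_inner P D D"
        by (rule L2_inner_square_expand[OF Rsq D])
      finally have "0 \<le> L2_inner P R R - 4 * L2_inner P R D + 4 * L2_inner P D D" by simp
      moreover have "d R = L2_inner P D D - 2 * L2_inner P R D + L2_inner P R R"
        using L2_inner_square_expand[OF D Rsq, of 1] unfolding d_def scaleR_one L2_inner_commute[of P D R] by simp
      ultimately show ?thesis by linarith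
    qed
    also have "\<dots> \<le> 2 * L2_inner P D D + 2 * (\<delta> + 1)"
    proof -
      have "e\<^sup>2 \<le> 1" using e by (simp add: power_le_one)
      then have "d R \<le> \<delta> + 1" using R(2) by (meson add_left_mono less_imp_le order_trans)
      then show ?thesis by (intro add_left_mono mult_left_mono) simp_all
    qed
    finally have "sqrt (L2_inner P R R) \<le> sqrt (2 * L2_inner P D D + 2 * (\<delta> + 1))" by (rule real_sqrt_le_mono)
    then have "e * sqrt (L2_inner P R R) \<le> e * sqrt (2 * L2_inner P D D + 2 * (\<delta> + 1))"
      using e by (intro mult_left_mono) auto
    moreover have "d R = L2_inner P (\<lambda>\<omega>. D \<omega> - R \<omega>) D - L2_inner P (\<lambda>\<omega>. D \<omega> - R \<omega>) R"
      unfolding d_def by (rule L2_inner_diff_right[OF D Rsq E])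
    ultimately have "d R \<le> e * K + e * sqrt (2 * L2_inner P D D + 2 * (\<delta> + 1))"
      using 1 orth[OF R(1)] by linarith
    then have "d R \<le> e * M" by (simp add: M_def distrib_left)
    with R show ?thesis by blast
  qed
  have "\<exists>R. \<forall>m :: nat. R m \<in> V \<and> d (R m) \<le> (1 / real (Suc m)) * M"
  proof (rule choice, rule allI)
    fix m :: nat
    show "\<exists>R. R \<in> V \<and> d R \<le> (1 / real (Suc m)) * M"
      using main[of "1 / real (Suc m)"] by auto
  qed
  then obtain R where R: "\<And>m :: nat. R m \<in> V" "\<And>m. d (R m) \<le> (1 / real (Suc m)) * M" by blast
  have lim: "(\<lambda>m. sqrt ((1 / real (Suc m)) * M)) \<longlonglongrightarrow> 0"
  proof -
    have "(\<lambda>m. (1 / real (Suc m)) * M) \<longlonglongrightarrow> 0 * M"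
      by (intro tendsto_mult tendsto_const) (use LIMSEQ_inverse_real_of_nat in \<open>simp add: inverse_eq_divide\<close>)
    from tendsto_real_sqrt[OF this] show ?thesis by simp
  qed
  have "(\<lambda>m. L2_dist P D (R m)) \<longlonglongrightarrow> 0"
  proof (rule Lim_null_comparison[OF always_eventually lim], rule allI)
    fix m
    have "L2_dist P D (R m) = sqrt (d (R m))" by (simp only: L2_dist_inner d_def)
    also have "\<dots> \<le> sqrt ((1 / real (Suc m)) * M)" by (intro real_sqrt_le_mono R)
    finally show "norm (L2_dist P D (R m)) \<le> sqrt ((1 / real (Suc m)) * M)"
      by (simp only: real_norm_def abs_of_nonneg[OF L2_dist_nonneg])
  qed
  with R(1) show ?thesis by blast
qed

section \<open>Wavelet coefficients\<close>

lemma mat_powr_measurable: "(\<lambda>x. mat_powr x M $ i $ a) \<in> borel_measurable borel"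
proof -
  have "continuous_on UNIV (\<lambda>s. mat_exp (s *\<^sub>R M) $ i $ a)"
    by (intro continuous_at_imp_continuous_on ballI DERIV_isCont[OF DERIV_mat_exp])
  then have e: "(\<lambda>s. mat_exp (s *\<^sub>R M) $ i $ a) \<in> borel_measurable borel"
    by (rule borel_measurable_continuous_onI)
  have lm: "(\<lambda>x. mat_exp (ln x *\<^sub>R M) $ i $ a) \<in> borel_measurable borel"
    by (rule measurable_compose[OF _ e]) measurable
  have eq: "(\<lambda>x. mat_powr x M $ i $ a) = (\<lambda>x. if x \<in> {0<..} then mat_exp (ln x *\<^sub>R M) $ i $ a else 0)"
    by (auto simp: mat_powr_def)
  show ?thesis
    unfolding eq by (rule measurable_If_set[OF lm borel_measurable_const]) simp
qed

lemma variance_mat_measurable: "(\<lambda>y. variance_mat H S y $ i $ l) \<in> borel_measurable borel"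
proof -
  have m: "(\<lambda>y. mat_powr \<bar>y\<bar> H $ i $ a) \<in> borel_measurable borel" for i a
    by (rule measurable_compose[OF _ mat_powr_measurable]) measurable
  show ?thesis
    unfolding variance_mat_entry
    by (intro borel_measurable_sum borel_measurable_times borel_measurable_const m)
qed

lemma wavelet_facts:
  assumes "is_wavelet \<psi> N \<alpha>"
  obtains R where "R \<ge> 0" "integrable lborel \<psi>" "\<And>t. \<psi> t \<noteq> 0 \<Longrightarrow> \<bar>t\<bar> \<le> R"
    "(\<integral>t. \<psi> t \<partial>lborel) = 0" "(\<integral>t. \<psi> t * t \<partial>lborel) = 0"
proof -
  have i: "integrable lborel \<psi>" and N: "N \<ge> 2"
    and m: "\<And>q. q < N \<Longrightarrow> has_bochner_integral lborel (\<lambda>t. t ^ q * \<psi> t) 0"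
    and ex: "\<exists>a b. closure {t. \<psi> t \<noteq> 0} = {a..b}"
    using assms unfolding is_wavelet_def by simp_all
  obtain a b where ab: "closure {t. \<psi> t \<noteq> 0} = {a..b}" using ex by blast
  have "\<bar>t\<bar> \<le> \<bar>a\<bar> + \<bar>b\<bar>" if "\<psi> t \<noteq> 0" for t
  proof -
    have "t \<in> closure {t. \<psi> t \<noteq> 0}" by (rule subsetD[OF closure_subset]) (simp add: that)
    then show ?thesis unfolding ab by auto
  qed
  moreover have "(\<integral>t. t ^ 0 * \<psi> t \<partial>lborel) = 0" "(\<integral>t. t ^ 1 * \<psi> t \<partial>lborel) = 0"
    using m[of 0] m[of 1] N by (simp_all only: has_bochner_integral_iff)
  ultimately show ?thesis
    by (intro that[of "\<bar>a\<bar> + \<bar>b\<bar>"] i) (simp_all add: mult.commute)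
qed

text \<open>Testing a vector-valued integral against a variable along axis i extracts its component
  i.\<close>

lemma sqi_axis:
  fixes W :: "'a \<Rightarrow> real"
  assumes "square_integrable P W" shows "square_integrable P (\<lambda>\<omega>. axis i (W \<omega>) :: real^'n)"
proof (rule sqi_contraction[OF assms])
  show "(\<lambda>\<omega>. axis i (W \<omega>) :: real^'n) \<in> borel_measurable P"
  proof (rule borel_measurable_vec)
    fix m
    show "(\<lambda>\<omega>. (axis i (W \<omega>) :: real^'n) $ m) \<in> borel_measurable P"
      unfolding axis_def vec_lambda_beta
      by (cases "m = i") (simp_all only: if_True if_False simp_thms sqi_meas[OF assms] borel_measurable_const)
  qed
  show "norm (axis i (W \<omega>) :: real^'n) \<le> norm (W \<omega>)" for \<omega>
    by (simp add: norm_eq_sqrt_inner inner_axis_axis)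
qed

lemma L2_inner_axis:
  fixes X :: "'a \<Rightarrow> real^'n"
  shows "L2_inner P X (\<lambda>\<omega>. axis i (W \<omega>)) = L2_inner P (\<lambda>\<omega>. X \<omega> $ i) W"
  by (simp only: L2_inner_def inner_axis)

lemma real_combination_add:
  fixes b :: "'t \<Rightarrow> 'n::finite \<Rightarrow> real"
  assumes "finite I" "finite J"
  shows "(\<Sum>t\<in>I \<union> J. \<Sum>i\<in>UNIV. ((if t \<in> I then c t i else 0) + (if t \<in> J then d t i else 0)) * b t i) =
    (\<Sum>t\<in>I. \<Sum>i\<in>UNIV. c t i * b t i) + (\<Sum>t\<in>J. \<Sum>i\<in>UNIV. d t i * b t i)"
proof -
  have "(\<Sum>t\<in>I \<union> J. \<Sum>i\<in>UNIV. ((if t \<in> I then c t i else 0) + (if t \<in> J then d t i else 0)) * b t i) =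
      (\<Sum>t\<in>I \<union> J. if t \<in> I then \<Sum>i\<in>UNIV. c t i * b t i else 0) +
      (\<Sum>t\<in>I \<union> J. if t \<in> J then \<Sum>i\<in>UNIV. d t i * b t i else 0)"
    unfolding sum.distrib[symmetric]
    by (intro sum.cong refl) (auto simp: sum.distrib distrib_right)
  also have "(\<Sum>t\<in>I \<union> J. if t \<in> I then \<Sum>i\<in>UNIV. c t i * b t i else 0) = (\<Sum>t\<in>I. \<Sum>i\<in>UNIV. c t i * b t i)"
    using assms by (subst sum.inter_restrict[symmetric]) (auto intro: sum.cong)
  also have "(\<Sum>t\<in>I \<union> J. if t \<in> J then \<Sum>i\<in>UNIV. d t i * b t i else 0) = (\<Sum>t\<in>J. \<Sum>i\<in>UNIV. d t i * b t i)"
    using assms by (subst sum.inter_restrict[symmetric]) (auto intro: sum.cong)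
  finally show ?thesis .
qed

section \<open>Finite linear combinations of the process\<close>

definition process_span :: "(real \<Rightarrow> 'a \<Rightarrow> real^'n) \<Rightarrow> ('a \<Rightarrow> real) set" where
  "process_span B = {v. \<exists>T c. finite T \<and> v = (\<lambda>\<omega>. \<Sum>t\<in>T. \<Sum>i\<in>UNIV. c t i *\<^sub>R B t \<omega> $ i)}"

lemma process_span_zero: "(\<lambda>\<omega>. 0) \<in> process_span B"
  unfolding process_span_def by (rule CollectI, rule exI[of _ "{}"]) simp

lemma process_span_add:
  assumes "v \<in> process_span B" "w \<in> process_span B"
  shows "(\<lambda>\<omega>. v \<omega> + a *\<^sub>R w \<omega>) \<in> process_span B"
proof -
  obtain I c where I: "finite I" "v = (\<lambda>\<omega>. \<Sum>t\<in>I. \<Sum>i\<in>UNIV. c t i *\<^sub>R B t \<omega> $ i)"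
    using assms(1) unfolding process_span_def by (elim CollectE exE conjE)
  obtain J d where J: "finite J" "w = (\<lambda>\<omega>. \<Sum>t\<in>J. \<Sum>i\<in>UNIV. d t i *\<^sub>R B t \<omega> $ i)"
    using assms(2) unfolding process_span_def by (elim CollectE exE conjE)
  have "v \<omega> + a *\<^sub>R w \<omega> = (\<Sum>t\<in>I. \<Sum>i\<in>UNIV. c t i * B t \<omega> $ i) + (\<Sum>t\<in>J. \<Sum>i\<in>UNIV. (a * d t i) * B t \<omega> $ i)" for \<omega>
    unfolding I(2) J(2) by (simp add: sum_distrib_left mult.assoc)
  then have "(\<lambda>\<omega>. v \<omega> + a *\<^sub>R w \<omega>) = (\<lambda>\<omega>. \<Sum>t\<in>I \<union> J. \<Sum>i\<in>UNIV.
      ((if t \<in> I then c t i else 0) + (if t \<in> J then a * d t i else 0)) *\<^sub>R B t \<omega> $ i)"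
    by (simp only: real_combination_add[OF I(1) J(1)] real_scaleR_def)
  moreover have "finite (I \<union> J)" using I(1) J(1) by simp
  ultimately show ?thesis
    unfolding process_span_def by (intro CollectI exI conjI)
qed

lemma process_span_component: "(\<lambda>\<omega>. B t \<omega> $ i) \<in> process_span B"
proof -
  have "(\<lambda>\<omega>. B t \<omega> $ i) = (\<lambda>\<omega>. \<Sum>s\<in>{t}. \<Sum>m\<in>UNIV. (if m = i then 1 else 0) *\<^sub>R B s \<omega> $ m)"
    by (simp add: if_distrib[of "\<lambda>t. t * _"] sum.delta' cong: if_cong)
  then show ?thesis
    unfolding process_span_def by (intro CollectI exI[of _ "{t}"] exI[of _ "\<lambda>_ m. if m = i then 1 else 0"] conjI) simp_all
qed

lemma process_span_sum:
  assumes "\<And>r. r \<in> J \<Longrightarrow> v r \<in> process_span B"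
  shows "(\<lambda>\<omega>. \<Sum>r\<in>J. u r *\<^sub>R v r \<omega>) \<in> process_span B"
  using assms
proof (induction J rule: infinite_finite_induct)
  case (insert r J)
  have "(\<lambda>\<omega>. (\<Sum>r\<in>J. u r *\<^sub>R v r \<omega>) + u r *\<^sub>R v r \<omega>) \<in> process_span B"
    by (intro process_span_add insert.IH insert.prems) simp_all
  then show ?case using insert.hyps by (simp add: add.commute)
qed (simp_all add: process_span_zero)

context
  fixes P :: "'a measure" and Q :: "'q measure" and Z :: "real set \<Rightarrow> 'q \<Rightarrow> complex^'n"
    and H :: "real^'n^'n" and A :: "complex^'n^'n" and B :: "real \<Rightarrow> 'a \<Rightarrow> real^'n"
    and \<psi> :: "real \<Rightarrow> real" and R K :: real and Dc :: "nat \<Rightarrow> int \<Rightarrow> 'a \<Rightarrow> real^'n" and S :: "real^'n^'n"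
  assumes B: "is_ofbm Q Z H A P B" and rev: "Im_mat (A ** adjoint_mat A) = 0"
    and Dc: "wavelet_coefficients P B \<psi> Dc" and S: "S = second_moment P (B 1)"
    and R: "R \<ge> 0" and \<psi>: "integrable lborel \<psi>" and supp: "\<And>t. \<psi> t \<noteq> 0 \<Longrightarrow> \<bar>t\<bar> \<le> R"
    and m0: "(\<integral>t. \<psi> t \<partial>lborel) = 0"
    and K: "K \<ge> 0" "\<And>t i l. \<bar>variance_mat H S t $ i $ l\<bar> \<le> K * (1 + t\<^sup>2)"
begin

section \<open>Covariances and joint Gaussianity of wavelet coefficients\<close>

lemma cov_B: "L2_inner P (\<lambda>\<omega>. B s \<omega> $ i) (\<lambda>\<omega>. B t \<omega> $ l) =
    (variance_mat H S s $ i $ l + variance_mat H S t $ i $ l - variance_mat H S (s - t) $ i $ l) / 2"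
  unfolding S by (rule ofbm_covariance[OF B rev])

lemma var_B: "L2_inner P (\<lambda>\<omega>. B t \<omega> $ i) (\<lambda>\<omega>. B t \<omega> $ l) = variance_mat H S t $ i $ l"
  unfolding cov_B by (simp add: variance_mat_zero)

lemma variance_mat_sym: "variance_mat H S t $ i $ l = variance_mat H S t $ l $ i"
  unfolding var_B[symmetric] by (rule L2_inner_commute)

lemma Dc_sqi: "square_integrable P (\<lambda>\<omega>. Dc j k \<omega> $ i)"
  using Dc unfolding wavelet_coefficients_def mean_square_integral_def by (intro sqi_vec_nth) blast

text \<open>The weak form of the mean-square integral, one component at a time. Its measurability
  premise is checked for each test variable from explicit covariances.\<close>

lemma Dc_weak:
  assumes W: "square_integrable P W"
    and meas: "(\<lambda>z. L2_inner P (\<lambda>\<omega>. B (2 ^ j * z + 2 ^ j * of_int k) \<omega> $ i) W) \<in> borel_measurable borel"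
  shows "L2_inner P (\<lambda>\<omega>. Dc j k \<omega> $ i) W =
    (\<integral>z. \<psi> z * L2_inner P (\<lambda>\<omega>. B (2 ^ j * z + 2 ^ j * of_int k) \<omega> $ i) W \<partial>lborel)"
proof -
  have msi: "mean_square_integral P (\<lambda>z \<omega>. \<psi> z *\<^sub>R B (2 ^ j * z + 2 ^ j * of_int k) \<omega>) (Dc j k)"
    using Dc unfolding wavelet_coefficients_def by blast
  have e: "L2_inner P (\<lambda>\<omega>. \<psi> z *\<^sub>R B (2 ^ j * z + 2 ^ j * of_int k) \<omega>) (\<lambda>\<omega>. axis i (W \<omega>)) =
      \<psi> z * L2_inner P (\<lambda>\<omega>. B (2 ^ j * z + 2 ^ j * of_int k) \<omega> $ i) W" for z
    unfolding L2_inner_axis vector_scaleR_component by (rule L2_inner_scaleR_left)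
  have "(\<lambda>z. \<psi> z * L2_inner P (\<lambda>\<omega>. B (2 ^ j * z + 2 ^ j * of_int k) \<omega> $ i) W) \<in> borel_measurable borel"
    by (intro borel_measurable_times psi_meas[OF \<psi> supp] meas)
  from mean_square_integral_weak[OF msi sqi_axis[OF W, of i], unfolded e, OF this]
  show ?thesis unfolding L2_inner_axis .
qed

lemma variance_affine_measurable: "(\<lambda>z. variance_mat H S (a * z + b) $ i $ l) \<in> borel_measurable borel"
  by (rule measurable_compose[OF _ variance_mat_measurable]) measurable

lemma variance_affine_integrable: "integrable lborel (\<lambda>z. \<psi> z * variance_mat H S (a * z + b) $ i $ l)"
proof (rule weighted_integral_bound(1)[OF \<psi> variance_affine_measurable])
  fix z assume "\<psi> z \<noteq> 0"
  then have "\<bar>a\<bar> * \<bar>z\<bar> \<le> \<bar>a\<bar> * R" by (intro mult_left_mono supp) auto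
  then have "\<bar>a * z + b\<bar> \<le> \<bar>a\<bar> * R + \<bar>b\<bar>"
    using abs_triangle_ineq[of "a * z" b] by (simp add: abs_mult)
  then have "\<bar>a * z + b\<bar>\<^sup>2 \<le> (\<bar>a\<bar> * R + \<bar>b\<bar>)\<^sup>2" by (intro power_mono) auto
  then have "K * (1 + (a * z + b)\<^sup>2) \<le> K * (1 + (\<bar>a\<bar> * R + \<bar>b\<bar>)\<^sup>2)" using K(1) by (intro mult_left_mono) auto
  then show "\<bar>variance_mat H S (a * z + b) $ i $ l\<bar> \<le> K * (1 + (\<bar>a\<bar> * R + \<bar>b\<bar>)\<^sup>2)"
    using K(2)[of "a * z + b" i l] by linarith
qed

lemma cov_affine_measurable: "(\<lambda>z. L2_inner P (\<lambda>\<omega>. B (a * z + b) \<omega> $ i) (\<lambda>\<omega>. B t \<omega> $ l)) \<in> borel_measurable borel"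
proof -
  have e: "a * z + b - t = a * z + (b - t)" for z by simp
  show ?thesis
    unfolding cov_B e
    by (intro borel_measurable_divide borel_measurable_diff borel_measurable_add borel_measurable_const variance_affine_measurable)
qed

text \<open>The term V(s) / 2 of the covariance does not depend on the integration variable and
  disappears because \<psi> has integral 0.\<close>

lemma cov_D_B:
  "L2_inner P (\<lambda>\<omega>. Dc j k \<omega> $ l) (\<lambda>\<omega>. B s \<omega> $ i) =
    ((\<integral>w. \<psi> w * variance_mat H S (2 ^ j * w + 2 ^ j * of_int k) $ i $ l \<partial>lborel)
      - (\<integral>w. \<psi> w * variance_mat H S (s - (2 ^ j * w + 2 ^ j * of_int k)) $ i $ l \<partial>lborel)) / 2"
proof -
  define \<tau> where "\<tau> w = 2 ^ j * w + 2 ^ j * of_int k" for w :: real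
  have i1: "integrable lborel (\<lambda>w. \<psi> w * variance_mat H S (\<tau> w) $ i $ l)"
    unfolding \<tau>_def by (rule variance_affine_integrable)
  have "integrable lborel (\<lambda>w. \<psi> w * variance_mat H S (- (2 ^ j) * w + (s - 2 ^ j * of_int k)) $ i $ l)"
    by (rule variance_affine_integrable)
  moreover have "- (2 ^ j) * w + (s - 2 ^ j * of_int k) = s - \<tau> w" for w by (simp add: \<tau>_def)
  ultimately have i2: "integrable lborel (\<lambda>w. \<psi> w * variance_mat H S (s - \<tau> w) $ i $ l)" by (simp only:)
  have e: "\<psi> w * L2_inner P (\<lambda>\<omega>. B (\<tau> w) \<omega> $ l) (\<lambda>\<omega>. B s \<omega> $ i) =
      (\<psi> w * variance_mat H S (\<tau> w) $ i $ l - \<psi> w * variance_mat H S (s - \<tau> w) $ i $ l) / 2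
        + (variance_mat H S s $ i $ l / 2) * \<psi> w" for w
    unfolding cov_B variance_mat_sym[of _ l i] using variance_mat_minus[of H S "s - \<tau> w"] by (simp add: field_simps)
  have "L2_inner P (\<lambda>\<omega>. Dc j k \<omega> $ l) (\<lambda>\<omega>. B s \<omega> $ i) = (\<integral>w. \<psi> w * L2_inner P (\<lambda>\<omega>. B (\<tau> w) \<omega> $ l) (\<lambda>\<omega>. B s \<omega> $ i) \<partial>lborel)"
    unfolding \<tau>_def by (rule Dc_weak[OF ofbm_sqi[OF B] cov_affine_measurable])
  also have "\<dots> = (\<integral>w. (\<psi> w * variance_mat H S (\<tau> w) $ i $ l - \<psi> w * variance_mat H S (s - \<tau> w) $ i $ l) / 2 \<partial>lborel)
      + (\<integral>w. (variance_mat H S s $ i $ l / 2) * \<psi> w \<partial>lborel)"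
    unfolding e
    by (rule Bochner_Integration.integral_add)
       (intro integrable_divide Bochner_Integration.integrable_diff i1 i2 integrable_mult_right \<psi>)+
  also have "\<dots> = ((\<integral>w. \<psi> w * variance_mat H S (\<tau> w) $ i $ l \<partial>lborel) - (\<integral>w. \<psi> w * variance_mat H S (s - \<tau> w) $ i $ l \<partial>lborel)) / 2"
    by (simp only: integral_mult_right_zero m0 mult_zero_right add_0_right integral_divide_zero
        Bochner_Integration.integral_diff[OF i1 i2])
  finally show ?thesis unfolding \<tau>_def .
qed

lemma cov_D_B_affine:
  "L2_inner P (\<lambda>\<omega>. B (2 ^ j' * z + 2 ^ j' * of_int k') \<omega> $ i) (\<lambda>\<omega>. Dc j k \<omega> $ l) =
    ((\<integral>w. \<psi> w * variance_mat H S (2 ^ j * w + 2 ^ j * of_int k) $ i $ l \<partial>lborel)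
      - (\<integral>w. \<psi> w * variance_mat H S (2 ^ j' * z - 2 ^ j * w + (2 ^ j' * of_int k' - 2 ^ j * of_int k)) $ i $ l \<partial>lborel)) / 2"
proof -
  have "2 ^ j' * z + 2 ^ j' * of_int k' - (2 ^ j * w + 2 ^ j * of_int k) =
      2 ^ j' * z - 2 ^ j * w + (2 ^ j' * of_int k' - 2 ^ j * of_int k)" for w :: real by simp
  then show ?thesis
    unfolding L2_inner_commute[of P _ "\<lambda>\<omega>. Dc j k \<omega> $ l"] cov_D_B by (simp only:)
qed

lemma cov_D_B_measurable:
  "(\<lambda>z. L2_inner P (\<lambda>\<omega>. B (2 ^ j' * z + 2 ^ j' * of_int k') \<omega> $ i) (\<lambda>\<omega>. Dc j k \<omega> $ l)) \<in> borel_measurable borel"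
  unfolding cov_D_B_affine
  by (intro borel_measurable_divide borel_measurable_diff borel_measurable_const
      inner_wavelet_measurable[OF \<psi> supp variance_mat_measurable])

text \<open>Integration over the second wavelet leaves a term constant in z, which the first wavelet
  removes. Only the variance of time differences survives, so the positions enter through 2^j k -
  2^j' k' alone.\<close>

theorem wavelet_covariance:
  "L2_inner P (\<lambda>\<omega>. Dc j k \<omega> $ i) (\<lambda>\<omega>. Dc j' k' \<omega> $ l) =
    - (1/2) * double_wavelet \<psi> (\<lambda>y. variance_mat H S y $ i $ l) (2 ^ j) (2 ^ j') (2 ^ j * of_int k - 2 ^ j' * of_int k')"
proof -
  define a where "a = (\<integral>w. \<psi> w * variance_mat H S (2 ^ j' * w + 2 ^ j' * of_int k') $ i $ l \<partial>lborel)"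
  define I where "I z = (\<integral>w. \<psi> w * variance_mat H S (2 ^ j * z - 2 ^ j' * w + (2 ^ j * of_int k - 2 ^ j' * of_int k')) $ i $ l \<partial>lborel)" for z
  have iI: "integrable lborel (\<lambda>z. \<psi> z * I z)"
    unfolding I_def by (rule double_wavelet_bound(1)[OF \<psi> supp variance_mat_measurable K(2) K(1)])
  have e: "\<psi> z * ((a - I z) / 2) = (a / 2) * \<psi> z + - (1/2) * (\<psi> z * I z)" for z
    by (simp add: field_simps)
  have "L2_inner P (\<lambda>\<omega>. Dc j k \<omega> $ i) (\<lambda>\<omega>. Dc j' k' \<omega> $ l) = (\<integral>z. \<psi> z * ((a - I z) / 2) \<partial>lborel)"
    using Dc_weak[OF Dc_sqi[of j' k' l] cov_D_B_measurable, of j k i] unfolding cov_D_B_affine a_def I_def .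
  also have "\<dots> = (\<integral>z. (a / 2) * \<psi> z \<partial>lborel) + (\<integral>z. - (1/2) * (\<psi> z * I z) \<partial>lborel)"
    unfolding e by (rule Bochner_Integration.integral_add) (intro integrable_mult_right \<psi> iI)+
  also have "\<dots> = - (1/2) * (\<integral>z. \<psi> z * I z \<partial>lborel)"
    by (simp only: integral_mult_right_zero m0 mult_zero_right add_0)
  finally show ?thesis unfolding double_wavelet_def I_def .
qed

text \<open>Pairing an error E with the coefficient is an integral over z of pairings of E with
  \<open>B\<close> at times in a bounded interval. If E is nearly orthogonal to the span, each of
  these is at most e M, so the closure criterion applies.\<close>

lemma Dc_closure: "\<exists>X. (\<forall>m :: nat. X m \<in> process_span B) \<and> (\<lambda>m. L2_dist P (\<lambda>\<omega>. Dc j k \<omega> $ i) (X m)) \<longlonglongrightarrow> 0"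
proof -
  define \<tau> where "\<tau> z = 2 ^ j * z + 2 ^ j * of_int k" for z :: real
  define M where "M = sqrt (K * (1 + (2 ^ j * R + \<bar>2 ^ j * of_int k\<bar>)\<^sup>2))"
  define n where "n = (\<integral>t. \<bar>\<psi> t\<bar> \<partial>lborel)"
  have n: "n \<ge> 0" unfolding n_def by (intro Bochner_Integration.integral_nonneg) simp
  have M: "M \<ge> 0" unfolding M_def using K(1) by simp
  have Vsq: "square_integrable P v" if mem: "v \<in> process_span B" for v
  proof -
    obtain T c where "finite T" and v: "v = (\<lambda>\<omega>. \<Sum>t\<in>T. \<Sum>i\<in>UNIV. c t i *\<^sub>R B t \<omega> $ i)"
      using mem unfolding process_span_def by (elim CollectE exE conjE)
    show ?thesis unfolding v by (intro sqi_sum sqi_scaleR ofbm_sqi[OF B])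
  qed
  show ?thesis
  proof (rule L2_closure_criterion[OF process_span_zero process_span_add Vsq Dc_sqi, where K = "M * n"])
    show "0 \<le> M * n" using M n by simp
    fix X e assume X: "X \<in> process_span B" and e: "0 \<le> e"
      and orth: "\<And>v. v \<in> process_span B \<Longrightarrow> \<bar>L2_inner P (\<lambda>\<omega>. Dc j k \<omega> $ i - X \<omega>) v\<bar> \<le> e * sqrt (L2_inner P v v)"
    define E where "E = (\<lambda>\<omega>. Dc j k \<omega> $ i - X \<omega>)"
    have E: "square_integrable P E" unfolding E_def by (rule sqi_diff[OF Dc_sqi Vsq[OF X]])
    obtain T c where "finite T" and v: "X = (\<lambda>\<omega>. \<Sum>t\<in>T. \<Sum>i\<in>UNIV. c t i *\<^sub>R B t \<omega> $ i)"
      using X unfolding process_span_def by (elim CollectE exE conjE)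
    have LX: "L2_inner P W X = (\<Sum>t\<in>T. \<Sum>i\<in>UNIV. c t i * L2_inner P W (\<lambda>\<omega>. B t \<omega> $ i))" if W: "square_integrable P W" for W
    proof -
      have "L2_inner P W X = (\<Sum>t\<in>T. L2_inner P W (\<lambda>\<omega>. \<Sum>i\<in>UNIV. c t i *\<^sub>R B t \<omega> $ i))"
        unfolding v by (rule L2_inner_sum_right) (intro sqi_sum sqi_scaleR ofbm_sqi[OF B] W)+
      also have "\<dots> = (\<Sum>t\<in>T. \<Sum>i\<in>UNIV. L2_inner P W (\<lambda>\<omega>. c t i *\<^sub>R B t \<omega> $ i))"
        by (intro sum.cong refl L2_inner_sum_right sqi_scaleR ofbm_sqi[OF B] W)
      finally show ?thesis unfolding L2_inner_scaleR_right .
    qed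
    \<comment> \<open>E is a coefficient minus a finite combination, so this function of z is a
      combination of covariances already known to be measurable.\<close>
    have meas: "(\<lambda>z. L2_inner P (\<lambda>\<omega>. B (2 ^ j * z + 2 ^ j * of_int k) \<omega> $ i) E) \<in> borel_measurable borel"
      unfolding E_def L2_inner_diff_right[OF Dc_sqi Vsq[OF X] ofbm_sqi[OF B]] LX[OF ofbm_sqi[OF B]]
      by (intro borel_measurable_diff borel_measurable_sum borel_measurable_times borel_measurable_const
          cov_D_B_measurable cov_affine_measurable)
    have "L2_inner P E (\<lambda>\<omega>. Dc j k \<omega> $ i) = (\<integral>z. \<psi> z * L2_inner P (\<lambda>\<omega>. B (2 ^ j * z + 2 ^ j * of_int k) \<omega> $ i) E \<partial>lborel)"
      unfolding L2_inner_commute[of P E] by (rule Dc_weak[OF E meas])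
    also have "\<bar>\<dots>\<bar> \<le> (e * M) * n"
      unfolding n_def
    proof (rule weighted_integral_bound(2)[OF \<psi> meas])
      fix z assume z: "\<psi> z \<noteq> 0"
      have "\<bar>L2_inner P (\<lambda>\<omega>. B (\<tau> z) \<omega> $ i) E\<bar> \<le> e * sqrt (L2_inner P (\<lambda>\<omega>. B (\<tau> z) \<omega> $ i) (\<lambda>\<omega>. B (\<tau> z) \<omega> $ i))"
        unfolding L2_inner_commute[of P _ E] unfolding E_def by (rule orth[OF process_span_component])
      also have "\<dots> \<le> e * M"
      proof (intro mult_left_mono e)
        have "\<bar>2 ^ j * z\<bar> \<le> 2 ^ j * R" using supp[OF z] by (simp add: abs_mult)
        then have "\<bar>\<tau> z\<bar> \<le> 2 ^ j * R + \<bar>2 ^ j * of_int k\<bar>"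
          unfolding \<tau>_def using abs_triangle_ineq[of "2 ^ j * z" "2 ^ j * of_int k"] by linarith
        then have "\<bar>\<tau> z\<bar>\<^sup>2 \<le> (2 ^ j * R + \<bar>2 ^ j * of_int k\<bar>)\<^sup>2" by (intro power_mono) auto
        then have "K * (1 + (\<tau> z)\<^sup>2) \<le> K * (1 + (2 ^ j * R + \<bar>2 ^ j * of_int k\<bar>)\<^sup>2)"
          using K(1) by (intro mult_left_mono) auto
        then show "sqrt (L2_inner P (\<lambda>\<omega>. B (\<tau> z) \<omega> $ i) (\<lambda>\<omega>. B (\<tau> z) \<omega> $ i)) \<le> M"
          unfolding var_B M_def using K(2)[of "\<tau> z" i i] by (intro real_sqrt_le_mono) linarith
      qed
      finally show "\<bar>L2_inner P (\<lambda>\<omega>. B (2 ^ j * z + 2 ^ j * of_int k) \<omega> $ i) E\<bar> \<le> e * M"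
        unfolding \<tau>_def .
    qed
    finally show "L2_inner P (\<lambda>\<omega>. Dc j k \<omega> $ i - X \<omega>) (\<lambda>\<omega>. Dc j k \<omega> $ i) \<le> e * (M * n)"
      unfolding E_def by (simp add: mult.assoc)
  qed
qed

theorem wavelet_gaussian:
  fixes oct :: "'r \<Rightarrow> nat" and pos :: "'r \<Rightarrow> int" and crd :: "'r \<Rightarrow> 'n"
  shows "gaussian_rv P (\<lambda>\<omega>. \<Sum>r\<in>J. u r *\<^sub>R Dc (oct r) (pos r) \<omega> $ crd r)"
proof -
  have P: "prob_space P" using B by (simp only: is_ofbm_def)
  have "\<exists>X. \<forall>r. (\<forall>m :: nat. X r m \<in> process_span B) \<and> (\<lambda>m. L2_dist P (\<lambda>\<omega>. Dc (oct r) (pos r) \<omega> $ crd r) (X r m)) \<longlonglongrightarrow> 0"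
    by (rule choice, rule allI, rule Dc_closure)
  then obtain X where X0: "\<forall>r. (\<forall>m :: nat. X r m \<in> process_span B) \<and>
      (\<lambda>m. L2_dist P (\<lambda>\<omega>. Dc (oct r) (pos r) \<omega> $ crd r) (X r m)) \<longlonglongrightarrow> 0"
    by (rule exE)
  have X: "X r m \<in> process_span B"
    "(\<lambda>m. L2_dist P (\<lambda>\<omega>. Dc (oct r) (pos r) \<omega> $ crd r) (X r m)) \<longlonglongrightarrow> 0" for r m
    by (rule X0[THEN spec, THEN conjunct1, THEN spec], rule X0[THEN spec, THEN conjunct2])
  have span: "gaussian_rv P v" if v: "v \<in> process_span B" for v
  proof -
    obtain T c where T: "finite T" "v = (\<lambda>\<omega>. \<Sum>t\<in>T. \<Sum>i\<in>UNIV. c t i *\<^sub>R B t \<omega> $ i)"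
      using v unfolding process_span_def by (elim CollectE exE conjE)
    show ?thesis unfolding T(2) by (rule ofbm_gaussian[OF B T(1)])
  qed
  have Xsq: "square_integrable P (X r m)" for r m
    using span[OF X(1)] unfolding gaussian_rv_def by (rule conjunct1)
  show ?thesis
  proof (rule gaussian_rv_limit[OF P])
    show "square_integrable P (\<lambda>\<omega>. \<Sum>r\<in>J. u r *\<^sub>R Dc (oct r) (pos r) \<omega> $ crd r)"
      by (intro sqi_sum sqi_scaleR Dc_sqi)
    show "gaussian_rv P (\<lambda>\<omega>. \<Sum>r\<in>J. u r *\<^sub>R X r m \<omega>)" for m
      by (rule span[OF process_span_sum[OF X(1)]])
    show "(\<lambda>m. L2_dist P (\<lambda>\<omega>. \<Sum>r\<in>J. u r *\<^sub>R Dc (oct r) (pos r) \<omega> $ crd r) (\<lambda>\<omega>. \<Sum>r\<in>J. u r *\<^sub>R X r m \<omega>)) \<longlonglongrightarrow> 0"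
      by (intro L2_dist_sum_tendsto L2_dist_scaleR_tendsto sqi_scaleR Dc_sqi Xsq X(2))
  qed
qed

end

section \<open>Matrix integrals by entries, and integer lags\<close>

lemma integrable_mat:
  fixes f :: "'a \<Rightarrow> real^'n^'m"
  assumes "\<And>i l. integrable M (\<lambda>x. f x $ i $ l)"
  shows "integrable M f"
proof -
  have "f x = (\<Sum>i\<in>UNIV. \<Sum>l\<in>UNIV. (f x $ i $ l) *\<^sub>R axis i (axis l 1))" for x
  proof -
    have "(\<Sum>i'\<in>UNIV. \<Sum>l'\<in>UNIV. (f x $ i' $ l') *\<^sub>R axis i' (axis l' 1)) $ i $ l =
        (\<Sum>i'\<in>UNIV. if i' = i then \<Sum>l'\<in>UNIV. if l' = l then f x $ i' $ l' else 0 else 0)" for i l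
      unfolding sum_component vector_scaleR_component
      by (intro sum.cong refl) (auto simp: axis_def if_distrib[of "\<lambda>v. _ * v"] cong: if_cong)
    then show ?thesis by (simp add: vec_eq_iff)
  qed
  moreover have "integrable M (\<lambda>x. \<Sum>i\<in>UNIV. \<Sum>l\<in>UNIV. (f x $ i $ l) *\<^sub>R (axis i (axis l 1) :: real^'n^'m))"
    by (intro Bochner_Integration.integrable_sum integrable_scaleR_left assms)
  ultimately show ?thesis by (simp only:)
qed

lemma integral_mat_entry:
  fixes f :: "'a \<Rightarrow> real^'n^'m"
  assumes "\<And>i l. integrable M (\<lambda>x. f x $ i $ l)"
  shows "(\<integral>x. f x \<partial>M) $ i $ l = (\<integral>x. f x $ i $ l \<partial>M)"
proof -
  have "bounded_linear (\<lambda>A :: real^'n^'m. A $ i $ l)"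
    using bounded_linear_compose[OF bounded_linear_vec_nth[of l] bounded_linear_vec_nth[of i]] .
  from integral_bounded_linear[OF this integrable_mat[OF assms]] show ?thesis by (rule sym)
qed

lemma gcd_powers_of_two: "gcd (2 ^ j) (2 ^ j') = (2 :: nat) ^ min j j'"
proof (induction j j' rule: linorder_wlog)
  case (le a b)
  then have "(2 :: nat) ^ a dvd 2 ^ b" by (rule le_imp_power_dvd)
  then show ?case using le by (simp add: gcd_nat.absorb1)
next
  case (sym a b)
  then show ?case by (simp add: gcd.commute min.commute)
qed

text \<open>The integer z at which Omega is evaluated: 2^j k - 2^j' k' divided by the gcd. At least
  one of the two powers is 1, so every integer is a lag.\<close>

definition lag :: "nat \<Rightarrow> nat \<Rightarrow> int \<Rightarrow> int \<Rightarrow> int" where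
  "lag j j' k k' = 2 ^ (j - min j j') * k - 2 ^ (j' - min j j') * k'"

lemma lag_gcd: "of_int (lag j j' k k') * real (gcd (2 ^ j) (2 ^ j')) = 2 ^ j * of_int k - 2 ^ j' * of_int k'"
proof -
  have e: "(2 :: real) ^ (i - min j j') * 2 ^ min j j' = 2 ^ i" if "min j j' \<le> i" for i
    using that by (simp flip: power_add)
  have "of_int (lag j j' k k') * real (gcd (2 ^ j) (2 ^ j')) =
      (2 ^ (j - min j j') * 2 ^ min j j') * of_int k - (2 ^ (j' - min j j') * 2 ^ min j j') * (of_int k' :: real)"
    unfolding lag_def gcd_powers_of_two by (simp add: algebra_simps)
  then show ?thesis by (simp only: e min.cobounded1 min.cobounded2)
qed

lemma lag_commute: "lag j' j k' k = - lag j j' k k'"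
  by (simp add: lag_def min.commute)

lemma lag_surj: obtains k k' where "lag j j' k k' = z"
proof (cases "j \<le> j'")
  case True then show ?thesis using that[of z 0] by (simp add: lag_def)
next
  case False then show ?thesis using that[of 0 "- z"] by (simp add: lag_def)
qed

lemma inj_lag: "inj (lag j j' k)"
  by (rule injI) (simp add: lag_def)

section \<open>Omega as a covariance, and its decay\<close>

context
  fixes P :: "'a measure" and Q :: "'q measure" and Z :: "real set \<Rightarrow> 'q \<Rightarrow> complex^'n"
    and H :: "real^'n^'n" and A :: "complex^'n^'n" and B :: "real \<Rightarrow> 'a \<Rightarrow> real^'n"
    and \<psi> :: "real \<Rightarrow> real" and R K K' :: real and Dc :: "nat \<Rightarrow> int \<Rightarrow> 'a \<Rightarrow> real^'n" and S :: "real^'n^'n"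
  assumes B: "is_ofbm Q Z H A P B" and rev: "Im_mat (A ** adjoint_mat A) = 0"
    and Dc: "wavelet_coefficients P B \<psi> Dc" and S: "S = second_moment P (B 1)"
    and R: "R \<ge> 0" and \<psi>: "integrable lborel \<psi>" and supp: "\<And>t. \<psi> t \<noteq> 0 \<Longrightarrow> \<bar>t\<bar> \<le> R"
    and m0: "(\<integral>t. \<psi> t \<partial>lborel) = 0" and m1: "(\<integral>t. \<psi> t * t \<partial>lborel) = 0"
    and K: "K \<ge> 0" "\<And>t i l. \<bar>variance_mat H S t $ i $ l\<bar> \<le> K * (1 + t\<^sup>2)"
    and K': "\<And>t. t \<ge> 1 \<Longrightarrow> norm (mat_powr t H) \<le> K' * t"
begin

text \<open>Omega integrates matrices, \<open>double_wavelet\<close> numbers. Passing to entries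
  requires integrability at both levels; where \<psi> t vanishes the inner integrand is 0, elsewhere
  the bound on the support applies.\<close>

lemma Omega_entry:
  "Omega \<psi> H S j j' z $ i $ l = - (1/2) * double_wavelet \<psi> (\<lambda>y. variance_mat H S y $ i $ l)
     (2 ^ j) (2 ^ j') (of_int z * real (gcd (2 ^ j) (2 ^ j')))"
proof -
  define x where "x = of_int z * real (gcd (2 ^ j) (2 ^ j'))"
  define f where "f t t' = (\<psi> t * \<psi> t') *\<^sub>R variance_mat H S (2 ^ j * t - 2 ^ j' * t' + x)" for t t'
  define I where "I i l t = (\<integral>t'. \<psi> t' * variance_mat H S (2 ^ j * t - 2 ^ j' * t' + x) $ i $ l \<partial>lborel)" for i l t
  have e: "f t t' $ i $ l = \<psi> t * (\<psi> t' * variance_mat H S (2 ^ j * t - 2 ^ j' * t' + x) $ i $ l)" for t t' i l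
    by (simp add: f_def mult.assoc)
  have i1: "integrable lborel (\<lambda>t'. f t t' $ i $ l)" for t i l
  proof (cases "\<psi> t = 0")
    case True then show ?thesis unfolding e by simp
  next
    case False
    then show ?thesis
      unfolding e
      by (intro integrable_mult_right inner_wavelet_integrable(1)[OF \<psi> supp variance_mat_measurable K(2) K(1)])
  qed
  have e2: "(\<integral>t'. f t t' \<partial>lborel) $ i $ l = \<psi> t * I i l t" for t i l
    unfolding integral_mat_entry[OF i1] unfolding e I_def by (rule integral_mult_right_zero)
  have i2: "integrable lborel (\<lambda>t. (\<integral>t'. f t t' \<partial>lborel) $ i $ l)" for i l
    unfolding e2 unfolding I_def by (rule double_wavelet_bound(1)[OF \<psi> supp variance_mat_measurable K(2) K(1)])
  have "Omega \<psi> H S j j' z = - (1/2) *\<^sub>R (\<integral>t. (\<integral>t'. f t t' \<partial>lborel) \<partial>lborel)"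
    unfolding Omega_def Let_def f_def x_def variance_mat_def ..
  then have "Omega \<psi> H S j j' z $ i $ l = - (1/2) * (\<integral>t. (\<integral>t'. f t t' \<partial>lborel) \<partial>lborel) $ i $ l"
    by simp
  also have "\<dots> = - (1/2) * (\<integral>t. \<psi> t * I i l t \<partial>lborel)"
    unfolding integral_mat_entry[OF i2] unfolding e2 ..
  finally show ?thesis unfolding double_wavelet_def I_def x_def .
qed

lemma wavelet_covariance_Omega:
  "L2_inner P (\<lambda>\<omega>. Dc j k \<omega> $ i) (\<lambda>\<omega>. Dc j' k' \<omega> $ l) = Omega \<psi> H S j j' (lag j j' k k') $ i $ l"
  unfolding Omega_entry lag_gcd by (rule wavelet_covariance[OF B rev Dc S R \<psi> supp m0 K])

lemma Omega_decay: "\<exists>C\<ge>0. \<forall>z i l. \<bar>Omega \<psi> H S j j' z $ i $ l\<bar> \<le> C / (1 + (of_int z)\<^sup>2)"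
proof -
  obtain C0 where C0: "C0 \<ge> 0" "\<forall>x y i l. x \<ge> 2 \<longrightarrow> \<bar>y\<bar> \<le> x / 2 \<longrightarrow>
      \<bar>mat_conj H S (x + y) $ i $ l - (\<Sum>r<4. conj_deriv H S i l r x / fact r * y ^ r)\<bar> \<le> C0 / x\<^sup>2 * y ^ 4"
    using conj_taylor[OF K', of S] by blast
  have "\<exists>C\<ge>0. \<forall>x. \<bar>double_wavelet \<psi> (\<lambda>y. variance_mat H S y $ i $ l) (2 ^ j) (2 ^ j') x\<bar> \<le> C / (1 + x\<^sup>2)" for i l
  proof (rule double_wavelet_decay[OF \<psi> supp m0 m1 variance_mat_measurable K(2) K(1)])
    show "variance_mat H S (- y) $ i $ l = variance_mat H S y $ i $ l" for y
      by (simp only: variance_mat_minus)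
    show "C0 \<ge> 0" by (rule C0(1))
    fix x :: real assume x: "x \<ge> 2"
    show "\<exists>c. \<forall>y. \<bar>y\<bar> \<le> x / 2 \<longrightarrow> \<bar>variance_mat H S (x + y) $ i $ l - (\<Sum>r<4. c r * y ^ r)\<bar> \<le> C0 / x\<^sup>2 * y ^ 4"
    proof (rule exI[of _ "\<lambda>r. conj_deriv H S i l r x / fact r"], intro allI impI)
      fix y assume y: "\<bar>y\<bar> \<le> x / 2"
      then have "\<bar>x + y\<bar> = x + y" using x by linarith
      then show "\<bar>variance_mat H S (x + y) $ i $ l - (\<Sum>r<4. conj_deriv H S i l r x / fact r * y ^ r)\<bar> \<le> C0 / x\<^sup>2 * y ^ 4"
        unfolding variance_mat_conj using C0(2) x y by simp
    qed
  qed
  then have "\<exists>C. \<forall>i l. C i l \<ge> 0 \<and> (\<forall>x. \<bar>double_wavelet \<psi> (\<lambda>y. variance_mat H S y $ i $ l) (2 ^ j) (2 ^ j') x\<bar> \<le> C i l / (1 + x\<^sup>2))"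
    by (intro choice allI) (auto intro!: choice)
  then obtain C where C: "\<And>i l. C i l \<ge> 0"
      "\<And>i l x. \<bar>double_wavelet \<psi> (\<lambda>y. variance_mat H S y $ i $ l) (2 ^ j) (2 ^ j') x\<bar> \<le> C i l / (1 + x\<^sup>2)"
    by blast
  define C1 where "C1 = (\<Sum>i\<in>UNIV. \<Sum>l\<in>UNIV. C i l)"
  have C1: "C i l \<le> C1" for i l
  proof -
    have "C i l \<le> (\<Sum>l\<in>UNIV. C i l)" by (rule member_le_sum) (simp_all add: C(1))
    also have "\<dots> \<le> C1" unfolding C1_def
      by (rule member_le_sum[of i UNIV "\<lambda>i. \<Sum>l\<in>UNIV. C i l"]) (simp_all add: C(1) sum_nonneg)
    finally show ?thesis .
  qed
  have C1n: "C1 \<ge> 0" using C(1) C1 by (rule order_trans)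
  show ?thesis
  proof (intro exI[of _ C1] conjI allI C1n)
    fix z i l
    \<comment> \<open>The real shift is z g with g at least 1, so decay in the shift implies the
      same decay in z.\<close>
    define g where "g = real (gcd (2 ^ j) (2 ^ j'))"
    have "g \<ge> 1" unfolding g_def gcd_powers_of_two by simp
    then have "g\<^sup>2 \<ge> 1" by simp
    then have "(of_int z :: real)\<^sup>2 * 1 \<le> (of_int z)\<^sup>2 * g\<^sup>2" by (intro mult_left_mono) auto
    then have zg: "1 + (of_int z :: real)\<^sup>2 \<le> 1 + (of_int z * g)\<^sup>2" by (simp add: power_mult_distrib)
    have "\<bar>Omega \<psi> H S j j' z $ i $ l\<bar> \<le> C i l / (1 + (of_int z * g)\<^sup>2)"
      unfolding Omega_entry g_def[symmetric] using C(2)[of i l "of_int z * g"]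
      unfolding abs_mult by linarith
    also have "\<dots> \<le> C1 / (1 + (of_int z)\<^sup>2)"
      using zg C1 C1n by (intro frac_le) (auto intro: add_pos_nonneg)
    finally show "\<bar>Omega \<psi> H S j j' z $ i $ l\<bar> \<le> C1 / (1 + (of_int z)\<^sup>2)" .
  qed
qed

end

section \<open>Averages over lags\<close>

lemma summable_on_inverse_square_int: "(\<lambda>z :: int. 1 / (1 + (of_int z)\<^sup>2) :: real) summable_on UNIV"
proof -
  have s: "summable (\<lambda>n. 1 / (1 + (real n)\<^sup>2))"
  proof (rule summable_comparison_test')
    show "summable (\<lambda>n. inverse (real n ^ 2))" by (rule inverse_power_summable) simp
    show "norm (1 / (1 + (real n)\<^sup>2)) \<le> inverse (real n ^ 2)" if "n \<ge> 1" for n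
      using that by (simp add: inverse_eq_divide frac_le)
  qed
  have n: "(\<lambda>n. 1 / (1 + (real n)\<^sup>2)) summable_on UNIV"
    using s by (intro norm_summable_imp_summable_on) simp
  have p: "(\<lambda>z :: int. 1 / (1 + (of_int z)\<^sup>2) :: real) summable_on (range int)"
    using n by (subst summable_on_reindex) (simp_all add: o_def)
  have q: "(\<lambda>z :: int. 1 / (1 + (of_int z)\<^sup>2) :: real) summable_on (range (\<lambda>n. - int n))"
    using n by (subst summable_on_reindex) (simp_all add: o_def inj_on_def)
  have u: "range int \<union> range (\<lambda>n. - int n) = UNIV"
  proof -
    have "z \<in> range int \<union> range (\<lambda>n. - int n)" for z by (cases z rule: int_cases2) auto
    then show ?thesis by blast
  qed
  have d: "(\<lambda>z :: int. 1 / (1 + (of_int z)\<^sup>2) :: real) summable_on (range (\<lambda>n. - int n) - range int)"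
    by (rule summable_on_subset_banach[OF q]) auto
  have "(\<lambda>z :: int. 1 / (1 + (of_int z)\<^sup>2) :: real) summable_on (range int \<union> (range (\<lambda>n. - int n) - range int))"
    by (rule summable_on_Un_disjoint[OF p d]) auto
  then show ?thesis using u by simp
qed

text \<open>Absolutely convergent sums over lags are treated as integrals for the counting measure,
  where dominated convergence is available.\<close>

lemma integrable_count_space_int:
  fixes a :: "int \<Rightarrow> real"
  assumes "\<And>z. \<bar>a z\<bar> \<le> C / (1 + (of_int z)\<^sup>2)"
  shows "integrable (count_space UNIV) a"
proof -
  have "(\<lambda>z. C * (1 / (1 + (of_int z)\<^sup>2))) summable_on (UNIV :: int set)"
    by (rule summable_on_cmult_right[OF summable_on_inverse_square_int])
  then have "(\<lambda>z. \<bar>a z\<bar>) summable_on UNIV"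
    by (rule summable_on_comparison_test) (use assms in auto)
  then have "Infinite_Set_Sum.abs_summable_on a UNIV"
    unfolding abs_summable_equivalent[symmetric] by simp
  then show ?thesis unfolding Infinite_Set_Sum.abs_summable_on_def .
qed

lemma integral_count_space_infsum:
  fixes a :: "int \<Rightarrow> real"
  assumes "integrable (count_space UNIV) a"
  shows "(\<integral>z. a z \<partial>count_space UNIV) = (\<Sum>\<^sub>\<infinity>z\<in>UNIV. a z)"
proof -
  have "Infinite_Set_Sum.abs_summable_on a UNIV"
    using assms unfolding Infinite_Set_Sum.abs_summable_on_def .
  from infsetsum_infsum[OF this] show ?thesis unfolding infsetsum_def by simp
qed

text \<open>For fixed k different k' have different lags, so the sum is part of the full series and
  its bound does not depend on the number of positions.\<close>

lemma lag_sum_bound: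
  assumes "finite F"
  shows "(\<Sum>k'\<in>F. 1 / (1 + (of_int (lag j j' k (int k')))\<^sup>2)) \<le> (\<Sum>\<^sub>\<infinity>z\<in>UNIV. 1 / (1 + (of_int z)\<^sup>2) :: real)"
proof -
  have i: "inj_on (\<lambda>k'. lag j j' k (int k')) F"
    by (rule inj_onI) (metis inj_lag injD of_nat_eq_iff)
  have "(\<Sum>k'\<in>F. 1 / (1 + (of_int (lag j j' k (int k')))\<^sup>2)) = (\<Sum>z\<in>(\<lambda>k'. lag j j' k (int k')) ` F. 1 / (1 + (of_int z)\<^sup>2) :: real)"
    by (simp add: sum.reindex[OF i] o_def)
  also have "\<dots> \<le> (\<Sum>\<^sub>\<infinity>z\<in>UNIV. 1 / (1 + (of_int z)\<^sup>2))"
    using assms by (intro finite_sum_le_infsum summable_on_inverse_square_int) auto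
  finally show ?thesis .
qed

text \<open>A lag \<open>z\<close> occurs at most once for each \<open>k'\<close>, and at all but \<open>2 \<bar>z\<bar>\<close> of the \<open>k'\<close>, so the
  average over \<open>k'\<close> converges by dominated convergence with respect to the counting measure.\<close>

lemma lag_average_aux:
  fixes a :: "int \<Rightarrow> real" and c :: nat
  assumes a: "integrable (count_space UNIV) a" and c: "c \<ge> 1"
  shows "(\<lambda>n. (\<Sum>k = 1..c * n. \<Sum>k' = 1..n. a (int k - int c * int k')) / real n) \<longlonglongrightarrow> (\<Sum>\<^sub>\<infinity>z\<in>UNIV. a z)"
proof -
  \<comment> \<open>The lags that k' realises together with some k in 1..c n; \<open>w n z\<close>
    is the proportion of the k' that realise z.\<close>
  define J where "J n k' = {1 - int c * int k'..int c * int n - int c * int k'}" for n k' :: nat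
  define w where "w n z = (\<Sum>k' = 1..n. indicator (J n k') z) / real n" for n and z :: int
  have ia: "integrable (count_space UNIV) (\<lambda>z. indicator (J n k') z * a z)" for n k'
    using integrable_mult_indicator[OF _ a, of "J n k'"] by simp
  have inner: "(\<Sum>k = 1..c * n. a (int k - int c * int k')) = (\<integral>z. indicator (J n k') z * a z \<partial>count_space UNIV)" for n k'
  proof -
    have "bij_betw (\<lambda>k. int k - int c * int k') {1..c * n} (J n k')"
    proof (rule bij_betwI[where g = "\<lambda>z. nat (z + int c * int k')"])
      show "(\<lambda>k. int k - int c * int k') \<in> {1..c * n} \<rightarrow> J n k'"
        unfolding J_def by (auto simp flip: of_nat_mult)
      show "(\<lambda>z. nat (z + int c * int k')) \<in> J n k' \<rightarrow> {1..c * n}"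
        unfolding J_def by (auto simp: nat_le_iff)
      show "nat (int k - int c * int k' + int c * int k') = k" for k by simp
      show "int (nat (z + int c * int k')) - int c * int k' = z" if "z \<in> J n k'" for z
        using that unfolding J_def by auto
    qed
    then have "(\<Sum>k = 1..c * n. a (int k - int c * int k')) = (\<Sum>z\<in>J n k'. a z)"
      by (rule sum.reindex_bij_betw)
    also have "\<dots> = (\<integral>z. indicator (J n k') z * a z \<partial>count_space UNIV)"
    proof -
      have "(\<Sum>\<^sub>\<infinity>z\<in>UNIV. indicator (J n k') z * a z) = (\<Sum>\<^sub>\<infinity>z\<in>J n k'. a z)"
        by (rule infsum_cong_neutral) auto
      moreover have "finite (J n k')" unfolding J_def by simp
      ultimately show ?thesis unfolding integral_count_space_infsum[OF ia] by simp
    qed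
    finally show ?thesis .
  qed
  have eq: "(\<Sum>k = 1..c * n. \<Sum>k' = 1..n. a (int k - int c * int k')) / real n = (\<integral>z. w n z * a z \<partial>count_space UNIV)" for n
  proof -
    have "(\<Sum>k = 1..c * n. \<Sum>k' = 1..n. a (int k - int c * int k')) = (\<Sum>k' = 1..n. \<integral>z. indicator (J n k') z * a z \<partial>count_space UNIV)"
      unfolding inner[symmetric] by (rule sum.swap)
    also have "\<dots> = (\<integral>z. (\<Sum>k' = 1..n. indicator (J n k') z * a z) \<partial>count_space UNIV)"
      by (rule Bochner_Integration.integral_sum[symmetric]) (rule ia)
    finally show ?thesis
      unfolding w_def by (simp add: sum_distrib_right times_divide_eq_left integral_divide_zero)
  qed
  have wle: "0 \<le> w n z" "w n z \<le> 1" for n z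
  proof -
    have "(\<Sum>k' = 1..n. indicator (J n k') z :: real) \<le> (\<Sum>k' = 1..n. 1)"
      by (intro sum_mono) (simp add: indicator_def)
    then show "w n z \<le> 1" unfolding w_def by (cases "n = 0") (simp_all add: divide_le_eq_1)
    show "0 \<le> w n z" unfolding w_def by (intro divide_nonneg_nonneg sum_nonneg) auto
  qed
  have wlow: "w n z \<ge> 1 - 2 * \<bar>of_int z\<bar> / real n" if n: "n > 0" for n z
  proof -
    \<comment> \<open>Every k' from 1 + m to n - m realises z. If n < 2 m the interval is empty and
      the lower bound is negative.\<close>
    define m where "m = nat \<bar>z\<bar>"
    have sub: "{1 + m..n - m} \<subseteq> {1..n}" by auto
    have one: "indicator (J n k') z = (1 :: real)" if k: "k' \<in> {1 + m..n - m}" for k'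
    proof -
      have k': "1 + m \<le> k'" "k' + m \<le> n" using k by auto
      have "m \<le> c * m" using c by simp
      moreover have "c * (1 + m) \<le> c * k'" "c * (k' + m) \<le> c * n" by (rule mult_le_mono2, rule k')+
      ultimately have "1 + m \<le> c * k'" "c * k' + m \<le> c * n" unfolding distrib_left mult_1_right using c by linarith+
      then have "1 + int m \<le> int c * int k'" "int c * int k' + int m \<le> int c * int n"
        unfolding of_nat_mult[symmetric] by linarith+
      then have "z \<in> J n k'" unfolding J_def m_def by auto
      then show ?thesis by simp
    qed
    have "real n - 2 * real m \<le> real (card {1 + m..n - m})" by simp
    also have "\<dots> = (\<Sum>k'\<in>{1 + m..n - m}. indicator (J n k') z)" by (simp add: one)
    also have "\<dots> \<le> (\<Sum>k' = 1..n. indicator (J n k') z)" by (rule sum_mono2) (use sub in auto)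
    finally have "(real n - 2 * real m) / real n \<le> w n z"
      unfolding w_def by (rule divide_right_mono) simp
    moreover have "(real n - 2 * real m) / real n = 1 - 2 * \<bar>of_int z\<bar> / real n"
      using n unfolding m_def by (simp add: diff_divide_distrib)
    ultimately show ?thesis by simp
  qed
  have wlim: "(\<lambda>n. w n z) \<longlonglongrightarrow> 1" for z
  proof (rule tendsto_sandwich)
    show "\<forall>\<^sub>F n in sequentially. 1 - 2 * \<bar>of_int z\<bar> / real n \<le> w n z"
      by (rule eventually_sequentiallyI[of 1]) (rule wlow, simp)
    show "\<forall>\<^sub>F n in sequentially. w n z \<le> 1" by (simp add: wle)
    show "(\<lambda>n. 1 - 2 * \<bar>of_int z\<bar> / real n) \<longlonglongrightarrow> 1" by real_asymp
  qed simp
  have "(\<lambda>n. \<integral>z. w n z * a z \<partial>count_space UNIV) \<longlonglongrightarrow> (\<integral>z. a z \<partial>count_space UNIV)"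
  proof (rule integral_dominated_convergence[where w = "\<lambda>z. \<bar>a z\<bar>"])
    show "AE z in count_space UNIV. (\<lambda>n. w n z * a z) \<longlonglongrightarrow> a z"
      using tendsto_mult_right[OF wlim] by (intro AE_I2) fastforce
    show "AE z in count_space UNIV. norm (w n z * a z) \<le> \<bar>a z\<bar>" for n
      by (intro AE_I2) (simp add: abs_mult mult_left_le_one_le wle)
  qed (use a in simp_all)
  then show ?thesis unfolding eq integral_count_space_infsum[OF a] .
qed

text \<open>For j <= j' there are eventually c = 2^(j' - j) coefficients at octave j for each one at
  octave j', so the normalisation is sqrt c times the number at j', and 1 / sqrt c equals 2^(-(j +
  j')/2) times the gcd 2^j.\<close>

lemma lag_average_le:
  fixes a :: "int \<Rightarrow> real"
  assumes a: "integrable (count_space UNIV) a" and j: "j \<le> j'"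
  shows "(\<lambda>N. (1 / (sqrt (real (num_coeffs (2 ^ N) j)) * sqrt (real (num_coeffs (2 ^ N) j')))) *
      (\<Sum>k = 1..num_coeffs (2 ^ N) j. \<Sum>k' = 1..num_coeffs (2 ^ N) j'. a (lag j j' (int k) (int k'))))
    \<longlonglongrightarrow> 2 powr (- (real (j + j') / 2)) * real (gcd (2 ^ j) (2 ^ j')) * (\<Sum>\<^sub>\<infinity>z\<in>UNIV. a z)"
proof -
  define c :: nat where "c = 2 ^ (j' - j)"
  have c: "c \<ge> 1" unfolding c_def by simp
  define n :: "nat \<Rightarrow> nat" where "n N = 2 ^ (N - j')" for N
  have fn: "filterlim n sequentially sequentially"
    unfolding n_def by real_asymp
  have const: "2 powr (- (real (j + j') / 2)) * real (gcd (2 ^ j) (2 ^ j')) = 1 / sqrt (real c)"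
  proof -
    have g: "real (gcd (2 ^ j) (2 ^ j')) = 2 powr real j"
      unfolding gcd_powers_of_two using j by (simp add: powr_realpow min_absorb1)
    have sc: "sqrt (real c) = 2 powr (real (j' - j) / 2)"
      unfolding c_def by (simp add: powr_half_sqrt[symmetric] powr_realpow[symmetric] powr_powr)
    show ?thesis
    proof -
      have "- (real (j + j') / 2) + real j = - (real (j' - j) / 2)" using j by (simp add: of_nat_diff field_simps)
      then have "2 powr (- (real (j + j') / 2)) * 2 powr real j = (2 :: real) powr (- (real (j' - j) / 2))"
        by (simp only: powr_add[symmetric])
      then show ?thesis using sc g by (simp only: powr_minus_divide)
    qed
  qed
  have lim: "(\<lambda>N. 1 / sqrt (real c) * ((\<Sum>k = 1..c * n N. \<Sum>k' = 1..n N. a (int k - int c * int k')) / real (n N)))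
      \<longlonglongrightarrow> 1 / sqrt (real c) * (\<Sum>\<^sub>\<infinity>z\<in>UNIV. a z)"
    by (intro tendsto_mult_left filterlim_compose[OF lag_average_aux[OF a c] fn])
  \<comment> \<open>For N at least j' both divisions in \<open>num_coeffs\<close> are exact.\<close>
  have ev: "(1 / (sqrt (real (num_coeffs (2 ^ N) j)) * sqrt (real (num_coeffs (2 ^ N) j')))) *
      (\<Sum>k = 1..num_coeffs (2 ^ N) j. \<Sum>k' = 1..num_coeffs (2 ^ N) j'. a (lag j j' (int k) (int k'))) =
      1 / sqrt (real c) * ((\<Sum>k = 1..c * n N. \<Sum>k' = 1..n N. a (int k - int c * int k')) / real (n N))"
    if N: "N \<ge> j'" for N
  proof -
    have Kj': "num_coeffs (2 ^ N) j' = n N"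
      unfolding num_coeffs_def n_def using N by (simp add: power_diff)
    have Kj: "num_coeffs (2 ^ N) j = c * n N"
    proof -
      have "c * n N = 2 ^ (N - j)" unfolding c_def n_def using N j by (simp flip: power_add)
      then show ?thesis unfolding num_coeffs_def using N j by (simp add: power_diff)
    qed
    have l: "lag j j' k k' = k - int c * k'" for k k'
      unfolding lag_def c_def using j by (simp add: min_absorb1)
    have "sqrt (real (c * n N)) * sqrt (real (n N)) = sqrt (real c) * real (n N)"
      by (simp add: real_sqrt_mult)
    then show ?thesis unfolding Kj' Kj l by simp
  qed
  show ?thesis
    unfolding const
    by (rule Lim_transform_eventually[OF lim], rule eventually_sequentiallyI[of j']) (rule ev[symmetric])
qed

text \<open>Exchanging octaves and positions negates the lag, so the case j' < j follows from the
  other one for the reflected sequence.\<close>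

lemma lag_average:
  fixes a :: "int \<Rightarrow> real"
  assumes a: "integrable (count_space UNIV) a"
  shows "(\<lambda>N. (1 / (sqrt (real (num_coeffs (2 ^ N) j)) * sqrt (real (num_coeffs (2 ^ N) j')))) *
      (\<Sum>k = 1..num_coeffs (2 ^ N) j. \<Sum>k' = 1..num_coeffs (2 ^ N) j'. a (lag j j' (int k) (int k'))))
    \<longlonglongrightarrow> 2 powr (- (real (j + j') / 2)) * real (gcd (2 ^ j) (2 ^ j')) * (\<Sum>\<^sub>\<infinity>z\<in>UNIV. a z)"
proof (cases "j \<le> j'")
  case True then show ?thesis by (rule lag_average_le[OF a])
next
  case False
  then have j: "j' \<le> j" by simp
  have bij: "bij_betw uminus (UNIV :: int set) UNIV" by (rule bij_betwI[where g = uminus]) auto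
  have am: "integrable (count_space UNIV) (\<lambda>z. a (- z))"
    using integrable_bij_count_space[OF bij, of a] a by simp
  have s: "(\<Sum>\<^sub>\<infinity>z\<in>UNIV. a (- z)) = (\<Sum>\<^sub>\<infinity>z\<in>UNIV. a z)"
    by (rule infsum_reindex_bij_betw[OF bij])
  have l: "a (- lag j' j (int k') (int k)) = a (lag j j' (int k) (int k'))" for k k'
    unfolding lag_commute[of j' j] by simp
  have sw: "(\<Sum>k' = 1..num_coeffs (2 ^ N) j'. \<Sum>k = 1..num_coeffs (2 ^ N) j. a (lag j j' (int k) (int k'))) =
      (\<Sum>k = 1..num_coeffs (2 ^ N) j. \<Sum>k' = 1..num_coeffs (2 ^ N) j'. a (lag j j' (int k) (int k')))" for N
    by (rule sum.swap)
  show ?thesis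
    using lag_average_le[OF am j]
    unfolding s l sw add.commute[of j' j] gcd.commute[of "2 ^ j'" "2 ^ j"]
      mult.commute[of "sqrt (real (num_coeffs _ j'))"] .
qed

section \<open>Fluctuations of the wavelet variances\<close>

lemma num_coeffs_tendsto: "filterlim (\<lambda>N. sqrt (real (num_coeffs (2 ^ N) j))) at_top sequentially"
proof -
  have "filterlim (\<lambda>N. sqrt (2 ^ (N - j))) at_top sequentially" by real_asymp
  then show ?thesis
  proof (rule filterlim_cong[THEN iffD1, OF refl refl, rotated])
    show "\<forall>\<^sub>F N in sequentially. sqrt (2 ^ (N - j)) = sqrt (real (num_coeffs (2 ^ N) j))"
      by (rule eventually_sequentiallyI[of j]) (simp add: num_coeffs_def power_diff[symmetric] flip: power_diff)
  qed
qed

lemma wavelet_W_entry: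
  "wavelet_W Dc \<nu> j \<omega> $ a $ b =
    (1 / real (num_coeffs \<nu> j)) * (\<Sum>k = 1..num_coeffs \<nu> j. Dc j (int k) \<omega> $ a * Dc j (int k) \<omega> $ b)"
  unfolding wavelet_W_def by (simp add: sum_component outer_def)

lemma sum_reorder:
  "(\<Sum>k\<in>A. \<Sum>p\<in>B. \<Sum>e\<in>C. \<Sum>k'\<in>D e. \<Sum>q\<in>E. f k p e k' q) =
    (\<Sum>e\<in>C. \<Sum>p\<in>B. \<Sum>q\<in>E. \<Sum>k\<in>A. \<Sum>k'\<in>D e. f k p e k' q)"
proof -
  have "(\<Sum>k\<in>A. \<Sum>p\<in>B. \<Sum>e\<in>C. \<Sum>k'\<in>D e. \<Sum>q\<in>E. f k p e k' q) =
      (\<Sum>k\<in>A. \<Sum>e\<in>C. \<Sum>p\<in>B. \<Sum>k'\<in>D e. \<Sum>q\<in>E. f k p e k' q)"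
    by (intro sum.cong refl sum.swap)
  also have "\<dots> = (\<Sum>e\<in>C. \<Sum>k\<in>A. \<Sum>p\<in>B. \<Sum>k'\<in>D e. \<Sum>q\<in>E. f k p e k' q)"
    by (rule sum.swap)
  also have "\<dots> = (\<Sum>e\<in>C. \<Sum>p\<in>B. \<Sum>k\<in>A. \<Sum>k'\<in>D e. \<Sum>q\<in>E. f k p e k' q)"
    by (rule sum.cong[OF refl], rule sum.swap)
  also have "\<dots> = (\<Sum>e\<in>C. \<Sum>p\<in>B. \<Sum>k\<in>A. \<Sum>q\<in>E. \<Sum>k'\<in>D e. f k p e k' q)"
    by (rule sum.cong[OF refl], rule sum.cong[OF refl], rule sum.cong[OF refl], rule sum.swap)
  also have "\<dots> = (\<Sum>e\<in>C. \<Sum>p\<in>B. \<Sum>q\<in>E. \<Sum>k\<in>A. \<Sum>k'\<in>D e. f k p e k' q)"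
    by (rule sum.cong[OF refl], rule sum.cong[OF refl], rule sum.swap)
  finally show ?thesis .
qed

context
  fixes P :: "'a measure" and Dc :: "nat \<Rightarrow> int \<Rightarrow> 'a \<Rightarrow> real^('n::{finite,linorder})"
    and Om :: "nat \<Rightarrow> nat \<Rightarrow> int \<Rightarrow> real^('n::{finite,linorder})^('n::{finite,linorder})" and oct :: "'m::finite \<Rightarrow> nat"
begin

text \<open>A site (e, k, i) encodes octave \<open>oct e\<close>, position k and coordinate i, so
  that all coefficients form one finite family of real variables.\<close>

definition obs :: "'a \<Rightarrow> 'm \<times> nat \<times> 'n \<Rightarrow> real" where
  "obs \<omega> r = Dc (oct (fst r)) (int (fst (snd r))) \<omega> $ snd (snd r)"

definition sites :: "nat \<Rightarrow> ('m \<times> nat \<times> 'n) set" where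
  "sites N = (SIGMA e:UNIV. {1..num_coeffs (2 ^ N) (oct e)} \<times> UNIV)"

definition obs_cov :: "'m \<times> nat \<times> 'n \<Rightarrow> 'm \<times> nat \<times> 'n \<Rightarrow> real" where
  "obs_cov r s = L2_inner P (\<lambda>\<omega>. obs \<omega> r) (\<lambda>\<omega>. obs \<omega> s)"

text \<open>The symmetric matrix \<open>U\<close> with \<open>\<Sum>\<^sub>p u\<^sub>e\<^sub>p vec\<^sub>S(x x\<^sup>*)\<^sub>p = x\<^sup>* U x\<close>.\<close>

definition sym_coeff :: "real^('m \<times> ('n::{finite,linorder}) sympair) \<Rightarrow> 'm \<Rightarrow> 'n \<Rightarrow> 'n \<Rightarrow> real" where
  "sym_coeff u e i i' = (\<Sum>p\<in>UNIV. u $ (e, p) *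
    (((if i = pfst p \<and> i' = psnd p then 1 else 0) + (if i = psnd p \<and> i' = pfst p then 1 else 0)) / 2))"

text \<open>Block diagonal with one block per octave and position. The weight is the product of sqrt
  K_j from the normalisation and 1 / K_j from the average.\<close>

definition quad :: "real^('m \<times> ('n::{finite,linorder}) sympair) \<Rightarrow> nat \<Rightarrow> 'm \<times> nat \<times> 'n \<Rightarrow> 'm \<times> nat \<times> 'n \<Rightarrow> real" where
  "quad u N r s = (if fst s = fst r \<and> fst (snd s) = fst (snd r)
     then sym_coeff u (fst r) (snd (snd r)) (snd (snd s)) / sqrt (real (num_coeffs (2 ^ N) (oct (fst r)))) else 0)"

text \<open>By the Isserlis formula this is, for \<open>Om\<close> the covariances at each lag, the
  covariance of a product of two coordinates of one coefficient with such a product for another at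
  lag z.\<close>

definition cross :: "'m \<Rightarrow> 'm \<Rightarrow> 'n sympair \<Rightarrow> ('n::{finite,linorder}) sympair \<Rightarrow> int \<Rightarrow> real" where
  "cross e e' p q z =
     Om (oct e) (oct e') z $ pfst p $ pfst q * Om (oct e) (oct e') z $ psnd p $ psnd q +
     Om (oct e) (oct e') z $ pfst p $ psnd q * Om (oct e) (oct e') z $ psnd p $ pfst q"

section \<open>Sums over sites\<close>

lemma finite_sites: "finite (sites N)"
  unfolding sites_def by (intro finite_SigmaI finite_cartesian_product) simp_all

lemma sum_sites:
  fixes f :: "'m \<times> nat \<times> 'n \<Rightarrow> real"
  shows "(\<Sum>r\<in>sites N. f r) = (\<Sum>e\<in>UNIV. \<Sum>k = 1..num_coeffs (2 ^ N) (oct e). \<Sum>i\<in>UNIV. f (e, k, i))"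
proof -
  have "(\<Sum>k = 1..num_coeffs (2 ^ N) (oct e). \<Sum>i\<in>UNIV. f (e, k, i)) =
      (\<Sum>y\<in>{1..num_coeffs (2 ^ N) (oct e)} \<times> UNIV. f (e, y))" for e
    unfolding sum.cartesian_product by (intro sum.cong refl) auto
  then have "(\<Sum>e\<in>UNIV. \<Sum>k = 1..num_coeffs (2 ^ N) (oct e). \<Sum>i\<in>UNIV. f (e, k, i)) =
      (\<Sum>e\<in>UNIV. \<Sum>y\<in>{1..num_coeffs (2 ^ N) (oct e)} \<times> UNIV. f (e, y))"
    by (intro sum.cong refl)
  also have "\<dots> = (\<Sum>(e, y)\<in>sites N. f (e, y))"
    unfolding sites_def by (rule sum.Sigma) simp_all
  also have "\<dots> = (\<Sum>r\<in>sites N. f r)"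
    by (intro sum.cong refl) (simp only: case_prod_beta prod.collapse)
  finally show ?thesis by (rule sym)
qed

lemma sum_block:
  fixes f :: "'m \<times> nat \<times> 'n \<Rightarrow> real"
  assumes "r \<in> sites N"
  shows "(\<Sum>s\<in>sites N. if fst s = fst r \<and> fst (snd s) = fst (snd r) then f s else 0) = (\<Sum>i\<in>UNIV. f (fst r, fst (snd r), i))"
proof -
  have k: "fst (snd r) \<in> {1..num_coeffs (2 ^ N) (oct (fst r))}" using assms unfolding sites_def by auto
  have "(\<Sum>s\<in>sites N. if fst s = fst r \<and> fst (snd s) = fst (snd r) then f s else 0) =
      (\<Sum>e\<in>UNIV. if e = fst r then \<Sum>k = 1..num_coeffs (2 ^ N) (oct e). if k = fst (snd r) then \<Sum>i\<in>UNIV. f (e, k, i) else 0 else 0)"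
  proof -
    have "(\<Sum>i\<in>UNIV. if e = fst r \<and> k = fst (snd r) then f (e, k, i) else 0) =
        (if e = fst r then if k = fst (snd r) then \<Sum>i\<in>UNIV. f (e, k, i) else 0 else 0)" for e k
      by (cases "e = fst r"; cases "k = fst (snd r)") simp_all
    moreover have "(\<Sum>k = 1..num_coeffs (2 ^ N) (oct e). if e = fst r then g k else 0) =
        (if e = fst r then \<Sum>k = 1..num_coeffs (2 ^ N) (oct e). g k else 0)" for e and g :: "nat \<Rightarrow> real"
      by (cases "e = fst r") simp_all
    ultimately show ?thesis unfolding sum_sites by (simp only: fst_conv snd_conv)
  qed
  also have "\<dots> = (\<Sum>i\<in>UNIV. f (fst r, fst (snd r), i))"
    using k by (simp add: sum.delta)
  finally show ?thesis .
qed

lemma sum_quad: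
  assumes r: "r \<in> sites N"
  shows "(\<Sum>s\<in>sites N. quad u N r s * f s) = (\<Sum>i\<in>UNIV. sym_coeff u (fst r) (snd (snd r)) i
    / sqrt (real (num_coeffs (2 ^ N) (oct (fst r)))) * f (fst r, fst (snd r), i))"
proof -
  have "(\<Sum>s\<in>sites N. quad u N r s * f s) = (\<Sum>s\<in>sites N. if fst s = fst r \<and> fst (snd s) = fst (snd r) then
      sym_coeff u (fst r) (snd (snd r)) (snd (snd s)) / sqrt (real (num_coeffs (2 ^ N) (oct (fst r)))) * f s else 0)"
    unfolding quad_def by (intro sum.cong refl) auto
  also have "\<dots> = (\<Sum>i\<in>UNIV. sym_coeff u (fst r) (snd (snd r)) (snd (snd (fst r, fst (snd r), i)))
      / sqrt (real (num_coeffs (2 ^ N) (oct (fst r)))) * f (fst r, fst (snd r), i))"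
    by (rule sum_block[OF r])
  finally show ?thesis by (simp only: snd_conv)
qed

lemma sum_sym_coeff:
  "(\<Sum>i\<in>UNIV. \<Sum>i'\<in>UNIV. sym_coeff u e i i' * f i i') =
    (\<Sum>p\<in>UNIV. u $ (e, p) * ((f (pfst p) (psnd p) + f (psnd p) (pfst p)) / 2))"
proof -
  have d: "(\<Sum>i\<in>UNIV. \<Sum>i'\<in>UNIV. (if i = a \<and> i' = b then 1 else 0) * f i i') = f a b" for a b
  proof -
    have "(\<Sum>i\<in>UNIV. \<Sum>i'\<in>UNIV. (if i = a \<and> i' = b then 1 else 0) * f i i') =
        (\<Sum>i\<in>UNIV. if i = a then \<Sum>i'\<in>UNIV. if i' = b then f i i' else 0 else 0)"
      by (intro sum.cong refl) (auto simp: if_distrib[of "\<lambda>v. v * _"] cong: if_cong)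
    then show ?thesis by simp
  qed
  have "(\<Sum>i\<in>UNIV. \<Sum>i'\<in>UNIV. sym_coeff u e i i' * f i i') =
      (\<Sum>i\<in>UNIV. \<Sum>p\<in>UNIV. \<Sum>i'\<in>UNIV. u $ (e, p) / 2 * ((if i = pfst p \<and> i' = psnd p then 1 else 0) * f i i'
        + (if i = psnd p \<and> i' = pfst p then 1 else 0) * f i i'))"
    unfolding sym_coeff_def sum_distrib_right
    by (intro sum.cong refl) (subst sum.swap, intro sum.cong refl, simp add: field_simps)
  also have "\<dots> = (\<Sum>p\<in>UNIV. \<Sum>i\<in>UNIV. \<Sum>i'\<in>UNIV. u $ (e, p) / 2 * ((if i = pfst p \<and> i' = psnd p then 1 else 0) * f i i'
        + (if i = psnd p \<and> i' = pfst p then 1 else 0) * f i i'))"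
    by (rule sum.swap)
  also have "\<dots> = (\<Sum>p\<in>UNIV. u $ (e, p) / 2 * (f (pfst p) (psnd p) + f (psnd p) (pfst p)))"
    unfolding sum_distrib_left[symmetric] sum.distrib d ..
  finally show ?thesis by simp
qed

lemma sum_quad2:
  "(\<Sum>r\<in>sites N. \<Sum>s\<in>sites N. quad u N r s * f r s) =
    (\<Sum>e\<in>UNIV. \<Sum>k = 1..num_coeffs (2 ^ N) (oct e).
      (\<Sum>i\<in>UNIV. \<Sum>i'\<in>UNIV. sym_coeff u e i i' * (f (e, k, i) (e, k, i') / sqrt (real (num_coeffs (2 ^ N) (oct e))))))"
proof -
  have "(\<Sum>r\<in>sites N. \<Sum>s\<in>sites N. quad u N r s * f r s) =
      (\<Sum>r\<in>sites N. \<Sum>i'\<in>UNIV. sym_coeff u (fst r) (snd (snd r)) i'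
        / sqrt (real (num_coeffs (2 ^ N) (oct (fst r)))) * f r (fst r, fst (snd r), i'))"
    by (intro sum.cong refl sum_quad)
  also have "\<dots> = (\<Sum>e\<in>UNIV. \<Sum>k = 1..num_coeffs (2 ^ N) (oct e). \<Sum>i\<in>UNIV. \<Sum>i'\<in>UNIV. sym_coeff u e i i'
        / sqrt (real (num_coeffs (2 ^ N) (oct e))) * f (e, k, i) (e, k, i'))"
    unfolding sum_sites by (simp only: fst_conv snd_conv)
  finally show ?thesis by (simp add: times_divide_eq_left times_divide_eq_right)
qed

lemma sym_coeff_sym: "sym_coeff u e i i' = sym_coeff u e i' i"
  unfolding sym_coeff_def by (intro sum.cong refl) (simp add: conj_commute add.commute)

context
  assumes P: "prob_space P"
    and sqi: "\<And>j k i. square_integrable P (\<lambda>\<omega>. Dc j k \<omega> $ i)"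
    and cov: "\<And>j k i j' k' l. L2_inner P (\<lambda>\<omega>. Dc j k \<omega> $ i) (\<lambda>\<omega>. Dc j' k' \<omega> $ l) = Om j j' (lag j j' k k') $ i $ l"
    and decay: "\<And>j j'. \<exists>C\<ge>0. \<forall>z i l. \<bar>Om j j' z $ i $ l\<bar> \<le> C / (1 + (of_int z)\<^sup>2)"
    and gauss: "\<And>(J :: ('m \<times> nat \<times> 'n) set) u.
      gaussian_rv P (\<lambda>\<omega>. \<Sum>r\<in>J. u r *\<^sub>R Dc (oct (fst r)) (int (fst (snd r))) \<omega> $ snd (snd r))"
begin

section \<open>Row sums, trace and limit law\<close>

lemma obs_cov_entry: "obs_cov (e, k, i) (e', k', i') = Om (oct e) (oct e') (lag (oct e) (oct e') (int k) (int k')) $ i $ i'"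
  unfolding obs_cov_def obs_def by (simp only: fst_conv snd_conv cov)

lemma obs_cov_commute: "obs_cov r s = obs_cov s r"
  unfolding obs_cov_def by (rule L2_inner_commute)

text \<open>Position k has lag 0 from itself, as position 0 has: within an octave the coefficients
  are stationary, so centring at position 0 fits every k.\<close>

lemma obs_cov_diag: "obs_cov (e, k, i) (e, k, i') = second_moment P (Dc (oct e) 0) $ i $ i'"
proof -
  have "obs_cov (e, k, i) (e, k, i') = L2_inner P (\<lambda>\<omega>. Dc (oct e) 0 \<omega> $ i) (\<lambda>\<omega>. Dc (oct e) 0 \<omega> $ i')"
    unfolding obs_cov_entry cov
    by (rule arg_cong[where f = "\<lambda>z. Om (oct e) (oct e) z $ i $ i'"]) (simp add: lag_def)
  then show ?thesis by (simp add: L2_inner_def second_moment_def)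
qed

lemma fluctuation_entry:
  "wavelet_fluctuation P Dc oct \<nu> \<omega> $ (e, p) = sqrt (real (num_coeffs \<nu> (oct e))) *
    ((1 / real (num_coeffs \<nu> (oct e))) * (\<Sum>k = 1..num_coeffs \<nu> (oct e). Dc (oct e) (int k) \<omega> $ pfst p * Dc (oct e) (int k) \<omega> $ psnd p)
      - second_moment P (Dc (oct e) 0) $ pfst p $ psnd p)"
  by (simp add: wavelet_fluctuation_def vec_S_def wavelet_EW_def wavelet_W_entry Let_def)

lemma fluctuation_quadratic:
  "u \<bullet> wavelet_fluctuation P Dc oct (2 ^ N) \<omega> =
    (\<Sum>r\<in>sites N. \<Sum>s\<in>sites N. quad u N r s * obs \<omega> r * obs \<omega> s) - (\<Sum>r\<in>sites N. \<Sum>s\<in>sites N. quad u N r s * obs_cov r s)"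
proof -
  define K where "K e = num_coeffs (2 ^ N) (oct e)" for e
  define h where "h e k i i' = Dc (oct e) (int k) \<omega> $ i * Dc (oct e) (int k) \<omega> $ i' - second_moment P (Dc (oct e) 0) $ i $ i'"
    for e k i i'
  have hs: "h e k i i' = h e k i' i" for e k i i'
    unfolding h_def second_moment_def by (simp add: mult.commute)
  have "(\<Sum>r\<in>sites N. \<Sum>s\<in>sites N. quad u N r s * obs \<omega> r * obs \<omega> s) - (\<Sum>r\<in>sites N. \<Sum>s\<in>sites N. quad u N r s * obs_cov r s) =
      (\<Sum>r\<in>sites N. \<Sum>s\<in>sites N. quad u N r s * (obs \<omega> r * obs \<omega> s - obs_cov r s))"
    by (simp only: sum_subtractf right_diff_distrib mult.assoc)
  also have "\<dots> = (\<Sum>e\<in>UNIV. \<Sum>k = 1..K e. \<Sum>i\<in>UNIV. \<Sum>i'\<in>UNIV. sym_coeff u e i i' * (h e k i i' / sqrt (real (K e))))"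
    unfolding sum_quad2 K_def h_def obs_cov_diag by (simp only: obs_def fst_conv snd_conv)
  also have "\<dots> = (\<Sum>e\<in>UNIV. \<Sum>k = 1..K e. \<Sum>p\<in>UNIV. u $ (e, p) * (h e k (pfst p) (psnd p) / sqrt (real (K e))))"
    unfolding sum_sym_coeff by (intro sum.cong refl) (simp add: hs[of _ _ "psnd _"])
  also have "\<dots> = (\<Sum>e\<in>UNIV. \<Sum>p\<in>UNIV. u $ (e, p) * (\<Sum>k = 1..K e. h e k (pfst p) (psnd p) / sqrt (real (K e))))"
    by (intro sum.cong refl) (subst sum.swap, simp only: sum_distrib_left)
  also have "\<dots> = (\<Sum>e\<in>UNIV. \<Sum>p\<in>UNIV. u $ (e, p) * wavelet_fluctuation P Dc oct (2 ^ N) \<omega> $ (e, p))"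
  proof (intro sum.cong refl arg_cong2[where f = "(*)"])
    fix e and p :: "'n sympair"
    define c where "c = second_moment P (Dc (oct e) 0) $ pfst p $ psnd p"
    define s where "s = (\<Sum>k = 1..K e. Dc (oct e) (int k) \<omega> $ pfst p * Dc (oct e) (int k) \<omega> $ psnd p)"
    have "(\<Sum>k = 1..K e. h e k (pfst p) (psnd p) / sqrt (real (K e))) = (s - real (K e) * c) / sqrt (real (K e))"
      unfolding h_def sum_divide_distrib[symmetric] sum_subtractf s_def c_def by simp
    also have "\<dots> = sqrt (real (K e)) * ((1 / real (K e)) * s - c)"
    \<comment> \<open>While 2^N is below the scale of the octave there are no coefficients, and both
      sides are 0.\<close>
    proof (cases "K e = 0")
      case False
      then have "sqrt (real (K e)) * sqrt (real (K e)) = real (K e)" "sqrt (real (K e)) \<noteq> 0" by simp_all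
      then show ?thesis by (simp add: field_simps False)
    qed simp
    finally show "(\<Sum>k = 1..K e. h e k (pfst p) (psnd p) / sqrt (real (K e))) = wavelet_fluctuation P Dc oct (2 ^ N) \<omega> $ (e, p)"
      unfolding fluctuation_entry K_def s_def c_def .
  qed
  also have "\<dots> = u \<bullet> wavelet_fluctuation P Dc oct (2 ^ N) \<omega>"
    by (simp add: inner_vec_def sum.cartesian_product case_prod_beta)
  finally show ?thesis by simp
qed

lemma obs_sqi: "square_integrable P (\<lambda>\<omega>. obs \<omega> r)"
  unfolding obs_def by (rule sqi)

lemma obs_char:
  "(\<integral>\<omega>. iexp (\<Sum>r\<in>sites N. u r * obs \<omega> r) \<partial>P) =
    of_real (exp (- (\<Sum>r\<in>sites N. \<Sum>s\<in>sites N. u r * obs_cov r s * u s) / 2))"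
proof -
  define X where "X \<omega> = (\<Sum>r\<in>sites N. u r *\<^sub>R obs \<omega> r)" for \<omega>
  have "gaussian_rv P X" unfolding X_def obs_def by (rule gauss)
  then have c: "(\<integral>\<omega>. iexp (X \<omega>) \<partial>P) = of_real (exp (- L2_inner P X X / 2))"
    unfolding gaussian_rv_def by (rule conjunct2)
  have r: "L2_inner P W X = (\<Sum>s\<in>sites N. u s * L2_inner P W (\<lambda>\<omega>. obs \<omega> s))" if "square_integrable P W" for W
    unfolding X_def
    by (subst L2_inner_sum_right[OF sqi_scaleR[OF obs_sqi] that]) (simp only: L2_inner_scaleR_right)
  have Xs: "square_integrable P X" unfolding X_def by (intro sqi_sum sqi_scaleR obs_sqi)
  have "L2_inner P X (\<lambda>\<omega>. obs \<omega> s) = (\<Sum>r\<in>sites N. u r * obs_cov s r)" for s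
    unfolding L2_inner_commute[of P X] obs_cov_def by (rule r[OF obs_sqi])
  then have "L2_inner P X X = (\<Sum>s\<in>sites N. u s * (\<Sum>r\<in>sites N. u r * obs_cov s r))"
    unfolding r[OF Xs] by (simp only:)
  also have "\<dots> = (\<Sum>r\<in>sites N. \<Sum>s\<in>sites N. u r * obs_cov r s * u s)"
    unfolding sum_distrib_left by (intro sum.cong refl) simp
  finally show ?thesis using c unfolding X_def by simp
qed

lemma uniform_decay: "\<exists>C\<ge>0. \<forall>e e' z i l. \<bar>Om (oct e) (oct e') z $ i $ l\<bar> \<le> C / (1 + (of_int z)\<^sup>2)"
proof -
  have "\<exists>C. \<forall>e e'. C e e' \<ge> 0 \<and> (\<forall>z i l. \<bar>Om (oct e) (oct e') z $ i $ l\<bar> \<le> C e e' / (1 + (of_int z)\<^sup>2))"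
    using decay by (intro choice allI) (auto intro!: choice)
  then obtain C where C: "\<And>e e'. C e e' \<ge> 0"
      "\<And>e e' z i l. \<bar>Om (oct e) (oct e') z $ i $ l\<bar> \<le> C e e' / (1 + (of_int z)\<^sup>2)"
    by blast
  define D where "D = (\<Sum>e\<in>UNIV. \<Sum>e'\<in>UNIV. C e e')"
  have le: "C e e' \<le> D" for e e'
  proof -
    have "C e e' \<le> (\<Sum>e'\<in>UNIV. C e e')" by (rule member_le_sum) (simp_all add: C(1))
    also have "\<dots> \<le> D" unfolding D_def
      by (rule member_le_sum[of e UNIV "\<lambda>e. \<Sum>e'\<in>UNIV. C e e'"]) (simp_all add: C(1) sum_nonneg)
    finally show ?thesis .
  qed
  show ?thesis
  proof (intro exI[of _ D] conjI allI)
    show "D \<ge> 0" unfolding D_def by (intro sum_nonneg C(1))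
    show "\<bar>Om (oct e) (oct e') z $ i $ l\<bar> \<le> D / (1 + (of_int z)\<^sup>2)" for e e' z i l
      by (rule order_trans[OF C(2) divide_right_mono[OF le]]) simp
  qed
qed

text \<open>A row splits into one sum over positions for each octave and coordinate, and each of
  these is bounded by the full series over lags, independently of N.\<close>

lemma obs_cov_row_sum: "\<exists>g. \<forall>N. \<forall>r\<in>sites N. (\<Sum>s\<in>sites N. \<bar>obs_cov r s\<bar>) \<le> g"
proof -
  obtain C where C: "C \<ge> 0" "\<And>e e' z i l. \<bar>Om (oct e) (oct e') z $ i $ l\<bar> \<le> C / (1 + (of_int z)\<^sup>2)"
    using uniform_decay by blast
  define T where "T = (\<Sum>\<^sub>\<infinity>z\<in>UNIV. 1 / (1 + (of_int (z :: int))\<^sup>2) :: real)"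
  show ?thesis
  proof (intro exI[of _ "\<Sum>e\<in>(UNIV :: 'm set). \<Sum>i\<in>(UNIV :: 'n set). C * T"] allI ballI)
    fix N r assume "r \<in> sites N"
    obtain e k i where r: "r = (e, k, i)" by (cases r)
    have "(\<Sum>s\<in>sites N. \<bar>obs_cov r s\<bar>) = (\<Sum>e'\<in>UNIV. \<Sum>k' = 1..num_coeffs (2 ^ N) (oct e'). \<Sum>i'\<in>UNIV. \<bar>obs_cov r (e', k', i')\<bar>)"
      by (rule sum_sites)
    also have "\<dots> = (\<Sum>e'\<in>UNIV. \<Sum>i'\<in>UNIV. \<Sum>k' = 1..num_coeffs (2 ^ N) (oct e'). \<bar>obs_cov r (e', k', i')\<bar>)"
      by (intro sum.cong refl sum.swap)
    also have "\<dots> \<le> (\<Sum>e'\<in>(UNIV :: 'm set). \<Sum>i'\<in>(UNIV :: 'n set). C * T)"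
    proof (intro sum_mono)
      fix e' i'
      have "(\<Sum>k' = 1..num_coeffs (2 ^ N) (oct e'). \<bar>obs_cov r (e', k', i')\<bar>) \<le>
          (\<Sum>k' = 1..num_coeffs (2 ^ N) (oct e'). C * (1 / (1 + (of_int (lag (oct e) (oct e') (int k) (int k')))\<^sup>2)))"
        unfolding r obs_cov_entry by (intro sum_mono) (use C(2) in simp)
      also have "\<dots> \<le> C * T"
        unfolding sum_distrib_left[symmetric] T_def by (intro mult_left_mono lag_sum_bound C(1)) simp
      finally show "(\<Sum>k' = 1..num_coeffs (2 ^ N) (oct e'). \<bar>obs_cov r (e', k', i')\<bar>) \<le> C * T" .
    qed
    finally show "(\<Sum>s\<in>sites N. \<bar>obs_cov r s\<bar>) \<le> (\<Sum>e'\<in>(UNIV :: 'm set). \<Sum>i'\<in>(UNIV :: 'n set). C * T)" .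
  qed
qed

text \<open>A row meets a single block; summing over all octaves and coordinates gives one bound for
  every row.\<close>

lemma quad_row_sum:
  assumes "r \<in> sites N"
  shows "(\<Sum>s\<in>sites N. \<bar>quad u N r s\<bar>) \<le>
    (\<Sum>e\<in>UNIV. \<Sum>i\<in>UNIV. \<Sum>i'\<in>UNIV. \<bar>sym_coeff u e i i'\<bar> / sqrt (real (num_coeffs (2 ^ N) (oct e))))"
proof -
  define q where "q e i i' = \<bar>sym_coeff u e i i'\<bar> / sqrt (real (num_coeffs (2 ^ N) (oct e)))" for e i i'
  have q: "q e i i' \<ge> 0" for e i i' unfolding q_def by simp
  have "(\<Sum>s\<in>sites N. \<bar>quad u N r s\<bar>) =
      (\<Sum>s\<in>sites N. if fst s = fst r \<and> fst (snd s) = fst (snd r) then q (fst r) (snd (snd r)) (snd (snd s)) else 0)"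
    unfolding quad_def q_def by (intro sum.cong refl) simp
  also have "\<dots> = (\<Sum>i'\<in>UNIV. q (fst r) (snd (snd r)) i')"
    unfolding sum_block[OF assms] by (simp only: snd_conv)
  also have "\<dots> \<le> (\<Sum>i\<in>UNIV. \<Sum>i'\<in>UNIV. q (fst r) i i')"
    by (rule member_le_sum[of _ UNIV "\<lambda>i. \<Sum>i'\<in>UNIV. q (fst r) i i'"]) (auto intro!: sum_nonneg q)
  also have "\<dots> \<le> (\<Sum>e\<in>UNIV. \<Sum>i\<in>UNIV. \<Sum>i'\<in>UNIV. q e i i')"
    by (rule member_le_sum[of _ UNIV "\<lambda>e. \<Sum>i\<in>UNIV. \<Sum>i'\<in>UNIV. q e i i'"]) (auto intro!: sum_nonneg q)
  finally show ?thesis unfolding q_def .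
qed

lemma quad_row_tendsto:
  "(\<lambda>N. \<Sum>e\<in>UNIV. \<Sum>i\<in>UNIV. \<Sum>i'\<in>UNIV. \<bar>sym_coeff u e i i'\<bar> / sqrt (real (num_coeffs (2 ^ N) (oct e)))) \<longlonglongrightarrow> 0"
  by (intro tendsto_null_sum real_tendsto_divide_at_top[OF tendsto_const] num_coeffs_tendsto)

lemma cross_integrable: "integrable (count_space UNIV) (cross e e' p q)"
proof -
  obtain C where C: "C \<ge> 0" "\<forall>e e' z i l. \<bar>Om (oct e) (oct e') z $ i $ l\<bar> \<le> C / (1 + (of_int z)\<^sup>2)"
    using uniform_decay by (elim exE conjE)
  have C1: "\<bar>Om (oct e) (oct e') z $ i $ l\<bar> \<le> C / (1 + (of_int z)\<^sup>2)" for z i l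
    using C(2) by blast
  have C2: "\<bar>Om (oct e) (oct e') z $ i $ l\<bar> \<le> C" for z i l
  proof (rule order_trans[OF C1])
    show "C / (1 + (of_int z)\<^sup>2) \<le> C"
      using C(1) by (simp add: divide_le_eq mult_left_mono add_pos_nonneg mult_le_cancel_left1 algebra_simps)
  qed
  have m: "\<bar>Om (oct e) (oct e') z $ i $ l * Om (oct e) (oct e') z $ i' $ l'\<bar> \<le> C / (1 + (of_int z)\<^sup>2) * C" for z i l i' l'
    unfolding abs_mult using C(1) by (intro mult_mono C1 C2) (auto intro!: divide_nonneg_nonneg)
  show ?thesis
  proof (rule integrable_count_space_int)
    fix z
    have "\<bar>cross e e' p q z\<bar> \<le> C / (1 + (of_int z)\<^sup>2) * C + C / (1 + (of_int z)\<^sup>2) * C"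
      unfolding cross_def by (rule order_trans[OF abs_triangle_ineq add_mono[OF m m]])
    then show "\<bar>cross e e' p q z\<bar> \<le> 2 * C * C / (1 + (of_int z)\<^sup>2)" by simp
  qed
qed

text \<open>Every integer is the lag of some pair of positions, and there the claim is the symmetry
  of covariances.\<close>

lemma Om_commute: "Om (oct e') (oct e) (- z) $ l $ i = Om (oct e) (oct e') z $ i $ l"
proof -
  obtain k k' where z: "lag (oct e) (oct e') k k' = z" by (rule lag_surj)
  show ?thesis
    unfolding z[symmetric] lag_commute[symmetric] cov[symmetric] by (rule L2_inner_commute)
qed

lemma cross_commute: "cross e' e q p (- z) = cross e e' p q z"
  unfolding cross_def Om_commute by (simp add: mult.commute)

text \<open>Each factor \<open>quad\<close> contracts two coordinates to an index of
  \<open>vec_S\<close>, symmetrised with weight 1/2. Exchanging the two coordinates of p and those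
  of q gives four products that are equal in pairs, and the factor 2 leaves the two products of
  \<open>cross\<close>.\<close>

lemma trace_eq:
  "2 * (\<Sum>r\<in>sites N. \<Sum>s\<in>sites N. \<Sum>t\<in>sites N. \<Sum>v\<in>sites N. quad u N r s * obs_cov s t * quad u N t v * obs_cov v r) =
    (\<Sum>e\<in>UNIV. \<Sum>e'\<in>UNIV. \<Sum>p\<in>UNIV. \<Sum>q\<in>UNIV. u $ (e, p) * u $ (e', q) *
      ((1 / (sqrt (real (num_coeffs (2 ^ N) (oct e))) * sqrt (real (num_coeffs (2 ^ N) (oct e'))))) *
        (\<Sum>k = 1..num_coeffs (2 ^ N) (oct e). \<Sum>k' = 1..num_coeffs (2 ^ N) (oct e').
          cross e e' p q (lag (oct e) (oct e') (int k) (int k')))))"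
proof -
  define K where "K e = num_coeffs (2 ^ N) (oct e)" for e
  define c where "c e = sqrt (real (K e))" for e
  define T where "T s r = (\<Sum>t\<in>sites N. \<Sum>v\<in>sites N. quad u N t v * (obs_cov s t * obs_cov v r))" for s r
  define X where "X e e' k k' p q = cross e e' p q (lag (oct e) (oct e') (int k) (int k'))" for e e' k k' p q
  have T: "T s r = (\<Sum>e'\<in>UNIV. \<Sum>k' = 1..K e'. \<Sum>q\<in>UNIV. u $ (e', q) *
      ((obs_cov s (e', k', pfst q) * obs_cov (e', k', psnd q) r / c e' + obs_cov s (e', k', psnd q) * obs_cov (e', k', pfst q) r / c e') / 2))" for s r
    unfolding T_def sum_quad2 sum_sym_coeff K_def c_def ..
  have T2: "T (e, k, psnd p) (e, k, pfst p) + T (e, k, pfst p) (e, k, psnd p) =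
      (\<Sum>e'\<in>UNIV. \<Sum>k' = 1..K e'. \<Sum>q\<in>UNIV. u $ (e', q) * (X e e' k k' p q / c e'))" for e k p
    unfolding T sum.distrib[symmetric]
  proof (intro sum.cong refl)
    fix e' k' and q :: "'n sympair"
    have g1: "obs_cov (e, k, i) (e', k', l) = Om (oct e) (oct e') (lag (oct e) (oct e') (int k) (int k')) $ i $ l" for i l
      by (rule obs_cov_entry)
    have g2: "obs_cov (e', k', l) (e, k, i) = Om (oct e) (oct e') (lag (oct e) (oct e') (int k) (int k')) $ i $ l" for i l
      by (subst obs_cov_commute) (rule g1)
    \<comment> \<open>The two orders of p contribute the same products; d = 0 occurs while an octave
      has no coefficients.\<close>
    have alg: "w * ((x * y / d + x' * y' / d) / 2) + w * ((y' * x' / d + y * x / d) / 2) = w * ((y' * x' + y * x) / d)"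
      for w x y x' y' d :: real
      by (cases "d = 0") (simp_all add: field_simps)
    show "u $ (e', q) * ((obs_cov (e, k, psnd p) (e', k', pfst q) * obs_cov (e', k', psnd q) (e, k, pfst p) / c e' +
          obs_cov (e, k, psnd p) (e', k', psnd q) * obs_cov (e', k', pfst q) (e, k, pfst p) / c e') / 2) +
        u $ (e', q) * ((obs_cov (e, k, pfst p) (e', k', pfst q) * obs_cov (e', k', psnd q) (e, k, psnd p) / c e' +
          obs_cov (e, k, pfst p) (e', k', psnd q) * obs_cov (e', k', pfst q) (e, k, psnd p) / c e') / 2) =
        u $ (e', q) * (X e e' k k' p q / c e')"
      unfolding g1 g2 X_def cross_def by (rule alg)
  qed
  have "2 * (\<Sum>r\<in>sites N. \<Sum>s\<in>sites N. \<Sum>t\<in>sites N. \<Sum>v\<in>sites N. quad u N r s * obs_cov s t * quad u N t v * obs_cov v r) =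
      2 * (\<Sum>r\<in>sites N. \<Sum>s\<in>sites N. quad u N r s * T s r)"
    unfolding T_def sum_distrib_left by (intro sum.cong refl) (simp add: ac_simps)
  also have "\<dots> = (\<Sum>e\<in>UNIV. \<Sum>k = 1..K e. \<Sum>p\<in>UNIV. u $ (e, p) *
      ((T (e, k, psnd p) (e, k, pfst p) + T (e, k, pfst p) (e, k, psnd p)) / c e))"
    unfolding sum_quad2 sum_sym_coeff K_def[symmetric] c_def[symmetric] sum_distrib_left
    by (intro sum.cong refl) (simp add: add_divide_distrib)
  also have "\<dots> = (\<Sum>e\<in>UNIV. \<Sum>k = 1..K e. \<Sum>p\<in>UNIV. \<Sum>e'\<in>UNIV. \<Sum>k' = 1..K e'. \<Sum>q\<in>UNIV.
      u $ (e, p) * u $ (e', q) * (1 / (c e * c e') * X e e' k k' p q))"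
    unfolding T2 sum_divide_distrib sum_distrib_left by (intro sum.cong refl) (simp add: ac_simps)
  also have "\<dots> = (\<Sum>e\<in>UNIV. \<Sum>e'\<in>UNIV. \<Sum>p\<in>UNIV. \<Sum>q\<in>UNIV. \<Sum>k = 1..K e. \<Sum>k' = 1..K e'.
      u $ (e, p) * u $ (e', q) * (1 / (c e * c e') * X e e' k k' p q))"
    by (intro sum.cong refl sum_reorder)
  finally show ?thesis
    unfolding sum_distrib_left K_def c_def X_def .
qed

lemma trace_tendsto:
  "(\<lambda>N. 2 * (\<Sum>r\<in>sites N. \<Sum>s\<in>sites N. \<Sum>t\<in>sites N. \<Sum>v\<in>sites N. quad u N r s * obs_cov s t * quad u N t v * obs_cov v r))
    \<longlonglongrightarrow> (\<Sum>e\<in>UNIV. \<Sum>e'\<in>UNIV. \<Sum>p\<in>UNIV. \<Sum>q\<in>UNIV. u $ (e, p) * u $ (e', q) *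
      (2 powr (- (real (oct e + oct e') / 2)) * real (gcd (2 ^ oct e) (2 ^ oct e')) * (\<Sum>\<^sub>\<infinity>z\<in>UNIV. cross e e' p q z)))"
  unfolding trace_eq by (intro tendsto_sum tendsto_mult_left lag_average cross_integrable)

theorem fluctuation_clt:
  fixes F :: "real^('m \<times> ('n::{finite,linorder}) sympair)^('m \<times> ('n::{finite,linorder}) sympair)"
  assumes F: "\<And>e p e' q. F $ (e, p) $ (e', q) = 2 powr (- (real (oct e + oct e') / 2)) *
    real (gcd (2 ^ oct e) (2 ^ oct e')) * (\<Sum>\<^sub>\<infinity>z\<in>UNIV. cross e e' p q z)"
  shows "transpose F = F \<and> (\<exists>L. multivariate_normal L 0 F \<and>
    converges_in_distribution P (\<lambda>N. wavelet_fluctuation P Dc oct (2 ^ N)) L)"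
proof -
  define X where "X N = wavelet_fluctuation P Dc oct (2 ^ N)" for N
  have sym: "transpose F = F"
  proof -
    have bij: "bij_betw uminus (UNIV :: int set) UNIV" by (rule bij_betwI[where g = uminus]) auto
    have "F $ (e', q) $ (e, p) = F $ (e, p) $ (e', q)" for e e' p q
    proof -
      have "(\<Sum>\<^sub>\<infinity>z\<in>UNIV. cross e' e q p z) = (\<Sum>\<^sub>\<infinity>z\<in>UNIV. cross e' e q p (- z))"
        by (rule infsum_reindex_bij_betw[OF bij, symmetric])
      also have "\<dots> = (\<Sum>\<^sub>\<infinity>z\<in>UNIV. cross e e' p q z)" by (simp only: cross_commute)
      finally show ?thesis unfolding F by (simp only: add.commute gcd.commute)
    qed
    then show ?thesis by (simp add: vec_eq_iff transpose_def)
  qed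
  have quadform: "u \<bullet> (F *v u) = (\<Sum>e\<in>UNIV. \<Sum>e'\<in>UNIV. \<Sum>p\<in>UNIV. \<Sum>q\<in>UNIV. u $ (e, p) * u $ (e', q) *
      (2 powr (- (real (oct e + oct e') / 2)) * real (gcd (2 ^ oct e) (2 ^ oct e')) * (\<Sum>\<^sub>\<infinity>z\<in>UNIV. cross e e' p q z)))" for u
  proof -
    have pairs: "(\<Sum>r\<in>UNIV. f r) = (\<Sum>e\<in>UNIV. \<Sum>p\<in>UNIV. f (e, p))" for f :: "'m \<times> 'n sympair \<Rightarrow> real"
      by (simp add: sum.cartesian_product case_prod_beta)
    have "u \<bullet> (F *v u) = (\<Sum>e\<in>UNIV. \<Sum>p\<in>UNIV. \<Sum>e'\<in>UNIV. \<Sum>q\<in>UNIV. u $ (e, p) * F $ (e, p) $ (e', q) * u $ (e', q))"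
      unfolding quadratic_form_sum pairs ..
    also have "\<dots> = (\<Sum>e\<in>UNIV. \<Sum>e'\<in>UNIV. \<Sum>p\<in>UNIV. \<Sum>q\<in>UNIV. u $ (e, p) * F $ (e, p) $ (e', q) * u $ (e', q))"
      by (intro sum.cong refl sum.swap)
    finally show ?thesis unfolding F by (simp only: ac_simps)
  qed
  obtain g where g: "\<forall>N. \<forall>r\<in>sites N. (\<Sum>s\<in>sites N. \<bar>obs_cov r s\<bar>) \<le> g"
    using obs_cov_row_sum by (elim exE)
  have grow: "(\<Sum>s\<in>sites N. \<bar>obs_cov r s\<bar>) \<le> g" if "r \<in> sites N" for N r
    using g that by blast
  have quad_sym: "quad u N r s = quad u N s r" for u N r s
    unfolding quad_def using sym_coeff_sym[of u "fst r" "snd (snd r)" "snd (snd s)"] by auto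
  \<comment> \<open>Both conclusions of the quadratic limit theorem are used: nonnegativity of the
    limiting variance at every u is what the existence of the limit law requires.\<close>
  have clt: "(\<lambda>N. \<integral>\<omega>. iexp (u \<bullet> X N \<omega>) \<partial>P) \<longlonglongrightarrow> of_real (exp (- (u \<bullet> (F *v u)) / 2))"
    and nonneg: "0 \<le> u \<bullet> (F *v u)" for u
    unfolding X_def fluctuation_quadratic quadform
    by (rule gaussian_quadratic_clt[where I = sites and Y = obs and G = "\<lambda>_. obs_cov" and M = "quad u",
        OF P finite_sites sqi_meas[OF obs_sqi] obs_char obs_cov_commute quad_sym grow quad_row_sum quad_row_tendsto trace_tendsto],
        assumption+)+
  obtain L where L: "multivariate_normal L 0 F" using multivariate_normal_exists[OF sym nonneg] by (rule exE)
  have Lprob: "prob_space L" and Lsets: "sets L = sets borel" using L unfolding multivariate_normal_def by simp_all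
  have entry_meas: "(\<lambda>\<omega>. X N \<omega> $ r) \<in> borel_measurable P" for N r
  proof (cases r)
    case (Pair e p)
    show ?thesis
      unfolding Pair X_def fluctuation_entry
      by (intro borel_measurable_times borel_measurable_diff borel_measurable_sum borel_measurable_const sqi_meas[OF sqi])
  qed
  have Xmeas: "X N \<in> borel_measurable P" for N by (rule borel_measurable_vec[OF entry_meas])
  have "(\<lambda>N. \<integral>\<omega>. f (X N \<omega>) \<partial>P) \<longlonglongrightarrow> (\<integral>x. f x \<partial>L)"
    if f: "continuous_on UNIV f" and bd: "bounded (range f)" for f :: "real^('m \<times> 'n sympair) \<Rightarrow> real"
  proof -
    obtain M where M: "\<forall>x\<in>range f. norm x \<le> M" using bd unfolding bounded_iff by (rule exE)
    \<comment> \<open>Reads \<open>f\<close> as a function on coordinate functions, the form in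
      which the continuity theorem is stated.\<close>
    define h where "h x = f (\<chi> r. x r)" for x
    have hX: "h (($) x) = f x" for x unfolding h_def by (simp only: vec_nth_inverse)
    have fm: "f \<in> borel_measurable borel" by (rule borel_measurable_continuous_onI[OF f])
    have fmL: "f \<in> borel_measurable L" unfolding measurable_cong_sets[OF Lsets refl] by (rule fm)
    have idL: "(\<lambda>x. x $ r) \<in> borel_measurable L" for r
      unfolding measurable_cong_sets[OF Lsets refl]
      by (rule borel_measurable_continuous_onI) (intro continuous_intros)
    have ip: "(\<Sum>r\<in>UNIV. u r * x $ r) = (\<chi> r. u r) \<bullet> x" for u and x :: "real^('m \<times> 'n sympair)"
      by (simp add: inner_vec_def)
    have "(\<lambda>N. \<integral>\<omega>. h (($) (X N \<omega>)) \<partial>P) \<longlonglongrightarrow> (\<integral>x. h (($) x) \<partial>L)"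
    proof (rule multivariate_levy_continuity[where X = "\<lambda>N \<omega> r. X N \<omega> $ r" and Y = "\<lambda>x r. x $ r" and f = h and I = UNIV and M = M,
          OF P Lprob finite])
      show "(\<lambda>N. \<integral>\<omega>. iexp (\<Sum>r\<in>UNIV. u r * X N \<omega> $ r) \<partial>P) \<longlonglongrightarrow> (\<integral>x. iexp (\<Sum>r\<in>UNIV. u r * x $ r) \<partial>L)" for u
        unfolding ip char_multivariate_normal[OF L] by (rule clt)
      show "continuous_on UNIV h"
        unfolding h_def
        by (rule continuous_on_compose2[OF f]) (intro continuous_on_vec_lambda continuous_on_product_coordinates, simp)
      show "\<bar>h x\<bar> \<le> M" for x using M unfolding h_def by simp
      show "h x = h y" if "\<And>r. r \<in> UNIV \<Longrightarrow> x r = y r" for x y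
      proof -
        have "x = y" using that by auto
        then show ?thesis by simp
      qed
      show "(\<lambda>\<omega>. h (($) (X N \<omega>))) \<in> borel_measurable P" for N
        unfolding hX by (rule measurable_compose[OF Xmeas fm])
      show "(\<lambda>x. h (($) x)) \<in> borel_measurable L" unfolding hX by (rule fmL)
    qed (rule entry_meas idL)+
    then show ?thesis unfolding hX .
  qed
  then have "converges_in_distribution P X L"
    unfolding converges_in_distribution_def using Xmeas by blast
  then show ?thesis using sym L unfolding X_def by blast
qed

end

end

theorem theorem3p1:
  fixes P :: "'a measure"
    and Q :: "'q measure"
    and Z :: "real set \<Rightarrow> 'q \<Rightarrow> complex^('n::{finite,linorder})"
    and H :: "real^('n::{finite,linorder})^('n::{finite,linorder})"
    and A :: "complex^('n::{finite,linorder})^('n::{finite,linorder})"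
    and B :: "real \<Rightarrow> 'a \<Rightarrow> real^('n::{finite,linorder})"
    and \<psi> :: "real \<Rightarrow> real"
    and N\<psi> :: nat
    and \<alpha> :: real
    and Dc :: "nat \<Rightarrow> int \<Rightarrow> 'a \<Rightarrow> real^('n::{finite,linorder})"
    and oct :: "'m::{finite,linorder} \<Rightarrow> nat"
  assumes "CARD('n) \<ge> 2"
    and "\<And>h. eigenvalue (cmat H) h \<Longrightarrow> 0 < Re h \<and> Re h < 1"
    and "rank (Re_mat (A ** adjoint_mat A)) = CARD('n)"
    and "Im_mat (A ** adjoint_mat A) = 0"
    and "is_ofbm Q Z H A P B"
    and "is_wavelet \<psi> N\<psi> \<alpha>"
    and "wavelet_coefficients P B \<psi> Dc"
    and "strict_mono oct"
  shows "let \<Sigma> = second_moment P (B 1);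
             F = F_matrix \<psi> H \<Sigma> oct
         in transpose F = F \<and>
    (\<exists>L. multivariate_normal L 0 F \<and>
         converges_in_distribution P (\<lambda>N. wavelet_fluctuation P Dc oct (2 ^ N)) L)"
proof -
  note rank = assms(3) and rev = assms(4) and B = assms(5) and W = assms(6) and Dc = assms(7)
  have "\<exists>R\<ge>0. integrable lborel \<psi> \<and> (\<forall>t. \<psi> t \<noteq> 0 \<longrightarrow> \<bar>t\<bar> \<le> R) \<and>
      (\<integral>t. \<psi> t \<partial>lborel) = 0 \<and> (\<integral>t. \<psi> t * t \<partial>lborel) = 0"
    by (rule wavelet_facts[OF W]) blast
  then obtain R where R: "R \<ge> 0" and \<psi>: "integrable lborel \<psi>" and supp': "\<forall>t. \<psi> t \<noteq> 0 \<longrightarrow> \<bar>t\<bar> \<le> R"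
    and m0: "(\<integral>t. \<psi> t \<partial>lborel) = 0" and m1: "(\<integral>t. \<psi> t * t \<partial>lborel) = 0"
    by (elim exE conjE)
  have supp: "\<bar>t\<bar> \<le> R" if "\<psi> t \<noteq> 0" for t using supp' that by blast
  define S where "S = second_moment P (B 1)"
  obtain K where K: "K \<ge> 0" "\<forall>t i l. \<bar>variance_mat H S t $ i $ l\<bar> \<le> K * (1 + t\<^sup>2)"
    using ofbm_variance_growth(1)[OF B rev rank] unfolding S_def by (elim exE conjE)
  obtain K' where K': "\<forall>t\<ge>1. norm (mat_powr t H) \<le> K' * t"
    using ofbm_variance_growth(2)[OF B rev rank] by (elim exE)
  have KS: "\<bar>variance_mat H S t $ i $ l\<bar> \<le> K * (1 + t\<^sup>2)" for t i l using K(2) by blast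
  have KN: "norm (mat_powr t H) \<le> K' * t" if "t \<ge> 1" for t using K' that by blast
  note model = B rev Dc S_def R \<psi> supp m0
  have P: "prob_space P" using B unfolding is_ofbm_def by (rule conjunct1)
  have "F_matrix \<psi> H S oct $ (e, p) $ (e', q) = 2 powr (- (real (oct e + oct e') / 2)) *
      real (gcd (2 ^ oct e) (2 ^ oct e')) * (\<Sum>\<^sub>\<infinity>z\<in>UNIV. cross (Omega \<psi> H S) oct e e' p q z)" for e p e' q
    unfolding cross_def[abs_def] F_matrix_def G_block_def by (simp only: vec_lambda_beta fst_conv snd_conv)
  note clt = fluctuation_clt[OF P Dc_sqi[OF model K(1) KS] wavelet_covariance_Omega[OF model m1 K(1) KS KN]
      Omega_decay[OF model m1 K(1) KS KN] wavelet_gaussian[OF model K(1) KS] this]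
  show ?thesis unfolding Let_def S_def[symmetric] by (rule clt)
qed

end
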